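(* Let $[c^i_{jk}]\in M=\mathrm{Mat}(r_2\times r_1,\mathbb{Z})^n$ be a grading (a tuple of matrices of non-negative integers) giving matching fields $\Lambda_1$, $\Lambda_2$ and $\Lambda$ on $\mathrm{Gr}(r_1,nr_2)$, $\mathrm{Gr}(r_2,nr_1)$ and $K^n_{r_1r_2}$ respectively. Suppose the following two conditions hold: (1) $\Lambda_1$ and $\Lambda_2$ induce toric degenerations of $\mathrm{Gr}(r_1,nr_2)$ and $\mathrm{Gr}(r_2,nr_1)$. (2) Let $C_i$ be the cone over the matching field polytope $P_{\Lambda_i}$ ($i=1,2$). Let $v_1,\dots,v_l$ be lattice generators for $C_1\cap C_2$, and suppose that for each $i$ there exists some semi-invariant $f_i$ of $K^n_{r_1r_2}$ such that the exponent vector of $LM(f_i)$ is $v_i$. Then there is a toric degeneration of $K^n_{r_1r_2}$ to the normal toric variety $X_F$, where $F$ is the normal fan of the polytope $$r_2P_{\Lambda_1}\cap r_1P_{\Lambda_2}.$$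
   Context: Fix positive integers $r_1,r_2,n$. Kronecker moduli. Let $V=\mathrm{Mat}(r_2\times r_1,\mathbb{C})^{\oplus n}$ with coordinates $x^i_{jk}$ ($1\le i\le n$, $1\le j\le r_2$, $1\le k\le r_1$). $G=GL(r_1)\times GL(r_2)$ acts by $(g_1,g_2)\cdot(A_i)_i=(g_2A_ig_1^{-1})_i$. Semi-invariants of weight $\alpha\in\chi(G)\cong\mathbb{Z}^2$ are polynomials with $f(g\cdot v)=\alpha(g)f(v)$. With $\theta=(-r_2,r_1)$, $K^n_{r_1r_2}=\mathrm{Proj}\bigoplus_{k\ge0}SI_{k\theta}$, where $SI_{k\theta}$ is the space of semi-invariants of weight $k\theta$. Grading. $[c^i_{jk}]$ assigns weight $c^i_{jk}$ to $x^i_{jk}$; a monomial has weight the sum of the weights of its variables. For a polynomial $f$, $LM(f)$ refers to the term of maximal weight (the initial form being a monomial up to scalar); the initial algebra of a subalgebra is spanned by the initial forms (sums of terms of maximal weight) of its elements. Grassmannian matching fields. For $\mathrm{Gr}(r,N)$, with coordinates on an $r\times N$ matrix, a matching field assigns to each $r$-subset $I=\{i_1<\cdots<i_r\}$ of $\{1,\dots,N\}$ a permutation $\sigma_I\in Sym(r)$, i.e. picks one monomial $m_{\sigma_I}=\prod_t x_{\sigma_I(t),i_t}$ of the Plücker coordinate $p_I$ (maximal minor). A grading gives a (coherent) matching field if each $p_I$ has a unique monomial of maximal weight, and this is the chosen one. The matching field polytope $P_\Lambda\subset\mathrm{Mat}(r\times N,\mathbb{R})$ is the convex hull of the exponent vectors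 of the $m_{\sigma_I}$. A coherent matching field induces a toric degeneration if the Plücker coordinates are a SAGBI basis of the Plücker algebra (the subalgebra they generate, which is the Cox ring of $\mathrm{Gr}(r,N)$) for the grading, i.e. the initial algebra is generated by the leading monomials of the $p_I$. Identifications. The variables (and lattice $M$) are identified with the entries of (and lattice of) $r_2\times nr_1$ matrices by placing the $n$ matrices side by side, and of $r_1\times nr_2$ matrices by stacking them vertically and transposing. Thus $[c^i_{jk}]$ induces gradings for $\mathrm{Gr}(r_2,nr_1)$ and $\mathrm{Gr}(r_1,nr_2)$, and $P_{\Lambda_1},P_{\Lambda_2}$ and the cones over them lie in $M\otimes\mathbb{R}$. Lattice generators of $C_1\cap C_2$ are a finite set generating the semigroup $C_1\cap C_2\cap M$. Matching fields for $K^n_{r_1r_2}$. A linked tableaux pair $T^\pm$ consists, for some $a\in\frac1{\gcd(r_1,r_2)}\mathbb{Z}_{\ge0}$, of a filling $T^-$ of the $r_1\times ar_2$ rectangle ($r_1$ rows) by labels $ij$ ($1\le i\le n$, $1\le j\le r_2$), a filling $T^+$ of the $r_2\times ar_1$ rectangle by labels $ij$ ($1\le i\le n$, $1\le j\le r_1$), and a bijection (the link) from boxes of $T^-$ to boxes of $T^+$ taking each label $iq$ in row $p$ of $T^-$ to a label $ip$ in row $q$ of $T^+$. For a box $b$ of $T^+$ in row $k(b)$, column $c^+(b)$, with label having first entry $i(b)$, let $j(b),c^-(b)$ be the row and column of the linked box of $T^-$. For $w=(\tau,\pi)\in W^\alpha=Sym(r_1)^{ar_2}\times Sym(r_2)^{ar_1}$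 put $m_w=\prod_bx^{i(b)}_{\pi_{c^+(b)}(k(b)),\,\tau_{c^-(b)}(j(b))}$; the associated semi-invariant is $f_{T^\pm}=\sum_w\mathrm{sign}(w)m_w$. A matching field on $K^n_{r_1r_2}$ is a map assigning to each linked pair an element of its $W^\alpha$; a grading gives a (coherent) matching field $\Lambda$ on $K^n_{r_1r_2}$ if for each linked pair there is a unique monomial of maximal weight among the $m_w$, and it is $m_w$ for the $w$ assigned by $\Lambda$. A toric degeneration of a projective variety $X$ to $X_F$ is a flat family over $\mathbb{A}^1$ with fibres over $t\ne0$ isomorphic to $X$ and fibre over $0$ isomorphic to $X_F$. For a rational polytope $P\subset M_{\mathbb{R}}$, its normal fan is that of a lattice multiple $kP$; if $P$ is not full-dimensional it is taken for $kP-x$ in its linear span (with lattice the intersection of $M$ with that span), for a lattice point $x\in kP$. $X_F$ is the toric variety of the fan $F$. *)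

theory Defs
  imports
    "HOL-Analysis.Analysis"
    "HOL-Analysis.Finite_Function_Topology"
    "HOL-Algebra.Ideal"
    "HOL-Algebra.Module"
    "HOL-Algebra.Free_Abelian_Groups"
    "HOL-Combinatorics.Permutations"
    "Jordan_Normal_Form.Determinant"
begin

section \<open>Complex polynomials and gradings\<close>

text \<open>
  A polynomial is a finitely supported family of coefficients indexed by exponent vectors;
  its product is the convolution product of \<^theory>\<open>HOL-Library.Poly_Mapping\<close>.
\<close>

type_synonym 'v expo = "'v \<Rightarrow>\<^sub>0 nat"
type_synonym 'v cpoly = "('v \<Rightarrow>\<^sub>0 nat) \<Rightarrow>\<^sub>0 complex"

definition Const :: "complex \<Rightarrow> 'v cpoly" where
  "Const a = Poly_Mapping.single 0 a"

definition Monom :: "'v expo \<Rightarrow> 'v cpoly" where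
  "Monom e = Poly_Mapping.single e 1"

definition Indet :: "'v \<Rightarrow> 'v cpoly" where
  "Indet x = Monom (Poly_Mapping.single x 1)"

definition vars :: "'v cpoly \<Rightarrow> 'v set" where
  "vars f = (\<Union>e\<in>Poly_Mapping.keys f. Poly_Mapping.keys e)"

definition peval :: "'v cpoly \<Rightarrow> ('v \<Rightarrow> complex) \<Rightarrow> complex" where
  "peval f x = (\<Sum>e\<in>Poly_Mapping.keys f. Poly_Mapping.lookup f e *
      (\<Prod>v\<in>Poly_Mapping.keys e. x v ^ Poly_Mapping.lookup e v))"

definition weight :: "('v \<Rightarrow> nat) \<Rightarrow> 'v expo \<Rightarrow> nat" where
  "weight c e = (\<Sum>v\<in>Poly_Mapping.keys e. Poly_Mapping.lookup e v * c v)"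

text \<open>The sum of the terms of maximal weight (and \<open>0\<close> for the zero polynomial).\<close>

definition initial_form :: "('v \<Rightarrow> nat) \<Rightarrow> 'v cpoly \<Rightarrow> 'v cpoly" where
  "initial_form c f =
     (\<Sum>e\<in>{e \<in> Poly_Mapping.keys f. \<forall>e'\<in>Poly_Mapping.keys f. weight c e' \<le> weight c e}.
        Poly_Mapping.single e (Poly_Mapping.lookup f e))"

text \<open>\<open>LM(f)\<close> exists and has exponent vector \<open>e\<close>.\<close>

definition has_LM :: "('v \<Rightarrow> nat) \<Rightarrow> 'v cpoly \<Rightarrow> 'v expo \<Rightarrow> bool" where
  "has_LM c f e \<longleftrightarrow> (\<exists>a. a \<noteq> 0 \<and> initial_form c f = Poly_Mapping.single e a)"

inductive_set subalgebra :: "'v cpoly set \<Rightarrow> 'v cpoly set" for B :: "'v cpoly set" where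
  gen: "f \<in> B \<Longrightarrow> f \<in> subalgebra B"
| const: "Const a \<in> subalgebra B"
| add: "f \<in> subalgebra B \<Longrightarrow> g \<in> subalgebra B \<Longrightarrow> f + g \<in> subalgebra B"
| mult: "f \<in> subalgebra B \<Longrightarrow> g \<in> subalgebra B \<Longrightarrow> f * g \<in> subalgebra B"

definition cspan :: "'v cpoly set \<Rightarrow> 'v cpoly set" where
  "cspan B = {\<Sum>f\<in>S. Const (a f) * f | S a. finite S \<and> S \<subseteq> B}"

definition initial_algebra :: "('v \<Rightarrow> nat) \<Rightarrow> 'v cpoly set \<Rightarrow> 'v cpoly set" where
  "initial_algebra c A = cspan (initial_form c ` A)"


section \<open>The representation space and its semi-invariants\<close>

text \<open>
  All indices are shifted to start at \<open>0\<close>: the triple \<open>(i, j, k)\<close> with \<open>i < n\<close>, \<open>j < r2\<close>,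
  \<open>k < r1\<close> stands for the coordinate in row \<open>j\<close> and column \<open>k\<close> of the \<open>i\<close>-th matrix.
\<close>

type_synonym var = "nat \<times> nat \<times> nat"

definition var_set :: "nat \<Rightarrow> nat \<Rightarrow> nat \<Rightarrow> var set" where
  "var_set r1 r2 n = {..<n} \<times> {..<r2} \<times> {..<r1}"

definition coords :: "(nat \<Rightarrow> complex mat) \<Rightarrow> var \<Rightarrow> complex" where
  "coords A = (\<lambda>(i, j, k). A i $$ (j, k))"

text \<open>
  The character \<open>(a1, a2)\<close> of \<open>GL(r1) \<times> GL(r2)\<close> is \<open>(g1, g2) \<mapsto> det(g1)^a1 det(g2)^a2\<close>.
  In the following definition \<open>h1\<close> is the inverse of \<open>g1\<close>.
\<close>

definition SI :: "nat \<Rightarrow> nat \<Rightarrow> nat \<Rightarrow> int \<times> int \<Rightarrow> var cpoly set" where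
  "SI r1 r2 n \<alpha> = {f. vars f \<subseteq> var_set r1 r2 n \<and>
     (\<forall>g1 h1 g2 A. g1 \<in> carrier_mat r1 r1 \<longrightarrow> h1 \<in> carrier_mat r1 r1 \<longrightarrow>
        inverts_mat g1 h1 \<longrightarrow> inverts_mat h1 g1 \<longrightarrow>
        g2 \<in> carrier_mat r2 r2 \<longrightarrow> invertible_mat g2 \<longrightarrow>
        (\<forall>i<n. A i \<in> carrier_mat r2 r1) \<longrightarrow>
        peval f (coords (\<lambda>i. g2 * A i * h1)) =
          Determinant.det g1 powi fst \<alpha> * Determinant.det g2 powi snd \<alpha> * peval f (coords A))}"

text \<open>The weight \<open>k \<theta>\<close> with \<open>\<theta> = (- r2, r1)\<close>.\<close>

definition theta_multiple :: "nat \<Rightarrow> nat \<Rightarrow> nat \<Rightarrow> int \<times> int" where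
  "theta_multiple r1 r2 k = (- (int k * int r2), int k * int r1)"


section \<open>Grassmannian matching fields\<close>

text \<open>
  \<open>X s q\<close> is the variable in row \<open>s\<close> and column \<open>q\<close> of the \<open>r \<times> N\<close> matrix.
  The two matrices of variables below are obtained by stacking and transposing (an
  \<open>r1 \<times> (n r2)\<close> matrix), respectively by placing the matrices side by side
  (an \<open>r2 \<times> (n r1)\<close> matrix).
\<close>

definition stacked :: "nat \<Rightarrow> nat \<Rightarrow> nat \<Rightarrow> var" where
  "stacked r2 k q = (q div r2, q mod r2, k)"

definition side_by_side :: "nat \<Rightarrow> nat \<Rightarrow> nat \<Rightarrow> var" where
  "side_by_side r1 j q = (q div r1, j, q mod r1)"

definition minors :: "nat \<Rightarrow> nat \<Rightarrow> nat set set" where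
  "minors r N = {I. I \<subseteq> {..<N} \<and> card I = r}"

definition plucker :: "nat \<Rightarrow> (nat \<Rightarrow> nat \<Rightarrow> 'v) \<Rightarrow> nat set \<Rightarrow> 'v cpoly" where
  "plucker r X I = Determinant.det (mat r r (\<lambda>(s, t). Indet (X s (sorted_list_of_set I ! t))))"

definition gr_mono :: "nat \<Rightarrow> (nat \<Rightarrow> nat \<Rightarrow> 'v) \<Rightarrow> nat set \<Rightarrow> (nat \<Rightarrow> nat) \<Rightarrow> 'v expo" where
  "gr_mono r X I \<sigma> = (\<Sum>t<r. Poly_Mapping.single (X (\<sigma> t) (sorted_list_of_set I ! t)) 1)"

definition gives_gr_mf ::
    "('v \<Rightarrow> nat) \<Rightarrow> nat \<Rightarrow> nat \<Rightarrow> (nat \<Rightarrow> nat \<Rightarrow> 'v) \<Rightarrow> (nat set \<Rightarrow> nat \<Rightarrow> nat) \<Rightarrow> bool" where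
  "gives_gr_mf c r N X \<Lambda> \<longleftrightarrow> (\<forall>I\<in>minors r N. \<Lambda> I permutes {..<r} \<and>
     (\<forall>\<sigma>. \<sigma> permutes {..<r} \<longrightarrow> gr_mono r X I \<sigma> \<noteq> gr_mono r X I (\<Lambda> I) \<longrightarrow>
        weight c (gr_mono r X I \<sigma>) < weight c (gr_mono r X I (\<Lambda> I))))"

text \<open>The Plucker coordinates are a SAGBI basis of the Plucker algebra.\<close>

definition gr_toric_degeneration ::
    "('v \<Rightarrow> nat) \<Rightarrow> nat \<Rightarrow> nat \<Rightarrow> (nat \<Rightarrow> nat \<Rightarrow> 'v) \<Rightarrow> (nat set \<Rightarrow> nat \<Rightarrow> nat) \<Rightarrow> bool" where
  "gr_toric_degeneration c r N X \<Lambda> \<longleftrightarrow>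
     initial_algebra c (subalgebra (plucker r X ` minors r N)) =
       subalgebra ((\<lambda>I. Monom (gr_mono r X I (\<Lambda> I))) ` minors r N)"

definition real_expo :: "'v expo \<Rightarrow> 'v \<Rightarrow>\<^sub>0 real" where
  "real_expo e = Poly_Mapping.map real e"

definition mf_polytope ::
    "nat \<Rightarrow> nat \<Rightarrow> (nat \<Rightarrow> nat \<Rightarrow> 'v) \<Rightarrow> (nat set \<Rightarrow> nat \<Rightarrow> nat) \<Rightarrow> ('v \<Rightarrow>\<^sub>0 real) set" where
  "mf_polytope r N X \<Lambda> = convex hull ((\<lambda>I. real_expo (gr_mono r X I (\<Lambda> I))) ` minors r N)"

text \<open>The lattice \<open>M\<close> of integral points of \<open>M\<^sub>\<real> = \<real>^V\<close>.\<close>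

definition int_lattice :: "'v set \<Rightarrow> ('v \<Rightarrow>\<^sub>0 real) set" where
  "int_lattice V = {m. Poly_Mapping.keys m \<subseteq> V \<and> (\<forall>v. Poly_Mapping.lookup m v \<in> \<int>)}"

definition semigroup_generated :: "'a::real_vector set \<Rightarrow> 'a set" where
  "semigroup_generated G = {\<Sum>v\<in>G. real (k v) *\<^sub>R v | k :: 'a \<Rightarrow> nat. True}"


section \<open>Matching fields on the Kronecker moduli space\<close>

text \<open>
  The number \<open>a\<close> of the linked pair is \<open>width / gcd r1 r2\<close>.
  Boxes are pairs (row, column); a label \<open>ij\<close> is the pair \<open>(i, j)\<close>.
\<close>

record linked_pair =
  width :: nat
  Tminus :: "nat \<times> nat \<Rightarrow> nat \<times> nat"
  Tplus :: "nat \<times> nat \<Rightarrow> nat \<times> nat"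
  link :: "nat \<times> nat \<Rightarrow> nat \<times> nat"

definition cols_minus :: "nat \<Rightarrow> nat \<Rightarrow> linked_pair \<Rightarrow> nat" where
  "cols_minus r1 r2 T = width T * (r2 div gcd r1 r2)"

definition cols_plus :: "nat \<Rightarrow> nat \<Rightarrow> linked_pair \<Rightarrow> nat" where
  "cols_plus r1 r2 T = width T * (r1 div gcd r1 r2)"

definition boxes_minus :: "nat \<Rightarrow> nat \<Rightarrow> linked_pair \<Rightarrow> (nat \<times> nat) set" where
  "boxes_minus r1 r2 T = {..<r1} \<times> {..<cols_minus r1 r2 T}"

definition boxes_plus :: "nat \<Rightarrow> nat \<Rightarrow> linked_pair \<Rightarrow> (nat \<times> nat) set" where
  "boxes_plus r1 r2 T = {..<r2} \<times> {..<cols_plus r1 r2 T}"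

definition is_linked_pair :: "nat \<Rightarrow> nat \<Rightarrow> nat \<Rightarrow> linked_pair \<Rightarrow> bool" where
  "is_linked_pair r1 r2 n T \<longleftrightarrow>
     (\<forall>b\<in>boxes_minus r1 r2 T. Tminus T b \<in> {..<n} \<times> {..<r2}) \<and>
     (\<forall>b\<in>boxes_plus r1 r2 T. Tplus T b \<in> {..<n} \<times> {..<r1}) \<and>
     bij_betw (link T) (boxes_minus r1 r2 T) (boxes_plus r1 r2 T) \<and>
     (\<forall>b\<in>boxes_minus r1 r2 T.
        fst (link T b) = snd (Tminus T b) \<and> Tplus T (link T b) = (fst (Tminus T b), fst b))"

type_synonym col_perms = "(nat \<Rightarrow> nat \<Rightarrow> nat) \<times> (nat \<Rightarrow> nat \<Rightarrow> nat)"

definition W_alpha :: "nat \<Rightarrow> nat \<Rightarrow> linked_pair \<Rightarrow> col_perms set" where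
  "W_alpha r1 r2 T = {(\<tau>, \<pi>).
     (\<forall>c<cols_minus r1 r2 T. \<tau> c permutes {..<r1}) \<and> (\<forall>c<cols_plus r1 r2 T. \<pi> c permutes {..<r2})}"

definition tab_mono :: "nat \<Rightarrow> nat \<Rightarrow> linked_pair \<Rightarrow> col_perms \<Rightarrow> var expo" where
  "tab_mono r1 r2 T w = (\<Sum>b\<in>boxes_plus r1 r2 T.
     (let b' = inv_into (boxes_minus r1 r2 T) (link T) b
      in Poly_Mapping.single
           (fst (Tplus T b), snd w (snd b) (fst b), fst w (snd b') (fst b')) 1))"

text \<open>
  Different \<open>w\<close> may have the same monomial; the maximum is required to be unique as a monomial.
\<close>

definition gives_kronecker_mf ::
    "(var \<Rightarrow> nat) \<Rightarrow> nat \<Rightarrow> nat \<Rightarrow> nat \<Rightarrow> (linked_pair \<Rightarrow> col_perms) \<Rightarrow> bool" where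
  "gives_kronecker_mf c r1 r2 n \<Lambda> \<longleftrightarrow> (\<forall>T. is_linked_pair r1 r2 n T \<longrightarrow>
     \<Lambda> T \<in> W_alpha r1 r2 T \<and>
     (\<forall>w\<in>W_alpha r1 r2 T. tab_mono r1 r2 T w \<noteq> tab_mono r1 r2 T (\<Lambda> T) \<longrightarrow>
        weight c (tab_mono r1 r2 T w) < weight c (tab_mono r1 r2 T (\<Lambda> T))))"


section \<open>Varieties over the complex numbers\<close>

text \<open>
  Varieties are taken in the classical sense: a topological space of closed points together with
  a sheaf of complex-valued functions, locally isomorphic to an affine variety.
  \<open>regular X U\<close> is the set of functions that are regular on \<open>U\<close>; only their values on \<open>U\<close> matter.
\<close>

record 'p fspace =
  zariski :: "'p topology"
  regular :: "'p set \<Rightarrow> ('p \<Rightarrow> complex) set"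

abbreviation points :: "'p fspace \<Rightarrow> 'p set" where
  "points X \<equiv> topspace (zariski X)"

definition space_with_functions :: "'p fspace \<Rightarrow> bool" where
  "space_with_functions X \<longleftrightarrow>
     (\<forall>U. openin (zariski X) U \<longrightarrow>
        (\<forall>a. (\<lambda>_. a) \<in> regular X U) \<and>
        (\<forall>f\<in>regular X U. \<forall>g\<in>regular X U.
           (\<lambda>x. f x + g x) \<in> regular X U \<and> (\<lambda>x. f x * g x) \<in> regular X U) \<and>
        (\<forall>f g. f \<in> regular X U \<longrightarrow> (\<forall>x\<in>U. f x = g x) \<longrightarrow> g \<in> regular X U) \<and>
        (\<forall>f. f \<in> regular X U \<longleftrightarrow>
           (\<forall>x\<in>U. \<exists>V. openin (zariski X) V \<and> x \<in> V \<and> V \<subseteq> U \<and> f \<in> regular X V)))"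

definition preim :: "'p fspace \<Rightarrow> ('p \<Rightarrow> 'q) \<Rightarrow> 'q set \<Rightarrow> 'p set" where
  "preim X f U = {x \<in> points X. f x \<in> U}"

definition var_morphism :: "'p fspace \<Rightarrow> 'q fspace \<Rightarrow> ('p \<Rightarrow> 'q) \<Rightarrow> bool" where
  "var_morphism X Y f \<longleftrightarrow> continuous_map (zariski X) (zariski Y) f \<and>
     (\<forall>U \<phi>. openin (zariski Y) U \<longrightarrow> \<phi> \<in> regular Y U \<longrightarrow> \<phi> \<circ> f \<in> regular X (preim X f U))"

definition var_iso :: "'p fspace \<Rightarrow> 'q fspace \<Rightarrow> bool" where
  "var_iso X Y \<longleftrightarrow> (\<exists>f. homeomorphic_map (zariski X) (zariski Y) f \<and>
     (\<forall>U \<phi>. openin (zariski Y) U \<longrightarrow> (\<phi> \<in> regular Y U \<longleftrightarrow> \<phi> \<circ> f \<in> regular X (preim X f U))))"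

text \<open>The structure induced on an open or closed subset.\<close>

definition induced :: "'p fspace \<Rightarrow> 'p set \<Rightarrow> 'p fspace" where
  "induced X Z = \<lparr> zariski = subtopology (zariski X) Z,
     regular = (\<lambda>W. {\<phi>. \<forall>z\<in>W. \<exists>U \<psi>. openin (zariski X) U \<and> z \<in> U \<and> \<psi> \<in> regular X U \<and>
                        (\<forall>y\<in>U \<inter> W. \<phi> y = \<psi> y)}) \<rparr>"

text \<open>
  The space with functions given by a set \<open>X\<close> of points and an algebra \<open>A\<close> of functions on \<open>X\<close>:
  the sets \<open>{f \<noteq> 0}\<close> with \<open>f \<in> A\<close> are a basis of the topology, and regular functions are locally
  quotients of elements of \<open>A\<close>.  If the points are all characters of a finitely
  generated algebra \<open>A\<close>, this is the variety \<open>Spec A\<close>.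
\<close>

definition function_algebra_space :: "'p set \<Rightarrow> ('p \<Rightarrow> complex) set \<Rightarrow> 'p fspace" where
  "function_algebra_space X A =
     (let \<T> = topology_generated_by {{x \<in> X. f x \<noteq> 0} | f. f \<in> A}
      in \<lparr> zariski = \<T>,
           regular = (\<lambda>U. {\<phi>. \<forall>x\<in>U. \<exists>V. openin \<T> V \<and> x \<in> V \<and> V \<subseteq> U \<and>
              (\<exists>f\<in>A. \<exists>s\<in>A. \<forall>y\<in>V. s y \<noteq> 0 \<and> \<phi> y = f y / s y)}) \<rparr>)"

definition affine_line :: "complex fspace" where
  "affine_line = function_algebra_space UNIV (range poly)"

definition zero_locus :: "nat \<Rightarrow> nat cpoly set \<Rightarrow> (nat \<Rightarrow> complex) set" where
  "zero_locus m E = {x. (\<forall>i\<ge>m. x i = 0) \<and> (\<forall>f\<in>E. peval f x = 0)}"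

definition affine_variety :: "'p fspace \<Rightarrow> bool" where
  "affine_variety X \<longleftrightarrow> (\<exists>m E. var_iso X (function_algebra_space (zero_locus m E) (range peval)))"

text \<open>
  The Zariski topology on the product of two varieties, finer than the product topology: a basis
  is given by the non-vanishing sets of the functions \<open>\<Sum> a_i(x) b_i(y)\<close> on products of open sets.
\<close>

definition product_zariski :: "'p fspace \<Rightarrow> 'q fspace \<Rightarrow> ('p \<times> 'q) topology" where
  "product_zariski X Y = topology_generated_by
     {{(x, y) \<in> U \<times> V. (\<Sum>i<m. a i x * b i y) \<noteq> 0} | U V (m::nat) a b.
        openin (zariski X) U \<and> openin (zariski Y) V \<and>
        (\<forall>i<m. a i \<in> regular X U \<and> b i \<in> regular Y V)}"

definition separated_space :: "'p fspace \<Rightarrow> bool" where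
  "separated_space X \<longleftrightarrow> closedin (product_zariski X X) {(x, x) | x. x \<in> points X}"

definition variety :: "'p fspace \<Rightarrow> bool" where
  "variety X \<longleftrightarrow> space_with_functions X \<and>
     (\<exists>\<U>. finite \<U> \<and> (\<Union>\<U>) = points X \<and>
        (\<forall>U\<in>\<U>. openin (zariski X) U \<and> affine_variety (induced X U))) \<and>
     separated_space X"


section \<open>Flat morphisms\<close>

definition germ :: "'p fspace \<Rightarrow> 'p \<Rightarrow> 'p set \<Rightarrow> ('p \<Rightarrow> complex) \<Rightarrow> ('p set \<times> ('p \<Rightarrow> complex)) set" where
  "germ X x U \<phi> = {(V, \<psi>). openin (zariski X) V \<and> x \<in> V \<and> \<psi> \<in> regular X V \<and>
     (\<exists>W. openin (zariski X) W \<and> x \<in> W \<and> W \<subseteq> U \<inter> V \<and> (\<forall>w\<in>W. \<phi> w = \<psi> w))}"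

definition stalk :: "'p fspace \<Rightarrow> 'p \<Rightarrow> ('p set \<times> ('p \<Rightarrow> complex)) set ring" where
  "stalk X x =
     \<lparr> carrier = {germ X x U \<phi> | U \<phi>. openin (zariski X) U \<and> x \<in> U \<and> \<phi> \<in> regular X U},
       monoid.mult = (\<lambda>G H. \<Union>(U, \<phi>)\<in>G. \<Union>(V, \<psi>)\<in>H. germ X x (U \<inter> V) (\<lambda>y. \<phi> y * \<psi> y)),
       one = germ X x (points X) (\<lambda>_. 1),
       ring.zero = germ X x (points X) (\<lambda>_. 0),
       ring.add = (\<lambda>G H. \<Union>(U, \<phi>)\<in>G. \<Union>(V, \<psi>)\<in>H. germ X x (U \<inter> V) (\<lambda>y. \<phi> y + \<psi> y)) \<rparr>"

definition stalk_map :: "'p fspace \<Rightarrow> 'q fspace \<Rightarrow> ('p \<Rightarrow> 'q) \<Rightarrow> 'p \<Rightarrow>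
    ('q set \<times> ('q \<Rightarrow> complex)) set \<Rightarrow> ('p set \<times> ('p \<Rightarrow> complex)) set" where
  "stalk_map X Y f x G = (\<Union>(U, \<phi>)\<in>G. germ X x (preim X f U) (\<phi> \<circ> f))"

definition restrict_scalars :: "('a \<Rightarrow> 'b) \<Rightarrow> 'b ring \<Rightarrow> ('a, 'b) module" where
  "restrict_scalars h B = \<lparr> carrier = carrier B, monoid.mult = monoid.mult B, one = \<one>\<^bsub>B\<^esub>,
     ring.zero = \<zero>\<^bsub>B\<^esub>, ring.add = ring.add B, smult = (\<lambda>a b. h a \<otimes>\<^bsub>B\<^esub> b) \<rparr>"

text \<open>
  The relations defining the tensor product of an ideal \<open>I\<close> of \<open>A\<close> with an \<open>A\<close>-module \<open>N\<close>, as the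
  quotient of the free abelian group on \<open>I \<times> N\<close> by the subgroup they generate.
\<close>

definition tensor_relations :: "'a ring \<Rightarrow> 'a set \<Rightarrow> ('a, 'b) module \<Rightarrow> ('a \<times> 'b \<Rightarrow>\<^sub>0 int) set" where
  "tensor_relations A I N =
     {frag_of (x \<oplus>\<^bsub>A\<^esub> x', y) - frag_of (x, y) - frag_of (x', y) | x x' y.
        x \<in> I \<and> x' \<in> I \<and> y \<in> carrier N} \<union>
     {frag_of (x, y \<oplus>\<^bsub>N\<^esub> y') - frag_of (x, y) - frag_of (x, y') | x y y'.
        x \<in> I \<and> y \<in> carrier N \<and> y' \<in> carrier N} \<union>
     {frag_of (a \<otimes>\<^bsub>A\<^esub> x, y) - frag_of (x, a \<odot>\<^bsub>N\<^esub> y) | a x y.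
        a \<in> carrier A \<and> x \<in> I \<and> y \<in> carrier N}"

text \<open>
  Flatness: for every ideal \<open>I\<close> of \<open>A\<close> the map from the tensor product of \<open>I\<close> and \<open>N\<close> to \<open>N\<close>
  is injective.  (HOL cannot quantify over all modules inside a definition; ideals suffice.)
\<close>

definition flat_module :: "'a ring \<Rightarrow> ('a, 'b) module \<Rightarrow> bool" where
  "flat_module A N \<longleftrightarrow> (\<forall>I. ideal I A \<longrightarrow>
     (\<forall>z \<in> carrier (free_Abelian_group (I \<times> carrier N)).
        (\<Oplus>\<^bsub>N\<^esub>p\<in>Poly_Mapping.keys z. [Poly_Mapping.lookup z p] \<cdot>\<^bsub>N\<^esub> (fst p \<odot>\<^bsub>N\<^esub> snd p)) = \<zero>\<^bsub>N\<^esub> \<longrightarrow>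
        z \<in> generate (free_Abelian_group (I \<times> carrier N)) (tensor_relations A I N)))"

definition flat_morphism :: "'p fspace \<Rightarrow> 'q fspace \<Rightarrow> ('p \<Rightarrow> 'q) \<Rightarrow> bool" where
  "flat_morphism X Y f \<longleftrightarrow> var_morphism X Y f \<and>
     (\<forall>x\<in>points X. flat_module (stalk Y (f x)) (restrict_scalars (stalk_map X Y f x) (stalk X x)))"


section \<open>Toric degenerations\<close>

text \<open>
  The scheme-theoretic fibre of \<open>\<pi>\<close> over \<open>a\<close> is isomorphic to the variety \<open>Y\<close>: the fibre with its
  induced (reduced) structure is isomorphic to \<open>Y\<close>, and \<open>\<pi> - a\<close> generates the ideal of all
  functions vanishing on the fibre, i.e. the scheme-theoretic fibre is reduced.
\<close>

definition fibre_iso :: "'p fspace \<Rightarrow> ('p \<Rightarrow> complex) \<Rightarrow> complex \<Rightarrow> 'q fspace \<Rightarrow> bool" where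
  "fibre_iso X \<pi> a Y \<longleftrightarrow>
     var_iso (induced X (preim X \<pi> {a})) Y \<and>
     (\<forall>U \<phi> x. openin (zariski X) U \<longrightarrow> \<phi> \<in> regular X U \<longrightarrow> (\<forall>y\<in>U. \<pi> y = a \<longrightarrow> \<phi> y = 0) \<longrightarrow>
        x \<in> U \<longrightarrow> \<pi> x = a \<longrightarrow>
        (\<exists>W \<psi>. openin (zariski X) W \<and> x \<in> W \<and> W \<subseteq> U \<and> \<psi> \<in> regular X W \<and>
           (\<forall>y\<in>W. \<phi> y = (\<pi> y - a) * \<psi> y)))"

text \<open>
  The type of points of the total space is no restriction: a variety has at most
  continuum many points.
\<close>

definition toric_degeneration :: "'p fspace \<Rightarrow> 'q fspace \<Rightarrow> bool" where
  "toric_degeneration X X0 \<longleftrightarrow>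
     (\<exists>(\<X> :: (nat \<Rightarrow> complex) set fspace) \<pi>. variety \<X> \<and> flat_morphism \<X> affine_line \<pi> \<and>
        (\<forall>t. t \<noteq> 0 \<longrightarrow> fibre_iso \<X> \<pi> t X) \<and> fibre_iso \<X> \<pi> 0 X0)"


section \<open>Proj and the Kronecker moduli space\<close>

text \<open>
  \<open>R k\<close> is the homogeneous part of degree \<open>k\<close> of a graded subalgebra of a polynomial ring.
  The points of \<open>Proj\<close> are the closed ones, i.e. the maximal elements among the homogeneous primes
  that do not contain the irrelevant ideal.  At such a point \<open>p\<close> the value of a fraction \<open>f/s\<close> of
  elements of equal degree is the scalar \<open>v\<close> with \<open>f - v s \<in> p\<close>.
\<close>

definition graded_sum :: "(nat \<Rightarrow> 'v cpoly set) \<Rightarrow> 'v cpoly set" where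
  "graded_sum R = {\<Sum>k<m. f k | m f. \<forall>k. f k \<in> R k}"

definition graded_ring :: "(nat \<Rightarrow> 'v cpoly set) \<Rightarrow> 'v cpoly ring" where
  "graded_ring R = \<lparr> carrier = graded_sum R, monoid.mult = (*), one = 1, ring.zero = 0, ring.add = (+) \<rparr>"

definition relevant_primes :: "(nat \<Rightarrow> 'v cpoly set) \<Rightarrow> 'v cpoly set set" where
  "relevant_primes R = {p. primeideal p (graded_ring R) \<and>
     (\<forall>m f. (\<forall>k. f k \<in> R k) \<longrightarrow> (\<Sum>k<m. f k) \<in> p \<longrightarrow> (\<forall>k<m. f k \<in> p)) \<and>
     \<not> (\<Union>k\<in>{1..}. R k) \<subseteq> p}"

definition proj_points :: "(nat \<Rightarrow> 'v cpoly set) \<Rightarrow> 'v cpoly set set" where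
  "proj_points R = {p \<in> relevant_primes R. \<forall>q\<in>relevant_primes R. p \<subseteq> q \<longrightarrow> q = p}"

definition Proj :: "(nat \<Rightarrow> 'v cpoly set) \<Rightarrow> 'v cpoly set fspace" where
  "Proj R =
     (let \<T> = topology_generated_by {{p \<in> proj_points R. f \<notin> p} | f. f \<in> (\<Union>k. R k)}
      in \<lparr> zariski = \<T>,
           regular = (\<lambda>U. {\<phi>. \<forall>p\<in>U. \<exists>V. openin \<T> V \<and> p \<in> V \<and> V \<subseteq> U \<and>
              (\<exists>k. \<exists>f\<in>R k. \<exists>s\<in>R k. \<forall>q\<in>V. s \<notin> q \<and> f - Const (\<phi> q) * s \<in> q)}) \<rparr>)"

definition kronecker_moduli :: "nat \<Rightarrow> nat \<Rightarrow> nat \<Rightarrow> var cpoly set fspace" where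
  "kronecker_moduli r1 r2 n = Proj (\<lambda>k. SI r1 r2 n (theta_multiple r1 r2 k))"


section \<open>Normal fans and toric varieties\<close>

text \<open>
  \<open>direction P\<close> is the linear span of \<open>k P - x\<close> for any \<open>k > 0\<close> and \<open>x \<in> k P\<close>.  Translating and
  scaling \<open>P\<close> changes neither it nor the normal cones, so the latter are defined from \<open>P\<close> itself.
  Cones of the normal fan consist of linear functionals on \<open>direction P\<close>, the dual of
  \<open>M\<^sub>\<real> \<inter> direction P\<close>.  The normal cone of a face is given by the functionals that attain their
  minimum over \<open>P\<close> along that face (inner normals).  The empty polytope has the empty fan.
\<close>

definition direction :: "'a::real_vector set \<Rightarrow> 'a set" where
  "direction P = real_vector.span {p - q | p q. p \<in> P \<and> q \<in> P}"

definition dual_space :: "'a::real_vector set \<Rightarrow> ('a \<Rightarrow> real) set" where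
  "dual_space L = {restrict u L | u. linear u}"

definition normal_cone :: "'a::real_vector set \<Rightarrow> 'a set \<Rightarrow> ('a \<Rightarrow> real) set" where
  "normal_cone P Q = {u \<in> dual_space (direction P). \<forall>p\<in>P. \<forall>q\<in>Q. 0 \<le> u (p - q)}"

definition normal_fan :: "'a::real_vector set \<Rightarrow> ('a \<Rightarrow> real) set set" where
  "normal_fan P = {normal_cone P Q | Q. Q face_of P \<and> Q \<noteq> {}}"

text \<open>
  In the following, \<open>M\<close> is the character lattice and the cones of the fan \<open>F\<close> consist of linear
  functionals on its real span.
\<close>

definition dual_semigroup :: "'a set \<Rightarrow> ('a \<Rightarrow> real) set \<Rightarrow> 'a set" where
  "dual_semigroup M \<sigma> = {m \<in> M. \<forall>u\<in>\<sigma>. 0 \<le> u m}"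

text \<open>
  The points of \<open>Spec \<complex>[S]\<close> are the semigroup homomorphisms from \<open>S\<close> to \<open>(\<complex>, \<cdot>)\<close>, and the element
  \<open>\<Sum> a_m \<chi>^m\<close> of \<open>\<complex>[S]\<close> takes the value \<open>\<Sum> a_m \<gamma>(m)\<close> at \<open>\<gamma>\<close>.
\<close>

definition semigroup_points :: "'a::comm_monoid_add set \<Rightarrow> ('a \<Rightarrow> complex) set" where
  "semigroup_points S = {\<gamma> \<in> extensional S. \<gamma> 0 = 1 \<and> (\<forall>m\<in>S. \<forall>m'\<in>S. \<gamma> (m + m') = \<gamma> m * \<gamma> m')}"

definition affine_toric :: "'a::comm_monoid_add set \<Rightarrow> ('a \<Rightarrow> complex) fspace" where
  "affine_toric S = function_algebra_space (semigroup_points S)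
     {\<lambda>\<gamma>. \<Sum>m\<in>Poly_Mapping.keys g. Poly_Mapping.lookup g m * \<gamma> m |
        g :: 'a \<Rightarrow>\<^sub>0 complex. Poly_Mapping.keys g \<subseteq> S}"

abbreviation chart :: "'a::comm_monoid_add set \<Rightarrow> ('a \<Rightarrow> real) set \<Rightarrow> ('a \<Rightarrow> complex) fspace" where
  "chart M \<sigma> \<equiv> affine_toric (dual_semigroup M \<sigma>)"

text \<open>
  \<open>X_F\<close> is glued from the charts \<open>U_\<sigma>\<close>, \<open>\<sigma> \<in> F\<close>, along the \<open>U_(\<sigma> \<inter> \<tau>)\<close>, which are mapped to
  \<open>U_\<sigma>\<close> and \<open>U_\<tau>\<close> by restriction of semigroup homomorphisms.
\<close>

type_synonym 'a chart_point = "('a \<Rightarrow> real) set \<times> ('a \<Rightarrow> complex)"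

definition gluing :: "'a::comm_monoid_add set \<Rightarrow> ('a \<Rightarrow> real) set set \<Rightarrow>
    ('a chart_point \<times> 'a chart_point) set" where
  "gluing M F = {((\<sigma>, \<gamma>), (\<tau>, \<delta>)) | \<sigma> \<gamma> \<tau> \<delta>. \<sigma> \<in> F \<and> \<tau> \<in> F \<and>
     (\<exists>\<epsilon>\<in>points (chart M (\<sigma> \<inter> \<tau>)).
        restrict \<epsilon> (dual_semigroup M \<sigma>) = \<gamma> \<and> restrict \<epsilon> (dual_semigroup M \<tau>) = \<delta>)}"

definition glued_points :: "'a::comm_monoid_add set \<Rightarrow> ('a \<Rightarrow> real) set set \<Rightarrow>
    'a chart_point set set" where
  "glued_points M F = (SIGMA \<sigma>:F. points (chart M \<sigma>)) // gluing M F"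

definition chart_preimage :: "'a::comm_monoid_add set \<Rightarrow> ('a \<Rightarrow> real) set set \<Rightarrow>
    ('a \<Rightarrow> real) set \<Rightarrow> 'a chart_point set set \<Rightarrow> ('a \<Rightarrow> complex) set" where
  "chart_preimage M F \<sigma> W = {\<gamma> \<in> points (chart M \<sigma>). gluing M F `` {(\<sigma>, \<gamma>)} \<in> W}"

definition toric_variety :: "'a::comm_monoid_add set \<Rightarrow> ('a \<Rightarrow> real) set set \<Rightarrow>
    'a chart_point set fspace" where
  "toric_variety M F =
     \<lparr> zariski = topology (\<lambda>W. W \<subseteq> glued_points M F \<and>
         (\<forall>\<sigma>\<in>F. openin (zariski (chart M \<sigma>)) (chart_preimage M F \<sigma> W))),
       regular = (\<lambda>W. {\<phi>. \<forall>\<sigma>\<in>F.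
         (\<lambda>\<gamma>. \<phi> (gluing M F `` {(\<sigma>, \<gamma>)})) \<in> regular (chart M \<sigma>) (chart_preimage M F \<sigma> W)}) \<rparr>"

lemma istopology_toric_variety:
  "istopology (\<lambda>W. W \<subseteq> glued_points M F \<and>
     (\<forall>\<sigma>\<in>F. openin (zariski (chart M \<sigma>)) (chart_preimage M F \<sigma> W)))"
proof -
  have 1: "chart_preimage M F \<sigma> (V \<inter> W) = chart_preimage M F \<sigma> V \<inter> chart_preimage M F \<sigma> W"
    for \<sigma> V W by (auto simp: chart_preimage_def)
  have 2: "chart_preimage M F \<sigma> (\<Union>\<W>) = (\<Union>W\<in>\<W>. chart_preimage M F \<sigma> W)"
    for \<sigma> \<W> by (auto simp: chart_preimage_def)
  show ?thesis
    unfolding istopology_def 1 2 by (intro conjI allI impI) (auto intro!: openin_Union)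
qed

text \<open>The toric variety of the normal fan of \<open>P\<close>, with respect to the lattice \<open>M \<inter> direction P\<close>.\<close>

definition normal_toric_variety :: "'a::real_vector set \<Rightarrow> 'a set \<Rightarrow> 'a chart_point set fspace" where
  "normal_toric_variety M P = toric_variety (M \<inter> direction P) (normal_fan P)"

end

theory Submission
 imports Defs "HOL-Computational_Algebra.Fundamental_Theorem_Algebra"
begin

text \<open>
 Let \<open>R\<close> be the graded ring of semi-invariants. A semi-invariant is a relative invariant of each of
 the two general linear groups, hence a Plucker polynomial after multiplication with a power of a
 Plucker coordinate; by the SAGBI property its initial exponents lie in both cones \<open>C1\<close> and \<open>C2\<close>.
 Conversely the generators of \<open>C1 \<inter> C2 \<inter> M\<close> are leading exponents of semi-invariants, so the initial
 algebra of \<open>R\<close> is the algebra of the saturated semigroup \<open>C1 \<inter> C2 \<inter> M\<close>. A Veronese subalgebra of this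
 semigroup algebra is generated in degree one, and by subduction so is the Veronese subalgebra of the
 Rees algebra of \<open>R\<close>. It therefore defines a closed family in \<open>\<complex> \<times> \<P>\<^sup>N\<^sup>-\<^sup>1\<close>, which is torsion-free over the
 line, hence flat, with general fibre \<open>Proj R\<close>; its special fibre is given by the binomial equations of
 the slice of \<open>C1 \<inter> C2\<close> in degree \<open>r1 r2\<close>, which is \<open>r2 P1 \<inter> r1 P2\<close>.
\<close>

text \<open>Finite generation of the ring of semi-invariants is nowhere quoted. It comes out of
  subduction, which stops because weights are natural numbers. Polynomials are treated as functions
  throughout, so that identities in subalgebras, Veronese subalgebras and Rees algebras become
  identities of values; \<open>Proj\<close>, defined by maximal homogeneous primes, is matched with
  points by a Nullstellensatz. The initial form of a general semi-invariant need not be a monomial,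
  so membership in the two cones is proved for each of its exponents. The generators in the
  hypothesis describe lattice points only. To recover the polytope, the real points of the
  intersection of the cones must also be combinations of these generators; this rests on rationality
  and is obtained by Diophantine approximation. Fibres are reduced because the lifts of the
  monomials stay linearly independent at every parameter. Passing to a Veronese subalgebra
  multiplies the polytope by a positive number, which affects neither the normal fan nor the lattice
  in its linear span.\<close>

type_synonym cvec = "nat \<Rightarrow> complex"
hide_const (open) Determinants.det
abbreviation "tdeg \<equiv> weight (\<lambda>_. 1)"
abbreviation "keys \<equiv> Poly_Mapping.keys"
abbreviation "lookup \<equiv> Poly_Mapping.lookup"
abbreviation "single \<equiv> Poly_Mapping.single"

section \<open>Evaluation of polynomials\<close>

text \<open>Here \<open>p\<close> is an arbitrary function on the exponents. It will be a monomial
  evaluation, a homogenized one, a character of a lattice semigroup, or the values of chosen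
  monomials at a point of a cone; multiplicativity is demanded only where it is needed.\<close>

definition meval :: "('m \<Rightarrow> complex) \<Rightarrow> ('m \<Rightarrow>\<^sub>0 complex) \<Rightarrow> complex" where
 "meval p g = (\<Sum>m\<in>keys g. lookup g m * p m)"

lemma meval_eq_sum:
 assumes "finite K" "keys g \<subseteq> K"
 shows "meval p g = (\<Sum>m\<in>K. lookup g m * p m)"
 unfolding meval_def using assms by (intro sum.mono_neutral_left) (auto simp: in_keys_iff)

lemma meval_0 [simp]: "meval p 0 = 0"
 by (simp add: meval_def)

lemma meval_single [simp]: "meval p (single m a) = a * p m"
 by (simp add: meval_def)

lemma meval_add: "meval p (f + g) = meval p f + meval p g"
proof -
 let ?K = "keys f \<union> keys g"
 have "keys (f + g) \<subseteq> ?K" by (rule keys_add)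
 thus ?thesis by (simp add: meval_eq_sum[of ?K] lookup_add sum.distrib ring_distribs)
qed

lemma meval_sum: "meval p (\<Sum>i\<in>I. f i) = (\<Sum>i\<in>I. meval p (f i))"
 by (induction I rule: infinite_finite_induct) (auto simp: meval_add)

lemma sum_single_keys: "(\<Sum>m\<in>keys g. single m (lookup g m)) = g"
proof (rule poly_mapping_eqI)
 fix k
 have "(\<Sum>m\<in>keys g. lookup (single m (lookup g m)) k)
   = (\<Sum>m\<in>keys g. if m = k then lookup g m else 0)" by (intro sum.cong) (auto simp: lookup_single)
 thus "lookup (\<Sum>m\<in>keys g. single m (lookup g m)) k
   = lookup g k" by (simp add: lookup_sum in_keys_iff)
qed

lemma times_eq_sum:
 fixes f g :: "'m::comm_monoid_add \<Rightarrow>\<^sub>0 complex"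
 shows "f * g = (\<Sum>m\<in>keys f. \<Sum>m'\<in>keys g.
   single (m + m') (lookup f m * lookup g m'))"
 using arg_cong2[where f = "(*)", OF sum_single_keys[of f, symmetric] sum_single_keys[of g, symmetric]] unfolding sum_product mult_single .

text \<open>Three different functions are allowed in order to cover evaluations that depend on a degree.\<close>

lemma meval_mult:
 fixes f g :: "'m::comm_monoid_add \<Rightarrow>\<^sub>0 complex"
 assumes "\<And>m m'. m \<in> keys f \<Longrightarrow> m' \<in> keys g \<Longrightarrow> p'' (m + m') = p m * p' m'"
 shows "meval p'' (f * g) = meval p f * meval p' g"
proof -
 have "meval p'' (f * g) = (\<Sum>m\<in>keys f. \<Sum>m'\<in>keys g.
   lookup f m * lookup g m' * p'' (m + m'))" by (subst times_eq_sum) (simp add: meval_sum)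
 also have "\<dots> = (\<Sum>m\<in>keys f. \<Sum>m'\<in>keys g.
   (lookup f m * p m) * (lookup g m' * p' m'))" by (intro sum.cong refl) (simp add: assms)
 finally show ?thesis by (simp add: meval_def sum_product)
qed

section \<open>Monomials and polynomials as functions\<close>

definition mono_eval :: "('v \<Rightarrow> complex) \<Rightarrow> 'v expo \<Rightarrow> complex" where
 "mono_eval x e = (\<Prod>v\<in>keys e. x v ^ lookup e v)"

lemma mono_eval_eq_prod:
 assumes "finite K" "keys e \<subseteq> K"
 shows "mono_eval x e = (\<Prod>v\<in>K. x v ^ lookup e v)"
 unfolding mono_eval_def using assms by (intro prod.mono_neutral_left) (auto simp: in_keys_iff)

lemma mono_eval_0 [simp]: "mono_eval x 0 = 1"
 by (simp add: mono_eval_def)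

lemma mono_eval_add: "mono_eval x (e + e') = mono_eval x e * mono_eval x e'"
proof -
 let ?K = "keys e \<union> keys e'"
 have "keys (e + e') \<subseteq> ?K" by (rule keys_add)
 thus ?thesis by (simp add: mono_eval_eq_prod[of ?K] lookup_add power_add prod.distrib)
qed

lemma mono_eval_single [simp]: "mono_eval x (single v k) = x v ^ k"
 by (cases "k = 0") (auto simp: mono_eval_def)

lemma mono_eval_one [simp]: "mono_eval (\<lambda>_. 1) e = 1"
 by (simp add: mono_eval_def)

lemma mono_eval_times: "mono_eval (\<lambda>v. x v * y v) e = mono_eval x e * mono_eval y e"
 by (simp add: mono_eval_def power_mult_distrib prod.distrib)

lemma mono_eval_power:
 "mono_eval (\<lambda>v. a ^ c v) e = a ^ weight c e" by (simp add: mono_eval_def weight_def power_sum mult.commute flip: power_mult)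

lemma mono_eval_cong:
 "(\<And>v. v \<in> keys e \<Longrightarrow> x v = y v) \<Longrightarrow> mono_eval x e = mono_eval y e" by (simp add: mono_eval_def)

lemma peval_eq_meval: "peval f x = meval (mono_eval x) f"
 by (simp add: peval_def meval_def mono_eval_def)

lemma peval_0 [simp]: "peval 0 x = 0"
 by (simp add: peval_eq_meval)

lemma peval_add: "peval (f + g) x = peval f x + peval g x"
 by (simp add: peval_eq_meval meval_add)

lemma peval_sum: "peval (\<Sum>i\<in>I. f i) x = (\<Sum>i\<in>I. peval (f i) x)"
 by (simp add: peval_eq_meval meval_sum)

lemma peval_mult: "peval (f * g) x = peval f x * peval g x"
 unfolding peval_eq_meval by (rule meval_mult) (rule mono_eval_add)

lemma peval_Const [simp]: "peval (Const a) x = a"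
 by (simp add: peval_eq_meval Const_def)

lemma peval_Monom [simp]: "peval (Monom e) x = mono_eval x e"
 by (simp add: peval_eq_meval Monom_def)

lemma peval_Indet [simp]: "peval (Indet v) x = x v"
 by (simp add: Indet_def)

lemma Const_1 [simp]: "Const 1 = 1" and Const_0 [simp]: "Const 0 = 0"
 by (simp_all add: Const_def)

lemma Const_add: "Const (a + b) = Const a + Const b"
 by (simp add: Const_def single_add)

lemma Const_mult: "Const (a * b) = Const a * Const b"
 by (simp add: Const_def mult_single)

lemma Const_uminus: "Const (- a) = - Const a"
 by (simp add: Const_def single_uminus)

lemma Const_diff: "Const (a - b) = Const a - Const b"
 using Const_add[of a "- b"] by (simp add: Const_uminus)

lemma peval_1 [simp]: "peval 1 x = 1"
 by (metis peval_Const Const_1)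

lemma peval_uminus: "peval (- f) x = - peval f x"
 by (metis add.right_inverse eq_neg_iff_add_eq_0 peval_0 peval_add)

lemma peval_diff: "peval (f - g) x = peval f x - peval g x"
 by (metis diff_conv_add_uminus peval_add peval_uminus)

lemma peval_power: "peval (f ^ k) x = peval f x ^ k"
 by (induction k) (auto simp: peval_mult)

lemma peval_prod: "peval (\<Prod>i\<in>I. f i) x = (\<Prod>i\<in>I. peval (f i) x)"
 by (induction I rule: infinite_finite_induct) (auto simp: peval_mult)

lemma keys_Const_mult: "keys (Const a * f) \<subseteq> keys f"
 using keys_mult[of "Const a" f] by (auto simp: Const_def split: if_splits)

lemma lookup_Const_mult: "lookup (Const a * f) e = a * lookup f e"
proof -
 have "Const a * f = (\<Sum>m\<in>keys f. single m (a * lookup f m))"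
  by (subst (1) sum_single_keys[symmetric, of f]) (simp add: Const_def mult_single sum_distrib_left)
 also have "lookup \<dots> e = (\<Sum>m\<in>keys f. if m = e then a * lookup f m else 0)"
  unfolding lookup_sum by (intro sum.cong) (auto simp: lookup_single)
 finally show ?thesis by (simp add: in_keys_iff)
qed

text \<open>Distinct multiplicative functions on \<open>\<complex>\<^sup>V\<close> are linearly independent.\<close>

lemma mono_eval_independent:
 assumes "finite K" "\<And>x. (\<Sum>e\<in>K. a e * mono_eval x e) = 0"
 shows "\<forall>e\<in>K. a e = 0"
 using assms
proof (induction K arbitrary: a rule: finite_induct)
 case (insert e0 K)
 have rel: "a e0 * mono_eval x e0 + (\<Sum>e\<in>K. a e * mono_eval x e) = 0" for x using insert.prems[of x] insert.hyps by simp
 have K0: "a e = 0" if "e \<in> K" for e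
 proof -
  have "e \<noteq> e0" using that insert.hyps by auto
  then obtain v where v: "lookup e v \<noteq> lookup e0 v" by (meson poly_mapping_eqI)
  \<comment> \<open>Doubling the coordinate \<open>v\<close>, in which the exponents differ,
    multiplies the two monomials by different powers of 2. Subtracting the suitable multiple of the
    original relation removes \<open>e0\<close> and leaves a relation on \<open>K\<close> in which
    \<open>e\<close> keeps a nonzero factor.\<close>
  define g :: "'a \<Rightarrow> complex" where "g = (\<lambda>w. if w = v then 2 else 1)"
  have g: "mono_eval g e' = 2 ^ lookup e' v" for e'
  proof -
   have "mono_eval g e' = (\<Prod>w\<in>insert v (keys e'). g w ^ lookup e' w)" by (rule mono_eval_eq_prod) auto
   also have "\<dots> = g v ^ lookup e' v" by (subst prod.mono_neutral_right[of _ "{v}"]) (auto simp: g_def)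
   finally show ?thesis by (simp add: g_def)
  qed
  have "\<forall>e\<in>K. a e * (mono_eval g e - mono_eval g e0) = 0"
  proof (rule insert.IH)
   fix x
   have "(\<Sum>e\<in>K. a e * (mono_eval g e - mono_eval g e0) * mono_eval x e)
     = (\<Sum>e\<in>K. a e * mono_eval (\<lambda>w. g w * x w) e) - mono_eval g e0 * (\<Sum>e\<in>K. a e * mono_eval x e)"
    unfolding sum_distrib_left sum_subtractf[symmetric] by (intro sum.cong refl) (simp add: mono_eval_times algebra_simps)
   thus "(\<Sum>e\<in>K. a e * (mono_eval g e - mono_eval g e0) * mono_eval x e) = 0"
    using minus_unique[OF rel[of x], symmetric] minus_unique[OF rel[of "\<lambda>w. g w * x w"], symmetric] by (simp add: mono_eval_times)
  qed
  hence "a e * (mono_eval g e - mono_eval g e0) = 0" using that by blast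
  moreover have "norm (mono_eval g e) \<noteq> norm (mono_eval g e0)" using v by (simp add: g norm_power)
  ultimately show ?thesis by auto
 qed
 moreover have "a e0 = 0" using rel[of "\<lambda>_. 1"] K0 by simp
 ultimately show ?case by simp
qed simp

lemma peval_eq_0D:
 assumes "\<And>x. peval f x = 0"
 shows "f = 0"
proof -
 have "\<forall>e\<in>keys f. lookup f e = 0" using assms by (intro mono_eval_independent) (auto simp: peval_eq_meval meval_def)
 hence "lookup f e = 0" for e by (auto simp: in_keys_iff)
 thus ?thesis by (intro poly_mapping_eqI) simp
qed

lemma peval_eqD:
 assumes "\<And>x. peval f x = peval g x"
 shows "f = g"
proof -
 have "peval (f - g) x = 0" for x using assms[of x] by (simp add: peval_diff)
 hence "f - g = 0" by (rule peval_eq_0D)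
 thus ?thesis by simp
qed

lemma peval_cong:
 assumes "\<And>v. v \<in> vars f \<Longrightarrow> x v = y v"
 shows "peval f x = peval f y"
proof -
 have "mono_eval x e = mono_eval y e" if "e \<in> keys f" for e using that assms by (intro mono_eval_cong) (auto simp: vars_def)
 thus ?thesis by (simp add: peval_eq_meval meval_def)
qed

section \<open>Initial forms\<close>

lemma weight_eq_sum:
 assumes "finite K" "keys e \<subseteq> K"
 shows "weight c e = (\<Sum>v\<in>K. lookup e v * c v)"
 unfolding weight_def using assms by (intro sum.mono_neutral_left) (auto simp: in_keys_iff)

lemma weight_0 [simp]: "weight c 0 = 0"
 by (simp add: weight_def)

lemma weight_add: "weight c (e + e') = weight c e + weight c e'"
proof -
 let ?K = "keys e \<union> keys e'"
 have "keys (e + e') \<subseteq> ?K" by (rule keys_add)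
 thus ?thesis by (simp add: weight_eq_sum[of ?K] lookup_add sum.distrib ring_distribs)
qed

lemma weight_sum: "weight c (\<Sum>i\<in>I. e i) = (\<Sum>i\<in>I. weight c (e i))"
 by (induction I rule: infinite_finite_induct) (auto simp: weight_add)

lemma weight_single [simp]: "weight c (single v k) = k * c v"
 by (simp add: weight_def)

section \<open>Weights and homogenization\<close>

definition weight_le :: "('v \<Rightarrow> nat) \<Rightarrow> nat \<Rightarrow> 'v cpoly \<Rightarrow> bool" where
 "weight_le c w f \<longleftrightarrow> (\<forall>e\<in>keys f. weight c e \<le> w)"

text \<open>
 The homogenization of \<open>g\<close> with respect to the grading: \<open>\<Sum> g\<^sub>e t\<^sup>w\<^sup>-\<^sup>w\<^sup>(\<^sup>e\<^sup>) x\<^sup>e\<close>, to be used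
 for \<open>w\<close> at least the weight of \<open>g\<close>.
\<close>

definition heval :: "('v \<Rightarrow> nat) \<Rightarrow> nat \<Rightarrow> 'v cpoly \<Rightarrow> complex \<Rightarrow> ('v \<Rightarrow> complex) \<Rightarrow> complex" where
 "heval c w g t x = meval (\<lambda>e. t ^ (w - weight c e) * mono_eval x e) g"

lemma heval_0 [simp]: "heval c w 0 t x = 0"
 by (simp add: heval_def)

lemma heval_add: "heval c w (f + g) t x = heval c w f t x + heval c w g t x"
 by (simp add: heval_def meval_add)

lemma heval_sum: "heval c w (\<Sum>i\<in>I. f i) t x = (\<Sum>i\<in>I. heval c w (f i) t x)"
 by (simp add: heval_def meval_sum)

lemma heval_mult:
 assumes "weight_le c w f" "weight_le c w' g"
 shows "heval c (w + w') (f * g) t x = heval c w f t x * heval c w' g t x"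
 unfolding heval_def
proof (rule meval_mult)
 fix m m' assume "m \<in> keys f" "m' \<in> keys g"
 hence "weight c m \<le> w" "weight c m' \<le> w'" using assms by (auto simp: weight_le_def)
 hence "w + w' - weight c (m + m') = (w - weight c m) + (w' - weight c m')" by (simp add: weight_add)
 thus "t ^ (w + w' - weight c (m + m')) * mono_eval x (m + m') =
   t ^ (w - weight c m) * mono_eval x m * (t ^ (w' - weight c m') * mono_eval x m')" by (simp add: power_add mono_eval_add)
qed

lemma heval_Const [simp]: "heval c 0 (Const a) t x = a"
 by (simp add: heval_def Const_def)

lemma heval_1 [simp]: "heval c 0 1 t x = 1"
 by (metis heval_Const Const_1)

lemma heval_diff: "heval c w (f - g) t x = heval c w f t x - heval c w g t x"
 by (metis add_diff_cancel diff_add_cancel heval_add)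

lemma heval_Const_mult: "heval c w (Const a * g) t x = a * heval c w g t x"
proof -
 have "heval c w (Const a * g) t x = (\<Sum>e\<in>keys g. lookup (Const a * g) e * (t ^ (w - weight c e) * mono_eval x e))"
  unfolding heval_def by (rule meval_eq_sum) (auto intro: keys_Const_mult[THEN subsetD])
 thus ?thesis by (simp add: lookup_Const_mult heval_def meval_def sum_distrib_left mult.assoc)
qed

lemma heval_le:
 assumes "weight_le c w g" "w \<le> W"
 shows "heval c W g t x = t ^ (W - w) * heval c w g t x"
 unfolding heval_def meval_def sum_distrib_left
 by (intro sum.cong refl) (use assms in \<open>auto simp: weight_le_def simp flip: power_add\<close>)

text \<open>The substitution is the one-parameter subgroup with weights \<open>c\<close>. Away from
  \<open>t = 0\<close> it identifies the homogenized polynomial with the original one up to a power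
  of \<open>t\<close>; this is what trivializes the family there.\<close>

lemma heval_peval:
 assumes "weight_le c w g"
 shows "heval c w g t (\<lambda>v. t ^ c v * x v) = t ^ w * peval g x"
proof -
 have *: "t ^ (w - weight c e) * t ^ weight c e = t ^ w"
  if "e \<in> keys g" for e using that assms by (auto simp: weight_le_def simp flip: power_add)
 show ?thesis unfolding heval_def peval_eq_meval meval_def sum_distrib_left
  by (intro sum.cong refl) (simp add: mono_eval_times mono_eval_power flip: *)
qed

definition wpart :: "('v \<Rightarrow> nat) \<Rightarrow> nat \<Rightarrow> 'v cpoly \<Rightarrow> 'v cpoly" where
 "wpart c w f = (\<Sum>e\<in>{e\<in>keys f. weight c e = w}. single e (lookup f e))"

lemma lookup_wpart:
 "lookup (wpart c w f) e = (if weight c e = w then lookup f e else 0)"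
proof -
 have "lookup (wpart c w f) e
   = (\<Sum>m\<in>{m\<in>keys f. weight c m = w}. if m = e then lookup f m else 0)"
  unfolding wpart_def lookup_sum by (intro sum.cong) (auto simp: lookup_single)
 thus ?thesis by (simp add: in_keys_iff)
qed

lemma keys_wpart:
 "keys (wpart c w f) = {e\<in>keys f. weight c e = w}" by (auto simp: in_keys_iff lookup_wpart split: if_splits)

lemma wpart_Const_mult: "wpart c w (Const a * g) = Const a * wpart c w g"
 by (rule poly_mapping_eqI) (simp add: lookup_wpart lookup_Const_mult)

text \<open>At \<open>t = 0\<close> the factor \<open>0 ^ (w - weight c e)\<close> is 1 for the
  terms of weight \<open>w\<close> and 0 for the lighter ones. The special fibre therefore sees
  initial forms.\<close>

lemma heval_at_0:
 assumes "weight_le c w g"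
 shows "heval c w g 0 x = peval (wpart c w g) x"
proof -
 have "peval (wpart c w g) x
   = (\<Sum>e\<in>keys g. lookup (wpart c w g) e * mono_eval x e)" unfolding peval_eq_meval by (rule meval_eq_sum) (auto simp: keys_wpart)
 also have "\<dots> = (\<Sum>e\<in>keys g. lookup g e * (0 ^ (w - weight c e) * mono_eval x e))"
  by (intro sum.cong refl) (use assms in \<open>auto simp: lookup_wpart weight_le_def zero_power\<close>)
 finally show ?thesis by (simp add: heval_def meval_def)
qed

lemma weight_le_mult:
 assumes "weight_le c w f" "weight_le c w' g"
 shows "weight_le c (w + w') (f * g)"
 unfolding weight_le_def
proof
 fix e assume "e \<in> keys (f * g)"
 then obtain a b where "e = a + b" "a \<in> keys f" "b \<in> keys g" using keys_mult[of f g] by blast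
 thus "weight c e \<le> w + w'" using assms by (auto simp: weight_le_def weight_add intro: add_mono)
qed

lemma weight_le_add:
 assumes "weight_le c w f" "weight_le c w g"
 shows "weight_le c w (f + g)"
 using assms keys_add[of f g] unfolding weight_le_def by blast

text \<open>This is the multiplicativity of homogenization, read at \<open>t = 0\<close>.\<close>

lemma wpart_mult:
 assumes "weight_le c w f" "weight_le c w' g"
 shows "wpart c (w + w') (f * g) = wpart c w f * wpart c w' g"
proof (rule peval_eqD)
 fix x
 show "peval (wpart c (w + w') (f * g)) x = peval (wpart c w f * wpart c w' g) x"
  using heval_mult[OF assms, of 0 x] by (simp add: heval_at_0 assms weight_le_mult peval_mult)
qed

lemma weight_le_Const_mult: "weight_le c w f \<Longrightarrow> weight_le c w (Const a * f)"
 using keys_Const_mult[of a f] unfolding weight_le_def by blast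

lemma weight_le_sum:
 assumes "\<And>i. i \<in> I \<Longrightarrow> weight_le c w (f i)"
 shows "weight_le c w (\<Sum>i\<in>I. f i)"
 using assms
proof (induction I rule: infinite_finite_induct)
 case (insert i I)
 thus ?case by (simp add: weight_le_add)
qed (simp_all add: weight_le_def)

lemma weight_le_ex: "\<exists>w. weight_le c w f"
 unfolding weight_le_def by (rule exI[of _ "Max (weight c ` keys f)"]) auto

lemma initial_form_eq_wpart:
 assumes "weight_le c w f" "wpart c w f \<noteq> 0"
 shows "initial_form c f = wpart c w f"
proof -
 have "keys (wpart c w f) \<noteq> {}" using assms(2) by simp
 then obtain e where "e \<in> keys f" "weight c e = w" unfolding keys_wpart by auto
 hence "{e \<in> keys f. \<forall>e'\<in>keys f. weight c e' \<le> weight c e}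
   = {e\<in>keys f. weight c e = w}" using assms(1) by (auto simp: weight_le_def intro: antisym)
 thus ?thesis by (simp add: initial_form_def wpart_def)
qed

lemma initial_form_weight:
 assumes "f \<noteq> 0"
 obtains w where "weight_le c w f" "wpart c w f \<noteq> 0" "initial_form c f = wpart c w f"
proof -
 let ?w = "Max (weight c ` keys f)"
 have le: "weight_le c ?w f" by (auto simp: weight_le_def)
 have "?w \<in> weight c ` keys f" using assms by (intro Max_in) auto
 hence "keys (wpart c ?w f) \<noteq> {}" unfolding keys_wpart by auto
 hence "wpart c ?w f \<noteq> 0" by auto
 thus ?thesis using that le initial_form_eq_wpart by blast
qed

lemma initial_form_0 [simp]: "initial_form c 0 = 0"
 by (simp add: initial_form_def)

lemma single_eq_0_iff [simp]: "single e a = 0 \<longleftrightarrow> a = 0"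
 by (metis lookup_single_eq lookup_zero single_zero)

text \<open>Phrased with \<open>wpart\<close> because taking the part of a fixed weight is
  multiplicative without any condition of non-vanishing.\<close>

lemma has_LM_iff:
 "has_LM c f e \<longleftrightarrow> (\<exists>a. a \<noteq> 0 \<and> weight_le c (weight c e) f \<and> wpart c (weight c e) f = single e a)"
proof
 assume "has_LM c f e"
 then obtain a where a: "a \<noteq> 0" "initial_form c f = single e a" by (auto simp: has_LM_def)
 hence "f \<noteq> 0" by auto
 then obtain w where w: "weight_le c w f" "wpart c w f \<noteq> 0" "initial_form c f = wpart c w f" by (rule initial_form_weight)
 hence "e \<in> keys (wpart c w f)" using a unfolding w(3) by simp
 hence "weight c e = w" unfolding keys_wpart by blast
 thus "\<exists>a. a \<noteq> 0 \<and> weight_le c (weight c e) f \<and> wpart c (weight c e) f = single e a" using a w by auto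
qed (use initial_form_eq_wpart[of c "weight c e" f] in \<open>auto simp: has_LM_def\<close>)

lemma has_LM_Const:
 assumes "a \<noteq> 0"
 shows "has_LM c (Const a) 0"
proof -
 have "wpart c 0 (Const a) = Const a" by (rule poly_mapping_eqI) (auto simp: lookup_wpart Const_def lookup_single when_def)
 moreover have "weight_le c 0 (Const a)" by (auto simp: weight_le_def Const_def split: if_splits)
 ultimately show ?thesis unfolding has_LM_iff using assms by (auto simp: Const_def)
qed

lemma has_LM_mult:
 assumes "has_LM c f e" "has_LM c g e'"
 shows "has_LM c (f * g) (e + e')"
proof -
 obtain a where a: "a \<noteq> 0" "weight_le c (weight c e) f" "wpart c (weight c e) f = single e a"
  using assms(1) by (auto simp: has_LM_iff)
 obtain b where b: "b \<noteq> 0" "weight_le c (weight c e') g" "wpart c (weight c e') g = single e' b"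
  using assms(2) by (auto simp: has_LM_iff)
 have "wpart c (weight c e + weight c e') (f * g) = single (e + e') (a * b)"
  using wpart_mult[OF a(2) b(2)] a(3) b(3) by (simp add: mult_single)
 moreover have "weight_le c (weight c e + weight c e') (f * g)" by (rule weight_le_mult[OF a(2) b(2)])
 ultimately show ?thesis unfolding has_LM_iff weight_add using a(1) b(1) by (metis mult_eq_0_iff)
qed

text \<open>Since the initial form of \<open>g\<close> is a single monomial, multiplication by it
  only translates the exponents of the initial form of \<open>f\<close>, so no cancellation can
  occur.\<close>

lemma keys_initial_form_mult:
 assumes "e \<in> keys (initial_form c f)" "has_LM c g e'"
 shows "e + e' \<in> keys (initial_form c (f * g))"
proof -
 have "f \<noteq> 0" using assms(1) by auto
 then obtain w where w: "weight_le c w f" "wpart c w f \<noteq> 0" "initial_form c f = wpart c w f" by (rule initial_form_weight)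
 obtain b where b: "b \<noteq> 0" "weight_le c (weight c e') g" "wpart c (weight c e') g = single e' b"
  using assms(2) by (auto simp: has_LM_iff)
 have eq: "wpart c (w + weight c e') (f * g) = wpart c w f * single e' b" using wpart_mult[OF w(1) b(2)] b(3) by simp
 have "wpart c w f * single e' b = (\<Sum>m\<in>keys (wpart c w f).
   single (m + e') (lookup (wpart c w f) m * b))" by (subst times_eq_sum) (simp add: b)
 also have "lookup \<dots> (e + e') = (\<Sum>m\<in>keys (wpart c w f). 
   if m = e then lookup (wpart c w f) m * b else 0)" unfolding lookup_sum by (intro sum.cong) (auto simp: lookup_single)
 also have "\<dots> = lookup (wpart c w f) e * b" using assms(1) w by simp
 also have "\<dots> \<noteq> 0" using assms(1) w b by (simp add: in_keys_iff)
 finally have "e + e' \<in> keys (wpart c (w + weight c e') (f * g))" by (simp add: in_keys_iff eq)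
 moreover hence "wpart c (w + weight c e') (f * g) \<noteq> 0" by auto
 ultimately show ?thesis using initial_form_eq_wpart[OF weight_le_mult[OF w(1) b(2)]] by simp
qed

section \<open>Spaces with functions presented by a basis\<close>

text \<open>
 The pairs in \<open>\<F>\<close> consist of a basic open set and a regular function on it; every regular function
 is locally one of these.
\<close>

abbreviation near :: "('p set \<times> ('p \<Rightarrow> complex)) set \<Rightarrow> 'p \<Rightarrow> 'p set \<Rightarrow> ('p \<Rightarrow> complex) \<Rightarrow> bool" where
 "near \<F> x U f \<equiv> \<exists>D p. (D, p) \<in> \<F> \<and> x \<in> D \<and> D \<subseteq> U \<and> (\<forall>y\<in>D. f y = p y)"

text \<open>On an overlap the two functions may differ, so the smaller pair restricts only the first
  of them. Taking the pairs in either order gives restrictions of both.\<close>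

definition refining :: "('p set \<times> ('p \<Rightarrow> complex)) set \<Rightarrow> bool" where
 "refining \<F> \<longleftrightarrow> (\<forall>D p D' p' x. (D, p) \<in> \<F> \<longrightarrow> (D', p') \<in> \<F> \<longrightarrow> x \<in> D \<inter> D' \<longrightarrow>
   (\<exists>D'' p''. (D'', p'') \<in> \<F> \<and> x \<in> D'' \<and> D'' \<subseteq> D \<inter> D' \<and> (\<forall>y\<in>D''. p'' y = p y)))"

text \<open>Regularity is described on open sets only. In an induced space, say, a function that is
  regular on a non-open set need not be covered by basic pairs.\<close>

definition presented :: "'p fspace \<Rightarrow> ('p set \<times> ('p \<Rightarrow> complex)) set \<Rightarrow> bool" where
 "presented X \<F> \<longleftrightarrow> refining \<F> \<and>
   (\<forall>U. openin (zariski X) U \<longleftrightarrow> (\<forall>x\<in>U. \<exists>D p. (D, p) \<in> \<F> \<and> x \<in> D \<and> D \<subseteq> U)) \<and>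
   (\<forall>U f. openin (zariski X) U \<longrightarrow> (f \<in> regular X U \<longleftrightarrow>
    (\<forall>x\<in>U. near \<F> x U f)))"

lemma refiningD:
 assumes "refining \<F>" "(D, p) \<in> \<F>" "(D', p') \<in> \<F>" "x \<in> D" "x \<in> D'"
 obtains D'' p'' where "(D'', p'') \<in> \<F>" "x \<in> D''" "D'' \<subseteq> D" "D'' \<subseteq> D'" "\<And>y. y \<in> D'' \<Longrightarrow> p'' y = p y"
 using assms(1)[unfolded refining_def, rule_format, OF assms(2,3) IntI[OF assms(4,5)]] that by blast

lemma presented_refining: "presented X \<F> \<Longrightarrow> refining \<F>"
 by (simp add: presented_def)

lemma presented_openI:
 assumes "presented X \<F>" "\<And>x. x \<in> U \<Longrightarrow> \<exists>D p. (D, p) \<in> \<F> \<and> x \<in> D \<and> D \<subseteq> U"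
 shows "openin (zariski X) U"
 using assms unfolding presented_def by blast

lemma presented_openE:
 assumes "presented X \<F>" "openin (zariski X) U" "x \<in> U"
 obtains D p where "(D, p) \<in> \<F>" "x \<in> D" "D \<subseteq> U" using assms unfolding presented_def by metis

lemma presented_regularI:
 assumes "presented X \<F>" "openin (zariski X) U"
  "\<And>x. x \<in> U \<Longrightarrow> near \<F> x U f"
 shows "f \<in> regular X U"
 using assms unfolding presented_def by blast

lemma presented_regularE:
 assumes "presented X \<F>" "openin (zariski X) U" "f \<in> regular X U" "x \<in> U"
 obtains D p where "(D, p) \<in> \<F>" "x \<in> D" "D \<subseteq> U" "\<And>y. y \<in> D \<Longrightarrow> f y = p y"
 using assms unfolding presented_def by metis

lemma presented_open_basic:
 assumes "presented X \<F>" "(D, p) \<in> \<F>"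
 shows "openin (zariski X) D"
 using assms by (intro presented_openI[OF assms(1)]) blast

lemma presented_regular_basic:
 assumes "presented X \<F>" "(D, p) \<in> \<F>"
 shows "p \<in> regular X D"
 using assms presented_open_basic[OF assms] by (intro presented_regularI[OF assms(1)]) blast+

lemma presented_points_iff:
 assumes "presented X \<F>"
 shows "x \<in> points X \<longleftrightarrow> (\<exists>D p. (D, p) \<in> \<F> \<and> x \<in> D)"
 by (metis assms openin_subset openin_topspace presented_openE presented_open_basic subset_iff)

lemma presented_subset_points: "presented X \<F> \<Longrightarrow> (D, p) \<in> \<F> \<Longrightarrow> D \<subseteq> points X"
 using presented_points_iff[of X \<F>] by auto

lemma presentedI:
 assumes ref: "refining \<F>"
  and top: "zariski X = topology_generated_by (fst ` \<F>)"
  and reg: "\<And>U f. f \<in> regular X U \<longleftrightarrow> (\<forall>x\<in>U. \<exists>V D p. openin (zariski X) V \<and> x \<in> V \<and> V \<subseteq> U \<and>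
    (D, p) \<in> \<F> \<and> V \<subseteq> D \<and> (\<forall>y\<in>V. f y = p y))"
 shows "presented X \<F>"
proof -
 have basic: "openin (zariski X) D" if "(D, p) \<in> \<F>" for D p
  unfolding top using that by (intro topology_generated_by_Basis) (force simp: image_iff)
 have "\<forall>x\<in>U. \<exists>D p. (D, p) \<in> \<F> \<and> x \<in> D \<and> D \<subseteq> U" if "generate_topology_on (fst ` \<F>) U" for U
  using that
 proof (induction rule: generate_topology_on.induct)
  case (Int a b)
  show ?case
  proof
   fix x assume "x \<in> a \<inter> b"
   then obtain D p D' p' where "(D, p) \<in> \<F>" "x \<in> D" "D \<subseteq> a" "(D', p') \<in> \<F>" "x \<in> D'" "D' \<subseteq> b"
    using Int by blast
   thus "\<exists>D p. (D, p) \<in> \<F> \<and> x \<in> D \<and> D \<subseteq> a \<inter> b"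
    using refiningD[OF ref, of D p D' p' x] by (metis Int_greatest order_trans)
  qed
 next
  case (UN K)
  thus ?case by (meson Union_iff Union_upper order_trans)
 next
  case (Basis s)
  thus ?case by force
 qed auto
 hence 1: "openin (zariski X) U \<longleftrightarrow> (\<forall>x\<in>U. \<exists>D p. (D, p) \<in> \<F> \<and> x \<in> D \<and> D \<subseteq> U)" for U
  by (metis basic openin_subopen openin_topology_generated_by_iff top)
 have 2: "f \<in> regular X U \<longleftrightarrow>
    (\<forall>x\<in>U. near \<F> x U f)" if "openin (zariski X) U" for U f
 proof
  assume "f \<in> regular X U"
  show "\<forall>x\<in>U. near \<F> x U f"
  proof
   fix x assume "x \<in> U"
   then obtain V D p where V: "openin (zariski X) V" "x \<in> V" "V \<subseteq> U" "(D, p) \<in> \<F>" "V \<subseteq> D" "\<forall>y\<in>V. f y = p y"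
    using bspec[OF iffD1[OF reg \<open>f \<in> regular X U\<close>] \<open>x \<in> U\<close>] by blast
   then obtain D' p' where D': "(D', p') \<in> \<F>" "x \<in> D'" "D' \<subseteq> V" using 1 by meson
   have "x \<in> D" using V by auto
   then obtain D'' p'' where "(D'', p'') \<in> \<F>" "x \<in> D''" "D'' \<subseteq> D" "D'' \<subseteq> D'" "\<And>y. y \<in> D'' \<Longrightarrow> p'' y = p y"
    using refiningD[OF ref V(4) D'(1) _ D'(2)] by blast
   moreover from this have "D'' \<subseteq> U" "\<forall>y\<in>D''. f y = p'' y" using V D' by (auto simp: subset_iff)
   ultimately show "near \<F> x U f" by blast
  qed
 next
  assume *: "\<forall>x\<in>U. near \<F> x U f"
  show "f \<in> regular X U" unfolding reg
  proof
   fix x assume "x \<in> U"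
   then obtain D p where "(D, p) \<in> \<F>" "x \<in> D" "D \<subseteq> U" "\<forall>y\<in>D. f y = p y" using * by meson
   thus "\<exists>V D p. openin (zariski X) V \<and> x \<in> V \<and> V \<subseteq> U \<and> (D, p) \<in> \<F> \<and> V \<subseteq> D \<and> (\<forall>y\<in>V. f y = p y)"
    using basic by blast
  qed
 qed
 show ?thesis unfolding presented_def using ref 1 2 by blast
qed

lemma presented_morphism:
 assumes X: "presented X \<F>" and Y: "presented Y \<G>" and hY: "\<And>x. x \<in> points X \<Longrightarrow> h x \<in> points Y"
  and A: "\<And>D p x. (D, p) \<in> \<G> \<Longrightarrow> x \<in> points X \<Longrightarrow> h x \<in> D \<Longrightarrow>
   \<exists>D' p'. (D', p') \<in> \<F> \<and> x \<in> D' \<and> (\<forall>y\<in>D'. h y \<in> D \<and> p' y = p (h y))"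
 shows "var_morphism X Y h"
proof -
 have ptsX: "D \<subseteq> points X" if "(D, p) \<in> \<F>" for D p using presented_subset_points[OF X that] .
 have pre: "openin (zariski X) (preim X h U)" if U: "openin (zariski Y) U" for U
 proof (rule presented_openI[OF X])
  fix x assume "x \<in> preim X h U"
  hence x: "x \<in> points X" "h x \<in> U" by (auto simp: preim_def)
  obtain D p where "(D, p) \<in> \<G>" "h x \<in> D" "D \<subseteq> U" by (rule presented_openE[OF Y U x(2)])
  then obtain D' p' where "(D', p') \<in> \<F>" "x \<in> D'" "\<forall>y\<in>D'. h y \<in> D" using A x(1) by meson
  thus "\<exists>D p. (D, p) \<in> \<F> \<and> x \<in> D \<and> D \<subseteq> preim X h U"
   using ptsX \<open>D \<subseteq> U\<close> unfolding preim_def by blast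
 qed
 have "f \<circ> h \<in> regular X (preim X h U)" if U: "openin (zariski Y) U" and f: "f \<in> regular Y U" for U f
 proof (rule presented_regularI[OF X pre[OF U]])
  fix x assume "x \<in> preim X h U"
  hence x: "x \<in> points X" "h x \<in> U" by (auto simp: preim_def)
  obtain D p where D: "(D, p) \<in> \<G>" "h x \<in> D" "D \<subseteq> U" "\<And>y. y \<in> D \<Longrightarrow> f y = p y"
   using presented_regularE[OF Y U f x(2)] by blast
  then obtain D' p' where D': "(D', p') \<in> \<F>" "x \<in> D'" "\<forall>y\<in>D'. h y \<in> D \<and> p' y = p (h y)" using A x(1) by meson
  hence "D' \<subseteq> preim X h U" "\<forall>y\<in>D'. (f \<circ> h) y = p' y" using ptsX[OF D'(1)] D unfolding preim_def by auto
  thus "near \<F> x (preim X h U) (f \<circ> h)" using D' by blast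
 qed
 moreover have "continuous_map (zariski X) (zariski Y) h" unfolding continuous_map_def using pre hY by (auto simp: preim_def)
 ultimately show ?thesis unfolding var_morphism_def by blast
qed

text \<open>Conditions \<open>A\<close> and \<open>B\<close> test \<open>h\<close> and its inverse
  on basic pairs. \<open>B\<close> is phrased with points of the source, so that in applications the
  inverse never has to be named.\<close>

lemma presented_iso:
 assumes X: "presented X \<F>" and Y: "presented Y \<G>" and bij: "bij_betw h (points X) (points Y)"
  and A: "\<And>D p x. (D, p) \<in> \<G> \<Longrightarrow> x \<in> points X \<Longrightarrow> h x \<in> D \<Longrightarrow>
   \<exists>D' p'. (D', p') \<in> \<F> \<and> x \<in> D' \<and> (\<forall>y\<in>D'. h y \<in> D \<and> p' y = p (h y))"
  and B: "\<And>D p x. (D, p) \<in> \<F> \<Longrightarrow> x \<in> D \<Longrightarrow>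
   \<exists>D' p'. (D', p') \<in> \<G> \<and> h x \<in> D' \<and> (\<forall>y\<in>points X. h y \<in> D' \<longrightarrow> y \<in> D \<and> p y = p' (h y))"
 shows "var_iso X Y"
proof -
 define g where "g = inv_into (points X) h"
 have hY: "h x \<in> points Y" "g (h x) = x" if "x \<in> points X" for x using bij that unfolding g_def by (auto simp: bij_betw_def)
 have gX: "g y \<in> points X" "h (g y) = y" if "y \<in> points Y" for y
  using bij that unfolding g_def by (auto simp: bij_betw_inv_into_right bij_betw_def inv_into_into)
 have h: "var_morphism X Y h" by (rule presented_morphism[OF X Y hY(1) A])
 have g: "var_morphism Y X g"
 proof (rule presented_morphism[OF Y X gX(1)])
  fix D p y assume D: "(D, p) \<in> \<F>" "y \<in> points Y" "g y \<in> D"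
  from B[OF D(1,3)] obtain D' p' where D': "(D', p') \<in> \<G>" "h (g y) \<in> D'"
   "\<forall>y\<in>points X. h y \<in> D' \<longrightarrow> y \<in> D \<and> p y = p' (h y)" by blast
  have "g z \<in> D \<and> p' z = p (g z)" if "z \<in> D'" for z using D'(3) gX[of z] that presented_subset_points[OF Y D'(1)] by auto
  thus "\<exists>D' p'. (D', p') \<in> \<G> \<and> y \<in> D' \<and> (\<forall>z\<in>D'. g z \<in> D \<and> p' z = p (g z))"
   using D' gX(2)[OF D(2)] by auto
 qed
 have "homeomorphic_map (zariski X) (zariski Y) h"
  using h g hY(2) gX(2) unfolding homeomorphic_map_maps homeomorphic_maps_def var_morphism_def by auto
 moreover have "f \<in> regular Y U" if U: "openin (zariski Y) U" and f: "f \<circ> h \<in> regular X (preim X h U)" for U f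
 proof (rule presented_regularI[OF Y U])
  have pre: "openin (zariski X) (preim X h U)" using h U unfolding var_morphism_def continuous_map_def preim_def by blast
  hence "(f \<circ> h) \<circ> g \<in> regular Y (preim Y g (preim X h U))" using g f unfolding var_morphism_def by blast
  moreover have "preim Y g (preim X h U) = U" using openin_subset[OF U] gX by (auto simp: preim_def)
  ultimately have *: "(f \<circ> h) \<circ> g \<in> regular Y U" by simp
  fix y assume "y \<in> U"
  then obtain D p where D: "(D, p) \<in> \<G>" "y \<in> D" "D \<subseteq> U" "\<forall>z\<in>D. ((f \<circ> h) \<circ> g) z = p z"
   by (rule presented_regularE[OF Y U *]) blast
  hence "f z = p z" if "z \<in> D" for z using that gX(2)[of z] openin_subset[OF U] by fastforce
  thus "near \<G> y U f" using D by blast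
 qed
 ultimately show ?thesis using h unfolding var_iso_def var_morphism_def by blast
qed

lemma presented_induced:
 assumes X: "presented X \<F>"
 shows "presented (induced X Z) ((\<lambda>(D, p). (D \<inter> Z, p)) ` \<F>)"
proof -
 let ?\<G> = "(\<lambda>(D, p). (D \<inter> Z, p)) ` \<F>"
 have G: "(E, p) \<in> ?\<G> \<longleftrightarrow> (\<exists>D. (D, p) \<in> \<F> \<and> E = D \<inter> Z)" for E p by force
 have ref: "refining \<F>" using X by (rule presented_refining)
 have 1: "refining ?\<G>" unfolding refining_def
 proof (intro allI impI)
  fix E p E' p' x assume "(E, p) \<in> ?\<G>" "(E', p') \<in> ?\<G>" "x \<in> E \<inter> E'"
  then obtain D D' where D: "(D, p) \<in> \<F>" "E = D \<inter> Z" "(D', p') \<in> \<F>" "E' = D' \<inter> Z" "x \<in> D" "x \<in> D'" "x \<in> Z"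
   unfolding G by auto
  obtain D'' p'' where "(D'', p'') \<in> \<F>" "x \<in> D''" "D'' \<subseteq> D" "D'' \<subseteq> D'" "\<And>y. y \<in> D'' \<Longrightarrow> p'' y = p y"
   using refiningD[OF ref D(1,3,5,6)] by metis
  thus "\<exists>D'' p''. (D'', p'') \<in> ?\<G> \<and> x \<in> D'' \<and> D'' \<subseteq> E \<inter> E' \<and> (\<forall>y\<in>D''. p'' y = p y)"
   unfolding G using D by (intro exI[of _ "D'' \<inter> Z"] exI[of _ p'']) auto
 qed
 have open_iff: "openin (zariski (induced X Z)) U \<longleftrightarrow> (\<exists>T. openin (zariski X) T \<and> U = T \<inter> Z)" for U
  by (simp add: induced_def openin_subtopology)
 have 2: "openin (zariski (induced X Z)) U \<longleftrightarrow> (\<forall>x\<in>U. \<exists>D p. (D, p) \<in> ?\<G> \<and> x \<in> D \<and> D \<subseteq> U)" for U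
 proof
  assume "openin (zariski (induced X Z)) U"
  then obtain T where T: "openin (zariski X) T" "U = T \<inter> Z" unfolding open_iff by auto
  show "\<forall>x\<in>U. \<exists>D p. (D, p) \<in> ?\<G> \<and> x \<in> D \<and> D \<subseteq> U"
  proof
   fix x assume "x \<in> U"
   then obtain D p where "(D, p) \<in> \<F>" "x \<in> D" "D \<subseteq> T" using presented_openE[OF X T(1)] T by blast
   thus "\<exists>D p. (D, p) \<in> ?\<G> \<and> x \<in> D \<and> D \<subseteq> U" unfolding G using \<open>x \<in> U\<close> T by blast
  qed
 next
  assume *: "\<forall>x\<in>U. \<exists>D p. (D, p) \<in> ?\<G> \<and> x \<in> D \<and> D \<subseteq> U"
  let ?T = "\<Union>{D. openin (zariski X) D \<and> D \<inter> Z \<subseteq> U}"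
  have "openin (zariski X) ?T" by (rule openin_Union) auto
  moreover have "U = ?T \<inter> Z"
  proof
   show "U \<subseteq> ?T \<inter> Z"
   proof
    fix x assume "x \<in> U"
    then obtain D p where "(D, p) \<in> \<F>" "x \<in> D" "x \<in> Z" "D \<inter> Z \<subseteq> U" using * unfolding G by blast
    thus "x \<in> ?T \<inter> Z" using presented_open_basic[OF X] by blast
   qed
  qed auto
  ultimately show "openin (zariski (induced X Z)) U" unfolding open_iff by blast
 qed
 have 3: "f \<in> regular (induced X Z) U \<longleftrightarrow> (\<forall>x\<in>U. near ?\<G> x U f)"
  if U: "openin (zariski (induced X Z)) U" for U f
 proof
  assume f: "f \<in> regular (induced X Z) U"
  show "\<forall>x\<in>U. near ?\<G> x U f"
  proof
   fix x assume x: "x \<in> U"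
   then obtain V p where V: "openin (zariski X) V" "x \<in> V" "p \<in> regular X V" "\<forall>y\<in>V \<inter> U. f y = p y"
    using f unfolding induced_def by auto
   obtain D p1 where D: "(D, p1) \<in> \<F>" "x \<in> D" "D \<subseteq> V" "\<And>y. y \<in> D \<Longrightarrow> p y = p1 y"
    using presented_regularE[OF X V(1,3,2)] by metis
   obtain T where T: "openin (zariski X) T" "U = T \<inter> Z" using U unfolding open_iff by auto
   obtain D2 p2 where D2: "(D2, p2) \<in> \<F>" "x \<in> D2" "D2 \<subseteq> T" using presented_openE[OF X T(1)] T x by blast
   obtain D3 p3 where D3: "(D3, p3) \<in> \<F>" "x \<in> D3" "D3 \<subseteq> D" "D3 \<subseteq> D2" "\<And>y. y \<in> D3 \<Longrightarrow> p3 y = p1 y"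
    using refiningD[OF ref D(1) D2(1) D(2) D2(2)] by metis
   have "x \<in> D3 \<inter> Z" "D3 \<inter> Z \<subseteq> U" using D3 D2 T x by auto
   moreover have "\<forall>y\<in>D3 \<inter> Z. f y = p3 y" using D3 D V(4) \<open>D3 \<inter> Z \<subseteq> U\<close> by (auto simp: subset_iff)
   ultimately show "near ?\<G> x U f" unfolding G using D3(1) by blast
  qed
 next
  assume *: "\<forall>x\<in>U. near ?\<G> x U f"
  have UZ: "U \<subseteq> Z" using U unfolding open_iff by auto
  have "\<exists>V p. openin (zariski X) V \<and> x \<in> V \<and> p \<in> regular X V \<and> (\<forall>y\<in>V \<inter> U. f y = p y)" if x: "x \<in> U" for x
  proof -
   obtain D p where D: "(D, p) \<in> \<F>" "x \<in> D" "\<forall>y\<in>D \<inter> Z. f y = p y" using * x unfolding G by blast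
   thus ?thesis using presented_open_basic[OF X D(1)] presented_regular_basic[OF X D(1)] UZ by blast
  qed
  thus "f \<in> regular (induced X Z) U" by (simp add: induced_def)
 qed
 show ?thesis unfolding presented_def using 1 2 3 by blast
qed

lemma presented_function_algebra_space:
 assumes "\<And>f g. f \<in> A \<Longrightarrow> g \<in> A \<Longrightarrow> \<exists>h\<in>A. \<forall>x\<in>X. h x = f x * g x"
 shows "presented (function_algebra_space X A) {({x\<in>X. s x \<noteq> 0}, \<lambda>x. f x / s x) | f s. f \<in> A \<and> s \<in> A}"
  (is "presented _ ?\<F>")
proof (rule presentedI)
 show "refining ?\<F>" unfolding refining_def
 proof (intro allI impI)
  fix D u D' u' x assume "(D, u) \<in> ?\<F>" "(D', u') \<in> ?\<F>" "x \<in> D \<inter> D'"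
  then obtain f s f' s' where 1: "D = {x\<in>X. s x \<noteq> 0}" "u = (\<lambda>x. f x / s x)" "f \<in> A" "s \<in> A"
   "D' = {x\<in>X. s' x \<noteq> 0}" "s' \<in> A" "x \<in> X" "s x \<noteq> 0" "s' x \<noteq> 0" by auto
  obtain p q where pq: "p \<in> A" "\<forall>x\<in>X. p x = f x * s' x" "q \<in> A" "\<forall>x\<in>X. q x = s x * s' x"
   using assms[OF 1(3) 1(6)] assms[OF 1(4) 1(6)] by blast
  let ?D = "{x\<in>X. q x \<noteq> 0}" and ?u = "\<lambda>x. p x / q x"
  have "(?D, ?u) \<in> ?\<F>" using pq(1,3) by blast
  moreover have "x \<in> ?D" "?D \<subseteq> D \<inter> D'" "\<forall>y\<in>?D. ?u y = u y" using 1 pq(2,4) by auto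
  ultimately show "\<exists>D'' u''. (D'', u'') \<in> ?\<F> \<and> x \<in> D'' \<and> D'' \<subseteq> D \<inter> D' \<and> (\<forall>y\<in>D''. u'' y = u y)"
   by blast
 qed
 have fst: "fst ` ?\<F> = {{x \<in> X. f x \<noteq> 0} | f. f \<in> A}" by (force simp: image_def)
 show "zariski (function_algebra_space X A) = topology_generated_by (fst ` ?\<F>)"
  unfolding fst by (simp add: function_algebra_space_def Let_def)
 show "v \<in> regular (function_algebra_space X A) U \<longleftrightarrow> (\<forall>x\<in>U. \<exists>V D u. openin (zariski (function_algebra_space X A)) V \<and>
   x \<in> V \<and> V \<subseteq> U \<and> (D, u) \<in> ?\<F> \<and> V \<subseteq> D \<and> (\<forall>y\<in>V. v y = u y))" (is "?L \<longleftrightarrow> ?R") for U v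
 proof
  assume ?L
  show ?R
  proof
   fix x assume "x \<in> U"
   then obtain V f s where V: "openin (zariski (function_algebra_space X A)) V" "x \<in> V" "V \<subseteq> U" "f \<in> A" "s \<in> A"
    "\<forall>y\<in>V. s y \<noteq> 0 \<and> v y = f y / s y" using \<open>?L\<close> by (auto simp: function_algebra_space_def Let_def)
   have "V \<subseteq> X" using openin_subset[OF V(1)] by (auto simp: function_algebra_space_def Let_def)
   hence "({x\<in>X. s x \<noteq> 0}, \<lambda>x. f x / s x) \<in> ?\<F> \<and> V \<subseteq> {x\<in>X. s x \<noteq> 0} \<and> (\<forall>y\<in>V. v y = (\<lambda>x. f x / s x) y)"
    using V by auto
   thus "\<exists>V D u. openin (zariski (function_algebra_space X A)) V \<and>
    x \<in> V \<and> V \<subseteq> U \<and> (D, u) \<in> ?\<F> \<and> V \<subseteq> D \<and> (\<forall>y\<in>V. v y = u y)" using V(1-3) by blast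
  qed
 next
  assume ?R
  have "\<exists>V. openin (zariski (function_algebra_space X A)) V \<and> x \<in> V \<and> V \<subseteq> U \<and>
       (\<exists>f\<in>A. \<exists>s\<in>A. \<forall>y\<in>V. s y \<noteq> 0 \<and> v y = f y / s y)" if "x \<in> U" for x
  proof -
   obtain V D u where V: "openin (zariski (function_algebra_space X A)) V"
    "x \<in> V" "V \<subseteq> U" "(D, u) \<in> ?\<F>" "V \<subseteq> D" "\<forall>y\<in>V. v y = u y" using bspec[OF \<open>?R\<close> \<open>x \<in> U\<close>] by (elim exE conjE)
   then obtain f s where fs: "f \<in> A" "s \<in> A" "D = {x\<in>X. s x \<noteq> 0}" "u = (\<lambda>x. f x / s x)" by auto
   hence "\<forall>y\<in>V. s y \<noteq> 0 \<and> v y = f y / s y" using V by auto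
   thus ?thesis using V(1-3) fs by blast
  qed
  thus ?L by (simp add: function_algebra_space_def Let_def)
 qed
qed

lemma presented_space_with_functions:
 assumes X: "presented X \<F>"
  and const: "\<And>x a. x \<in> points X \<Longrightarrow> \<exists>D p. (D, p) \<in> \<F> \<and> x \<in> D \<and> (\<forall>y\<in>D. p y = a)"
  and add: "\<And>D p D' p' x. (D, p) \<in> \<F> \<Longrightarrow> (D', p') \<in> \<F> \<Longrightarrow> x \<in> D \<Longrightarrow> x \<in> D' \<Longrightarrow>
   \<exists>D'' p''. (D'', p'') \<in> \<F> \<and> x \<in> D'' \<and> D'' \<subseteq> D \<inter> D' \<and> (\<forall>y\<in>D''. p'' y = p y + p' y)"
  and mult: "\<And>D p D' p' x. (D, p) \<in> \<F> \<Longrightarrow> (D', p') \<in> \<F> \<Longrightarrow> x \<in> D \<Longrightarrow> x \<in> D' \<Longrightarrow>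
   \<exists>D'' p''. (D'', p'') \<in> \<F> \<and> x \<in> D'' \<and> D'' \<subseteq> D \<inter> D' \<and> (\<forall>y\<in>D''. p'' y = p y * p' y)"
 shows "space_with_functions X"
 unfolding space_with_functions_def
proof (intro allI impI conjI)
 fix U assume U: "openin (zariski X) U"
 have ref: "refining \<F>" using X by (rule presented_refining)
 note IU = presented_regularI[OF X U] and EU = presented_regularE[OF X U]
 have shrink: "\<exists>D' p'. (D', p') \<in> \<F> \<and> x \<in> D' \<and> D' \<subseteq> D \<and> D' \<subseteq> V \<and> (\<forall>y\<in>D'. p' y = p y)"
  if D: "(D, p) \<in> \<F>" "x \<in> D" "openin (zariski X) V" "x \<in> V" for D p x V
 proof -
  obtain D2 p2 where D2: "(D2, p2) \<in> \<F>" "x \<in> D2" "D2 \<subseteq> V" using presented_openE[OF X D(3,4)] by blast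
  obtain D3 p3 where "(D3, p3) \<in> \<F>" "x \<in> D3" "D3 \<subseteq> D" "D3 \<subseteq> D2" "\<And>y. y \<in> D3 \<Longrightarrow> p3 y = p y"
   using refiningD[OF ref D(1) D2(1) D(2) D2(2)] by blast
  thus ?thesis using D2 by blast
 qed
 show "(\<lambda>_. a) \<in> regular X U" for a
 proof (rule IU)
  fix x assume x: "x \<in> U"
  hence "x \<in> points X" using openin_subset[OF U] by blast
  then obtain D p where "(D, p) \<in> \<F>" "x \<in> D" "\<forall>y\<in>D. p y = a" using const by meson
  thus "near \<F> x U (\<lambda>y. a)" using shrink[OF _ _ U x, of D p] by (metis subsetD)
 qed
 show "\<forall>f\<in>regular X U. \<forall>g\<in>regular X U.
      (\<lambda>x. f x + g x) \<in> regular X U \<and> (\<lambda>x. f x * g x) \<in> regular X U"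
 proof (intro ballI conjI)
  fix f g assume f: "f \<in> regular X U" and g: "g \<in> regular X U"
  have op: "(\<lambda>x. k (f x) (g x)) \<in> regular X U"
   if k: "\<And>D p D' p' x. (D, p) \<in> \<F> \<Longrightarrow> (D', p') \<in> \<F> \<Longrightarrow> x \<in> D \<Longrightarrow> x \<in> D' \<Longrightarrow>
    \<exists>D'' p''. (D'', p'') \<in> \<F> \<and> x \<in> D'' \<and> D'' \<subseteq> D \<inter> D' \<and> (\<forall>y\<in>D''. p'' y = k (p y) (p' y))" for k
  proof (rule IU)
   fix x assume x: "x \<in> U"
   obtain D p D' p' where D: "(D, p) \<in> \<F>" "(D', p') \<in> \<F>" "x \<in> D" "x \<in> D'" "D \<subseteq> U" "\<forall>y\<in>D. f y = p y" "\<forall>y\<in>D'. g y = p' y"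
    by (metis EU[OF f x] EU[OF g x])
   from k[OF D(1-4)] obtain D'' p'' where D'': "(D'', p'') \<in> \<F>" "x \<in> D''" "D'' \<subseteq> D \<inter> D'" "\<forall>y\<in>D''. p'' y = k (p y) (p' y)"
    by blast
   hence "D'' \<subseteq> U" "\<forall>y\<in>D''. k (f y) (g y) = p'' y" using D by (auto simp: subset_iff)
   thus "near \<F> x U (\<lambda>y. k (f y) (g y))" using D'' by blast
  qed
  show "(\<lambda>x. f x + g x) \<in> regular X U" "(\<lambda>x. f x * g x) \<in> regular X U" by (rule op[OF add] op[OF mult], assumption+)+
 qed
 show "g \<in> regular X U" if f: "f \<in> regular X U" and eq: "\<forall>x\<in>U. f x = g x" for f g
 proof (rule IU)
  fix x assume "x \<in> U"
  from EU[OF f this] obtain D p where "(D, p) \<in> \<F>" "x \<in> D" "D \<subseteq> U" "\<And>y. y \<in> D \<Longrightarrow> f y = p y" by metis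
  thus "near \<F> x U g" using eq by (metis subsetD)
 qed
 show "f \<in> regular X U \<longleftrightarrow> (\<forall>x\<in>U. \<exists>V. openin (zariski X) V \<and> x \<in> V \<and> V \<subseteq> U \<and> f \<in> regular X V)" for f
 proof
  assume "f \<in> regular X U"
  thus "\<forall>x\<in>U. \<exists>V. openin (zariski X) V \<and> x \<in> V \<and> V \<subseteq> U \<and> f \<in> regular X V" using U by blast
 next
  assume *: "\<forall>x\<in>U. \<exists>V. openin (zariski X) V \<and> x \<in> V \<and> V \<subseteq> U \<and> f \<in> regular X V"
  show "f \<in> regular X U"
  proof (rule IU)
   fix x assume "x \<in> U"
   then obtain V where V: "openin (zariski X) V" "x \<in> V" "V \<subseteq> U" "f \<in> regular X V" using * by meson
   then obtain D p where "(D, p) \<in> \<F>" "x \<in> D" "D \<subseteq> V" "\<And>y. y \<in> D \<Longrightarrow> f y = p y"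
    using presented_regularE[OF X V(1,4,2)] by metis
   thus "near \<F> x U f" using V by blast
  qed
 qed
qed

section \<open>Projective families over the affine line\<close>

text \<open>
 A point of \<open>\<complex> \<times> \<complex>\<^sup>N\<close> is a function \<open>z\<close> with the parameter \<open>z 0\<close> and the homogeneous coordinates
 \<open>z 1, \<dots>, z N\<close>.  \<open>hfun k F\<close> means that \<open>F\<close> is a polynomial function which is homogeneous of degree \<open>k\<close>
 in the homogeneous coordinates.
\<close>

inductive hfun :: "nat \<Rightarrow> (cvec \<Rightarrow> complex) \<Rightarrow> bool" where
 const: "hfun 0 (\<lambda>_. a)"
| param: "hfun 0 (\<lambda>z. z 0)"
| coord: "i > 0 \<Longrightarrow> hfun 1 (\<lambda>z. z i)"
| zero: "hfun k (\<lambda>_. 0)"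
| add: "hfun k F \<Longrightarrow> hfun k G \<Longrightarrow> hfun k (\<lambda>z. F z + G z)"
| mult: "hfun k F \<Longrightarrow> hfun l G \<Longrightarrow> hfun (k + l) (\<lambda>z. F z * G z)"

lemma hfun_cmult: "hfun k F \<Longrightarrow> hfun k (\<lambda>z. a * F z)"
 using hfun.mult[OF hfun.const[of a], of k F] by simp

lemma hfun_mult_param: "hfun 0 P \<Longrightarrow> hfun k F \<Longrightarrow> hfun k (\<lambda>z. P z * F z)"
 using hfun.mult[of 0 P k F] by simp

lemma hfun_diff: "hfun k F \<Longrightarrow> hfun k G \<Longrightarrow> hfun k (\<lambda>z. F z - G z)"
 using hfun.add[OF _ hfun_cmult[of k G "-1"], of F] by simp

lemma hfun_sum: "(\<And>i. i \<in> I \<Longrightarrow> hfun k (F i)) \<Longrightarrow> hfun k (\<lambda>z. \<Sum>i\<in>I. F i z)"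
 by (induction I rule: infinite_finite_induct) (auto intro: hfun.zero hfun.add)

lemma hfun_power: "hfun k F \<Longrightarrow> hfun (k * m) (\<lambda>z. F z ^ m)"
proof (induction m)
 case 0
 thus ?case using hfun.const[of 1] by simp
next
 case (Suc m)
 thus ?case using hfun.mult[of k F "k * m" "\<lambda>z. F z ^ m"] by simp
qed

lemma hfun_coord_power: "i > 0 \<Longrightarrow> hfun m (\<lambda>z. z i ^ m)"
 using hfun_power[OF hfun.coord, of i m] by simp

lemma hfun_poly: "hfun 0 (\<lambda>z. poly p (z 0))"
proof (induction p)
 case 0
 show ?case using hfun.zero by simp
next
 case (pCons a p)
 have "hfun 0 (\<lambda>z. a + z 0 * poly p (z 0))" using hfun.add[OF hfun.const[of a] hfun.mult[OF hfun.param pCons(2), simplified]] .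
 thus ?case by simp
qed

section \<open>Orbits of homogeneous coordinates\<close>

definition rescale :: "complex \<Rightarrow> cvec \<Rightarrow> nat \<Rightarrow> complex" where
 "rescale a z = (\<lambda>j. if j = 0 then z 0 else a * z j)"

lemma rescale_0 [simp]: "rescale a z 0 = z 0"
 and rescale_pos: "i > 0 \<Longrightarrow> rescale a z i = a * z i" by (simp_all add: rescale_def)

lemma rescale_1 [simp]: "rescale 1 z = z"
 by (rule ext) (simp add: rescale_def)

lemma rescale_rescale: "rescale a (rescale b z) = rescale (a * b) z"
 by (rule ext) (simp add: rescale_def)

lemma hfun_rescale: "hfun k F \<Longrightarrow> F (rescale a z) = a ^ k * F z"
 by (induction rule: hfun.induct) (auto simp: rescale_def power_add algebra_simps)

definition orbit :: "cvec \<Rightarrow> cvec set" where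
 "orbit z = {rescale a z | a. a \<noteq> 0}"

lemma self_in_orbit: "z \<in> orbit z"
 unfolding orbit_def by (auto intro!: exI[of _ 1])

lemma orbit_rescale: "a \<noteq> 0 \<Longrightarrow> orbit (rescale a z) = orbit z"
proof -
 assume a: "a \<noteq> 0"
 have "rescale b z = rescale (b / a) (rescale a z)" for b using a by (simp add: rescale_rescale)
 thus ?thesis unfolding orbit_def using a by (fastforce simp: rescale_rescale)
qed

lemma orbit_eq_iff: "orbit z = orbit w \<longleftrightarrow> (\<exists>a. a \<noteq> 0 \<and> w = rescale a z)"
proof
 assume "orbit z = orbit w"
 thus "\<exists>a. a \<noteq> 0 \<and> w = rescale a z" using self_in_orbit[of w] unfolding orbit_def by auto
qed (auto simp: orbit_rescale)

definition orbit_rep :: "cvec set \<Rightarrow> nat \<Rightarrow> complex" where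
 "orbit_rep p = (SOME z. z \<in> p)"

lemma orbit_rep_orbit:
 obtains a where "a \<noteq> 0" "orbit_rep (orbit z) = rescale a z"
proof -
 have "orbit_rep (orbit z) \<in> orbit z" unfolding orbit_rep_def by (rule someI[of "\<lambda>v. v \<in> orbit z", OF self_in_orbit])
 thus ?thesis using that unfolding orbit_def by auto
qed

definition ratio :: "(cvec \<Rightarrow> complex) \<Rightarrow> (cvec \<Rightarrow> complex) \<Rightarrow> cvec set \<Rightarrow> complex" where
 "ratio F G p = F (orbit_rep p) / G (orbit_rep p)"

lemma ratio_orbit:
 assumes "hfun k F" "hfun k G"
 shows "ratio F G (orbit z) = F z / G z"
proof -
 obtain a where "a \<noteq> 0" "orbit_rep (orbit z) = rescale a z" by (rule orbit_rep_orbit)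
 thus ?thesis by (simp add: ratio_def hfun_rescale[OF assms(1)] hfun_rescale[OF assms(2)])
qed

definition orbit_param :: "cvec set \<Rightarrow> complex" where
 "orbit_param p = orbit_rep p 0"

lemma orbit_param_orbit [simp]: "orbit_param (orbit z) = z 0"
 unfolding orbit_param_def by (metis orbit_rep_orbit rescale_0)

lemma space_with_functions_const:
 "space_with_functions X \<Longrightarrow> openin (zariski X) U \<Longrightarrow> (\<lambda>_. a) \<in> regular X U"
 unfolding space_with_functions_def by (drule spec, drule (1) mp, elim conjE, erule spec)

definition is_cone :: "cvec set \<Rightarrow> bool" where
 "is_cone Y \<longleftrightarrow> (\<forall>z\<in>Y. \<forall>a. a \<noteq> 0 \<longrightarrow> rescale a z \<in> Y)"

definition basic_open :: "cvec set \<Rightarrow> (cvec \<Rightarrow> complex) \<Rightarrow> cvec set set" where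
 "basic_open Y G = orbit ` {z\<in>Y. G z \<noteq> 0}"

lemma orbit_in_basic_open:
 assumes "is_cone Y" "hfun k G" "z \<in> Y"
 shows "orbit z \<in> basic_open Y G \<longleftrightarrow> G z \<noteq> 0"
 unfolding basic_open_def using assms by (auto simp: orbit_eq_iff hfun_rescale)

lemma basic_openE:
 assumes "p \<in> basic_open Y G"
 obtains z where "z \<in> Y" "p = orbit z" "G z \<noteq> 0" using assms unfolding basic_open_def by auto

definition proj_basis :: "cvec set \<Rightarrow> (cvec set set \<times> (cvec set \<Rightarrow> complex)) set" where
 "proj_basis Y = {(basic_open Y G, ratio F G) | k F G. hfun k F \<and> hfun k G}"

text \<open>For a cone \<open>Y\<close> of vectors with nonzero homogeneous part this is its image
  in the product of the line with a projective space. Regular functions are written directly as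
  local quotients of equal degree, so that the presentation by \<open>proj_basis\<close> holds by
  construction.\<close>

definition proj_space :: "cvec set \<Rightarrow> cvec set fspace" where
 "proj_space Y = (let \<T> = topology_generated_by (fst ` proj_basis Y) in
   \<lparr> zariski = \<T>, regular = (\<lambda>U. {f. \<forall>x\<in>U. \<exists>V D p. openin \<T> V \<and> x \<in> V \<and> V \<subseteq> U \<and>
    (D, p) \<in> proj_basis Y \<and> V \<subseteq> D \<and> (\<forall>y\<in>V. f y = p y)}) \<rparr>)"

lemma proj_basisI: "hfun k F \<Longrightarrow> hfun k G \<Longrightarrow> (basic_open Y G, ratio F G) \<in> proj_basis Y"
 unfolding proj_basis_def by blast

lemma proj_basisE:
 assumes "(D, p) \<in> proj_basis Y"
 obtains k F G where "hfun k F" "hfun k G" "D = basic_open Y G" "p = ratio F G" using assms unfolding proj_basis_def by blast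

lemma basic_open_mult:
 assumes "is_cone Y" "hfun k G" "hfun l G'"
 shows "basic_open Y (\<lambda>z. G z * G' z) = basic_open Y G \<inter> basic_open Y G'"
proof -
 note GG = hfun.mult[OF assms(2,3)]
 have *: "basic_open Y F \<subseteq> orbit ` Y" for F by (auto simp: basic_open_def)
 have "orbit z \<in> basic_open Y (\<lambda>z. G z * G' z) \<longleftrightarrow> orbit z \<in> basic_open Y G \<inter> basic_open Y G'" if "z \<in> Y" for z
  using that by (simp add: orbit_in_basic_open[OF assms(1) GG] orbit_in_basic_open[OF assms(1,2)] orbit_in_basic_open[OF assms(1,3)])
 thus ?thesis using *[of "\<lambda>z. G z * G' z"] *[of G] by blast
qed

context
 fixes Y assumes cone: "is_cone Y"
begin

lemma proj_refining: "refining (proj_basis Y)"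
 unfolding refining_def
proof (intro allI impI)
 fix D f D' f' p assume "(D, f) \<in> proj_basis Y" "(D', f') \<in> proj_basis Y" and p: "p \<in> D \<inter> D'"
 then obtain k F G l F' G' where 1: "hfun k F" "hfun k G" "D = basic_open Y G" "f = ratio F G"
  "hfun l F'" "hfun l G'" "D' = basic_open Y G'" "f' = ratio F' G'" by (auto elim!: proj_basisE)
 note FG = hfun.mult[OF 1(1,6)] and GG = hfun.mult[OF 1(2,6)]
 have D'': "basic_open Y (\<lambda>z. G z * G' z) = D \<inter> D'" using 1 by (simp add: basic_open_mult[OF cone 1(2,6)])
 have "ratio (\<lambda>z. F z * G' z) (\<lambda>z. G z * G' z) q = f q" if q: "q \<in> basic_open Y (\<lambda>z. G z * G' z)" for q
 proof -
  from q obtain z where "q = orbit z" "G z * G' z \<noteq> 0" by (rule basic_openE)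
  thus ?thesis using ratio_orbit[OF FG GG, of z] ratio_orbit[OF 1(1,2), of z] 1 by simp
 qed
 thus "\<exists>D'' f''. (D'', f'') \<in> proj_basis Y \<and> p \<in> D'' \<and> D'' \<subseteq> D \<inter> D' \<and> (\<forall>y\<in>D''. f'' y = f y)"
  using p proj_basisI[OF FG GG, of Y] unfolding D'' by blast
qed

lemma presented_proj_space: "presented (proj_space Y) (proj_basis Y)"
 by (rule presentedI[OF proj_refining]) (simp_all add: proj_space_def Let_def)

lemma points_proj_space: "points (proj_space Y) = orbit ` Y"
proof -
 have "p \<in> points (proj_space Y) \<longleftrightarrow> p \<in> orbit ` Y" for p unfolding presented_points_iff[OF presented_proj_space]
 using proj_basisI hfun.const proj_basisE basic_openE unfolding basic_open_def by blast
 thus ?thesis by blast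
qed

lemma ratio_regular:
 assumes "hfun k F" "hfun k G"
 shows "openin (zariski (proj_space Y)) (basic_open Y G)" "ratio F G \<in> regular (proj_space Y) (basic_open Y G)"
 using proj_basisI[OF assms, of Y] presented_open_basic[OF presented_proj_space] presented_regular_basic[OF presented_proj_space] by auto

lemma proj_space_with_functions: "space_with_functions (proj_space Y)"
proof (rule presented_space_with_functions[OF presented_proj_space])
 show "\<exists>D f. (D, f) \<in> proj_basis Y \<and> p \<in> D \<and> (\<forall>y\<in>D. f y = a)" if "p \<in> points (proj_space Y)" for p a
 proof (intro exI conjI)
  show "(basic_open Y (\<lambda>_. 1), ratio (\<lambda>_. a) (\<lambda>_. 1)) \<in> proj_basis Y" by (rule proj_basisI) (rule hfun.const)+
  show "p \<in> basic_open Y (\<lambda>_. 1)" using that unfolding points_proj_space by (simp add: basic_open_def)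
 qed (simp add: ratio_def)
next
 fix D f D' f' p assume "(D, f) \<in> proj_basis Y" "(D', f') \<in> proj_basis Y" and p: "p \<in> D" "p \<in> D'"
 then obtain k F G l F' G' where 1: "hfun k F" "hfun k G" "D = basic_open Y G" "f = ratio F G"
  "hfun l F'" "hfun l G'" "D' = basic_open Y G'" "f' = ratio F' G'" by (auto elim!: proj_basisE)
 note GG = hfun.mult[OF 1(2,6)] and FF = hfun.mult[OF 1(1,5)]
 have A: "hfun (k + l) (\<lambda>z. F z * G' z + G z * F' z)" by (intro hfun.add hfun.mult 1)
 have D'': "basic_open Y (\<lambda>z. G z * G' z) = D \<inter> D'" using 1 by (simp add: basic_open_mult[OF cone 1(2,6)])
 have "ratio (\<lambda>z. F z * G' z + G z * F' z) (\<lambda>z. G z * G' z) q = f q + f' q \<and>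
   ratio (\<lambda>z. F z * F' z) (\<lambda>z. G z * G' z) q = f q * f' q" if q: "q \<in> basic_open Y (\<lambda>z. G z * G' z)" for q
 proof -
  from q obtain z where "q = orbit z" "G z * G' z \<noteq> 0" by (rule basic_openE)
  thus ?thesis unfolding 1(4,8) by (simp only: ratio_orbit[OF A GG] ratio_orbit[OF FF GG] ratio_orbit[OF 1(1,2)] ratio_orbit[OF 1(5,6)])
    (simp add: field_simps)
 qed
 thus "\<exists>D'' f''. (D'', f'') \<in> proj_basis Y \<and> p \<in> D'' \<and> D'' \<subseteq> D \<inter> D' \<and> (\<forall>y\<in>D''. f'' y = f y + f' y)"
  "\<exists>D'' f''. (D'', f'') \<in> proj_basis Y \<and> p \<in> D'' \<and> D'' \<subseteq> D \<inter> D' \<and> (\<forall>y\<in>D''. f'' y = f y * f' y)"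
  using p proj_basisI[OF A GG, of Y] proj_basisI[OF FF GG, of Y] unfolding D'' by blast+
qed

text \<open>For distinct orbits there are functions \<open>F\<close> and \<open>L\<close> of degree
  one, \<open>L\<close> nonzero at both, whose quotients \<open>F / L\<close> differ. The pairs at
  which the two values of \<open>F / L\<close> are different form an open set of the finer product
  topology, and it misses the diagonal.\<close>

lemma proj_space_separated:
 assumes coords: "\<And>z. z \<in> Y \<Longrightarrow> \<exists>i>0. z i \<noteq> 0"
 shows "separated_space (proj_space Y)"
proof -
 let ?X = "proj_space Y"
 define B where "B = {{(x, y) \<in> U \<times> V. (\<Sum>i<m. a i x * b i y) \<noteq> 0} | U V (m::nat) a b.
    openin (zariski ?X) U \<and> openin (zariski ?X) V \<and>
    (\<forall>i<m. a i \<in> regular ?X U \<and> b i \<in> regular ?X V)}"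
 have prod: "product_zariski ?X ?X = topology_generated_by B" by (simp add: product_zariski_def B_def)
 have B: "{(x, y) \<in> U \<times> V. (\<Sum>i<m. a i x * b i y) \<noteq> 0} \<in> B"
  if "openin (zariski ?X) U" "openin (zariski ?X) V" "\<And>i. a i \<in> regular ?X U \<and> b i \<in> regular ?X V" for U V a b and m :: nat
  unfolding B_def using that by blast
 have reg: "(\<lambda>_. a) \<in> regular ?X U" if "openin (zariski ?X) U" for a U
  using proj_space_with_functions that by (rule space_with_functions_const)
 have "{(x, y) \<in> points ?X \<times> points ?X. (\<Sum>i<(1::nat). 1 * 1) \<noteq> (0::complex)} \<in> B" by (rule B) (auto intro: reg)
 hence "points ?X \<times> points ?X \<subseteq> \<Union>B" by auto
 moreover have sub: "T \<subseteq> points ?X \<times> points ?X" if T: "T \<in> B" for T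
  using T unfolding B_def mem_Collect_eq using exE conjE openin_subset by force
 ultimately have ts: "topspace (product_zariski ?X ?X) = points ?X \<times> points ?X"
  unfolding prod topology_generated_by_topspace by blast
 have off: "\<exists>T\<in>B. (p, q) \<in> T \<and> (\<forall>x. (x, x) \<notin> T)" if pq: "p \<in> points ?X" "q \<in> points ?X" "p \<noteq> q" for p q
 proof -
  obtain z w where z: "z \<in> Y" "p = orbit z" and w: "w \<in> Y" "q = orbit w" using pq unfolding points_proj_space by auto
  obtain i j where i: "i > 0" "z i \<noteq> 0" and j: "j > 0" "w j \<noteq> 0" using coords z w by meson
  \<comment> \<open>A linear form nonzero at both points: one of the coordinates \<open>i\<close>,
    \<open>j\<close>, or their sum if each of these vanishes at the other point.\<close>
  have "\<exists>L. hfun 1 L \<and> L z \<noteq> 0 \<and> L w \<noteq> 0"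
  proof (cases "w i = 0 \<and> z j = 0")
   case True
   thus ?thesis using i j hfun.add[OF hfun.coord[OF i(1)] hfun.coord[OF j(1)]] by (intro exI[of _ "\<lambda>x. x i + x j"]) auto
  next
   case False
   thus ?thesis using i j hfun.coord[OF i(1)] hfun.coord[OF j(1)] by blast
  qed
  then obtain L where L: "hfun 1 L" "L z \<noteq> 0" "L w \<noteq> 0" by blast
  have "\<exists>F. hfun 1 F \<and> F z / L z \<noteq> F w / L w"
  proof (rule ccontr)
   assume "\<nexists>F. hfun 1 F \<and> F z / L z \<noteq> F w / L w"
   hence eq: "F z / L z = F w / L w" if "hfun 1 F" for F using that by blast
   \<comment> \<open>The parameters are compared through the function \<open>z 0 * L z\<close>,
     which also has degree one.\<close>
   have "w = rescale (L w / L z) z"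
   proof
    fix k show "w k = rescale (L w / L z) z k" using eq[OF hfun_mult_param[OF hfun.param L(1)]] eq[OF hfun.coord[of k]] L(2,3)
     by (cases "k = 0") (simp_all add: rescale_def field_simps)
   qed
   thus False using pq(3) L(2,3) unfolding z w by (metis divide_eq_0_iff orbit_rescale)
  qed
  then obtain F where F: "hfun 1 F" "F z / L z \<noteq> F w / L w" by blast
  let ?U = "basic_open Y L" and ?a = "\<lambda>i. if i = (0::nat) then ratio F L else (\<lambda>_. 1)"
   and ?b = "\<lambda>i. if i = (0::nat) then \<lambda>_. 1 else (\<lambda>x. - 1 * ratio F L x)"
  have "(\<lambda>x. - 1 * ratio F L x) = ratio (\<lambda>z. - 1 * F z) L" by (rule ext) (simp add: ratio_def)
  hence "{(x, y) \<in> ?U \<times> ?U. (\<Sum>i<2. ?a i x * ?b i y) \<noteq> 0} \<in> B" (is "?T \<in> B")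
   using ratio_regular[OF F(1) L(1)] ratio_regular[OF hfun_cmult[OF F(1), of "-1"] L(1)] by (intro B) (auto intro: reg)
  moreover have "?T = {(x, y) \<in> ?U \<times> ?U. ratio F L x \<noteq> ratio F L y}" by (auto simp: eval_nat_numeral)
  moreover have "(p, q) \<in> {(x, y) \<in> ?U \<times> ?U. ratio F L x \<noteq> ratio F L y}"
   using F(2) L z w by (auto simp: ratio_orbit[OF F(1) L(1)] basic_open_def)
  ultimately show ?thesis by (intro bexI[of _ ?T]) auto
 qed
 have "openin (product_zariski ?X ?X) (topspace (product_zariski ?X ?X) - {(x, x) | x. x \<in> points ?X})"
 proof (subst openin_subopen, rule ballI)
  fix r assume "r \<in> topspace (product_zariski ?X ?X) - {(x, x) | x. x \<in> points ?X}"
  then obtain p q where r: "r = (p, q)" "p \<in> points ?X" "q \<in> points ?X" "p \<noteq> q" unfolding ts by auto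
  obtain T where T: "T \<in> B" "(p, q) \<in> T" "\<forall>x. (x, x) \<notin> T" using off[OF r(2-4)] by blast
  have "openin (product_zariski ?X ?X) T" unfolding prod using T(1) by (rule topology_generated_by_Basis)
  thus "\<exists>T. openin (product_zariski ?X ?X) T \<and> r \<in> T \<and> T \<subseteq> topspace (product_zariski ?X ?X) - {(x, x) | x. x \<in> points ?X}"
   using T r(1) sub[OF T(1)] unfolding ts by blast
 qed
 thus ?thesis unfolding separated_space_def closedin_def ts by auto
qed

end

subsection \<open>Affine charts\<close>

lemma peval_induct:
 assumes "\<And>a. P (\<lambda>x. a)" "\<And>v. P (\<lambda>x. x v)"
  "\<And>f g. P f \<Longrightarrow> P g \<Longrightarrow> P (\<lambda>x. f x + g x)" "\<And>f g. P f \<Longrightarrow> P g \<Longrightarrow> P (\<lambda>x. f x * g x)"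
 shows "P (peval p)"
proof -
 have pow: "P (\<lambda>x. x v ^ k)" for v k by (induction k) (auto intro: assms)
 have mono: "P (\<lambda>x. \<Prod>v\<in>K. x v ^ lookup e v)" if "finite K" for K and e :: "'a expo"
  using that by (induction K) (auto intro: assms pow)
 have "P (\<lambda>x. \<Sum>e\<in>K. lookup p e * mono_eval x e)" if "finite K" for K using that
 proof (induction K)
  case (insert e K)
  have "P (\<lambda>x. mono_eval x e)" unfolding mono_eval_def by (rule mono) simp
  hence "P (\<lambda>x. lookup p e * mono_eval x e)" by (intro assms)
  thus ?case using insert by (auto intro: assms)
 qed (use assms(1) in simp)
 hence "P (\<lambda>x. \<Sum>e\<in>keys p. lookup p e * mono_eval x e)" by simp
 moreover have "peval p = (\<lambda>x. \<Sum>e\<in>keys p. lookup p e * mono_eval x e)" by (rule ext) (simp add: peval_eq_meval meval_def)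
 ultimately show ?thesis by simp
qed

lemma range_peval_mult: "f \<in> range peval \<Longrightarrow> g \<in> range peval \<Longrightarrow> (\<lambda>x. f x * g x) \<in> range peval"
proof -
 assume "f \<in> range peval" "g \<in> range peval"
 then obtain p q where "f = peval p" "g = peval q" by auto
 hence "(\<lambda>x. f x * g x) = peval (p * q)" by (auto simp: peval_mult)
 thus ?thesis by simp
qed

lemma hfun_closure:
 assumes "hfun k F" "\<And>a. P (\<lambda>_. a)" "\<And>i. P (\<lambda>z. z i)"
  "\<And>F G. P F \<Longrightarrow> P G \<Longrightarrow> P (\<lambda>z. F z + G z)" "\<And>F G. P F \<Longrightarrow> P G \<Longrightarrow> P (\<lambda>z. F z * G z)"
 shows "P F"
 using assms(1) by (induction rule: hfun.induct) (auto intro: assms(2-))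

lemma hfun_range_peval: "hfun k F \<Longrightarrow> F \<in> range peval"
proof (erule hfun_closure)
 show "(\<lambda>_. a) \<in> range peval" for a by (rule range_eqI[of _ _ "Const a"]) auto
 show "(\<lambda>z. z i) \<in> range peval" for i by (rule range_eqI[of _ _ "Indet i"]) auto
 show "(\<lambda>z. F z + G z) \<in> range peval" if "F \<in> range peval" "G \<in> range peval" for F G
  using that by (auto simp: fun_eq_iff image_iff simp flip: peval_add)
qed (rule range_peval_mult)

text \<open>Clearing denominators: constants and the parameter have degree 0, any other coordinate
  has degree 1, and the two sides of a sum are brought to a common degree by powers of coordinate
  \<open>i\<close>.\<close>

lemma homogenization:
 assumes i: "i > 0"
 shows "\<exists>k F. hfun k F \<and> (\<forall>z. z i \<noteq> 0 \<longrightarrow> F z = z i ^ k * peval p (rescale (1 / z i) z))"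
proof (rule peval_induct[where P = "\<lambda>f. \<exists>k F. hfun k F \<and> (\<forall>z. z i \<noteq> 0 \<longrightarrow> F z = z i ^ k * f (rescale (1 / z i) z))"])
 fix a :: complex
 show "\<exists>k F. hfun k F \<and> (\<forall>z. z i \<noteq> 0 \<longrightarrow> F z = z i ^ k * a)"
  by (intro exI[of _ 0] exI[of _ "\<lambda>_. a"]) (auto intro: hfun.const)
next
 fix v
 show "\<exists>k F. hfun k F \<and> (\<forall>z. z i \<noteq> 0 \<longrightarrow> F z = z i ^ k * rescale (1 / z i) z v)"
 proof (cases "v = 0")
  case True
  thus ?thesis by (intro exI[of _ 0] exI[of _ "\<lambda>z. z 0"]) (auto intro: hfun.param)
 next
  case False
  thus ?thesis by (intro exI[of _ 1] exI[of _ "\<lambda>z. z v"]) (auto intro: hfun.coord[simplified] simp: rescale_pos)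
 qed
next
 fix f g
 assume "\<exists>k F. hfun k F \<and> (\<forall>z. z i \<noteq> 0 \<longrightarrow> F z = z i ^ k * f (rescale (1 / z i) z))"
  "\<exists>k F. hfun k F \<and> (\<forall>z. z i \<noteq> 0 \<longrightarrow> F z = z i ^ k * g (rescale (1 / z i) z))"
 then obtain k F l G where F: "hfun k F" "\<forall>z. z i \<noteq> 0 \<longrightarrow> F z = z i ^ k * f (rescale (1 / z i) z)"
  and G: "hfun l G" "\<forall>z. z i \<noteq> 0 \<longrightarrow> G z = z i ^ l * g (rescale (1 / z i) z)" by blast
 have "hfun (k + l) (\<lambda>z. F z * z i ^ l + z i ^ k * G z)" by (intro hfun.add hfun.mult F G hfun_coord_power i)
 thus "\<exists>k F. hfun k F \<and> (\<forall>z. z i \<noteq> 0 \<longrightarrow> F z = z i ^ k * (f (rescale (1 / z i) z) + g (rescale (1 / z i) z)))"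
  using F G by (intro exI[of _ "k + l"] exI[of _ "\<lambda>z. F z * z i ^ l + z i ^ k * G z"]) (auto simp: power_add algebra_simps)
 show "\<exists>k F. hfun k F \<and> (\<forall>z. z i \<noteq> 0 \<longrightarrow> F z = z i ^ k * (f (rescale (1 / z i) z) * g (rescale (1 / z i) z)))"
  using F G by (intro exI[of _ "k + l"] exI[of _ "\<lambda>z. F z * G z"]) (auto simp: power_add intro: hfun.mult)
qed

lemma nonzero_coord: "\<exists>i>0. z i \<noteq> (0::complex) \<Longrightarrow> \<forall>j>N. z j = 0 \<Longrightarrow> \<exists>i\<in>{1..N::nat}. z i \<noteq> 0"
 by (metis atLeastAtMost_iff less_eq_Suc_le One_nat_def not_le)

section \<open>Projective zero sets are varieties\<close>

definition proj_zeros :: "nat \<Rightarrow> (cvec \<Rightarrow> complex) set \<Rightarrow> cvec set" where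
 "proj_zeros N E = {z. (\<forall>j>N. z j = 0) \<and> (\<exists>i>0. z i \<noteq> 0) \<and> (\<forall>F\<in>E. F z = 0)}"

lemma proj_zeros_cone:
 assumes "\<And>F. F \<in> E \<Longrightarrow> \<exists>k. hfun k F"
 shows "is_cone (proj_zeros N E)"
 unfolding is_cone_def
proof (intro ballI allI impI)
 fix z a assume z: "z \<in> proj_zeros N E" and a: "a \<noteq> (0::complex)"
 have "F (rescale a z) = 0" if "F \<in> E" for F
 proof -
  obtain k where "hfun k F" using assms \<open>F \<in> E\<close> by blast
  thus ?thesis using hfun_rescale[of k F a z] z that by (simp add: proj_zeros_def)
 qed
 thus "rescale a z \<in> proj_zeros N E" using z a by (auto simp: proj_zeros_def rescale_def)
qed

text \<open>The slice \<open>z i = 1\<close> meets every orbit of the chart exactly once, so it is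
  an affine model of the chart; homogenization and restriction to the slice translate the basic
  pairs into each other.\<close>

lemma proj_zeros_chart:
 assumes E: "\<And>F. F \<in> E \<Longrightarrow> \<exists>k. hfun k F" and i: "i > 0" "i \<le> N"
 defines "Y \<equiv> proj_zeros N E"
 shows "affine_variety (induced (proj_space Y) (basic_open Y (\<lambda>z. z i)))"
proof -
 let ?U = "basic_open Y (\<lambda>z. z i)"
 let ?X = "induced (proj_space Y) ?U"
 let ?E = "{p. peval p \<in> E} \<union> {Indet i - 1}"
 \<comment> \<open>The coordinates are 0 to \<open>N\<close>, the parameter included, hence
   \<open>Suc N\<close>.\<close>
 define Z where "Z = zero_locus (Suc N) ?E"
 let ?A = "function_algebra_space Z (range peval)"
 let ?F = "(\<lambda>(D, g). (D \<inter> ?U, g)) ` proj_basis Y"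
 let ?G = "{({x\<in>Z. s x \<noteq> 0}, \<lambda>x. f x / s x) | f s. f \<in> range peval \<and> s \<in> range peval}"
 have cone: "is_cone Y" unfolding Y_def using E by (rule proj_zeros_cone)
 note ci = hfun.coord[OF i(1)]
 have Z_iff: "z \<in> Z \<longleftrightarrow> z \<in> Y \<and> z i = 1" for z
 proof
  assume z: "z \<in> Z"
  have "F z = 0" if "F \<in> E" for F using E hfun_range_peval z that unfolding Z_def zero_locus_def by blast
  moreover have "z i = 1" using z by (simp add: Z_def zero_locus_def peval_diff)
  ultimately show "z \<in> Y \<and> z i = 1" using z i by (auto simp: Y_def proj_zeros_def Z_def zero_locus_def intro!: exI[of _ i])
 next
  assume "z \<in> Y \<and> z i = 1"
  thus "z \<in> Z" by (auto simp: Y_def proj_zeros_def Z_def zero_locus_def peval_diff)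
 qed
 have X: "presented ?X ?F" by (rule presented_induced[OF presented_proj_space[OF cone]])
 have A: "presented ?A ?G" by (rule presented_function_algebra_space, rule bexI, rule ballI, rule refl, rule range_peval_mult)
 have ptsA: "points ?A = Z"
 proof -
  have "(\<lambda>_. 1) = peval (1 :: nat cpoly)" by auto
  hence "({x\<in>Z. (1::complex) \<noteq> 0}, \<lambda>x. 1 / 1) \<in> ?G" by (intro CollectI exI[of _ "\<lambda>_. 1"]) auto
  hence "x \<in> points ?A \<longleftrightarrow> x \<in> Z" for x unfolding presented_points_iff[OF A] by auto
  thus ?thesis by blast
 qed
 have ptsX: "points ?X = ?U" using points_proj_space[OF cone] by (auto simp: induced_def basic_open_def)
 define h where "h = (\<lambda>p. rescale (1 / orbit_rep p i) (orbit_rep p))"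
 have h: "h (orbit z) = rescale (1 / z i) z" for z
 proof -
  obtain a where "a \<noteq> 0" "orbit_rep (orbit z) = rescale a z" by (rule orbit_rep_orbit)
  thus ?thesis using i by (simp add: h_def rescale_rescale rescale_pos)
 qed
 have hZ: "rescale (1 / z i) z \<in> Z" if "z \<in> Y" "z i \<noteq> 0" for z
  unfolding Z_iff using that cone i by (simp add: is_cone_def rescale_pos)
 have "bij_betw h (points ?X) (points ?A)" unfolding ptsX ptsA
 proof (rule bij_betw_byWitness[where f' = orbit])
  show "\<forall>p\<in>?U. orbit (h p) = p" by (auto elim!: basic_openE simp: h orbit_rescale)
  show "\<forall>z\<in>Z. h (orbit z) = z" by (auto simp: h Z_iff)
  show "h ` ?U \<subseteq> Z" by (auto elim!: basic_openE simp: h hZ)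
  show "orbit ` Z \<subseteq> ?U" by (auto simp: Z_iff basic_open_def)
 qed
 hence "var_iso ?X ?A"
 proof (rule presented_iso[OF X A])
  fix D g p assume "(D, g) \<in> ?G" and p: "p \<in> points ?X" "h p \<in> D"
  then obtain f s where fs: "D = {x\<in>Z. peval s x \<noteq> 0}" "g = (\<lambda>x. peval f x / peval s x)" by auto
  obtain k F where F: "hfun k F" "\<And>z. z i \<noteq> 0 \<Longrightarrow> F z = z i ^ k * peval f (rescale (1 / z i) z)"
   using homogenization[OF i(1), of f] by blast
  obtain l G where G: "hfun l G" "\<And>z. z i \<noteq> 0 \<Longrightarrow> G z = z i ^ l * peval s (rescale (1 / z i) z)"
   using homogenization[OF i(1), of s] by blast
  have F1: "hfun (k + l) (\<lambda>z. F z * z i ^ l)" and G1: "hfun (k + l) (\<lambda>z. z i ^ k * G z)"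
   by (intro hfun.mult F G hfun_coord_power i)+
  let ?D = "basic_open Y (\<lambda>z. z i ^ k * G z) \<inter> ?U" and ?g = "ratio (\<lambda>z. F z * z i ^ l) (\<lambda>z. z i ^ k * G z)"
  have "(?D, ?g) \<in> ?F" using proj_basisI[OF F1 G1, of Y] by force
  moreover have "p \<in> ?D"
  proof -
   obtain z where z: "z \<in> Y" "p = orbit z" "z i \<noteq> 0" using p unfolding ptsX by (auto elim: basic_openE)
   thus ?thesis using p unfolding ptsX fs by (simp add: orbit_in_basic_open[OF cone G1] h G)
  qed
  moreover have "h q \<in> D \<and> ?g q = g (h q)" if "q \<in> ?D" for q
  proof -
   have "q \<in> ?U" using that by simp
   then obtain z where z: "z \<in> Y" "q = orbit z" "z i \<noteq> 0" by (rule basic_openE)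
   thus ?thesis using that unfolding fs by (simp add: orbit_in_basic_open[OF cone G1] h hZ ratio_orbit[OF F1 G1] F G)
  qed
  ultimately show "\<exists>D' g'. (D', g') \<in> ?F \<and> p \<in> D' \<and> (\<forall>y\<in>D'. h y \<in> D \<and> g' y = g (h y))" by blast
 next
  fix D g p assume "(D, g) \<in> ?F" and p: "p \<in> D"
  then obtain k F G where FG: "hfun k F" "hfun k G" "D = basic_open Y G \<inter> ?U" "g = ratio F G" by (auto elim!: proj_basisE)
  let ?D = "{x\<in>Z. G x \<noteq> 0}" and ?g = "\<lambda>x. F x / G x"
  have "(?D, ?g) \<in> ?G" using hfun_range_peval[OF FG(1)] hfun_range_peval[OF FG(2)] by blast
  moreover have "h p \<in> ?D"
  proof -
   obtain z where z: "z \<in> Y" "p = orbit z" "z i \<noteq> 0" using p unfolding FG by (auto elim: basic_openE)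
   thus ?thesis using p unfolding FG by (simp add: orbit_in_basic_open[OF cone FG(2)] h hZ hfun_rescale[OF FG(2)])
  qed
  moreover have "q \<in> D \<and> g q = ?g (h q)" if q: "q \<in> points ?X" "h q \<in> ?D" for q
  proof -
   obtain z where z: "z \<in> Y" "q = orbit z" "z i \<noteq> 0" using q unfolding ptsX by (auto elim: basic_openE)
   thus ?thesis using q unfolding FG ptsX
    by (simp add: orbit_in_basic_open[OF cone FG(2)] h ratio_orbit[OF FG(1,2)] hfun_rescale[OF FG(2)] hfun_rescale[OF FG(1)])
  qed
  ultimately show "\<exists>D' g'. (D', g') \<in> ?G \<and> h p \<in> D' \<and> (\<forall>y\<in>points ?X. h y \<in> D' \<longrightarrow> y \<in> D \<and> g y = g' (h y))" by blast
 qed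
 thus ?thesis unfolding affine_variety_def Z_def by blast
qed

theorem proj_zeros_variety:
 assumes E: "\<And>F. F \<in> E \<Longrightarrow> \<exists>k. hfun k F"
 shows "variety (proj_space (proj_zeros N E))"
proof -
 let ?Y = "proj_zeros N E"
 have cone: "is_cone ?Y" using E by (rule proj_zeros_cone)
 let ?C = "(\<lambda>i. basic_open ?Y (\<lambda>z. z i)) ` {1..N}"
 have ex: "\<exists>i\<in>{1..N}. z i \<noteq> 0" if "z \<in> ?Y" for z using that unfolding proj_zeros_def by (intro nonzero_coord) auto
 have "\<Union>?C = points (proj_space ?Y)" unfolding points_proj_space[OF cone] basic_open_def using ex by blast
 moreover have "openin (zariski (proj_space ?Y)) U \<and> affine_variety (induced (proj_space ?Y) U)" if "U \<in> ?C" for U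
 proof -
  obtain i where "i \<in> {1..N}" "U = basic_open ?Y (\<lambda>z. z i)" using \<open>U \<in> ?C\<close> by (rule imageE)
  hence i: "i > 0" "i \<le> N" "U = basic_open ?Y (\<lambda>z. z i)" by auto
  thus ?thesis using ratio_regular(1)[OF cone hfun.coord[OF i(1)] hfun.coord[OF i(1)]] proj_zeros_chart[OF E i(1,2)] by simp
 qed
 moreover have "separated_space (proj_space ?Y)" by (rule proj_space_separated[OF cone]) (auto simp: proj_zeros_def)
 ultimately show ?thesis unfolding variety_def using proj_space_with_functions[OF cone] by (intro conjI exI[of _ ?C]) auto
qed

section \<open>Flatness over the affine line\<close>

lemma (in abelian_group) finsum_int_multiples_add:
 fixes z z' :: "'c \<Rightarrow>\<^sub>0 int"
 assumes S: "keys z \<subseteq> S" "keys z' \<subseteq> S" and f: "\<And>p. p \<in> S \<Longrightarrow> f p \<in> carrier G"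
 shows "(\<Oplus>p\<in>keys (z + z'). [lookup (z + z') p] \<cdot> f p) =
  (\<Oplus>p\<in>keys z. [lookup z p] \<cdot> f p) \<oplus>
  (\<Oplus>p\<in>keys z'. [lookup z' p] \<cdot> f p)"
proof -
 define K where "K = keys z \<union> keys z'"
 have fin: "finite K" by (simp add: K_def)
 have fK: "f p \<in> carrier G" if "p \<in> K" for p using that S f by (auto simp: K_def)
 have cl: "[(k::int)] \<cdot> f p \<in> carrier G" if "p \<in> K" for p k using fK[OF that] by (rule add.int_pow_closed)
 have z0: "[(0::int)] \<cdot> f p = \<zero>" for p by (simp add: add_pow_def)
 have ext: "(\<Oplus>p\<in>keys w. [lookup w p] \<cdot> f p) = (\<Oplus>p\<in>K. [lookup w p] \<cdot> f p)"
  if w: "keys w \<subseteq> K" for w :: "'c \<Rightarrow>\<^sub>0 int"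
 proof (rule add.finprod_mono_neutral_cong_left[OF fin w])
  show "[lookup w p] \<cdot> f p = \<zero>" if "p \<in> K - keys w" for p using that z0 by (simp add: in_keys_iff)
 qed (use cl in auto)
 have "(\<Oplus>p\<in>K. [lookup (z + z') p] \<cdot> f p) =
   (\<Oplus>p\<in>K. [lookup z p] \<cdot> f p \<oplus> [lookup z' p] \<cdot> f p)"
 proof (rule add.finprod_cong')
  show "[lookup (z + z') p] \<cdot> f p = [lookup z p] \<cdot> f p \<oplus> [lookup z' p] \<cdot> f p"
   if "p \<in> K" for p unfolding lookup_add using fK[OF that] by (rule add.int_pow_mult)
 qed (use cl in auto)
 also have "\<dots> = (\<Oplus>p\<in>K. [lookup z p] \<cdot> f p) \<oplus> (\<Oplus>p\<in>K. [lookup z' p] \<cdot> f p)"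
  by (rule finsum_addf) (use cl in auto)
 finally show ?thesis using ext[of "z + z'"] ext[of z] ext[of z'] keys_add[of z z'] by (simp add: K_def)
qed

text \<open>
 Of two elements of a valuation ring one divides the other, so every element of the tensor product is of
 the form \<open>a \<otimes> Y\<close>.
\<close>

lemma flat_module_valuation:
 fixes A :: "'a ring" and N :: "('a, 'b) module"
 assumes N: "abelian_group N"
  and closed: "\<And>a y. a \<in> carrier A \<Longrightarrow> y \<in> carrier N \<Longrightarrow> a \<odot>\<^bsub>N\<^esub> y \<in> carrier N"
  and add: "\<And>a y y'. a \<in> carrier A \<Longrightarrow> y \<in> carrier N \<Longrightarrow> y' \<in> carrier N \<Longrightarrow>
   a \<odot>\<^bsub>N\<^esub> (y \<oplus>\<^bsub>N\<^esub> y') = a \<odot>\<^bsub>N\<^esub> y \<oplus>\<^bsub>N\<^esub> a \<odot>\<^bsub>N\<^esub> y'"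
  and assoc: "\<And>a b y. a \<in> carrier A \<Longrightarrow> b \<in> carrier A \<Longrightarrow> y \<in> carrier N \<Longrightarrow>
   (a \<otimes>\<^bsub>A\<^esub> b) \<odot>\<^bsub>N\<^esub> y = a \<odot>\<^bsub>N\<^esub> (b \<odot>\<^bsub>N\<^esub> y)"
  and comm: "\<And>a b. a \<in> carrier A \<Longrightarrow> b \<in> carrier A \<Longrightarrow> a \<otimes>\<^bsub>A\<^esub> b = b \<otimes>\<^bsub>A\<^esub> a"
  and val: "\<And>a b. a \<in> carrier A \<Longrightarrow> b \<in> carrier A \<Longrightarrow>
   (\<exists>c\<in>carrier A. a = b \<otimes>\<^bsub>A\<^esub> c) \<or> (\<exists>c\<in>carrier A. b = a \<otimes>\<^bsub>A\<^esub> c)"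
  and tf: "\<And>a y. a \<in> carrier A \<Longrightarrow> y \<in> carrier N \<Longrightarrow> a \<odot>\<^bsub>N\<^esub> y = \<zero>\<^bsub>N\<^esub> \<Longrightarrow> a = \<zero>\<^bsub>A\<^esub> \<or> y = \<zero>\<^bsub>N\<^esub>"
 shows "flat_module A N"
 unfolding flat_module_def
proof (intro allI impI ballI)
 fix I z
 assume I: "ideal I A" and z: "z \<in> carrier (free_Abelian_group (I \<times> carrier N))"
  and eq: "(\<Oplus>\<^bsub>N\<^esub>p\<in>keys z. [lookup z p] \<cdot>\<^bsub>N\<^esub> (fst p \<odot>\<^bsub>N\<^esub> snd p)) = \<zero>\<^bsub>N\<^esub>"
 interpret I: ideal I A by fact
 interpret N: abelian_group N by fact
 let ?S = "I \<times> carrier N"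
 let ?F = "free_Abelian_group ?S"
 let ?R = "tensor_relations A I N"
 let ?H = "generate ?F ?R"
 let ?f = "\<lambda>p. fst p \<odot>\<^bsub>N\<^esub> snd p"
 let ?ev = "\<lambda>z. (\<Oplus>\<^bsub>N\<^esub>p\<in>keys z. [lookup z p] \<cdot>\<^bsub>N\<^esub> ?f p)"
 have IA: "a \<in> carrier A" if "a \<in> I" for a using I.a_subset that by blast
 have keys3: "keys (frag_of x - frag_of y - frag_of w) \<subseteq> ?S" if "x \<in> ?S" "y \<in> ?S" "w \<in> ?S" for x y w
  using that keys_diff[of "frag_of x - frag_of y" "frag_of w"] keys_diff[of "frag_of x" "frag_of y"] by (auto simp: keys_frag_of)
 have keys2: "keys (frag_of x - frag_of y) \<subseteq> ?S" if "x \<in> ?S" "y \<in> ?S" for x y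
  using that keys_diff[of "frag_of x" "frag_of y"] by (auto simp: keys_frag_of)
 have R: "?R \<subseteq> carrier ?F"
 proof
  fix r assume "r \<in> ?R"
  thus "r \<in> carrier ?F" unfolding tensor_relations_def carrier_free_Abelian_group_iff
   by (elim UnE CollectE exE conjE) (simp only:, (rule keys3 keys2; auto simp: I.I_l_closed closed IA))+
 qed
 have sub: "subgroup ?H ?F" by (rule group.generate_is_subgroup[OF group_free_Abelian_group R])
 have H0: "0 \<in> ?H" using subgroup.one_closed[OF sub] by simp
 have HS: "keys x \<subseteq> ?S" if "x \<in> ?H" for x using subgroup.mem_carrier[OF sub that] by simp
 have Hadd: "x + y \<in> ?H" if "x \<in> ?H" "y \<in> ?H" for x y using subgroup.m_closed[OF sub that] by simp
 have Hneg: "- x \<in> ?H" if "x \<in> ?H" for x using subgroup.m_inv_closed[OF sub that] HS[OF that] by simp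
 have Hdiff: "x - y \<in> ?H" if "x \<in> ?H" "y \<in> ?H" for x y using Hadd[OF that(1) Hneg[OF that(2)]] by simp
 have HR: "x \<in> ?H" if "x \<in> ?R" for x using that by (rule generate.incl)
 have r1: "frag_of (x \<oplus>\<^bsub>A\<^esub> x', y) - frag_of (x, y) - frag_of (x', y) \<in> ?H" if "x \<in> I" "x' \<in> I" "y \<in> carrier N" for x x' y
  by (rule HR) (use that in \<open>auto simp: tensor_relations_def\<close>)
 have r2: "frag_of (x, y \<oplus>\<^bsub>N\<^esub> y') - frag_of (x, y) - frag_of (x, y') \<in> ?H" if "x \<in> I" "y \<in> carrier N" "y' \<in> carrier N" for x y y'
  by (rule HR) (use that in \<open>auto simp: tensor_relations_def\<close>)
 have r3: "frag_of (a \<otimes>\<^bsub>A\<^esub> x, y) - frag_of (x, a \<odot>\<^bsub>N\<^esub> y) \<in> ?H" if "a \<in> carrier A" "x \<in> I" "y \<in> carrier N" for a x y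
  by (rule HR) (use that in \<open>auto simp: tensor_relations_def\<close>)
 have Hz1: "frag_of (\<zero>\<^bsub>A\<^esub>, y) \<in> ?H" if "y \<in> carrier N" for y
  using Hneg[OF r1[of "\<zero>\<^bsub>A\<^esub>" "\<zero>\<^bsub>A\<^esub>" y]] that by simp
 have Hz2: "frag_of (x, \<zero>\<^bsub>N\<^esub>) \<in> ?H" if "x \<in> I" for x
  using Hneg[OF r2[of x "\<zero>\<^bsub>N\<^esub>" "\<zero>\<^bsub>N\<^esub>"]] that by simp
 have f: "?f p \<in> carrier N" if "p \<in> ?S" for p using that closed IA by auto
 let ?P = "\<lambda>x a Y. a \<in> I \<and> Y \<in> carrier N \<and> x - frag_of (a, Y) \<in> ?H \<and> ?ev x = a \<odot>\<^bsub>N\<^esub> Y"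
 \<comment> \<open>Moving the factor \<open>c\<close> across the tensor sign: \<open>a\<close>
   tensor \<open>Y\<close> equals \<open>b\<close> tensor \<open>c Y\<close> if
   \<open>a = b c\<close>. By the valuation property any two tensors acquire a common first
   factor.\<close>
 have div: "?P x b (c \<odot>\<^bsub>N\<^esub> Y)" if x: "?P x a Y" and b: "b \<in> I" and c: "c \<in> carrier A" "a = b \<otimes>\<^bsub>A\<^esub> c" for x a b c Y
 proof -
  have ac: "a = c \<otimes>\<^bsub>A\<^esub> b" using c b IA comm by simp
  have "(x - frag_of (a, Y)) + (frag_of (c \<otimes>\<^bsub>A\<^esub> b, Y) - frag_of (b, c \<odot>\<^bsub>N\<^esub> Y)) \<in> ?H"
   using x r3[OF c(1) b] by (intro Hadd) auto
  thus ?thesis using x b c assoc[OF IA[OF b] c(1)] closed[OF c(1)] unfolding ac[symmetric] by simp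
 qed
 have zk: "keys z \<subseteq> ?S" using z by simp
 have "\<exists>a Y. ?P z a Y"
 proof (rule free_Abelian_group_induct[of z ?S "\<lambda>x. \<exists>a Y. ?P x a Y"])
  have a: "\<zero>\<^bsub>A\<^esub> \<in> I" using additive_subgroup.zero_closed[OF ideal.axioms(1)[OF I]] .
  note aA = IA[OF a]
  have "\<zero>\<^bsub>A\<^esub> \<odot>\<^bsub>N\<^esub> \<zero>\<^bsub>N\<^esub> \<oplus>\<^bsub>N\<^esub> \<zero>\<^bsub>A\<^esub> \<odot>\<^bsub>N\<^esub> \<zero>\<^bsub>N\<^esub> = \<zero>\<^bsub>A\<^esub> \<odot>\<^bsub>N\<^esub> \<zero>\<^bsub>N\<^esub>" using add[OF aA N.zero_closed N.zero_closed] by simp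
  hence "\<zero>\<^bsub>A\<^esub> \<odot>\<^bsub>N\<^esub> \<zero>\<^bsub>N\<^esub> = \<zero>\<^bsub>N\<^esub>" using closed[OF aA N.zero_closed] by (metis N.add.r_cancel_one')
  thus "\<exists>a Y. ?P 0 a Y"
   using a Hneg[OF Hz2[OF a]] by (intro exI[of _ "\<zero>\<^bsub>A\<^esub>"] exI[of _ "\<zero>\<^bsub>N\<^esub>"]) auto
 next
  fix x y assume xy: "keys x \<subseteq> ?S" "keys y \<subseteq> ?S" "\<exists>a Y. ?P x a Y" "\<exists>a Y. ?P y a Y"
  then obtain a1 Z1 a2 Z2 where Z: "?P x a1 Z1" "?P y a2 Z2" by blast
  hence "a1 \<in> carrier A" "a2 \<in> carrier A" using IA by blast+
  hence "\<exists>a Y1 Y2. ?P x a Y1 \<and> ?P y a Y2" using val[of a1 a2] div[OF Z(1), of a2] div[OF Z(2), of a1] Z by blast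
  then obtain a Y1 Y2 where a: "a \<in> I" and Y: "Y1 \<in> carrier N" "x - frag_of (a, Y1) \<in> ?H" "?ev x = a \<odot>\<^bsub>N\<^esub> Y1"
   "Y2 \<in> carrier N" "y - frag_of (a, Y2) \<in> ?H" "?ev y = a \<odot>\<^bsub>N\<^esub> Y2" by blast
  note aA = IA[OF a]
  let ?Y = "Y1 \<ominus>\<^bsub>N\<^esub> Y2"
  have Yc: "?Y \<in> carrier N" using Y by simp
  have Y1: "?Y \<oplus>\<^bsub>N\<^esub> Y2 = Y1" using Y by (simp add: N.minus_eq N.a_assoc N.l_neg)
  have "frag_of (a, Y1) - frag_of (a, ?Y) - frag_of (a, Y2) \<in> ?H" using r2[OF a Yc Y(4)] unfolding Y1 .
  with Y(2,5) have "(x - frag_of (a, Y1)) - (y - frag_of (a, Y2)) + (frag_of (a, Y1) - frag_of (a, ?Y) - frag_of (a, Y2)) \<in> ?H"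
   using Hadd[OF Hdiff] by blast
  hence 1: "x - y - frag_of (a, ?Y) \<in> ?H" by (simp add: algebra_simps)
  have keysxy: "keys (x - y) \<subseteq> ?S" "keys y \<subseteq> ?S" using keys_diff[of x y] xy by auto
  \<comment> \<open>The induction principle for free abelian groups provides differences, while
    evaluation is known to respect sums; so \<open>x\<close> is written as the sum of
    \<open>x - y\<close> and \<open>y\<close>.\<close>
  have "?ev ((x - y) + y) = ?ev (x - y) \<oplus>\<^bsub>N\<^esub> ?ev y" by (rule N.finsum_int_multiples_add[OF keysxy f])
  hence "a \<odot>\<^bsub>N\<^esub> ?Y \<oplus>\<^bsub>N\<^esub> a \<odot>\<^bsub>N\<^esub> Y2 = ?ev (x - y) \<oplus>\<^bsub>N\<^esub> a \<odot>\<^bsub>N\<^esub> Y2"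
   using Y(3,6) add[OF aA Yc Y(4)] Y1 by simp
  moreover have "?ev (x - y) \<in> carrier N" using keysxy(1) f by (intro N.finsum_closed) (auto simp: Pi_def)
  ultimately have "?ev (x - y) = a \<odot>\<^bsub>N\<^esub> ?Y" using closed[OF aA Yc] closed[OF aA Y(4)] by simp
  thus "\<exists>a Y. ?P (x - y) a Y" using 1 Yc a by blast
 next
  fix p assume p: "p \<in> ?S"
  hence "?ev (frag_of p) = ?f p" using f[of p] by (auto simp: keys_frag_of N.add.int_pow_1)
  thus "\<exists>a Y. ?P (frag_of p) a Y" using p H0 by (intro exI[of _ "fst p"] exI[of _ "snd p"]) auto
 qed (rule zk)
 then obtain a Y where a: "a \<in> I" and Y: "Y \<in> carrier N" "z - frag_of (a, Y) \<in> ?H" "?ev z = a \<odot>\<^bsub>N\<^esub> Y" by blast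
 note aA = IA[OF a]
 \<comment> \<open>Since \<open>a Y\<close> is zero, torsion-freeness makes one of the factors zero,
   and then \<open>a\<close> tensor \<open>Y\<close> is itself a consequence of the
   relations.\<close>
 have "frag_of (a, Y) \<in> ?H" using tf[OF aA Y(1)] Y(3) eq Hz1 Hz2 a Y(1) by auto
 hence "z - frag_of (a, Y) + frag_of (a, Y) \<in> ?H" by (rule Hadd[OF Y(2)])
 thus "z \<in> ?H" by simp
qed

section \<open>Germs and stalks\<close>

definition local_section :: "'p fspace \<Rightarrow> 'p \<Rightarrow> 'p set \<Rightarrow> ('p \<Rightarrow> complex) \<Rightarrow> bool" where
 "local_section X x U f \<longleftrightarrow> openin (zariski X) U \<and> x \<in> U \<and> f \<in> regular X U"

lemma presented_regular_subset:
 assumes X: "presented X \<F>" and "openin (zariski X) U" "f \<in> regular X U" "openin (zariski X) V" "V \<subseteq> U"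
 shows "f \<in> regular X V"
proof (rule presented_regularI[OF X assms(4)])
 fix x assume x: "x \<in> V"
 hence "x \<in> U" using assms by blast
 then obtain D p where D: "(D, p) \<in> \<F>" "x \<in> D" "D \<subseteq> U" "\<And>y. y \<in> D \<Longrightarrow> f y = p y"
  using presented_regularE[OF X assms(2,3)] by blast
 obtain D' p' where D': "(D', p') \<in> \<F>" "x \<in> D'" "D' \<subseteq> V" using presented_openE[OF X assms(4) x] by blast
 obtain D'' p'' where "(D'', p'') \<in> \<F>" "x \<in> D''" "D'' \<subseteq> D" "D'' \<subseteq> D'" "\<And>y. y \<in> D'' \<Longrightarrow> p'' y = p y"
  using refiningD[OF presented_refining[OF X] D(1) D'(1) D(2) D'(2)] by blast
 moreover from this have "D'' \<subseteq> V" "\<forall>y\<in>D''. f y = p'' y" using D(4) D'(3) by auto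
 ultimately show "near \<F> x V f" by blast
qed

lemma germ_eq_iff:
 assumes "local_section X x U f" "local_section X x V q"
 shows "germ X x U f = germ X x V q \<longleftrightarrow> (\<exists>W. openin (zariski X) W \<and> x \<in> W \<and> W \<subseteq> U \<inter> V \<and> (\<forall>w\<in>W. f w = q w))"
proof
 assume "germ X x U f = germ X x V q"
 moreover have "(V, q) \<in> germ X x V q" using assms by (auto simp: germ_def local_section_def)
 ultimately have "(V, q) \<in> germ X x U f" by simp
 thus "\<exists>W. openin (zariski X) W \<and> x \<in> W \<and> W \<subseteq> U \<inter> V \<and> (\<forall>w\<in>W. f w = q w)"
  by (simp add: germ_def)
next
 have *: "germ X x U f \<subseteq> germ X x V q" if W: "openin (zariski X) W" "x \<in> W" "W \<subseteq> U \<inter> V" "\<forall>w\<in>W. f w = q w"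
  for U f V q W
 proof
  fix p assume "p \<in> germ X x U f"
  then obtain V' q' W' where p: "p = (V', q')" "openin (zariski X) V'" "x \<in> V'" "q' \<in> regular X V'"
   "openin (zariski X) W'" "x \<in> W'" "W' \<subseteq> U \<inter> V'" "\<forall>w\<in>W'. f w = q' w" by (auto simp: germ_def)
  have "openin (zariski X) (W \<inter> W')" "x \<in> W \<inter> W'" "W \<inter> W' \<subseteq> V \<inter> V'" "\<forall>w\<in>W \<inter> W'. q w = q' w"
   using p(5-8) W by auto
  thus "p \<in> germ X x V q" unfolding germ_def p(1) using p(2-4)
   by (intro CollectI, unfold case_prod_conv, intro conjI exI[of _ "W \<inter> W'"])
 qed
 assume "\<exists>W. openin (zariski X) W \<and> x \<in> W \<and> W \<subseteq> U \<inter> V \<and> (\<forall>w\<in>W. f w = q w)"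
 then obtain W where W: "openin (zariski X) W" "x \<in> W" "W \<subseteq> U \<inter> V" "\<forall>w\<in>W. f w = q w" by blast
 show "germ X x U f = germ X x V q"
 proof (rule equalityI)
  show "germ X x U f \<subseteq> germ X x V q" using W by (rule *)
  show "germ X x V q \<subseteq> germ X x U f" using W by (intro *[of W]) auto
 qed
qed

lemma germ_memD:
 assumes "local_section X x U f" "(V, p) \<in> germ X x U f"
 shows "local_section X x V p" "germ X x V p = germ X x U f"
proof -
 show V: "local_section X x V p" using assms(2) by (auto simp: germ_def local_section_def)
 show "germ X x V p = germ X x U f"
 proof -
  obtain W where "openin (zariski X) W" "x \<in> W" "W \<subseteq> U \<inter> V" "\<forall>w\<in>W. f w = p w"
   using assms(2) by (auto simp: germ_def)
  thus ?thesis unfolding germ_eq_iff[OF V assms(1)] by (intro exI[of _ W]) auto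
 qed
qed

lemma germ_self: "local_section X x U f \<Longrightarrow> (U, f) \<in> germ X x U f"
 by (auto simp: germ_def local_section_def)

text \<open>The operations on stalks are defined as unions over all representatives of a germ. When
  every representative yields the same result, the union is that result.\<close>

lemma germ_UN:
 assumes "local_section X x U f"
  and "\<And>U' f'. local_section X x U' f' \<Longrightarrow> germ X x U' f' = germ X x U f \<Longrightarrow> g U' f' = g U f"
 shows "(\<Union>(U, f)\<in>germ X x U f. g U f) = g U f"
proof -
 have "case p of (U', f') \<Rightarrow> g U' f' = g U f" if "p \<in> germ X x U f" for p
  using that assms(2) germ_memD[OF assms(1)] by (cases p) blast
 hence "(\<Union>p\<in>germ X x U f. case p of (U, f) \<Rightarrow> g U f) = (\<Union>p\<in>germ X x U f. g U f)"
  by (intro SUP_cong refl) auto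
 also have "\<dots> = g U f" using germ_self[OF assms(1)] by auto
 finally show ?thesis .
qed

lemma germ_UN2:
 assumes 1: "local_section X x U f" and 2: "local_section X x V p"
  and op: "\<And>W f p. openin (zariski X) W \<Longrightarrow> f \<in> regular X W \<Longrightarrow> p \<in> regular X W \<Longrightarrow> (\<lambda>y. op (f y) (p y)) \<in> regular X W"
  and X: "presented X \<F>"
 shows "(\<Union>(U, f)\<in>germ X x U f. \<Union>(V, p)\<in>germ X x V p. germ X x (U \<inter> V) (\<lambda>y. op (f y) (p y))) =
  germ X x (U \<inter> V) (\<lambda>y. op (f y) (p y))"
  and "local_section X x (U \<inter> V) (\<lambda>y. op (f y) (p y))"
proof -
 have sec: "local_section X x (U \<inter> V) (\<lambda>y. op (f y) (p y))" if s: "local_section X x U f" "local_section X x V p" for U V f p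
 proof -
  have o: "openin (zariski X) (U \<inter> V)" using s by (simp add: local_section_def openin_Int)
  have "f \<in> regular X (U \<inter> V)" "p \<in> regular X (U \<inter> V)"
   using s presented_regular_subset[OF X _ _ o] unfolding local_section_def by blast+
  thus ?thesis using op[OF o] o s by (simp add: local_section_def)
 qed
 thus "local_section X x (U \<inter> V) (\<lambda>y. op (f y) (p y))" using 1 2 by blast
 have eq: "germ X x (U' \<inter> V') (\<lambda>y. op (f' y) (p' y)) = germ X x (U \<inter> V) (\<lambda>y. op (f y) (p y))"
  if s: "local_section X x U f" "local_section X x V p" "local_section X x U' f'" "local_section X x V' p'"
   "germ X x U' f' = germ X x U f" "germ X x V' p' = germ X x V p" for U V U' V' f p f' p'
 proof -
  obtain W where W: "openin (zariski X) W" "x \<in> W" "W \<subseteq> U' \<inter> U" "\<forall>w\<in>W. f' w = f w"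
   using s(5) unfolding germ_eq_iff[OF s(3,1)] by blast
  obtain W' where W': "openin (zariski X) W'" "x \<in> W'" "W' \<subseteq> V' \<inter> V" "\<forall>w\<in>W'. p' w = p w"
   using s(6) unfolding germ_eq_iff[OF s(4,2)] by blast
  show ?thesis unfolding germ_eq_iff[OF sec[OF s(3,4)] sec[OF s(1,2)]] using W W' by (intro exI[of _ "W \<inter> W'"]) auto
 qed
 have "(\<Union>(V', p')\<in>germ X x V p. germ X x (U' \<inter> V') (\<lambda>y. op (f' y) (p' y))) = germ X x (U' \<inter> V) (\<lambda>y. op (f' y) (p y))"
  if "local_section X x U' f'" for U' f'
  by (rule germ_UN[OF 2, of "\<lambda>V' p'. germ X x (U' \<inter> V') (\<lambda>y. op (f' y) (p' y))"]) (rule eq[OF that 2 that _ refl])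
 note inner = this
 show "(\<Union>(U, f)\<in>germ X x U f. \<Union>(V, p)\<in>germ X x V p. germ X x (U \<inter> V) (\<lambda>y. op (f y) (p y))) =
  germ X x (U \<inter> V) (\<lambda>y. op (f y) (p y))"
 proof (subst germ_UN[OF 1, of "\<lambda>U f. \<Union>(V, p)\<in>germ X x V p. germ X x (U \<inter> V) (\<lambda>y. op (f y) (p y))"])
  show "(\<Union>(V, p)\<in>germ X x V p. germ X x (U' \<inter> V) (\<lambda>y. op (f' y) (p y))) =
    (\<Union>(V, p)\<in>germ X x V p. germ X x (U \<inter> V) (\<lambda>y. op (f y) (p y)))"
   if "local_section X x U' f'" "germ X x U' f' = germ X x U f" for U' f'
   unfolding inner[OF that(1)] inner[OF 1] by (rule eq[OF 1 2 that(1) 2 that(2) refl])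
 qed (rule inner[OF 1])
qed

locale function_space =
 fixes X :: "'p fspace" and \<F>
 assumes presented: "presented X \<F>" and swf: "space_with_functions X"
begin

lemma regular_const: "openin (zariski X) U \<Longrightarrow> (\<lambda>_. a) \<in> regular X U"
 using swf by (rule space_with_functions_const)

lemma regular_add:
 "openin (zariski X) U \<Longrightarrow> f \<in> regular X U \<Longrightarrow> p \<in> regular X U \<Longrightarrow> (\<lambda>x. f x + p x) \<in> regular X U"
 using spec[OF swf[unfolded space_with_functions_def], of U] by blast

lemma regular_mult:
 "openin (zariski X) U \<Longrightarrow> f \<in> regular X U \<Longrightarrow> p \<in> regular X U \<Longrightarrow> (\<lambda>x. f x * p x) \<in> regular X U"
 using spec[OF swf[unfolded space_with_functions_def], of U] by blast

lemma stalk_carrier: "G \<in> carrier (stalk X x) \<longleftrightarrow> (\<exists>U f. local_section X x U f \<and> G = germ X x U f)"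
 by (auto simp: stalk_def local_section_def)

lemma stalkE:
 assumes "G \<in> carrier (stalk X x)"
 obtains U f where "local_section X x U f" "G = germ X x U f" using assms unfolding stalk_carrier by blast

lemma stalkI: "local_section X x U f \<Longrightarrow> germ X x U f \<in> carrier (stalk X x)"
 unfolding stalk_carrier by blast

context
 fixes x U f V p assumes 1: "local_section X x U f" and 2: "local_section X x V p"
begin

lemma stalk_add: "germ X x U f \<oplus>\<^bsub>stalk X x\<^esub> germ X x V p = germ X x (U \<inter> V) (\<lambda>y. f y + p y)"
 using germ_UN2(1)[OF 1 2 regular_add presented] by (simp add: stalk_def)

lemma section_add: "local_section X x (U \<inter> V) (\<lambda>y. f y + p y)"
 by (rule germ_UN2(2)[OF 1 2 regular_add presented])

lemma stalk_mult: "germ X x U f \<otimes>\<^bsub>stalk X x\<^esub> germ X x V p = germ X x (U \<inter> V) (\<lambda>y. f y * p y)"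
 using germ_UN2(1)[OF 1 2 regular_mult presented] by (simp add: stalk_def)

lemma section_mult: "local_section X x (U \<inter> V) (\<lambda>y. f y * p y)"
 by (rule germ_UN2(2)[OF 1 2 regular_mult presented])

end

lemma stalk_zero: "\<zero>\<^bsub>stalk X x\<^esub> = germ X x (points X) (\<lambda>_. 0)"
 by (simp add: stalk_def)

lemma section_const: "x \<in> points X \<Longrightarrow> local_section X x (points X) (\<lambda>_. a)"
 by (auto simp: local_section_def intro: regular_const)

lemma germ_eqI:
 assumes "local_section X x U f" "local_section X x V p" "\<And>w. w \<in> U \<Longrightarrow> w \<in> V \<Longrightarrow> f w = p w"
 shows "germ X x U f = germ X x V p"
 unfolding germ_eq_iff[OF assms(1,2)] using assms by (intro exI[of _ "U \<inter> V"]) (auto simp: local_section_def)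

lemma stalk_abelian_group:
 assumes x: "x \<in> points X"
 shows "abelian_group (stalk X x)"
proof (rule abelian_groupI)
 let ?B = "stalk X x"
 note z = section_const[OF x, of 0]
 show "\<zero>\<^bsub>?B\<^esub> \<in> carrier ?B" unfolding stalk_zero by (rule stalkI[OF z])
 fix a assume "a \<in> carrier ?B"
 then obtain U f where a: "local_section X x U f" "a = germ X x U f" by (rule stalkE)
 show "\<zero>\<^bsub>?B\<^esub> \<oplus>\<^bsub>?B\<^esub> a = a"
  unfolding stalk_zero a(2) stalk_add[OF z a(1)] by (rule germ_eqI[OF section_add[OF z a(1)] a(1)]) simp
 have o: "openin (zariski X) U" "x \<in> U" using a(1) by (auto simp: local_section_def)
 have n: "local_section X x U (\<lambda>y. (-1) * f y)" unfolding local_section_def using a(1)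
  by (intro conjI o regular_mult[OF o(1) regular_const[OF o(1)]]) (simp add: local_section_def)
 show "\<exists>b\<in>carrier ?B. b \<oplus>\<^bsub>?B\<^esub> a = \<zero>\<^bsub>?B\<^esub>"
 proof (rule bexI[OF _ stalkI[OF n]])
  show "germ X x U (\<lambda>y. (-1) * f y) \<oplus>\<^bsub>?B\<^esub> a = \<zero>\<^bsub>?B\<^esub>"
   unfolding stalk_zero a(2) stalk_add[OF n a(1)] by (rule germ_eqI[OF section_add[OF n a(1)] z]) simp
 qed
 fix b assume "b \<in> carrier ?B"
 then obtain V q where b: "local_section X x V q" "b = germ X x V q" by (rule stalkE)
 show "a \<oplus>\<^bsub>?B\<^esub> b \<in> carrier ?B" unfolding a(2) b(2) stalk_add[OF a(1) b(1)] by (rule stalkI[OF section_add[OF a(1) b(1)]])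
 show "a \<oplus>\<^bsub>?B\<^esub> b = b \<oplus>\<^bsub>?B\<^esub> a" unfolding a(2) b(2) stalk_add[OF a(1) b(1)] stalk_add[OF b(1) a(1)]
  by (rule germ_eqI[OF section_add[OF a(1) b(1)] section_add[OF b(1) a(1)]]) simp
 fix c assume "c \<in> carrier ?B"
 then obtain W p where c: "local_section X x W p" "c = germ X x W p" by (rule stalkE)
 note ab = section_add[OF a(1) b(1)] and bc = section_add[OF b(1) c(1)]
 show "a \<oplus>\<^bsub>?B\<^esub> b \<oplus>\<^bsub>?B\<^esub> c = a \<oplus>\<^bsub>?B\<^esub> (b \<oplus>\<^bsub>?B\<^esub> c)"
  unfolding a(2) b(2) c(2) stalk_add[OF a(1) b(1)] stalk_add[OF b(1) c(1)] stalk_add[OF ab c(1)] stalk_add[OF a(1) bc]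
  by (rule germ_eqI[OF section_add[OF ab c(1)] section_add[OF a(1) bc]]) simp
qed

end

lemma restrict_scalars_simps [simp]:
 "carrier (restrict_scalars h B) = carrier B"
 "\<zero>\<^bsub>restrict_scalars h B\<^esub> = \<zero>\<^bsub>B\<^esub>"
 "x \<oplus>\<^bsub>restrict_scalars h B\<^esub> y = x \<oplus>\<^bsub>B\<^esub> y"
 "a \<odot>\<^bsub>restrict_scalars h B\<^esub> y = h a \<otimes>\<^bsub>B\<^esub> y" by (simp_all add: restrict_scalars_def)

lemma restrict_scalars_abelian_group: "abelian_group B \<Longrightarrow> abelian_group (restrict_scalars h B)"
proof -
 assume "abelian_group B"
 then interpret B: abelian_group B .
 show ?thesis by (rule abelian_groupI) (auto simp: B.a_ac intro: B.l_neg B.a_inv_closed bexI[of _ "\<ominus>\<^bsub>B\<^esub> x" for x])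
qed

section \<open>Local rings of the affine line\<close>

lemma range_poly_mult: "f \<in> range poly \<Longrightarrow> g \<in> range poly \<Longrightarrow> (\<lambda>x. f x * g x :: complex) \<in> range poly"
 by (auto simp flip: poly_mult intro!: image_eqI)

abbreviation line_basis :: "(complex set \<times> (complex \<Rightarrow> complex)) set" where
 "line_basis \<equiv> {({x\<in>UNIV. s x \<noteq> 0}, \<lambda>x. f x / s x) | f s. f \<in> range poly \<and> s \<in> range poly}"

lemma line_basisI: "({x. poly s x \<noteq> 0}, \<lambda>x. poly f x / poly s x) \<in> line_basis"
 by auto

lemma line_basisE:
 assumes "(D, p) \<in> line_basis"
 obtains f s where "D = {x. poly s x \<noteq> 0}" "p = (\<lambda>x. poly f x / poly s x)" using assms by auto

lemma affine_line_presented: "presented affine_line line_basis"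
 unfolding affine_line_def by (rule presented_function_algebra_space, rule bexI, rule ballI, rule refl, rule range_poly_mult)

lemma points_affine_line [simp]: "points affine_line = UNIV"
proof -
 have "x \<in> points affine_line" for x
 proof -
  have "x \<in> {x. poly 1 x \<noteq> 0}" by simp
  thus ?thesis unfolding presented_points_iff[OF affine_line_presented] using line_basisI[of 1 1] by blast
 qed
 thus ?thesis by blast
qed

lemma affine_line_space_with_functions: "space_with_functions affine_line"
proof (rule presented_space_with_functions[OF affine_line_presented])
 show "\<exists>D p. (D, p) \<in> line_basis \<and> x \<in> D \<and> (\<forall>y\<in>D. p y = a)" for x a
 proof -
  have "x \<in> {x. poly 1 x \<noteq> 0}" "\<forall>y\<in>{x. poly 1 x \<noteq> 0}. poly [:a:] y / poly 1 y = a" by simp_all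
  thus ?thesis using line_basisI[of 1 "[:a:]"] by blast
 qed
next
 fix D p D' p' x assume "(D, p) \<in> line_basis" "(D', p') \<in> line_basis" and x: "x \<in> D" "x \<in> D'"
 then obtain f s f' s' where 1: "D = {x. poly s x \<noteq> 0}" "p = (\<lambda>x. poly f x / poly s x)"
  "D' = {x. poly s' x \<noteq> 0}" "p' = (\<lambda>x. poly f' x / poly s' x)" by (auto elim!: line_basisE)
 have "({x. poly (s * s') x \<noteq> 0}, \<lambda>x. poly (f * s' + f' * s) x / poly (s * s') x) \<in> line_basis"
  "({x. poly (s * s') x \<noteq> 0}, \<lambda>x. poly (f * f') x / poly (s * s') x) \<in> line_basis" by (rule line_basisI)+
 moreover have "x \<in> {x. poly (s * s') x \<noteq> 0}" "{x. poly (s * s') x \<noteq> 0} \<subseteq> D \<inter> D'" using x 1 by auto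
 moreover have "\<forall>y\<in>{x. poly (s * s') x \<noteq> 0}. poly (f * s' + f' * s) y / poly (s * s') y = p y + p' y"
  "\<forall>y\<in>{x. poly (s * s') x \<noteq> 0}. poly (f * f') y / poly (s * s') y = p y * p' y" using 1 by (auto simp: field_simps)
 ultimately show "\<exists>D'' p''. (D'', p'') \<in> line_basis \<and> x \<in> D'' \<and> D'' \<subseteq> D \<inter> D' \<and> (\<forall>y\<in>D''. p'' y = p y + p' y)"
  "\<exists>D'' p''. (D'', p'') \<in> line_basis \<and> x \<in> D'' \<and> D'' \<subseteq> D \<inter> D' \<and> (\<forall>y\<in>D''. p'' y = p y * p' y)"
  by blast+
qed

interpretation line: function_space affine_line line_basis
 by unfold_locales (rule affine_line_presented, rule affine_line_space_with_functions)

lemma line_section: "poly s a \<noteq> 0 \<Longrightarrow> local_section affine_line a {x. poly s x \<noteq> 0} (\<lambda>x. poly f x / poly s x)"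
 using presented_open_basic[OF affine_line_presented line_basisI] presented_regular_basic[OF affine_line_presented line_basisI]
 by (auto simp: local_section_def)

lemma line_stalkE:
 assumes "G \<in> carrier (stalk affine_line a)"
 obtains f s where "poly s a \<noteq> 0" "G = germ affine_line a {x. poly s x \<noteq> 0} (\<lambda>x. poly f x / poly s x)"
proof -
 obtain U p where U: "local_section affine_line a U p" "G = germ affine_line a U p" using assms by (rule line.stalkE)
 then obtain D q where D: "(D, q) \<in> line_basis" "a \<in> D" "D \<subseteq> U" "\<And>y. y \<in> D \<Longrightarrow> p y = q y"
  unfolding local_section_def using presented_regularE[OF affine_line_presented] by blast
 obtain f s where fs: "D = {x. poly s x \<noteq> 0}" "q = (\<lambda>x. poly f x / poly s x)" using D(1) by (rule line_basisE)
 have s: "poly s a \<noteq> 0" using D fs by simp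
 have "G = germ affine_line a {x. poly s x \<noteq> 0} (\<lambda>x. poly f x / poly s x)"
  unfolding U(2) by (rule line.germ_eqI[OF U(1) line_section[OF s]]) (use D fs in auto)
 thus ?thesis using that s by blast
qed

text \<open>The local ring at \<open>a\<close> is a discrete valuation ring: of two fractions, the
  one whose numerator has the higher order of vanishing at \<open>a\<close> is a multiple of the
  other.\<close>

lemma line_stalk_valuation:
 assumes "G \<in> carrier (stalk affine_line a)" "H \<in> carrier (stalk affine_line a)"
 shows "(\<exists>c\<in>carrier (stalk affine_line a). G = H \<otimes>\<^bsub>stalk affine_line a\<^esub> c) \<or>
     (\<exists>c\<in>carrier (stalk affine_line a). H = G \<otimes>\<^bsub>stalk affine_line a\<^esub> c)"
proof -
 let ?g = "\<lambda>f s. germ affine_line a {x. poly s x \<noteq> 0} (\<lambda>x. poly f x / poly s x)"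
 obtain f s where f: "poly s a \<noteq> 0" "G = ?g f s" using assms(1) by (rule line_stalkE)
 obtain f' s' where f': "poly s' a \<noteq> 0" "H = ?g f' s'" using assms(2) by (rule line_stalkE)
 \<comment> \<open>The quotient is \<open>q s' / (s u)\<close>, regular at \<open>a\<close> because
   neither \<open>s\<close> nor \<open>u\<close> vanishes there.\<close>
 have dvd: "\<exists>c\<in>carrier (stalk affine_line a). ?g f s = ?g f' s' \<otimes>\<^bsub>stalk affine_line a\<^esub> c"
  if s: "poly s a \<noteq> 0" "poly s' a \<noteq> 0" and q: "f * u = f' * q" "poly u a \<noteq> 0" for f s f' s' q u
 proof -
  have su: "poly (s * u) a \<noteq> 0" using s q by simp
  note sec = line_section[OF su, of "q * s'"]
  show ?thesis
  proof (rule bexI[OF _ line.stalkI[OF sec]])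
   show "?g f s = ?g f' s' \<otimes>\<^bsub>stalk affine_line a\<^esub> ?g (q * s') (s * u)"
    unfolding line.stalk_mult[OF line_section[OF s(2)] sec]
   proof (rule line.germ_eqI[OF line_section[OF s(1)] line.section_mult[OF line_section[OF s(2)] sec]])
    fix w assume "w \<in> {x. poly s x \<noteq> 0}" "w \<in> {x. poly s' x \<noteq> 0} \<inter> {x. poly (s * u) x \<noteq> 0}"
    moreover have "poly f w * poly u w = poly f' w * poly q w" using q(1) by (metis poly_mult)
    ultimately show "poly f w / poly s w = poly f' w / poly s' w * (poly (q * s') w / poly (s * u) w)" by (simp add: field_simps)
   qed
  qed
 qed
 consider "f = 0" | "f' = 0" | "f \<noteq> 0" "f' \<noteq> 0" by blast
 thus ?thesis
 proof cases
  case 1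
  thus ?thesis using dvd[OF f(1) f'(1), of f 1 f' 0] f f' by auto
 next
  case 2
  thus ?thesis using dvd[OF f'(1) f(1), of f' 1 f 0] f f' by auto
 next
  case 3
  let ?l = "[:- a, 1:]"
  obtain u where u: "f = ?l ^ Polynomial.order a f * u" "\<not> ?l dvd u" using order_decomp[OF 3(1)] by blast
  obtain u' where u': "f' = ?l ^ Polynomial.order a f' * u'" "\<not> ?l dvd u'" using order_decomp[OF 3(2)] by blast
  have nz: "poly u a \<noteq> 0" "poly u' a \<noteq> 0" using u u' by (auto simp: poly_eq_0_iff_dvd)
  show ?thesis
  proof (cases "Polynomial.order a f' \<le> Polynomial.order a f")
   case True
   hence "f * u' = f' * (?l ^ (Polynomial.order a f - Polynomial.order a f') * u)"
    by (subst u(1), subst u'(1)) (simp add: power_add[symmetric] ac_simps flip: mult.assoc)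
   thus ?thesis using dvd[OF f(1) f'(1) _ nz(2)] f f' by auto
  next
   case False
   hence "f' * u = f * (?l ^ (Polynomial.order a f' - Polynomial.order a f) * u')"
    by (subst u(1), subst u'(1)) (simp add: power_add[symmetric] ac_simps flip: mult.assoc)
   thus ?thesis using dvd[OF f'(1) f(1) _ nz(1)] f f' by auto
  qed
 qed
qed

text \<open>A germ of the line is a polynomial divided by one that is invertible at the point, so a
  section killed by a nonzero germ is killed by a nonzero polynomial in the parameter. Hence
  \<open>tf\<close>, which speaks of polynomials only, yields torsion-freeness over the valuation
  rings of the line.\<close>

theorem (in function_space) flat_over_line:
 assumes mor: "var_morphism X affine_line u"
  and tf: "\<And>p U q x. p \<noteq> 0 \<Longrightarrow> local_section X x U q \<Longrightarrow> (\<forall>y\<in>U. poly p (u y) * q y = 0) \<Longrightarrow>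
   \<exists>W. openin (zariski X) W \<and> x \<in> W \<and> W \<subseteq> U \<and> (\<forall>y\<in>W. q y = 0)"
 shows "flat_morphism X affine_line u"
 unfolding flat_morphism_def
proof (intro conjI ballI mor)
 fix x assume x: "x \<in> points X"
 let ?a = "u x"
 let ?A = "stalk affine_line ?a" and ?B = "stalk X x" and ?h = "stalk_map X affine_line u x"
 have pull: "local_section X x (preim X u U) (q \<circ> u)" if "local_section affine_line ?a U q" for U q
  using that mor x unfolding local_section_def var_morphism_def preim_def continuous_map_def by blast
 have h: "?h (germ affine_line ?a U q) = germ X x (preim X u U) (q \<circ> u)" if s: "local_section affine_line ?a U q" for U q
  unfolding stalk_map_def
 proof (rule germ_UN[OF s])
  fix U' q' assume s': "local_section affine_line ?a U' q'" and "germ affine_line ?a U' q' = germ affine_line ?a U q"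
  then obtain W where W: "openin (zariski affine_line) W" "?a \<in> W" "W \<subseteq> U' \<inter> U" "\<forall>w\<in>W. q' w = q w"
   unfolding germ_eq_iff[OF s' s] by blast
  have "openin (zariski X) (preim X u W)" using mor W(1) unfolding var_morphism_def continuous_map_def preim_def by blast
  thus "germ X x (preim X u U') (q' \<circ> u) = germ X x (preim X u U) (q \<circ> u)" unfolding germ_eq_iff[OF pull[OF s'] pull[OF s]]
   using W x by (intro exI[of _ "preim X u W"]) (auto simp: preim_def)
 qed
 show "flat_module ?A (restrict_scalars ?h ?B)"
 proof (rule flat_module_valuation, unfold restrict_scalars_simps)
  show "abelian_group (restrict_scalars ?h ?B)" by (rule restrict_scalars_abelian_group[OF stalk_abelian_group[OF x]])
 next
  fix G assume "G \<in> carrier ?A"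
  then obtain U q where G: "local_section affine_line ?a U q" "G = germ affine_line ?a U q" by (rule line.stalkE)
  note hG = h[OF G(1)] and pG = pull[OF G(1)]
  show "?h G \<otimes>\<^bsub>?B\<^esub> y \<in> carrier ?B" if y0: "y \<in> carrier ?B" for y
  proof -
   obtain V g where y: "local_section X x V g" "y = germ X x V g" using y0 by (rule stalkE)
   show ?thesis unfolding G(2) hG y(2) stalk_mult[OF pG y(1)] by (rule stalkI[OF section_mult[OF pG y(1)]])
  qed
  show "?h G \<otimes>\<^bsub>?B\<^esub> (y \<oplus>\<^bsub>?B\<^esub> y') = ?h G \<otimes>\<^bsub>?B\<^esub> y \<oplus>\<^bsub>?B\<^esub> ?h G \<otimes>\<^bsub>?B\<^esub> y'" if y0: "y \<in> carrier ?B" "y' \<in> carrier ?B" for y y'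
  proof -
   obtain V g where y: "local_section X x V g" "y = germ X x V g" using y0(1) by (rule stalkE)
   obtain V' g' where y': "local_section X x V' g'" "y' = germ X x V' g'" using y0(2) by (rule stalkE)
   note s1 = section_mult[OF pG y(1)] and s2 = section_mult[OF pG y'(1)] and s3 = section_add[OF y(1) y'(1)]
   show ?thesis
    unfolding G(2) hG y(2) y'(2) stalk_mult[OF pG y(1)] stalk_mult[OF pG y'(1)] stalk_add[OF y(1) y'(1)] stalk_add[OF s1 s2] stalk_mult[OF pG s3]
    by (rule germ_eqI[OF section_mult[OF pG s3] section_add[OF s1 s2]]) (simp add: algebra_simps)
  qed
  fix H assume "H \<in> carrier ?A"
  then obtain V g where H: "local_section affine_line ?a V g" "H = germ affine_line ?a V g" by (rule line.stalkE)
  note hH = h[OF H(1)] and pH = pull[OF H(1)] and GH = line.section_mult[OF G(1) H(1)] and HG = line.section_mult[OF H(1) G(1)]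
  show "G \<otimes>\<^bsub>?A\<^esub> H = H \<otimes>\<^bsub>?A\<^esub> G"
   unfolding G(2) H(2) line.stalk_mult[OF G(1) H(1)] line.stalk_mult[OF H(1) G(1)] by (rule line.germ_eqI[OF GH HG]) simp
  show "(\<exists>c\<in>carrier ?A. G = H \<otimes>\<^bsub>?A\<^esub> c) \<or> (\<exists>c\<in>carrier ?A. H = G \<otimes>\<^bsub>?A\<^esub> c)"
   using \<open>G \<in> carrier ?A\<close> \<open>H \<in> carrier ?A\<close> by (rule line_stalk_valuation)
  show "?h (G \<otimes>\<^bsub>?A\<^esub> H) \<otimes>\<^bsub>?B\<^esub> y = ?h G \<otimes>\<^bsub>?B\<^esub> (?h H \<otimes>\<^bsub>?B\<^esub> y)" if y0: "y \<in> carrier ?B" for y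
  proof -
   obtain W v where y: "local_section X x W v" "y = germ X x W v" using y0 by (rule stalkE)
   note pGH = pull[OF GH] and s = section_mult[OF pH y(1)]
   show ?thesis
    unfolding G(2) H(2) line.stalk_mult[OF G(1) H(1)] hG hH h[OF GH] y(2) stalk_mult[OF pGH y(1)] stalk_mult[OF pH y(1)] stalk_mult[OF pG s]
    by (rule germ_eqI[OF section_mult[OF pGH y(1)] section_mult[OF pG s]]) simp
  qed
 next
  fix G y assume "G \<in> carrier ?A" "y \<in> carrier ?B" and eq: "?h G \<otimes>\<^bsub>?B\<^esub> y = \<zero>\<^bsub>?B\<^esub>"
  obtain f s where G: "poly s ?a \<noteq> 0" "G = germ affine_line ?a {x. poly s x \<noteq> 0} (\<lambda>x. poly f x / poly s x)"
   using \<open>G \<in> carrier ?A\<close> by (rule line_stalkE)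
  obtain V g where y: "local_section X x V g" "y = germ X x V g" using \<open>y \<in> carrier ?B\<close> by (rule stalkE)
  note G' = line_section[OF G(1), of f]
  note pG = pull[OF G']
  show "G = \<zero>\<^bsub>?A\<^esub> \<or> y = \<zero>\<^bsub>?B\<^esub>"
  proof (cases "f = 0")
   case True
   have "G = \<zero>\<^bsub>?A\<^esub>" unfolding G(2) line.stalk_zero
    by (rule line.germ_eqI[OF G' line.section_const]) (simp_all add: True)
   thus ?thesis ..
  next
   case False
   from eq obtain W where W: "openin (zariski X) W" "x \<in> W" "W \<subseteq> preim X u {x. poly s x \<noteq> 0} \<inter> V \<inter> points X"
    "\<forall>w\<in>W. ((\<lambda>x. poly f x / poly s x) \<circ> u) w * g w = 0"
    unfolding G(2) h[OF G'] y(2) stalk_mult[OF pG y(1)] stalk_zero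
     germ_eq_iff[OF section_mult[OF pG y(1)] section_const[OF x]] by (elim exE conjE)
   have "local_section X x W g" using y(1) W presented_regular_subset[OF presented, of V g W] unfolding local_section_def by blast
   moreover have "\<forall>w\<in>W. poly f (u w) * g w = 0" using W(3,4) by (auto simp: preim_def)
   ultimately obtain W' where W': "openin (zariski X) W'" "x \<in> W'" "W' \<subseteq> W" "\<forall>w\<in>W'. g w = 0"
    using tf[OF False, of x W g] by (elim meta_impE exE conjE)
   have "y = \<zero>\<^bsub>?B\<^esub>" unfolding y(2) stalk_zero germ_eq_iff[OF y(1) section_const[OF x]]
    using W' W(3) by (intro exI[of _ W']) auto
   thus ?thesis ..
  qed
 qed
qed

section \<open>Flatness and reduced fibres of projective families\<close>

lemma orbit_param_morphism:
 assumes cone: "is_cone Y"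
 shows "var_morphism (proj_space Y) affine_line orbit_param"
proof (rule presented_morphism[OF presented_proj_space[OF cone] affine_line_presented])
 fix D g p assume "(D, g) \<in> line_basis" and p: "p \<in> points (proj_space Y)" "orbit_param p \<in> D"
 then obtain f s where fs: "D = {x. poly s x \<noteq> 0}" "g = (\<lambda>x. poly f x / poly s x)" by (auto elim!: line_basisE)
 note F = hfun_poly[of f] and S = hfun_poly[of s]
 show "\<exists>D' g'. (D', g') \<in> proj_basis Y \<and> p \<in> D' \<and> (\<forall>y\<in>D'. orbit_param y \<in> D \<and> g' y = g (orbit_param y))"
 proof (intro exI conjI ballI)
  show "(basic_open Y (\<lambda>z. poly s (z 0)), ratio (\<lambda>z. poly f (z 0)) (\<lambda>z. poly s (z 0))) \<in> proj_basis Y"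
   by (rule proj_basisI[OF F S])
  show "p \<in> basic_open Y (\<lambda>z. poly s (z 0))" using p unfolding points_proj_space[OF cone] fs by (auto simp: basic_open_def)
  fix q assume "q \<in> basic_open Y (\<lambda>z. poly s (z 0))"
  then obtain z where z: "q = orbit z" "poly s (z 0) \<noteq> 0" by (rule basic_openE)
  thus "orbit_param q \<in> D" "ratio (\<lambda>z. poly f (z 0)) (\<lambda>z. poly s (z 0)) q = g (orbit_param q)"
   using ratio_orbit[OF F S, of z] fs by auto
 qed
qed simp

theorem proj_space_flat:
 assumes cone: "is_cone Y"
  and tf: "\<And>p k F. p \<noteq> 0 \<Longrightarrow> hfun k F \<Longrightarrow> \<forall>z\<in>Y. poly p (z 0) * F z = 0 \<Longrightarrow> \<forall>z\<in>Y. F z = 0"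
 shows "flat_morphism (proj_space Y) affine_line orbit_param"
proof -
 interpret function_space "proj_space Y" "proj_basis Y"
  by unfold_locales (rule presented_proj_space[OF cone], rule proj_space_with_functions[OF cone])
 show ?thesis
 proof (rule flat_over_line[OF orbit_param_morphism[OF cone]])
  fix p U f x
  assume p: "p \<noteq> (0 :: complex poly)" and sec: "local_section (proj_space Y) x U f"
   and zero: "\<forall>y\<in>U. poly p (orbit_param y) * f y = 0"
  obtain D q where D: "(D, q) \<in> proj_basis Y" "x \<in> D" "D \<subseteq> U" "\<And>y. y \<in> D \<Longrightarrow> f y = q y"
   using presented_regularE[OF presented] sec unfolding local_section_def by metis
  obtain k F G where FG: "hfun k F" "hfun k G" "D = basic_open Y G" "q = ratio F G" using D(1) by (rule proj_basisE)
  have val: "f (orbit z) = F z / G z" if "z \<in> Y" "G z \<noteq> 0" for z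
   using D(4)[of "orbit z"] that FG by (simp add: orbit_in_basic_open[OF cone FG(2)] ratio_orbit[OF FG(1,2)])
  \<comment> \<open>Multiplying the numerator by the denominator \<open>G\<close> makes the local
    relation global: outside the open set \<open>G\<close> is zero anyway.\<close>
  have "poly p (z 0) * (F z * G z) = 0" if "z \<in> Y" for z
  proof (cases "G z = 0")
   case False
   hence "orbit z \<in> U" using D(3) that FG by (auto simp: orbit_in_basic_open[OF cone FG(2)])
   thus ?thesis using zero val[OF that False] False by fastforce
  qed simp
  hence "F z * G z = 0" if "z \<in> Y" for z using tf[OF p hfun.mult[OF FG(1,2)]] that by blast
  hence "f (orbit z) = 0" if "z \<in> Y" "G z \<noteq> 0" for z using val[OF that] that by force
  hence "\<forall>y\<in>D. f y = 0" unfolding FG(3) by (auto elim!: basic_openE)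
  thus "\<exists>W. openin (zariski (proj_space Y)) W \<and> x \<in> W \<and> W \<subseteq> U \<and> (\<forall>y\<in>W. f y = 0)"
   using D presented_open_basic[OF presented D(1)] by blast
 qed
qed

lemma fibre_presented:
 assumes cone: "is_cone Y"
 shows "presented (induced (proj_space Y) (preim (proj_space Y) orbit_param {a})) (proj_basis {z\<in>Y. z 0 = a})"
proof -
 have b: "basic_open Y G \<inter> preim (proj_space Y) orbit_param {a} = basic_open {z\<in>Y. z 0 = a} G" for G
  by (auto simp: basic_open_def preim_def points_proj_space[OF cone])
 have "(\<lambda>(D, q). (D \<inter> preim (proj_space Y) orbit_param {a}, q)) ` proj_basis Y = proj_basis {z\<in>Y. z 0 = a}"
  (is "?g ` _ = _")
 proof (intro equalityI subsetI)
  fix p assume "p \<in> ?g ` proj_basis Y"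
  then obtain D q where p: "(D, q) \<in> proj_basis Y" "p = ?g (D, q)" by auto
  obtain k F G where "hfun k F" "hfun k G" "D = basic_open Y G" "q = ratio F G" using p(1) by (rule proj_basisE)
  thus "p \<in> proj_basis {z\<in>Y. z 0 = a}" unfolding p(2) by (simp add: b proj_basisI)
 next
  fix p assume p: "p \<in> proj_basis {z\<in>Y. z 0 = a}"
  obtain D q where D: "p = (D, q)" by (cases p)
  obtain k F G where FG: "hfun k F" "hfun k G" "D = basic_open {z\<in>Y. z 0 = a} G" "q = ratio F G"
   using p unfolding D by (rule proj_basisE)
  have "p = ?g (basic_open Y G, ratio F G)" unfolding D FG(3,4) by (simp add: b)
  thus "p \<in> ?g ` proj_basis Y" using imageI[OF proj_basisI[OF FG(1,2), of Y], of ?g] by simp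
 qed
 thus ?thesis using presented_induced[OF presented_proj_space[OF cone], of "preim (proj_space Y) orbit_param {a}"] by simp
qed

text \<open>That the parameter minus \<open>a\<close> generates the ideal of the fibre need only be
  known for homogeneous functions: a local section \<open>F / G\<close> vanishing on the fibre is
  rewritten as \<open>F * G / (G * G)\<close>, and \<open>F * G\<close> vanishes on the whole fibre,
  also where \<open>G\<close> does.\<close>

theorem proj_space_fibre_iso:
 assumes cone: "is_cone Y"
  and key: "\<And>k F. hfun k F \<Longrightarrow> \<forall>z\<in>Y. z 0 = a \<longrightarrow> F z = 0 \<Longrightarrow> \<exists>F'. hfun k F' \<and> (\<forall>z\<in>Y. F z = (z 0 - a) * F' z)"
  and iso: "var_iso (induced (proj_space Y) (preim (proj_space Y) orbit_param {a})) Z"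
 shows "fibre_iso (proj_space Y) orbit_param a Z"
 unfolding fibre_iso_def
proof (intro conjI iso allI impI)
 fix U f x
 assume U: "openin (zariski (proj_space Y)) U" and f: "f \<in> regular (proj_space Y) U"
  and zero: "\<forall>y\<in>U. orbit_param y = a \<longrightarrow> f y = 0" and x: "x \<in> U"
 obtain D p where D: "(D, p) \<in> proj_basis Y" "x \<in> D" "D \<subseteq> U" "\<And>y. y \<in> D \<Longrightarrow> f y = p y"
  using presented_regularE[OF presented_proj_space[OF cone] U f x] by metis
 obtain k F G where FG: "hfun k F" "hfun k G" "D = basic_open Y G" "p = ratio F G" using D(1) by (rule proj_basisE)
 have val: "f (orbit z) = F z / G z" "orbit z \<in> U" if "z \<in> Y" "G z \<noteq> 0" for z
  using D(3,4) that FG by (auto simp: orbit_in_basic_open[OF cone FG(2)] ratio_orbit[OF FG(1,2)])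
 have "F z * G z = 0" if "z \<in> Y" "z 0 = a" for z using val[OF that(1)] zero that(2) by fastforce
 then obtain F' where F': "hfun (k + k) F'" "\<And>z. z \<in> Y \<Longrightarrow> F z * G z = (z 0 - a) * F' z"
  using key[OF hfun.mult[OF FG(1,2)]] by blast
 note GG = hfun.mult[OF FG(2,2)]
 have D_eq: "basic_open Y (\<lambda>z. G z * G z) = D" using basic_open_mult[OF cone FG(2,2)] FG(3) by simp
 have "f y = (orbit_param y - a) * ratio F' (\<lambda>z. G z * G z) y" if y: "y \<in> D" for y
 proof -
  obtain z where z: "z \<in> Y" "y = orbit z" "G z \<noteq> 0" using y unfolding FG(3) by (rule basic_openE)
  thus ?thesis using val(1)[OF z(1,3)] F'(2)[OF z(1)] by (simp add: ratio_orbit[OF F'(1) GG] field_simps)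
 qed
 thus "\<exists>W p. openin (zariski (proj_space Y)) W \<and> x \<in> W \<and> W \<subseteq> U \<and> p \<in> regular (proj_space Y) W \<and>
      (\<forall>y\<in>W. f y = (orbit_param y - a) * p y)" using D(2,3) ratio_regular[OF cone F'(1) GG] unfolding D_eq by blast
qed

section \<open>The Rees degeneration\<close>

lemma hfun_prod_list: "(\<And>j. j \<in> set xs \<Longrightarrow> j > 0) \<Longrightarrow> hfun (length xs) (\<lambda>z. prod_list (map z xs))"
proof (induction xs)
 case Nil
 show ?case using hfun.const[of 1] by simp
next
 case (Cons j xs)
 have "hfun (1 + length xs) (\<lambda>z. z j * prod_list (map z xs))" using Cons by (intro hfun.mult hfun.coord) auto
 thus ?case by simp
qed

definition specialization :: "('v \<Rightarrow> nat) \<Rightarrow> nat \<Rightarrow> complex \<Rightarrow> 'v cpoly \<Rightarrow> 'v cpoly" where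
 "specialization c w a g = (\<Sum>e\<in>keys g. single e (lookup g e * a ^ (w - weight c e)))"

lemma heval_specialization: "heval c w g a x = peval (specialization c w a g) x"
 unfolding heval_def peval_eq_meval specialization_def meval_sum meval_single by (simp add: meval_def mult.assoc)

lemma lookup_specialization:
 "lookup (specialization c w a g) e = lookup g e * a ^ (w - weight c e)"
proof -
 have "lookup (specialization c w a g) e
   = (\<Sum>m\<in>keys g. if m = e then lookup g m * a ^ (w - weight c m) else 0)"
  unfolding specialization_def lookup_sum by (intro sum.cong) (auto simp: lookup_single)
 thus ?thesis by (simp add: in_keys_iff)
qed

text \<open>The initial forms in degree \<open>k\<close> involve only sums of \<open>k\<close> of
  the exponents \<open>s j\<close>, each of which is the monic leading monomial of an element
  \<open>f j\<close> of degree one. That the \<open>f j\<close> generate the algebra is a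
  consequence, obtained by subduction.\<close>

locale rees =
 fixes c :: "'v \<Rightarrow> nat" and R :: "nat \<Rightarrow> 'v cpoly set" and N :: nat
  and f :: "nat \<Rightarrow> 'v cpoly" and s :: "nat \<Rightarrow> 'v expo"
 assumes R_0: "0 \<in> R k"
  and R_add: "g \<in> R k \<Longrightarrow> h \<in> R k \<Longrightarrow> g + h \<in> R k"
  and R_Const_mult: "g \<in> R k \<Longrightarrow> Const a * g \<in> R k"
  and R_mult: "g \<in> R k \<Longrightarrow> h \<in> R l \<Longrightarrow> g * h \<in> R (k + l)"
  and R_1: "1 \<in> R 0"
  and f_R: "j \<in> {1..N} \<Longrightarrow> f j \<in> R 1"
  and f_weight: "j \<in> {1..N} \<Longrightarrow> weight_le c (weight c (s j)) (f j)"
  and f_initial: "j \<in> {1..N} \<Longrightarrow> wpart c (weight c (s j)) (f j) = Monom (s j)"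
  and R_initial: "g \<in> R k \<Longrightarrow> e \<in> keys (initial_form c g) \<Longrightarrow>
   \<exists>xs. length xs = k \<and> set xs \<subseteq> {1..N} \<and> e = sum_list (map s xs)"
begin

definition words :: "nat \<Rightarrow> nat list set" where
 "words k = {xs. length xs = k \<and> set xs \<subseteq> {1..N}}"

definition S :: "nat \<Rightarrow> 'v expo set" where
 "S k = (\<lambda>xs. sum_list (map s xs)) ` words k"

text \<open>One factorization of \<open>e\<close> is fixed. Different factorizations may have
  different lifts with the same leading monomial; choosing one per exponent is what makes the lifts
  linearly independent.\<close>

definition word :: "nat \<Rightarrow> 'v expo \<Rightarrow> nat list" where
 "word k e = (SOME xs. xs \<in> words k \<and> e = sum_list (map s xs))"

definition lift :: "nat \<Rightarrow> 'v expo \<Rightarrow> 'v cpoly" where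
 "lift k e = prod_list (map f (word k e))"

definition cmono :: "nat \<Rightarrow> 'v expo \<Rightarrow> cvec \<Rightarrow> complex" where
 "cmono k e z = prod_list (map z (word k e))"

text \<open>The parametrization of the family: the total space will be cut out by all homogeneous
  functions that vanish on the image of this map, for all \<open>t\<close> and \<open>x\<close>
  together.\<close>

definition fam :: "complex \<Rightarrow> ('v \<Rightarrow> complex) \<Rightarrow> nat \<Rightarrow> complex" where
 "fam t x j = (if j = 0 then t else if j \<le> N then heval c (weight c (s j)) (f j) t x else 0)"

lemma fam_0 [simp]: "fam t x 0 = t"
 by (simp add: fam_def)

lemma finite_S: "finite (S k)"
proof -
 have "words k = {xs. set xs \<subseteq> {1..N} \<and> length xs = k}" by (auto simp: words_def)
 thus ?thesis unfolding S_def using finite_lists_length_eq[of "{1..N}" k] by simp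
qed

lemma word: "e \<in> S k \<Longrightarrow> word k e \<in> words k \<and> e = sum_list (map s (word k e))"
 unfolding S_def word_def by (rule someI_ex) auto

lemma cmono_hfun: "e \<in> S k \<Longrightarrow> hfun k (cmono k e)"
 using word[of e k] hfun_prod_list[of "word k e"] unfolding words_def cmono_def by fastforce

lemma words_prod_conj:
 "set xs \<subseteq> {1..N} \<Longrightarrow> prod_list (map f xs) \<in> R (length xs) \<and>
  weight_le c (weight c (sum_list (map s xs))) (prod_list (map f xs)) \<and>
  wpart c (weight c (sum_list (map s xs))) (prod_list (map f xs)) = Monom (sum_list (map s xs)) \<and>
  prod_list (map (fam t x) xs) = heval c (weight c (sum_list (map s xs))) (prod_list (map f xs)) t x"
proof (induction xs)
 case Nil
 have "wpart c 0 (1 :: 'v cpoly) = 1" by (rule poly_mapping_eqI) (auto simp: lookup_wpart lookup_one when_def)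
 thus ?case by (simp add: R_1 weight_le_def Monom_def)
next
 case (Cons j xs)
 hence j: "j \<in> {1..N}" by simp
 note IH = Cons.IH[THEN conjunct1] Cons.IH[THEN conjunct2, THEN conjunct1] Cons.IH[THEN conjunct2, THEN conjunct2]
 have xs: "set xs \<subseteq> {1..N}" using Cons.prems by simp
 have "f j * prod_list (map f xs) \<in> R (1 + length xs)" using R_mult[OF f_R[OF j] IH(1)[OF xs]] .
 moreover have "fam t x j = heval c (weight c (s j)) (f j) t x" using j by (simp add: fam_def)
 ultimately show ?case using weight_le_mult[OF f_weight[OF j] IH(2)[OF xs]] wpart_mult[OF f_weight[OF j] IH(2)[OF xs]]
   heval_mult[OF f_weight[OF j] IH(2)[OF xs], of t x] f_initial[OF j] IH(3)[OF xs] by (simp add: weight_add Monom_def mult_single)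
qed

lemmas words_prod = words_prod_conj[THEN conjunct1] words_prod_conj[THEN conjunct2, THEN conjunct1]
 words_prod_conj[THEN conjunct2, THEN conjunct2, THEN conjunct1] words_prod_conj[THEN conjunct2, THEN conjunct2, THEN conjunct2]

lemma lift:
 assumes "e \<in> S k"
 shows "lift k e \<in> R k" "weight_le c (weight c e) (lift k e)" "wpart c (weight c e) (lift k e) = Monom e"
  "cmono k e (fam t x) = heval c (weight c e) (lift k e) t x"
proof -
 have w: "set (word k e) \<subseteq> {1..N}" "length (word k e) = k" "sum_list (map s (word k e)) = e"
  using word[OF assms] by (auto simp: words_def)
 show "lift k e \<in> R k" "weight_le c (weight c e) (lift k e)" "wpart c (weight c e) (lift k e) = Monom e"
  "cmono k e (fam t x) = heval c (weight c e) (lift k e) t x" using words_prod[OF w(1)] unfolding w lift_def cmono_def by blast+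
qed

lemma R_diff: "g \<in> R k \<Longrightarrow> h \<in> R k \<Longrightarrow> g - h \<in> R k"
 using R_add[OF _ R_Const_mult[of h k "-1"], of g] by (simp add: Const_uminus)

lemma R_sum: "(\<And>i. i \<in> I \<Longrightarrow> g i \<in> R k) \<Longrightarrow> (\<Sum>i\<in>I. g i) \<in> R k"
 by (induction I rule: infinite_finite_induct) (auto simp: R_0 R_add)

lemma wpart_diff: "wpart c w (g - h) = wpart c w g - wpart c w h"
 by (rule poly_mapping_eqI) (simp add: lookup_wpart lookup_minus)

lemma wpart_sum: "wpart c w (\<Sum>i\<in>I. g i) = (\<Sum>i\<in>I. wpart c w (g i))"
 by (rule poly_mapping_eqI) (simp add: lookup_wpart lookup_sum)

text \<open>Subduction: the initial form of \<open>g\<close> is cancelled by subtracting lifts of its terms.\<close>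

lemma subduction_step:
 assumes g: "g \<in> R k" "weight_le c w g"
 obtains g' where "g' \<in> R k" "\<forall>e\<in>keys g'. weight c e < w"
  "\<And>W t x. w \<le> W \<Longrightarrow> heval c W g t x = heval c W g' t x +
   (\<Sum>e\<in>{e\<in>S k. weight c e = w}. lookup g e * t ^ (W - w) * cmono k e (fam t x))"
proof -
 let ?T = "{e\<in>S k. weight c e = w}"
 let ?h = "\<Sum>e\<in>?T. Const (lookup g e) * lift k e"
 have hR: "?h \<in> R k" by (intro R_sum R_Const_mult) (simp add: lift)
 have lw: "weight_le c w (lift k e)" if "e \<in> ?T" for e using that lift(2)[of e k] by auto
 hence hw: "weight_le c w ?h" by (intro weight_le_sum weight_le_Const_mult)
 have dw: "weight_le c w (g - ?h)" using weight_le_add[OF g(2) weight_le_Const_mult[OF hw, of "-1"]] by (simp add: Const_uminus)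
 have "lookup (wpart c w ?h) e' = lookup (wpart c w g) e'" for e'
 proof -
  have "lookup (wpart c w ?h) e' = (\<Sum>e\<in>?T. lookup g e * lookup (wpart c w (lift k e)) e')"
   by (simp add: wpart_sum wpart_Const_mult lookup_sum lookup_Const_mult)
  also have "\<dots> = (\<Sum>e\<in>?T. if e = e' then lookup g e else 0)"
   by (intro sum.cong refl) (use lift(3)[of _ k] in \<open>auto simp: Monom_def lookup_single when_def\<close>)
  also have "\<dots> = (if e' \<in> ?T then lookup g e' else 0)" using finite_S by simp
  also have "\<dots> = lookup (wpart c w g) e'"
  proof (cases "e' \<in> keys (wpart c w g)")
   case True
   hence "e' \<in> keys (initial_form c g)" by (subst initial_form_eq_wpart[OF g(2)]) auto
   hence "e' \<in> S k" using R_initial[OF g(1)] unfolding S_def words_def by blast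
   thus ?thesis by (simp add: lookup_wpart)
  next
   case False
   thus ?thesis by (auto simp: in_keys_iff lookup_wpart split: if_splits)
  qed
  finally show ?thesis .
 qed
 hence "wpart c w ?h = wpart c w g" by (rule poly_mapping_eqI)
 hence zero: "wpart c w (g - ?h) = 0" by (simp add: wpart_diff)
 have "weight c e < w" if e: "e \<in> keys (g - ?h)" for e
 proof -
  have "e \<notin> keys (wpart c w (g - ?h))" unfolding zero by simp
  hence "weight c e \<noteq> w" unfolding keys_wpart using e by blast
  thus ?thesis using bspec[OF dw[unfolded weight_le_def] e] by linarith
 qed
 moreover have "heval c W g t x = heval c W (g - ?h) t x + (\<Sum>e\<in>?T. lookup g e * t ^ (W - w) * cmono k e (fam t x))"
  if "w \<le> W" for W t x
 proof -
  have "heval c W ?h t x = (\<Sum>e\<in>?T. lookup g e * t ^ (W - w) * cmono k e (fam t x))"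
   unfolding heval_sum heval_Const_mult by (intro sum.cong refl) (use heval_le[OF lw that] in \<open>auto simp: lift(4)\<close>)
  thus ?thesis by (simp add: heval_diff)
 qed
 ultimately show ?thesis using that R_diff[OF g(1) hR] by blast
qed

text \<open>Induction on a strict bound for the weights. The coefficients already found vanish from
  weight \<open>w\<close> on, so those of weight exactly \<open>w\<close> are filled in without
  conflict, and \<open>w \<le> Suc W\<close> keeps the truncated subtraction in the exponent of
  \<open>t\<close> exact.\<close>

lemma subduction_less:
 assumes "g \<in> R k" "\<forall>e\<in>keys g. weight c e < w"
 shows "\<exists>a. (\<forall>e\<in>S k. w \<le> weight c e \<longrightarrow> a e = 0) \<and>
  (\<forall>W t x. w \<le> Suc W \<longrightarrow> heval c W g t x = (\<Sum>e\<in>S k. a e * t ^ (W - weight c e) * cmono k e (fam t x)))"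
 using assms
proof (induction w arbitrary: g)
 case 0
 hence "g = 0" by simp
 thus ?case by (intro exI[of _ "\<lambda>_. 0"]) simp
next
 case (Suc w g)
 hence "weight_le c w g" by (auto simp: weight_le_def less_Suc_eq_le)
 with Suc.prems(1) obtain g' where g': "g' \<in> R k" "\<forall>e\<in>keys g'. weight c e < w"
  "\<And>W t x. w \<le> W \<Longrightarrow> heval c W g t x = heval c W g' t x +
   (\<Sum>e\<in>{e\<in>S k. weight c e = w}. lookup g e * t ^ (W - w) * cmono k e (fam t x))" by (rule subduction_step) blast
 obtain a where a: "\<And>e. e \<in> S k \<Longrightarrow> w \<le> weight c e \<Longrightarrow> a e = 0"
  "\<And>W t x. w \<le> Suc W \<Longrightarrow> heval c W g' t x = (\<Sum>e\<in>S k. a e * t ^ (W - weight c e) * cmono k e (fam t x))"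
  using Suc.IH[OF g'(1,2)] by blast
 let ?a = "\<lambda>e. if weight c e = w then lookup g e else a e"
 have "heval c W g t x = (\<Sum>e\<in>S k. ?a e * t ^ (W - weight c e) * cmono k e (fam t x))" if "Suc w \<le> Suc W" for W t x
 proof -
  have "heval c W g t x = (\<Sum>e\<in>S k. a e * t ^ (W - weight c e) * cmono k e (fam t x) +
    (if weight c e = w then lookup g e * t ^ (W - w) * cmono k e (fam t x) else 0))"
   using that by (simp add: g'(3) a(2) sum.distrib sum.inter_filter[OF finite_S])
  also have "\<dots> = (\<Sum>e\<in>S k. ?a e * t ^ (W - weight c e) * cmono k e (fam t x))" by (intro sum.cong refl) (simp add: a(1))
  finally show ?thesis .
 qed
 moreover have "\<forall>e\<in>S k. Suc w \<le> weight c e \<longrightarrow> ?a e = 0" using a(1) by auto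
 ultimately show ?case by (intro exI[of _ ?a]) blast
qed

lemma subduction:
 assumes "g \<in> R k" "weight_le c w g"
 shows "\<exists>a. \<forall>t x. heval c w g t x = (\<Sum>e\<in>S k. a e * t ^ (w - weight c e) * cmono k e (fam t x))"
 using subduction_less[OF assms(1), of "Suc w"] assms(2) by (auto simp: weight_le_def less_Suc_eq_le)

text \<open>The degree \<open>k\<close> part of the Rees algebra, realized as functions of
  \<open>t\<close> and \<open>x\<close>: sums of polynomial multiples of homogenizations, with every
  admissible bound \<open>w\<close>.\<close>

inductive rees_fun :: "nat \<Rightarrow> (complex \<Rightarrow> ('v \<Rightarrow> complex) \<Rightarrow> complex) \<Rightarrow> bool" where
 base: "g \<in> R k \<Longrightarrow> weight_le c w g \<Longrightarrow> rees_fun k (\<lambda>t x. poly q t * heval c w g t x)"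
| zero: "rees_fun k (\<lambda>t x. 0)"
| add: "rees_fun k h \<Longrightarrow> rees_fun k h' \<Longrightarrow> rees_fun k (\<lambda>t x. h t x + h' t x)"

lemma rees_fun_mult:
 assumes "rees_fun k h" "rees_fun l h'"
 shows "rees_fun (k + l) (\<lambda>t x. h t x * h' t x)"
 using assms(1)
proof induction
 case b: (base g k w q)
 show ?case using assms(2)
 proof induction
  case (base g' l w' q')
  have "rees_fun (k + l) (\<lambda>t x. poly (q * q') t * heval c (w + w') (g * g') t x)"
   by (intro rees_fun.base R_mult weight_le_mult b base)
  moreover have "(\<lambda>t x. poly (q * q') t * heval c (w + w') (g * g') t x) =
    (\<lambda>t x. (poly q t * heval c w g t x) * (poly q' t * heval c w' g' t x))"
   by (intro ext, subst heval_mult[OF b(2) base(2)], simp add: ac_simps)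
  ultimately show ?case by simp
 next
  case (zero l)
  thus ?case by (simp add: rees_fun.zero)
 next
  case (add l h h')
  show ?case using rees_fun.add[OF add.IH] by (simp add: distrib_left)
 qed
next
 case (zero k)
 thus ?case by (simp add: rees_fun.zero)
next
 case (add k h h')
 show ?case using rees_fun.add[OF add.IH] by (simp add: distrib_right)
qed

lemma hfun_rees_fun: "hfun k F \<Longrightarrow> rees_fun k (\<lambda>t x. F (fam t x))"
proof (induction rule: hfun.induct)
 case (const a)
 show ?case using rees_fun.base[OF R_1, of 0 "[:a:]"] by (simp add: weight_le_def)
next
 case param
 show ?case using rees_fun.base[OF R_1, of 0 "[:0, 1:]"] by (simp add: weight_le_def fam_def)
next
 case (coord i)
 show ?case
 proof (cases "i \<le> N")
  case True
  thus ?thesis using coord rees_fun.base[OF f_R f_weight, of i 1] by (simp add: fam_def)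
 next
  case False
  thus ?thesis using coord by (simp add: fam_def rees_fun.zero)
 qed
qed (auto intro: rees_fun.zero rees_fun.add rees_fun_mult)

text \<open>Subduction makes the chosen monomials span over the polynomials in \<open>t\<close>.
  Together with their independence at every single parameter this controls which functions vanish on
  a fibre.\<close>

lemma rees_fun_normal_form:
 "rees_fun k h \<Longrightarrow> \<exists>p. \<forall>t x. h t x = (\<Sum>e\<in>S k. poly (p e) t * cmono k e (fam t x))"
proof (induction rule: rees_fun.induct)
 case (base g k w q)
 obtain a where a: "\<And>t x. heval c w g t x = (\<Sum>e\<in>S k. a e * t ^ (w - weight c e) * cmono k e (fam t x))"
  using subduction[OF base] by blast
 show ?case by (intro exI[of _ "\<lambda>e. q * monom (a e) (w - weight c e)"]) (simp add: a sum_distrib_left poly_monom mult.assoc)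
next
 case (zero k)
 show ?case by (intro exI[of _ "\<lambda>_. 0"]) simp
next
 case (add k h h')
 then obtain p p' where "\<And>t x. h t x = (\<Sum>e\<in>S k. poly (p e) t * cmono k e (fam t x))"
  "\<And>t x. h' t x = (\<Sum>e\<in>S k. poly (p' e) t * cmono k e (fam t x))" by blast
 thus ?case by (intro exI[of _ "\<lambda>e. p e + p' e"]) (simp add: sum.distrib distrib_right)
qed

section \<open>Independence of the lifts in each fibre\<close>

lemma lookup_lift:
 assumes "e \<in> S k" "lookup (lift k e) e' \<noteq> 0" "weight c e \<le> weight c e'"
 shows "e = e'"
proof -
 have "e' \<in> keys (lift k e)" using assms by (simp add: in_keys_iff)
 hence "weight c e' = weight c e" using lift(2)[OF assms(1)] assms(3) by (auto simp: weight_le_def)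
 hence "lookup (wpart c (weight c e) (lift k e)) e' \<noteq> 0" using assms by (simp add: lookup_wpart)
 thus ?thesis unfolding lift(3)[OF assms(1)] by (auto simp: Monom_def lookup_single when_def split: if_splits)
qed

lemma lookup_lift_self: "e \<in> S k \<Longrightarrow> lookup (lift k e) e = 1"
 using lift(3)[of e k] lookup_wpart[of c "weight c e" "lift k e" e] by (simp add: Monom_def)

text \<open>The argument is triangular. Among the exponents with nonzero coefficient take
  \<open>e0\<close> of maximal weight: it occurs in none of the other lifts involved, and in its own
  with coefficient 1 and the power 0 of \<open>a\<close>, so that \<open>a = 0\<close> is no
  exception.\<close>

lemma cmono_independent:
 assumes "\<And>x. (\<Sum>e\<in>S k. b e * cmono k e (fam a x)) = 0" "e \<in> S k"
 shows "b e = 0"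
proof (rule ccontr)
 assume "b e \<noteq> 0"
 let ?T = "{e\<in>S k. b e \<noteq> 0}"
 have fin: "finite ?T" and ne: "?T \<noteq> {}" using finite_S assms(2) \<open>b e \<noteq> 0\<close> by auto
 have "Max (weight c ` ?T) \<in> weight c ` ?T" using fin ne by (intro Max_in) auto
 then obtain e0 where e0: "e0 \<in> ?T" and "weight c e0 = Max (weight c ` ?T)" by auto
 hence max: "weight c e \<le> weight c e0" if "e \<in> ?T" for e using fin that by simp
 let ?co = "\<lambda>e'. \<Sum>e\<in>S k. b e * (lookup (lift k e) e' * a ^ (weight c e - weight c e'))"
 have "(\<Sum>e\<in>S k. Const (b e) * specialization c (weight c e) a (lift k e)) = 0"
 proof (rule peval_eq_0D)
  fix x
  have "peval (\<Sum>e\<in>S k. Const (b e) * specialization c (weight c e) a (lift k e)) x = (\<Sum>e\<in>S k. b e * cmono k e (fam a x))"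
   unfolding peval_sum peval_mult by (intro sum.cong refl) (simp add: lift(4) flip: heval_specialization)
  thus "peval (\<Sum>e\<in>S k. Const (b e) * specialization c (weight c e) a (lift k e)) x = 0" using assms(1) by simp
 qed
 from arg_cong[OF this, of "\<lambda>p. lookup p e0"] have "?co e0 = 0" by (simp add: lookup_sum lookup_Const_mult lookup_specialization)
 moreover have "?co e0 = b e0"
 proof -
  have "b e * (lookup (lift k e) e0 * a ^ (weight c e - weight c e0)) = (if e = e0 then b e0 else 0)" if "e \<in> S k" for e
  using lookup_lift_self that lookup_lift e0 max by auto
  hence "?co e0 = (\<Sum>e\<in>S k. if e = e0 then b e0 else 0)" by (intro sum.cong refl)
  thus ?thesis using e0 finite_S by simp
 qed
 ultimately show False using e0 by simp
qed

text \<open>By independence at the parameter \<open>a\<close>, the coefficients in the normal form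
  all vanish at \<open>a\<close>, and \<open>t - a\<close> can be divided out of each of them. This
  is the reason why the fibres are reduced.\<close>

lemma key_Phi:
 assumes "hfun k F" "\<And>x. F (fam a x) = 0"
 shows "\<exists>F'. hfun k F' \<and> (\<forall>t x. F (fam t x) = (t - a) * F' (fam t x))"
proof -
 obtain p where p: "\<And>t x. F (fam t x) = (\<Sum>e\<in>S k. poly (p e) t * cmono k e (fam t x))"
  using rees_fun_normal_form[OF hfun_rees_fun[OF assms(1)]] by blast
 have "poly (p e) a = 0" if "e \<in> S k" for e
  by (rule cmono_independent[where b = "\<lambda>e. poly (p e) a", OF _ that]) (use assms(2) p in simp)
 hence "\<exists>q. p e = [:- a, 1:] * q" if "e \<in> S k" for e using that by (simp add: poly_eq_0_iff_dvd dvd_def)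
 then obtain q where q: "\<And>e. e \<in> S k \<Longrightarrow> p e = [:- a, 1:] * q e" by metis
 let ?F = "\<lambda>z. \<Sum>e\<in>S k. poly (q e) (z 0) * cmono k e z"
 have "hfun k ?F" by (intro hfun_sum hfun_mult_param hfun_poly cmono_hfun)
 moreover have "F (fam t x) = (t - a) * ?F (fam t x)" for t x
 proof -
  have "F (fam t x) = (\<Sum>e\<in>S k. (t - a) * (poly (q e) t * cmono k e (fam t x)))"
   unfolding p by (intro sum.cong refl) (simp add: q algebra_simps)
  thus ?thesis by (simp add: sum_distrib_left fam_def[of t x 0])
 qed
 ultimately show ?thesis by blast
qed

section \<open>The total space and its fibres\<close>

definition relations :: "(cvec \<Rightarrow> complex) set" where
 "relations = {F. \<exists>k. hfun k F \<and> (\<forall>t x. F (fam t x) = 0)}"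

definition total :: "cvec set" where
 "total = proj_zeros N relations"

definition fibre :: "complex \<Rightarrow> cvec set" where
 "fibre a = {z. z 0 = a \<and> (\<forall>j>N. z j = 0) \<and> (\<exists>i>0. z i \<noteq> 0) \<and>
   (\<forall>k F. hfun k F \<longrightarrow> (\<forall>x. F (fam a x) = 0) \<longrightarrow> F z = 0)}"

lemma total_cone: "is_cone total"
 unfolding total_def by (rule proj_zeros_cone) (auto simp: relations_def)

lemma total_relation: "hfun k F \<Longrightarrow> (\<And>t x. F (fam t x) = 0) \<Longrightarrow> z \<in> total \<Longrightarrow> F z = 0"
 unfolding total_def proj_zeros_def relations_def by blast

lemma Phi_total: "i \<in> {1..N} \<Longrightarrow> fam t x i \<noteq> 0 \<Longrightarrow> fam t x \<in> total"
 unfolding total_def proj_zeros_def relations_def by (auto simp: fam_def intro!: exI[of _ i])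

lemma total_coord: "z \<in> total \<Longrightarrow> \<exists>i\<in>{1..N}. z i \<noteq> 0"
 unfolding total_def proj_zeros_def by (intro nonzero_coord) auto

lemma total_key:
 assumes "hfun k F" "\<And>x. F (fam a x) = 0"
 shows "\<exists>F'. hfun k F' \<and> (\<forall>z\<in>total. F z = (z 0 - a) * F' z)"
proof -
 obtain F' where F': "hfun k F'" "\<And>t x. F (fam t x) = (t - a) * F' (fam t x)" using key_Phi[OF assms] by blast
 have "hfun 0 (\<lambda>z. z 0 - a)" by (rule hfun_diff[OF hfun.param hfun.const])
 hence h: "hfun k (\<lambda>z. F z - (z 0 - a) * F' z)" by (rule hfun_diff[OF assms(1) hfun_mult_param[OF _ F'(1)]])
 have "F z - (z 0 - a) * F' z = 0" if "z \<in> total" for z by (rule total_relation[OF h _ that]) (simp add: F'(2))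
 thus ?thesis using F'(1) by auto
qed

text \<open>A priori \<open>fibre\<close> imposes more equations, namely all that hold on the image
  at the parameter \<open>a\<close> alone. On \<open>total\<close> such a function is a multiple of
  \<open>z 0 - a\<close>, so it vanishes wherever \<open>z 0 = a\<close>.\<close>

lemma fibre_eq: "{z\<in>total. z 0 = a} = fibre a"
proof (intro equalityI subsetI)
 fix z assume "z \<in> {z\<in>total. z 0 = a}"
 hence z: "z \<in> total" "z 0 = a" by auto
 have "F z = 0" if "hfun k F" "\<forall>x. F (fam a x) = 0" for k F using total_key[of k F a] that z by auto
 thus "z \<in> fibre a" using z unfolding fibre_def total_def proj_zeros_def by blast
next
 fix z assume "z \<in> fibre a"
 thus "z \<in> {z\<in>total. z 0 = a}" unfolding fibre_def total_def proj_zeros_def relations_def by blast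
qed

lemma hfun_Phi_peval: "hfun k F \<Longrightarrow> \<exists>P. \<forall>x. F (fam a x) = peval P x"
proof (erule hfun_closure)
 show "\<exists>P. \<forall>x::'v \<Rightarrow> complex. b = peval P x" for b by (intro exI[of _ "Const b"]) simp
 show "\<exists>P. \<forall>x. fam a x i = peval P x" for i
  by (cases "i = 0"; cases "i \<le> N") (auto simp: fam_def heval_specialization intro: exI[of _ 0] exI[of _ "Const a"])
 fix F G assume "\<exists>P. \<forall>x. F (fam a x) = peval P x" "\<exists>P. \<forall>x. G (fam a x) = peval P x"
 thus "\<exists>P. \<forall>x. F (fam a x) + G (fam a x) = peval P x" "\<exists>P. \<forall>x. F (fam a x) * G (fam a x) = peval P x"
  by (metis peval_add, metis peval_mult)
qed

lemma hfun_Phi_poly: "hfun k F \<Longrightarrow> \<exists>q. \<forall>t. F (fam t x) = poly q t"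
proof (erule hfun_closure)
 show "\<exists>q. \<forall>t. b = poly q t" for b :: complex by (intro exI[of _ "[:b:]"]) simp
 fix i
 let ?P = "\<Sum>e\<in>keys (f i). monom (lookup (f i) e * mono_eval x e) (weight c (s i) - weight c e)"
 have "heval c (weight c (s i)) (f i) t x = poly ?P t" for t by (simp add: heval_def meval_def poly_sum poly_monom ac_simps)
 thus "\<exists>q. \<forall>t. fam t x i = poly q t"
  by (cases "i = 0"; cases "i \<le> N") (auto simp: fam_def intro: exI[of _ ?P] exI[of _ 0] exI[of _ "[:0, 1:]"])
next
 fix F G assume "\<exists>q. \<forall>t. F (fam t x) = poly q t" "\<exists>q. \<forall>t. G (fam t x) = poly q t"
 thus "\<exists>q. \<forall>t. F (fam t x) + G (fam t x) = poly q t" "\<exists>q. \<forall>t. F (fam t x) * G (fam t x) = poly q t"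
  by (metis poly_add, metis poly_mult)
qed

text \<open>The image of \<open>fam\<close> is known to lie in \<open>total\<close> only where some
  coordinate is nonzero. Multiplication with coordinate \<open>j\<close>, a polynomial with a
  leading monomial and hence not a zero divisor, removes this restriction.\<close>

lemma vanish_on_fibre:
 assumes F: "hfun k F" and zero: "\<forall>z\<in>total. z 0 = a \<longrightarrow> F z = 0" and j: "j \<in> {1..N}"
 shows "F (fam a x) = 0"
proof -
 let ?w = "weight c (s j)"
 obtain P where P: "\<And>x. F (fam a x) = peval P x" using hfun_Phi_peval[OF F] by blast
 let ?Q = "specialization c ?w a (f j)"
 have Q: "fam a x j = peval ?Q x" for x using j by (simp add: fam_def heval_specialization)
 have "weight_le c ?w ?Q" using f_weight[OF j] by (simp add: weight_le_def in_keys_iff lookup_specialization)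
 moreover have "wpart c ?w ?Q = single (s j) 1" unfolding f_initial[OF j, unfolded Monom_def, symmetric]
  by (rule poly_mapping_eqI) (simp add: lookup_wpart lookup_specialization)
 ultimately have LM: "has_LM c ?Q (s j)" unfolding has_LM_iff by (intro exI[of _ 1]) simp
 have "peval P x * peval ?Q x = 0" for x
 proof (cases "peval ?Q x = 0")
  case False
  hence "fam a x \<in> total" using Phi_total[OF j] Q by simp
  hence "F (fam a x) = 0" using zero by (simp add: fam_def)
  thus ?thesis by (simp add: P)
 qed simp
 hence PQ: "P * ?Q = 0" by (intro peval_eq_0D) (simp add: peval_mult)
 \<comment> \<open>Otherwise an exponent of the initial form of \<open>P\<close>, translated by
   \<open>s j\<close>, would occur in the product \<open>P * ?Q\<close>, which is zero.\<close>
 have "P = 0"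
 proof (rule ccontr)
  assume "P \<noteq> 0"
  then obtain w where "wpart c w P \<noteq> 0" "initial_form c P = wpart c w P" by (rule initial_form_weight)
  hence "keys (initial_form c P) \<noteq> {}" by simp
  then obtain e where "e \<in> keys (initial_form c P)" by blast
  from keys_initial_form_mult[OF this LM] show False unfolding PQ by simp
 qed
 thus ?thesis by (simp add: P)
qed

text \<open>For fixed \<open>x\<close> all functions are polynomials in \<open>t\<close>, where the
  nonzero \<open>p\<close> can be cancelled; the factor \<open>fam t x j\<close> takes care of the
  parameters at which the image may leave \<open>total\<close>.\<close>

lemma total_torsion_free:
 assumes p: "p \<noteq> 0" and F: "hfun k F" and zero: "\<forall>z\<in>total. poly p (z 0) * F z = 0"
 shows "\<forall>z\<in>total. F z = 0"
proof
 fix z assume z: "z \<in> total"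
 then obtain j where j: "j \<in> {1..N}" "z j \<noteq> 0" using total_coord by blast
 hence j0: "j > 0" by simp
 note Fj = hfun.mult[OF F hfun.coord[OF j0]]
 have "F (fam t x) * fam t x j = 0" for t x
 proof -
  obtain q where q: "\<And>t. F (fam t x) * fam t x j = poly q t" using hfun_Phi_poly[OF Fj] by blast
  have "poly (p * q) t = 0" for t
  proof (cases "fam t x j = 0")
   case False
   hence "fam t x \<in> total" using Phi_total[OF j(1)] by simp
   hence "poly p t * F (fam t x) = 0" using zero by force
   thus ?thesis by (auto simp flip: q)
  qed (simp flip: q)
  hence "p * q = 0" using poly_all_0_iff_0 by blast
  thus ?thesis using p by (simp add: q)
 qed
 hence "F z * z j = 0" using total_relation[OF Fj] z by blast
 thus "F z = 0" using j by simp
qed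

theorem rees_toric_degeneration:
 assumes general: "\<And>a W. a \<noteq> 0 \<Longrightarrow> presented W (proj_basis (fibre a)) \<Longrightarrow> var_iso W X"
  and special: "\<And>W. presented W (proj_basis (fibre 0)) \<Longrightarrow> var_iso W X0"
 shows "toric_degeneration X X0"
proof -
 \<comment> \<open>If \<open>total\<close> is empty, any function serves as \<open>F'\<close>;
   otherwise an index \<open>j\<close> in the range exists, as \<open>vanish_on_fibre\<close>
   requires.\<close>
 have key: "\<exists>F'. hfun k F' \<and> (\<forall>z\<in>total. F z = (z 0 - a) * F' z)"
  if "hfun k F" "\<forall>z\<in>total. z 0 = a \<longrightarrow> F z = 0" for a k F
 using total_coord that total_key vanish_on_fibre by blast
 note pres = fibre_presented[OF total_cone, unfolded fibre_eq]
 have "fibre_iso (proj_space total) orbit_param a X" if "a \<noteq> 0" for a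
  using general[OF that pres] by (intro proj_space_fibre_iso[OF total_cone key])
 moreover have "fibre_iso (proj_space total) orbit_param 0 X0" using special[OF pres] by (intro proj_space_fibre_iso[OF total_cone key])
 moreover have "variety (proj_space total)" unfolding total_def by (rule proj_zeros_variety) (auto simp: relations_def)
 moreover have "flat_morphism (proj_space total) affine_line orbit_param" by (rule proj_space_flat[OF total_cone total_torsion_free])
 ultimately show ?thesis unfolding toric_degeneration_def by blast
qed

end

section \<open>Hilbert's Nullstellensatz\<close>

lemma cpoly_induct:
 assumes "\<And>a. P (Const a)" "\<And>v. P (Indet v)" "\<And>f g. P f \<Longrightarrow> P g \<Longrightarrow> P (f + g)" "\<And>f g. P f \<Longrightarrow> P g \<Longrightarrow> P (f * g)"
 shows "P f"
proof -
 have pow: "P (Indet v ^ k)" for v k by (induction k) (auto intro: assms assms(1)[of 1, simplified])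
 have mono: "P (\<Prod>v\<in>K. Indet v ^ lookup e v)" if "finite K" for K and e :: "'a expo"
  using that by (induction K) (auto intro: assms pow assms(1)[of 1, simplified])
 have "P (\<Sum>e\<in>K. Const (lookup f e) * (\<Prod>v\<in>keys e. Indet v ^ lookup e v))" if "finite K" for K using that
 proof (induction K)
  case (insert e K)
  show ?case unfolding sum.insert[OF insert(1,2)] by (intro assms mono insert(3)) simp
 qed (use assms(1)[of 0] in simp)
 hence "P (\<Sum>e\<in>keys f. Const (lookup f e) * (\<Prod>v\<in>keys e. Indet v ^ lookup e v))" by simp
 moreover have "(\<Sum>e\<in>keys f. Const (lookup f e) * (\<Prod>v\<in>keys e. Indet v ^ lookup e v)) = f"
  by (rule peval_eqD) (simp add: peval_sum peval_mult peval_prod peval_power peval_def[of f])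
 ultimately show ?thesis by simp
qed

definition poly_at :: "'v cpoly \<Rightarrow> complex poly \<Rightarrow> 'v cpoly" where
 "poly_at g q = fold_coeffs (\<lambda>a b. Const a + g * b) q 0"

lemma poly_at_0 [simp]: "poly_at g 0 = 0"
 by (simp add: poly_at_def)

lemma poly_at_pCons [simp]: "poly_at g (pCons a q) = Const a + g * poly_at g q"
 by (cases "a = 0 \<and> q = 0") (auto simp: poly_at_def)

lemma poly_at_add: "poly_at g (p + q) = poly_at g p + poly_at g q"
 by (induction p q rule: poly_induct2) (simp_all add: Const_add algebra_simps)

lemma poly_at_smult: "poly_at g (Polynomial.smult a p) = Const a * poly_at g p"
 by (induction p) (simp_all add: Const_mult algebra_simps)

lemma poly_at_mult: "poly_at g (p * q) = poly_at g p * poly_at g q"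
 by (induction p) (simp_all add: poly_at_add poly_at_smult algebra_simps)

lemma poly_at_sum: "poly_at g (\<Sum>i\<in>I. p i) = (\<Sum>i\<in>I. poly_at g (p i))"
 by (induction I rule: infinite_finite_induct) (simp_all add: poly_at_add)

lemma poly_at_1 [simp]: "poly_at g 1 = 1"
 unfolding one_pCons by simp

lemma poly_at_prod: "poly_at g (\<Prod>i\<in>I. p i) = (\<Prod>i\<in>I. poly_at g (p i))"
 by (induction I rule: infinite_finite_induct) (simp_all add: poly_at_mult)

lemma countable_expo: "countable (UNIV :: nat expo set)"
proof -
 let ?g = "\<lambda>e :: nat expo. {(v, k). k \<noteq> 0 \<and> lookup e v = k}"
 have "inj ?g"
 proof (rule injI, rule poly_mapping_eqI)
  fix e e' :: "nat expo" and v assume eq: "?g e = ?g e'"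
  have *: "lookup e v = k \<longleftrightarrow> lookup e' v = k" if "k \<noteq> 0" for k using eq that by blast
  show "lookup e v = lookup e' v" using *[of "lookup e v"] *[of "lookup e' v"] by fastforce
 qed
 have "countable {A :: (nat \<times> nat) set. finite A}" by (rule countable_Collect_finite)
 moreover have "finite (?g e)" for e
 proof (rule finite_subset)
  show "?g e \<subseteq> (\<lambda>v. (v, lookup e v)) ` keys e" by (auto simp: in_keys_iff)
 qed simp
 ultimately have "countable (range ?g)" by (intro countable_subset[of "range ?g" "{A :: (nat \<times> nat) set. finite A}"]) auto
 thus ?thesis using \<open>inj ?g\<close> by (rule countable_image_inj_on)
qed

text \<open>The polynomial ring has countable dimension.\<close>

lemma uncountable_family_dependent:
 fixes h :: "complex \<Rightarrow> nat cpoly"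
 assumes "inj h"
 obtains A b a where "finite A" "a \<in> A" "b a \<noteq> 0" "(\<Sum>a\<in>A. Const (b a) * h a) = 0"
proof -
 interpret vs: vector_space "\<lambda>a (f :: nat cpoly). Const a * f" by unfold_locales (auto simp: algebra_simps Const_add Const_mult)
 \<comment> \<open>Pigeonhole: there are uncountably many parameters but only countably many finite
   supports, so infinitely many of the \<open>h a\<close> lie in the span of one finite set
   \<open>K\<close> of monomials.\<close>
 have "\<exists>K. infinite {a. keys (h a) = K}"
 proof (rule ccontr)
  assume "\<nexists>K. infinite {a. keys (h a) = K}"
  hence "countable {a. keys (h a) = K}" for K by (simp add: countable_finite)
  moreover have "countable {K :: nat expo set. finite K}" using countable_Collect_finite_subset[OF countable_expo] by simp
  ultimately have "countable (\<Union>K\<in>{K. finite K}. {a. keys (h a) = K})" by (intro countable_UN) auto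
  moreover have "a \<in> (\<Union>K\<in>{K. finite K}. {a. keys (h a) = K})" for a by (rule UN_I[of "keys (h a)"]) auto
  hence "(\<Union>K\<in>{K. finite K}. {a. keys (h a) = K}) = UNIV" by blast
  ultimately show False using uncountable_UNIV_complex by simp
 qed
 then obtain K where inf: "infinite {a. keys (h a) = K}" by blast
 then obtain a0 where "keys (h a0) = K" using infinite_imp_nonempty by blast
 hence finK: "finite K" by auto
 obtain A where A: "finite A" "card A = Suc (card K)" "A \<subseteq> {a. keys (h a) = K}" using infinite_arbitrarily_large[OF inf] by blast
 let ?B = "Monom ` K"
 have "h a \<in> vs.span ?B" if "a \<in> A" for a
 proof -
  have "h a = (\<Sum>e\<in>keys (h a). Const (lookup (h a) e) * Monom e)" by (simp add: Const_def Monom_def mult_single sum_single_keys)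
  moreover have "\<dots> \<in> vs.span ?B" using A(3) that by (intro vs.span_sum vs.span_scale vs.span_base) auto
  ultimately show ?thesis by simp
 qed
 hence "h ` A \<subseteq> vs.span ?B" by blast
 moreover have "card (h ` A) = Suc (card K)" using A assms by (simp add: card_image inj_on_subset)
 moreover have "card ?B \<le> card K" using finK by (rule card_image_le)
 ultimately have "vs.dependent (h ` A)" using vs.independent_span_bound[of ?B "h ` A"] finK by fastforce
 then obtain u where u: "\<exists>v\<in>h ` A. u v \<noteq> 0" "(\<Sum>v\<in>h ` A. Const (u v) * v) = 0"
  using vs.dependent_finite[of "h ` A"] A(1) by blast
 have "(\<Sum>a\<in>A. Const (u (h a)) * h a) = 0"
  using u(2) sum.reindex[of h A "\<lambda>v. Const (u v) * v"] assms by (simp add: inj_on_subset o_def)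
 moreover obtain a where "a \<in> A" "u (h a) \<noteq> 0" using u(1) by blast
 ultimately show ?thesis using that[of A a "\<lambda>a. u (h a)"] A(1) by blast
qed

definition poly_ideal :: "'v cpoly set \<Rightarrow> bool" where
 "poly_ideal J \<longleftrightarrow> 0 \<in> J \<and> (\<forall>f\<in>J. \<forall>g\<in>J. f + g \<in> J) \<and> (\<forall>f\<in>J. \<forall>h. h * f \<in> J)"

text \<open>There are infinitely many variables, and the proof uses the cardinality of the complex
  numbers: in the residue field of a maximal ideal a non-constant element \<open>g\<close> would
  yield the uncountable family of inverses of \<open>g - a\<close>, any linear relation among which
  makes \<open>g\<close> algebraic.\<close>

theorem nullstellensatz:
 fixes J :: "nat cpoly set"
 assumes J: "poly_ideal J" "1 \<notin> J"
 obtains z where "\<forall>f\<in>J. peval f z = 0"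
proof -
 let ?A = "{I. J \<subseteq> I \<and> poly_ideal I \<and> 1 \<notin> I}"
 have "\<exists>M\<in>?A. \<forall>X\<in>?A. M \<subseteq> X \<longrightarrow> X = M"
 proof (rule subset_Zorn_nonempty)
  show "?A \<noteq> {}" using J by blast
  fix C assume C: "C \<noteq> {}" "subset.chain ?A C"
  hence CA: "C \<subseteq> ?A" and lin: "\<And>X Y. X \<in> C \<Longrightarrow> Y \<in> C \<Longrightarrow> X \<subseteq> Y \<or> Y \<subseteq> X"
   unfolding subset.chain_def by auto
  have "f + g \<in> \<Union>C" if fg: "f \<in> \<Union>C" "g \<in> \<Union>C" for f g
  proof -
   obtain X Y where XY: "X \<in> C" "f \<in> X" "Y \<in> C" "g \<in> Y" using fg by blast
   have "\<exists>Z\<in>C. f \<in> Z \<and> g \<in> Z" using lin[OF XY(1,3)] XY by blast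
   then obtain Z where Z: "Z \<in> C" "f \<in> Z" "g \<in> Z" by blast
   hence "poly_ideal Z" using CA by blast
   hence "f + g \<in> Z" using Z(2,3) unfolding poly_ideal_def by simp
   thus ?thesis using Z(1) by blast
  qed
  moreover have "h * f \<in> \<Union>C" if f: "f \<in> \<Union>C" for f h using f CA unfolding poly_ideal_def by blast
  moreover have J_sub: "J \<subseteq> \<Union>C" using C(1) CA by blast
  moreover have "0 \<in> \<Union>C" using J(1) J_sub unfolding poly_ideal_def by blast
  moreover have "1 \<notin> \<Union>C" using CA by blast
  ultimately show "\<Union>C \<in> ?A" unfolding poly_ideal_def by blast
 qed
 then obtain M where MA: "M \<in> ?A" and max: "\<forall>X\<in>?A. M \<subseteq> X \<longrightarrow> X = M" by (rule bexE)
 hence M: "J \<subseteq> M" "poly_ideal M" "1 \<notin> M" by auto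
 have M0: "0 \<in> M" and Madd: "\<And>f g. f \<in> M \<Longrightarrow> g \<in> M \<Longrightarrow> f + g \<in> M" and Mmult: "\<And>f h. f \<in> M \<Longrightarrow> h * f \<in> M"
  using M(2) unfolding poly_ideal_def by blast+
 have Mdiff: "f - g \<in> M" if "f \<in> M" "g \<in> M" for f g using Madd[OF that(1) Mmult[OF that(2), of "-1"]] by simp
 have Msum: "(\<Sum>i\<in>I. f i) \<in> M" if "\<And>i. i \<in> I \<Longrightarrow> f i \<in> M" for I and f :: "complex \<Rightarrow> nat cpoly"
  using that by (induction I rule: infinite_finite_induct) (auto intro: M0 Madd)
 have inv: "\<exists>h. h * g - 1 \<in> M" if g: "g \<notin> M" for g
 proof -
  let ?X = "{m + h * g | m h. m \<in> M}"
  have 1: "M \<subseteq> ?X" by force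
  have "g = 0 + 1 * g" by simp
  hence 2: "g \<in> ?X" using M0 by blast
  have "poly_ideal ?X" unfolding poly_ideal_def
  proof (intro conjI ballI allI)
   show "0 \<in> ?X" using 1 M0 by blast
  next
   fix a b assume "a \<in> ?X" "b \<in> ?X"
   then obtain m h m' h' where "a = m + h * g" "b = m' + h' * g" "m \<in> M" "m' \<in> M" by blast
   thus "a + b \<in> ?X" using Madd by (intro CollectI exI[of _ "m + m'"] exI[of _ "h + h'"]) (simp add: algebra_simps)
  next
   fix a k assume "a \<in> ?X"
   then obtain m h where "a = m + h * g" "m \<in> M" by blast
   hence "k * a = k * m + (k * h) * g" by (simp add: algebra_simps)
   moreover have "k * m \<in> M" using \<open>m \<in> M\<close> by (rule Mmult)
   ultimately show "k * a \<in> ?X" by blast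
  qed
  moreover have "?X \<noteq> M" using 2 g by blast
  ultimately have "1 \<in> ?X" using bspec[OF max, of ?X] 1 M(1) by blast
  then obtain m h where mh: "1 = m + h * g" "m \<in> M" by blast
  hence "h * g - 1 = - 1 * m" by (simp add: algebra_simps)
  thus ?thesis using Mmult[OF mh(2), of "-1"] by (intro exI[of _ h]) simp
 qed
 have residue: "\<exists>a. g - Const a \<in> M" for g
 proof (rule ccontr)
  assume no: "\<nexists>a. g - Const a \<in> M"
  hence "\<forall>a. \<exists>k. k * (g - Const a) - 1 \<in> M" using inv by blast
  then obtain h where h: "\<And>a. h a * (g - Const a) - 1 \<in> M" by metis
  have "inj h"
  proof (rule injI, rule ccontr)
   fix a b assume eq: "h a = h b" and ne: "a \<noteq> b"
   have "(h a * (g - Const a) - 1) - (h b * (g - Const b) - 1) \<in> M" by (intro Mdiff h)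
   hence "h a * Const (b - a) \<in> M" unfolding eq by (simp add: algebra_simps Const_diff)
   hence "(g - Const a) * Const (1 / (b - a)) * (h a * Const (b - a)) \<in> M" by (rule Mmult)
   moreover have "(g - Const a) * Const (1 / (b - a)) * (h a * Const (b - a)) = (Const (1 / (b - a)) * Const (b - a)) * (h a * (g - Const a))"
    by (simp add: ac_simps)
   moreover have "Const (1 / (b - a)) * Const (b - a) = (1 :: nat cpoly)" using ne by (simp flip: Const_mult)
   ultimately have "h a * (g - Const a) \<in> M" by simp
   hence "1 \<in> M" using Mdiff[OF _ h[of a], of "h a * (g - Const a)"] by simp
   thus False using M(3) by simp
  qed
  then obtain A b a0 where A: "finite A" "a0 \<in> A" "b a0 \<noteq> 0" "(\<Sum>a\<in>A. Const (b a) * h a) = 0"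
   by (rule uncountable_family_dependent)
  \<comment> \<open>Clearing the denominators in the relation among the inverses of
    \<open>g - a\<close> leads to this polynomial. It is nonzero, as its value at \<open>a0\<close>
    shows, and its value at \<open>g\<close> lies in \<open>M\<close>.\<close>
  define q where "q = (\<Sum>a\<in>A. Polynomial.smult (b a) (\<Prod>a'\<in>A - {a}. [:- a', 1:]))"
  have lin: "poly_at g [:- a, 1:] = g - Const a" for a by (simp add: Const_uminus)
  have "poly q a0 = (\<Sum>a\<in>A. b a * (\<Prod>a'\<in>A - {a}. a0 - a'))" by (simp add: q_def poly_sum poly_prod)
  also have "\<dots> = (\<Sum>a\<in>A. if a = a0 then b a0 * (\<Prod>a'\<in>A - {a0}. a0 - a') else 0)"
   using A by (intro sum.cong refl) auto
  also have "\<dots> \<noteq> 0" using A by auto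
  finally have q0: "q \<noteq> 0" by auto
  let ?P = "\<lambda>a. \<Prod>a'\<in>A - {a}. g - Const a'"
  have "(\<Sum>a\<in>A. Const (b a) * ?P a * (h a * (g - Const a) - 1)) \<in> M" by (intro Msum Mmult h)
  also have "(\<Sum>a\<in>A. Const (b a) * ?P a * (h a * (g - Const a) - 1)) =
    (\<Sum>a\<in>A. (Const (b a) * h a) * (\<Prod>a\<in>A. g - Const a) - Const (b a) * ?P a)"
  proof (intro sum.cong refl)
   fix a assume "a \<in> A"
   hence eq: "(\<Prod>a\<in>A. g - Const a) = (g - Const a) * ?P a" using A(1) by (rule prod.remove[rotated])
   show "Const (b a) * ?P a * (h a * (g - Const a) - 1) = (Const (b a) * h a) * (\<Prod>a\<in>A. g - Const a) - Const (b a) * ?P a"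
    unfolding eq by (simp add: algebra_simps)
  qed
  also have "\<dots> = - (\<Sum>a\<in>A. Const (b a) * ?P a)" by (simp add: sum_subtractf A(4) flip: sum_distrib_right)
  also have "\<dots> = - poly_at g q" unfolding q_def poly_at_sum poly_at_smult poly_at_prod lin ..
  finally have "poly_at g q \<in> M" using Mmult[of "- poly_at g q" "-1"] by simp
  \<comment> \<open>Over the complex numbers \<open>q\<close> splits; a factor \<open>g - a\<close>
    is cancelled with its inverse \<open>h a\<close> modulo \<open>M\<close>, until a nonzero
    constant is left in \<open>M\<close>.\<close>
  hence False using q0
  proof (induction "degree q" arbitrary: q rule: less_induct)
   case less
   show ?case
   proof (cases "degree q = 0")
    case True
    then obtain a where "q = [:a:]" by (rule degree_eq_zeroE)
    hence "Const a \<in> M" "a \<noteq> 0" using less by auto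
    hence "Const (1 / a) * Const a \<in> M" using Mmult by blast
    hence "1 \<in> M" using \<open>a \<noteq> 0\<close> by (simp flip: Const_mult)
    thus ?thesis using M(3) by simp
   next
    case False
    then obtain a where "poly q a = 0" using fundamental_theorem_of_algebra[of q] by (auto simp: constant_degree)
    then obtain q' where q': "q = [:- a, 1:] * q'" by (auto simp: poly_eq_0_iff_dvd)
    have "q' \<noteq> 0" using q' less.prems(2) by auto
    moreover have "degree q' < degree q" using degree_mult_eq[of "[:- a, 1:]" q'] \<open>q' \<noteq> 0\<close> q' by simp
    moreover have "poly_at g q' \<in> M"
    proof -
     have "h a * poly_at g q - poly_at g q' * (h a * (g - Const a) - 1) \<in> M" by (rule Mdiff[OF Mmult[OF less.prems(1)] Mmult[OF h]])
     thus ?thesis unfolding q' poly_at_mult lin by (simp add: algebra_simps)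
    qed
    ultimately show ?thesis using less.hyps by blast
   qed
  qed
  thus False .
 qed
 hence "\<forall>v. \<exists>a. Indet v - Const a \<in> M" by blast
 then obtain z where z: "\<And>v. Indet v - Const (z v) \<in> M" by metis
 have "f - Const (peval f z) \<in> M" for f
 proof (induction f rule: cpoly_induct)
  case (3 f g)
  from Madd[OF this] show ?case by (simp add: peval_add Const_add algebra_simps)
 next
  case (4 f g)
  hence "g * (f - Const (peval f z)) + Const (peval f z) * (g - Const (peval g z)) \<in> M" by (intro Madd Mmult)
  thus ?case by (simp add: peval_mult Const_mult algebra_simps)
 qed (use M0 z in auto)
 note res = this
 have "peval f z = 0" if "f \<in> J" for f
 proof (rule ccontr)
  assume nz: "peval f z \<noteq> 0"
  have "f \<in> M" using \<open>f \<in> J\<close> M(1) by blast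
  hence "f - (f - Const (peval f z)) \<in> M" using res by (rule Mdiff)
  hence "Const (peval f z) \<in> M" by simp
  hence "Const (1 / peval f z) * Const (peval f z) \<in> M" by (rule Mmult)
  hence "1 \<in> M" using nz by (simp flip: Const_mult)
  thus False using M(3) by simp
 qed
 thus ?thesis using that by blast
qed

section \<open>Closed points of Proj\<close>

text \<open>Elements of \<open>R k\<close> are homogeneous of total degree \<open>k D\<close>, and
  \<open>D\<close> is positive. The grading is thus visible on exponents, and homogeneous components
  are obtained without choosing a decomposition.\<close>

locale graded_algebra =
 fixes R :: "nat \<Rightarrow> 'v cpoly set" and D :: nat
 assumes R_0: "0 \<in> R k"
  and R_add: "g \<in> R k \<Longrightarrow> h \<in> R k \<Longrightarrow> g + h \<in> R k"
  and R_Const_mult: "g \<in> R k \<Longrightarrow> Const a * g \<in> R k"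
  and R_mult: "g \<in> R k \<Longrightarrow> h \<in> R l \<Longrightarrow> g * h \<in> R (k + l)"
  and R_1: "1 \<in> R 0"
  and R_degree: "g \<in> R k \<Longrightarrow> e \<in> keys g \<Longrightarrow> tdeg e = k * D"
  and D_pos: "D > 0"
begin

lemma R_uminus: "g \<in> R k \<Longrightarrow> - g \<in> R k"
 using R_Const_mult[of g k "-1"] by (simp add: Const_uminus)

lemma R_diff: "g \<in> R k \<Longrightarrow> h \<in> R k \<Longrightarrow> g - h \<in> R k"
 using R_add[OF _ R_uminus[of h k], of g] by simp

lemma R_Const: "Const a \<in> R 0"
 using R_Const_mult[OF R_1, of a] by simp

lemma R_power: "g \<in> R k \<Longrightarrow> g ^ m \<in> R (m * k)"
 by (induction m) (auto simp: R_1 R_mult)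

definition comp :: "nat \<Rightarrow> 'v cpoly \<Rightarrow> 'v cpoly" where
 "comp k = wpart (\<lambda>_. 1) (k * D)"

lemma comp_add: "comp k (g + h) = comp k g + comp k h"
 unfolding comp_def by (rule poly_mapping_eqI) (simp add: lookup_wpart lookup_add)

lemma comp_0 [simp]: "comp k 0 = 0"
 unfolding comp_def by (rule poly_mapping_eqI) (simp add: lookup_wpart)

lemma comp_sum: "comp k (\<Sum>i\<in>I. g i) = (\<Sum>i\<in>I. comp k (g i))"
 by (induction I rule: infinite_finite_induct) (simp_all add: comp_add)

lemma comp_R:
 assumes "g \<in> R l"
 shows "comp k g = (if k = l then g else 0)"
proof (rule poly_mapping_eqI)
 fix e
 have "lookup g e \<noteq> 0 \<Longrightarrow> tdeg e = l * D" using R_degree[OF assms, of e] by (simp add: in_keys_iff)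
 thus "lookup (comp k g) e = lookup (if k = l then g else 0) e"
  using D_pos by (cases "lookup g e = 0") (simp_all add: comp_def lookup_wpart)
qed

lemma comp_graded_sum:
 assumes "\<And>k. f k \<in> R k"
 shows "comp k (\<Sum>i<m. f i) = (if k < m then f k else 0)"
 unfolding comp_sum using comp_R[OF assms] by simp

lemma graded_sum_iff: "g \<in> graded_sum R \<longleftrightarrow> (\<forall>k. comp k g \<in> R k) \<and> (\<exists>m. g = (\<Sum>k<m. comp k g))"
proof
 assume "g \<in> graded_sum R"
 then obtain m f where g: "g = (\<Sum>k<m. f k)" and f: "\<And>k. f k \<in> R k" unfolding graded_sum_def by blast
 have "comp k g \<in> R k" for k unfolding g comp_graded_sum[OF f] using f R_0 by simp
 moreover have "g = (\<Sum>k<m. comp k g)" unfolding g comp_graded_sum[OF f] by simp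
 ultimately show "(\<forall>k. comp k g \<in> R k) \<and> (\<exists>m. g = (\<Sum>k<m. comp k g))" by blast
next
 assume "(\<forall>k. comp k g \<in> R k) \<and> (\<exists>m. g = (\<Sum>k<m. comp k g))"
 thus "g \<in> graded_sum R" unfolding graded_sum_def by blast
qed

lemma comp_in_R: "g \<in> graded_sum R \<Longrightarrow> comp k g \<in> R k"
 using graded_sum_iff by blast

lemma graded_sum_decomp:
 assumes "g \<in> graded_sum R"
 obtains m where "\<forall>n\<ge>m. g = (\<Sum>k<n. comp k g)"
proof -
 obtain m where m: "g = (\<Sum>k<m. comp k g)" using assms graded_sum_iff by blast
 have z: "comp k g = 0" if "k \<ge> m" for k using comp_graded_sum[of "\<lambda>k. comp k g" k m] comp_in_R[OF assms] m that by simp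
 have "g = (\<Sum>k<n. comp k g)" if "n \<ge> m" for n
 proof -
  have "(\<Sum>k<n. comp k g) = (\<Sum>k<m. comp k g)" using that z by (intro sum.mono_neutral_right) auto
  thus ?thesis using m by simp
 qed
 thus ?thesis using that by blast
qed

lemma R_graded_sum: "g \<in> R k \<Longrightarrow> g \<in> graded_sum R"
using comp_R graded_sum_iff R_0 by auto

lemma graded_sum_add: "g \<in> graded_sum R \<Longrightarrow> h \<in> graded_sum R \<Longrightarrow> g + h \<in> graded_sum R"
proof -
 assume gh: "g \<in> graded_sum R" "h \<in> graded_sum R"
 obtain m where m: "\<forall>n\<ge>m. g = (\<Sum>k<n. comp k g)" by (rule graded_sum_decomp[OF gh(1)])
 obtain m' where m': "\<forall>n\<ge>m'. h = (\<Sum>k<n. comp k h)" by (rule graded_sum_decomp[OF gh(2)])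
 have "g + h = (\<Sum>k<max m m'. comp k (g + h))"
  unfolding comp_add sum.distrib using m[rule_format, of "max m m'"] m'[rule_format, of "max m m'"] by simp
 moreover have "comp k (g + h) \<in> R k" for k unfolding comp_add by (intro R_add comp_in_R gh)
 ultimately show ?thesis unfolding graded_sum_iff by (intro conjI allI exI[of _ "max m m'"])
qed

lemma graded_sum_sum: "(\<And>i. i \<in> I \<Longrightarrow> g i \<in> graded_sum R) \<Longrightarrow> (\<Sum>i\<in>I. g i) \<in> graded_sum R"
 by (induction I rule: infinite_finite_induct) (auto intro: graded_sum_add R_graded_sum[OF R_0])

lemma graded_sum_mult:
 assumes "g \<in> graded_sum R" "h \<in> graded_sum R"
 shows "g * h \<in> graded_sum R" "comp n (g * h) = (\<Sum>i\<le>n. comp i g * comp (n - i) h)"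
proof -
 obtain m where m: "\<forall>n\<ge>m. g = (\<Sum>k<n. comp k g)" by (rule graded_sum_decomp[OF assms(1)])
 obtain m' where m': "\<forall>n\<ge>m'. h = (\<Sum>k<n. comp k h)" by (rule graded_sum_decomp[OF assms(2)])
 let ?M = "max (max m m') (Suc n)"
 have "g * h = (\<Sum>i<?M. comp i g) * (\<Sum>j<?M. comp j h)" using m[rule_format, of ?M] m'[rule_format, of ?M] by simp
 hence gh: "g * h = (\<Sum>i<?M. \<Sum>j<?M. comp i g * comp j h)" by (simp add: sum_product)
 have R: "comp i g * comp j h \<in> R (i + j)" for i j by (intro R_mult comp_in_R assms)
 show "g * h \<in> graded_sum R" unfolding gh by (intro graded_sum_sum R_graded_sum[OF R])
 have "comp n (g * h) = (\<Sum>i<?M. \<Sum>j<?M. if n = i + j then comp i g * comp j h else 0)" unfolding gh comp_sum comp_R[OF R] ..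
 also have "\<dots> = (\<Sum>i<?M. if i \<le> n then comp i g * comp (n - i) h else 0)"
 proof (intro sum.cong refl)
  fix i assume "i \<in> {..<?M}"
  have "(\<Sum>j<?M. if n = i + j then comp i g * comp j h else 0) = (\<Sum>j<?M. if j = n - i \<and> i \<le> n then comp i g * comp j h else 0)"
   by (intro sum.cong refl) auto
  also have "\<dots> = (if i \<le> n then comp i g * comp (n - i) h else 0)" by (cases "i \<le> n") auto
  finally show "(\<Sum>j<?M. if n = i + j then comp i g * comp j h else 0) = (if i \<le> n then comp i g * comp (n - i) h else 0)" .
 qed
 also have "\<dots> = (\<Sum>i\<in>{i\<in>{..<?M}. i \<le> n}. comp i g * comp (n - i) h)" by (rule sum.inter_filter[symmetric]) simp
 also have "{i\<in>{..<?M}. i \<le> n} = {..n}" by auto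
 finally show "comp n (g * h) = (\<Sum>i\<le>n. comp i g * comp (n - i) h)" .
qed

lemma graded_ring_simps [simp]:
 "carrier (graded_ring R) = graded_sum R" "x \<otimes>\<^bsub>graded_ring R\<^esub> y = x * y" "x \<oplus>\<^bsub>graded_ring R\<^esub> y = x + y"
 "\<one>\<^bsub>graded_ring R\<^esub> = 1" "\<zero>\<^bsub>graded_ring R\<^esub> = 0" by (simp_all add: graded_ring_def)

lemma graded_ring_cring: "cring (graded_ring R)"
proof (rule cringI)
 show "abelian_group (graded_ring R)"
 proof (rule abelian_groupI)
  fix x assume "x \<in> carrier (graded_ring R)"
  hence "- 1 * x \<in> graded_sum R" using graded_sum_mult(1)[OF R_graded_sum[OF R_uminus[OF R_1]]] by simp
  thus "\<exists>y\<in>carrier (graded_ring R). y \<oplus>\<^bsub>graded_ring R\<^esub> x = \<zero>\<^bsub>graded_ring R\<^esub>"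
   by (intro bexI[of _ "- x"]) simp_all
 qed (auto simp: graded_sum_add R_graded_sum[OF R_0])
 show "comm_monoid (graded_ring R)" by (rule comm_monoidI) (auto simp: graded_sum_mult(1) R_graded_sum[OF R_1] ac_simps)
qed (simp add: distrib_right)

lemma graded_ring_minus [simp]: "x \<in> graded_sum R \<Longrightarrow> \<ominus>\<^bsub>graded_ring R\<^esub> x = - x"
proof -
 interpret cring "graded_ring R" by (rule graded_ring_cring)
 assume x: "x \<in> graded_sum R"
 hence "- x \<in> graded_sum R" using graded_sum_mult(1)[OF R_graded_sum[OF R_uminus[OF R_1]]] by fastforce
 thus ?thesis using x by (intro minus_equality) auto
qed

text \<open>A homogeneous ideal is given by predicates on the homogeneous parts.\<close>

lemma homogeneous_prime:
 assumes V0: "\<And>k. V k 0"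
  and Vadd: "\<And>k f g. f \<in> R k \<Longrightarrow> g \<in> R k \<Longrightarrow> V k f \<Longrightarrow> V k g \<Longrightarrow> V k (f + g)"
  and Vmult: "\<And>k l f g. f \<in> R k \<Longrightarrow> g \<in> R l \<Longrightarrow> V k f \<Longrightarrow> V (k + l) (f * g)"
  and Vprime: "\<And>k l f g. f \<in> R k \<Longrightarrow> g \<in> R l \<Longrightarrow> V (k + l) (f * g) \<Longrightarrow> V k f \<or> V l g"
  and V1: "\<not> V 0 1"
  and rel: "k0 > 0" "f0 \<in> R k0" "\<not> V k0 f0"
 defines "p \<equiv> {g \<in> graded_sum R. \<forall>k. V k (comp k g)}"
 shows "p \<in> relevant_primes R" and "\<And>k f. f \<in> R k \<Longrightarrow> f \<in> p \<longleftrightarrow> V k f"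
proof -
 interpret cring "graded_ring R" by (rule graded_ring_cring)
 show hom: "f \<in> p \<longleftrightarrow> V k f" if "f \<in> R k" for k f using that R_graded_sum[OF that] V0 by (auto simp: p_def comp_R)
 have Vsum: "V k (\<Sum>i\<in>I. f i)" if "\<And>i. i \<in> I \<Longrightarrow> f i \<in> R k \<and> V k (f i)" for k and I :: "nat set" and f
 proof -
  have "(\<Sum>i\<in>I. f i) \<in> R k \<and> V k (\<Sum>i\<in>I. f i)"
   using that by (induction I rule: infinite_finite_induct) (auto simp: R_0 V0 R_add Vadd)
  thus ?thesis ..
 qed
 have pT: "g \<in> graded_sum R" if "g \<in> p" for g using that by (simp add: p_def)
 have pmult: "g * r \<in> p" if "g \<in> p" "r \<in> graded_sum R" for g r
 proof -
  have "V n (comp n (g * r))" for n unfolding graded_sum_mult(2)[OF pT[OF that(1)] that(2)]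
  proof (rule Vsum)
   fix i assume "i \<in> {..n}"
   thus "comp i g * comp (n - i) r \<in> R n \<and> V n (comp i g * comp (n - i) r)"
    using R_mult[OF comp_in_R[OF pT[OF that(1)], of i] comp_in_R[OF that(2), of "n - i"]]
     Vmult[OF comp_in_R[OF pT[OF that(1)], of i] comp_in_R[OF that(2), of "n - i"]] that(1) by (simp add: p_def)
  qed
  thus ?thesis using graded_sum_mult(1)[OF pT[OF that(1)] that(2)] by (simp add: p_def)
 qed
 have padd: "g + r \<in> p" if "g \<in> p" "r \<in> p" for g r
  using that Vadd comp_in_R by (auto simp: p_def comp_add intro: graded_sum_add)
 have "ideal p (graded_ring R)"
 proof (rule idealI[OF ring_axioms])
  show "subgroup p (add_monoid (graded_ring R))"
  proof (rule group.subgroupI[OF a_group])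
   show "p \<noteq> {}" using hom[OF R_0] V0 by blast
   fix g assume g: "g \<in> p"
   have "g * (- 1) \<in> p" using pmult[OF g R_graded_sum[OF R_uminus[OF R_1]]] .
   thus "inv\<^bsub>add_monoid (graded_ring R)\<^esub> g \<in> p" unfolding a_inv_def[symmetric] graded_ring_minus[OF pT[OF g]] by simp
  qed (use pT padd in auto)
 qed (use pmult in \<open>auto simp: mult.commute\<close>)
 moreover have "carrier (graded_ring R) \<noteq> p" using hom[OF R_1] V1 R_graded_sum[OF R_1] by auto
 moreover have "g \<in> p \<or> r \<in> p" if gr: "g \<in> graded_sum R" "r \<in> graded_sum R" "g * r \<in> p" for g r
 proof (rule ccontr)
  assume "\<not> (g \<in> p \<or> r \<in> p)"
  hence "\<exists>i. \<not> V i (comp i g)" "\<exists>j. \<not> V j (comp j r)" using gr by (auto simp: p_def)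
  \<comment> \<open>\<open>i\<close> and \<open>j\<close> are the lowest degrees in which
    \<open>g\<close> and \<open>r\<close> leave the ideal. In degree \<open>i + j\<close> of the
    product every other pair of components has a factor in the ideal.\<close>
  define i where "i = (LEAST i. \<not> V i (comp i g))"
  define j where "j = (LEAST j. \<not> V j (comp j r))"
  have i: "\<not> V i (comp i g)" "\<And>i'. i' < i \<Longrightarrow> V i' (comp i' g)"
   using LeastI_ex[OF \<open>\<exists>i. \<not> V i (comp i g)\<close>] not_less_Least unfolding i_def by blast+
  have j: "\<not> V j (comp j r)" "\<And>j'. j' < j \<Longrightarrow> V j' (comp j' r)"
   using LeastI_ex[OF \<open>\<exists>j. \<not> V j (comp j r)\<close>] not_less_Least unfolding j_def by blast+
  let ?t = "\<lambda>i'. comp i' g * comp (i + j - i') r"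
  have tR: "?t i' \<in> R (i + j)" if "i' \<le> i + j" for i'
   using R_mult[OF comp_in_R[OF gr(1), of i'] comp_in_R[OF gr(2), of "i + j - i'"]] that by simp
  have "V (i + j) (\<Sum>i'\<in>{..i + j} - {i}. ?t i')"
  proof (rule Vsum)
   fix i' assume i': "i' \<in> {..i + j} - {i}"
   have "V (i' + (i + j - i')) (?t i')"
   proof (cases "i' < i")
    case True
    thus ?thesis by (rule Vmult[OF comp_in_R[OF gr(1), of i'] comp_in_R[OF gr(2), of "i + j - i'"] i(2)])
   next
    case False
    hence "i + j - i' < j" using i' by auto
    hence "V (i + j - i' + i') (comp (i + j - i') r * comp i' g)" by (rule Vmult[OF comp_in_R[OF gr(2)] comp_in_R[OF gr(1)] j(2)])
    thus ?thesis by (simp add: ac_simps)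
   qed
   thus "?t i' \<in> R (i + j) \<and> V (i + j) (?t i')" using tR i' by simp
  qed
  moreover have "(\<Sum>i'\<in>{..i + j} - {i}. ?t i') \<in> R (i + j)"
  proof -
   have "(\<Sum>i'\<in>I. ?t i') \<in> R (i + j)" if "I \<subseteq> {..i + j}" for I
    using that by (induction I rule: infinite_finite_induct) (auto simp: R_0 R_add tR)
   from this[OF Diff_subset] show ?thesis .
  qed
  ultimately have "V (i + j) (- 1 * (\<Sum>i'\<in>{..i + j} - {i}. ?t i'))" and neg: "- 1 * (\<Sum>i'\<in>{..i + j} - {i}. ?t i') \<in> R (i + j)"
   using Vmult[of _ "i + j" "- 1" 0] R_uminus[OF R_1] R_uminus by (simp_all add: mult.commute)
  moreover have "V (i + j) (comp (i + j) (g * r))" using gr(3) by (simp add: p_def)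
  moreover have tot: "comp (i + j) (g * r) = ?t i + (\<Sum>i'\<in>{..i + j} - {i}. ?t i')"
   unfolding graded_sum_mult(2)[OF gr(1,2)] by (rule sum.remove) auto
  moreover have "comp (i + j) (g * r) \<in> R (i + j)" using comp_in_R[OF pT[OF gr(3)]] .
  ultimately have "V (i + j) (comp (i + j) (g * r) + - 1 * (\<Sum>i'\<in>{..i + j} - {i}. ?t i'))" by (intro Vadd)
  hence "V (i + j) (comp i g * comp j r)" unfolding tot by simp
  thus False using Vprime[OF comp_in_R[OF gr(1)] comp_in_R[OF gr(2)]] i(1) j(1) by blast
 qed
 ultimately have "primeideal p (graded_ring R)" by (intro primeidealI graded_ring_cring) simp_all
 moreover have "f k \<in> p" if "\<forall>k. f k \<in> R k" "(\<Sum>k<m. f k) \<in> p" "k < m" for m f k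
 proof -
  have "V k (comp k (\<Sum>k<m. f k))" using that(2) by (simp add: p_def)
  hence "V k (f k)" using comp_graded_sum[of f k m] that(1,3) by simp
  thus ?thesis using hom[OF that(1)[rule_format]] by simp
 qed
 moreover have "f0 \<in> (\<Union>k\<in>{1..}. R k)" using rel by (intro UN_I[of k0]) auto
 hence "\<not> (\<Union>k\<in>{1..}. R k) \<subseteq> p" using hom[OF rel(2)] rel(3) by blast
 ultimately show "p \<in> relevant_primes R" unfolding relevant_primes_def by blast
qed

context
 fixes p assumes p: "p \<in> relevant_primes R"
begin

lemma prime_ideal: "primeideal p (graded_ring R)"
 using p unfolding relevant_primes_def by blast

lemma prime_subset: "g \<in> p \<Longrightarrow> g \<in> graded_sum R"
 using additive_subgroup.a_subset[OF ideal.axioms(1)[OF primeideal.axioms(1)[OF prime_ideal]]] by auto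

lemma prime_0: "0 \<in> p"
 using additive_subgroup.zero_closed[OF ideal.axioms(1)[OF primeideal.axioms(1)[OF prime_ideal]]] by simp

lemma prime_add: "g \<in> p \<Longrightarrow> h \<in> p \<Longrightarrow> g + h \<in> p"
 using additive_subgroup.a_closed[OF ideal.axioms(1)[OF primeideal.axioms(1)[OF prime_ideal]]] by simp

lemma prime_mult: "g \<in> p \<Longrightarrow> h \<in> graded_sum R \<Longrightarrow> g * h \<in> p"
 using ideal.I_r_closed[OF primeideal.axioms(1)[OF prime_ideal]] by simp

lemma prime_prime: "g \<in> graded_sum R \<Longrightarrow> h \<in> graded_sum R \<Longrightarrow> g * h \<in> p \<Longrightarrow> g \<in> p \<or> h \<in> p"
 using primeideal.I_prime[OF prime_ideal] by simp

lemma prime_not_1: "1 \<notin> p"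
proof
 assume "1 \<in> p"
 hence "graded_sum R \<subseteq> p" using prime_mult[of 1] by auto
 thus False using primeideal.I_notcarr[OF prime_ideal] prime_subset by auto
qed

lemma prime_Const: "a \<noteq> 0 \<Longrightarrow> g \<in> graded_sum R \<Longrightarrow> Const a * g \<in> p \<Longrightarrow> g \<in> p"
proof -
 assume a: "a \<noteq> 0" and g: "Const a * g \<in> p"
 have "Const a * g * Const (1 / a) \<in> p" using g R_graded_sum[OF R_Const] by (rule prime_mult)
 moreover have "Const a * g * Const (1 / a) = Const (a * (1 / a)) * g" unfolding Const_mult by (simp only: ac_simps)
 ultimately show "g \<in> p" using a by simp
qed

lemma prime_power: "g \<in> graded_sum R \<Longrightarrow> g ^ m \<in> p \<Longrightarrow> g \<in> p"
proof (induction m)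
 case 0
 thus ?case using prime_not_1 by simp
next
 case (Suc m)
 have "g ^ m \<in> graded_sum R" using Suc.prems(1) by (induction m) (auto intro: graded_sum_mult R_graded_sum[OF R_1])
 thus ?case using prime_prime[OF Suc.prems(1)] Suc by auto
qed

lemma prime_comp: "g \<in> p \<Longrightarrow> comp k g \<in> p"
proof -
 assume g: "g \<in> p"
 obtain m where m: "\<forall>n\<ge>m. g = (\<Sum>k<n. comp k g)" by (rule graded_sum_decomp[OF prime_subset[OF g]])
 have "(\<Sum>k<max m (Suc k). comp k g) \<in> p" using m[rule_format, of "max m (Suc k)"] g by simp
 hence "\<forall>i<max m (Suc k). comp i g \<in> p" using p comp_in_R[OF prime_subset[OF g]] unfolding relevant_primes_def mem_Collect_eq
  by (elim conjE allE[where x = "max m (Suc k)"] allE[where x = "\<lambda>k. comp k g"]) simp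
 thus ?thesis by simp
qed


end

end

section \<open>Points of Proj through a Veronese subalgebra\<close>

definition coord_point :: "complex \<Rightarrow> nat \<Rightarrow> (nat \<Rightarrow> 'v cpoly) \<Rightarrow> ('v \<Rightarrow> complex) \<Rightarrow> nat \<Rightarrow> complex" where
 "coord_point a N h x j = (if j = 0 then a else if j \<le> N then peval (h j) x else 0)"

text \<open>
 The \<open>d\<close>-th Veronese subalgebra is generated by \<open>h 1, \<dots>, h N\<close> of degree \<open>d\<close>; \<open>cone\<close> consists of
 the nonzero points of its spectrum.
\<close>

locale veronese = graded_algebra R D for R :: "nat \<Rightarrow> 'v cpoly set" and D +
 fixes d N :: nat and a :: complex and h :: "nat \<Rightarrow> 'v cpoly"
 assumes d_pos: "d > 0"
  and h_R: "j \<in> {1..N} \<Longrightarrow> h j \<in> R d"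
  and generated: "g \<in> R (k * d) \<Longrightarrow> \<exists>F. hfun k F \<and> (\<forall>x. peval g x = F (coord_point a N h x))"
begin

abbreviation pt :: "('v \<Rightarrow> complex) \<Rightarrow> nat \<Rightarrow> complex" where
 "pt \<equiv> coord_point a N h"

definition cone :: "cvec set" where
 "cone = {z. z 0 = a \<and> (\<forall>j>N. z j = 0) \<and> (\<exists>i>0. z i \<noteq> 0) \<and>
   (\<forall>k F. hfun k F \<longrightarrow> (\<forall>x. F (pt x) = 0) \<longrightarrow> F z = 0)}"

lemma cone_relation: "z \<in> cone \<Longrightarrow> hfun k F \<Longrightarrow> (\<And>x. F (pt x) = 0) \<Longrightarrow> F z = 0"
 unfolding cone_def by blast

lemma cone_coord:
 assumes "z \<in> cone"
 obtains i where "i \<in> {1..N}" "z i \<noteq> 0" using assms nonzero_coord[of z N] unfolding cone_def by blast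

lemma is_cone_cone: "is_cone cone"
 unfolding is_cone_def
proof (intro ballI allI impI)
 fix z b assume z: "z \<in> cone" and b: "b \<noteq> (0 :: complex)"
 have "F (rescale b z) = 0" if "hfun k F" "\<forall>x. F (pt x) = 0" for k F
  using hfun_rescale[OF that(1)] cone_relation[OF z that(1)] that(2) by simp
 moreover have "\<forall>j>N. rescale b z j = 0" "\<exists>i>0. rescale b z i \<noteq> 0" "rescale b z 0 = a"
  using z b by (auto simp: cone_def rescale_def)
 ultimately show "rescale b z \<in> cone" unfolding cone_def by blast
qed

lemma hfun_R: "hfun k F \<Longrightarrow> \<exists>g\<in>R (k * d). \<forall>x. peval g x = F (pt x)"
proof (induction rule: hfun.induct)
 case (const b)
 show ?case using R_Const[of b] by (intro bexI[of _ "Const b"]) simp_all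
next
 case param
 show ?case using R_Const[of a] by (intro bexI[of _ "Const a"]) (simp_all add: coord_point_def)
next
 case (coord i)
 thus ?case using h_R[of i] R_0[of "1 * d"] by (cases "i \<le> N") (auto simp: coord_point_def intro: bexI[of _ "h i"] bexI[of _ 0])
next
 case (zero k)
 show ?case by (intro bexI[of _ 0] R_0) simp
next
 case (add k F G)
 then obtain f g where "f \<in> R (k * d)" "\<forall>x. peval f x = F (pt x)" "g \<in> R (k * d)" "\<forall>x. peval g x = G (pt x)" by blast
 thus ?case by (intro bexI[of _ "f + g"] R_add) (simp_all add: peval_add)
next
 case (mult k F l G)
 then obtain f g where fg: "f \<in> R (k * d)" "\<forall>x. peval f x = F (pt x)" "g \<in> R (l * d)" "\<forall>x. peval g x = G (pt x)" by blast
 hence "f * g \<in> R ((k + l) * d)" using R_mult[OF fg(1,3)] by (simp add: add_mult_distrib)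
 thus ?case using fg by (intro bexI[of _ "f * g"]) (simp_all add: peval_mult)
qed

text \<open>The value at \<open>z\<close> of an element of degree \<open>k d\<close>. Two functions
  representing it differ by a relation, which vanishes on \<open>cone\<close>, so the choice does
  not matter.\<close>

definition val :: "cvec \<Rightarrow> nat \<Rightarrow> 'v cpoly \<Rightarrow> complex" where
 "val z k g = (SOME F. hfun k F \<and> (\<forall>x. peval g x = F (pt x))) z"

lemma val_eq:
 assumes "z \<in> cone" "hfun k F" "\<And>x. peval g x = F (pt x)"
 shows "val z k g = F z"
proof -
 let ?G = "SOME F. hfun k F \<and> (\<forall>x. peval g x = F (pt x))"
 have G: "hfun k ?G \<and> (\<forall>x. peval g x = ?G (pt x))" by (rule someI[of "\<lambda>F. hfun k F \<and> (\<forall>x. peval g x = F (pt x))" F]) (use assms in blast)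
 have "?G z - F z = 0"
 proof (rule cone_relation[OF assms(1) hfun_diff[OF conjunct1[OF G] assms(2)]])
  show "?G (pt x) - F (pt x) = 0" for x by (simp only: conjunct2[OF G, rule_format, symmetric] assms(3)[symmetric] diff_self)
 qed
 thus ?thesis by (simp add: val_def)
qed

lemma val_add:
 assumes "z \<in> cone" "f \<in> R (k * d)" "g \<in> R (k * d)"
 shows "val z k (f + g) = val z k f + val z k g"
proof -
 obtain F where F: "hfun k F" "\<And>x. peval f x = F (pt x)" using generated[OF assms(2)] by blast
 obtain G where G: "hfun k G" "\<And>x. peval g x = G (pt x)" using generated[OF assms(3)] by blast
 show ?thesis unfolding val_eq[OF assms(1) F] val_eq[OF assms(1) G]
  by (rule val_eq[OF assms(1) hfun.add[OF F(1) G(1)]]) (simp add: peval_add F G)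
qed

lemma val_mult:
 assumes "z \<in> cone" "f \<in> R (k * d)" "g \<in> R (l * d)"
 shows "val z (k + l) (f * g) = val z k f * val z l g"
proof -
 obtain F where F: "hfun k F" "\<And>x. peval f x = F (pt x)" using generated[OF assms(2)] by blast
 obtain G where G: "hfun l G" "\<And>x. peval g x = G (pt x)" using generated[OF assms(3)] by blast
 show ?thesis unfolding val_eq[OF assms(1) F] val_eq[OF assms(1) G]
  by (rule val_eq[OF assms(1) hfun.mult[OF F(1) G(1)]]) (simp add: peval_mult F G)
qed

lemma val_Const: "z \<in> cone \<Longrightarrow> val z 0 (Const b) = b"
 by (rule val_eq[OF _ hfun.const]) simp_all

lemma val_0: "z \<in> cone \<Longrightarrow> val z k 0 = 0"
 by (rule val_eq[OF _ hfun.zero]) simp_all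

lemma val_Const_mult:
 assumes "z \<in> cone" "g \<in> R (k * d)"
 shows "val z k (Const b * g) = b * val z k g"
 using val_mult[OF assms(1), of "Const b" 0 g k] assms R_Const[of b] by (simp add: val_Const)

lemma val_h: "z \<in> cone \<Longrightarrow> j \<in> {1..N} \<Longrightarrow> val z 1 (h j) = z j"
 by (rule val_eq[OF _ hfun.coord]) (auto simp: coord_point_def)

lemma val_power:
 assumes "z \<in> cone" "g \<in> R (k * d)"
 shows "val z (m * k) (g ^ m) = val z k g ^ m"
proof (induction m)
 case 0
 show ?case using val_Const[OF assms(1), of 1] by simp
next
 case (Suc m)
 have "g ^ m \<in> R ((m * k) * d)" using R_power[OF assms(2), of m] by (simp add: mult.assoc)
 from val_mult[OF assms(1,2) this] show ?case using Suc by simp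
qed

text \<open>An element whose degree is not a multiple of \<open>d\<close> has no value at
  \<open>z\<close>, but its power with exponent \<open>d\<close> does.\<close>

definition vanishes :: "cvec \<Rightarrow> nat \<Rightarrow> 'v cpoly \<Rightarrow> bool" where
 "vanishes z k g \<longleftrightarrow> val z k (g ^ d) = 0"

lemma power_d: "g \<in> R k \<Longrightarrow> g ^ d \<in> R (k * d)"
 using R_power[of g k d] by (simp add: mult.commute)

lemma power_pred:
 assumes "g \<in> R k"
 shows "g ^ (d - 1) \<in> R ((d - 1) * k)" "k + (d - 1) * k = k * d" "g * g ^ (d - 1) = g ^ d"
proof -
 obtain d' where "d = Suc d'" using d_pos gr0_implies_Suc by blast
 thus "g ^ (d - 1) \<in> R ((d - 1) * k)" "k + (d - 1) * k = k * d" "g * g ^ (d - 1) = g ^ d" using R_power[OF assms] by simp_all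
qed

lemma vanishes_veronese: "z \<in> cone \<Longrightarrow> g \<in> R (k * d) \<Longrightarrow> vanishes z (k * d) g \<longleftrightarrow> val z k g = 0"
 using val_power[of z g k d] d_pos by (simp add: vanishes_def mult.commute)

text \<open>The definition by powers makes multiplicativity evident but hides additivity. Vanishing
  of all products that land in the Veronese subalgebra is a linear condition, and an equivalent one,
  since such a product raised to the power \<open>d\<close> contains the factor
  \<open>g ^ d\<close>.\<close>

lemma vanishes_iff:
 assumes z: "z \<in> cone" and g: "g \<in> R k"
 shows "vanishes z k g \<longleftrightarrow> (\<forall>l u m. u \<in> R l \<longrightarrow> k + l = m * d \<longrightarrow> val z m (g * u) = 0)"
proof
 assume v: "vanishes z k g"
 show "\<forall>l u m. u \<in> R l \<longrightarrow> k + l = m * d \<longrightarrow> val z m (g * u) = 0"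
 proof (intro allI impI)
  fix l u m assume u: "u \<in> R l" and m: "k + l = m * d"
  have gu: "g * u \<in> R (m * d)" using R_mult[OF g u] m by simp
  have "val z m (g * u) ^ d = val z (d * m) (g ^ d * u ^ d)" using val_power[OF z gu, of d] by (simp add: power_mult_distrib)
  also have "d * m = k + l" using m by (simp add: mult.commute)
  also have "val z (k + l) (g ^ d * u ^ d) = 0" using val_mult[OF z power_d[OF g] power_d[OF u]] v by (simp add: vanishes_def)
  finally show "val z m (g * u) = 0" using d_pos by simp
 qed
next
 assume *: "\<forall>l u m. u \<in> R l \<longrightarrow> k + l = m * d \<longrightarrow> val z m (g * u) = 0"
 have "val z k (g * g ^ (d - 1)) = 0" using *[rule_format, OF power_pred(1)[OF g] power_pred(2)[OF g]] .
 thus "vanishes z k g" unfolding vanishes_def power_pred(3)[OF g] .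
qed

lemma vanishes_0: "z \<in> cone \<Longrightarrow> vanishes z k 0"
 unfolding vanishes_def zero_power[OF d_pos] by (rule val_0)

lemma vanishes_add:
 assumes z: "z \<in> cone" and fg: "f \<in> R k" "g \<in> R k" "vanishes z k f" "vanishes z k g"
 shows "vanishes z k (f + g)"
 unfolding vanishes_iff[OF z R_add[OF fg(1,2)]]
proof (intro allI impI)
 fix l u m assume u: "u \<in> R l" "k + l = m * d"
 have "f * u \<in> R (m * d)" "g * u \<in> R (m * d)" using R_mult[OF fg(1) u(1)] R_mult[OF fg(2) u(1)] u(2) by simp_all
 moreover have "val z m (f * u) = 0" "val z m (g * u) = 0"
  using fg(3,4) u unfolding vanishes_iff[OF z fg(1)] vanishes_iff[OF z fg(2)] by blast+
 ultimately show "val z m ((f + g) * u) = 0" using val_add[OF z] by (simp add: distrib_right)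
qed

lemma vanishes_mult:
 assumes z: "z \<in> cone" and fg: "f \<in> R k" "g \<in> R l"
 shows "vanishes z (k + l) (f * g) \<longleftrightarrow> vanishes z k f \<or> vanishes z l g"
 unfolding vanishes_def power_mult_distrib val_mult[OF z power_d[OF fg(1)] power_d[OF fg(2)]] by simp

definition prime_at :: "cvec \<Rightarrow> 'v cpoly set" where
 "prime_at z = {g \<in> graded_sum R. \<forall>k. vanishes z k (comp k g)}"

lemma prime_at:
 assumes z: "z \<in> cone"
 shows "prime_at z \<in> relevant_primes R" "g \<in> R k \<Longrightarrow> g \<in> prime_at z \<longleftrightarrow> vanishes z k g"
proof -
 obtain i where i: "i \<in> {1..N}" "z i \<noteq> 0" using z by (rule cone_coord)
 have nv: "\<not> vanishes z d (h i)" using vanishes_veronese[OF z, of "h i" 1] h_R[OF i(1)] val_h[OF z i(1)] i(2) by simp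
 have n1: "\<not> vanishes z 0 1" using vanishes_veronese[OF z, of 1 0] val_Const[OF z, of 1] R_1 by simp
 note hp = homogeneous_prime[where V = "vanishes z", OF vanishes_0[OF z] vanishes_add[OF z] _ _ n1 d_pos h_R[OF i(1)] nv]
 show "prime_at z \<in> relevant_primes R" unfolding prime_at_def by (rule hp(1)) (auto simp: vanishes_mult[OF z])
 show "g \<in> R k \<Longrightarrow> g \<in> prime_at z \<longleftrightarrow> vanishes z k g" unfolding prime_at_def
  by (rule hp(2)) (auto simp: vanishes_mult[OF z])
qed

lemma prime_at_veronese:
 "z \<in> cone \<Longrightarrow> g \<in> R (k * d) \<Longrightarrow> g \<in> prime_at z \<longleftrightarrow> val z k g = 0"
 using prime_at(2) vanishes_veronese by simp

text \<open>If \<open>q\<close> were larger, take a homogeneous \<open>g\<close> in \<open>q\<close>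
  outside the prime and an \<open>f\<close> of positive degree outside \<open>q\<close>, and bring
  powers of both to the same degree. The combination that vanishes at \<open>z\<close> lies in the
  prime, hence in \<open>q\<close>, and forces a power of \<open>f\<close> into
  \<open>q\<close>.\<close>

lemma prime_at_maximal:
 assumes z: "z \<in> cone" and q: "q \<in> relevant_primes R" "prime_at z \<subseteq> q"
 shows "q = prime_at z"
proof (rule equalityI[OF _ q(2)], rule subsetI, rule ccontr)
 fix g assume g: "g \<in> q" "g \<notin> prime_at z"
 note gT = prime_subset[OF q(1) g(1)]
 obtain j where j: "\<not> vanishes z j (comp j g)" using g(2) gT unfolding prime_at_def by blast
 let ?g = "comp j g"
 have gR: "?g \<in> R j" by (rule comp_in_R[OF gT])
 have gq: "?g \<in> q" by (rule prime_comp[OF q(1) g(1)])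
 obtain k f where f: "k \<ge> 1" "f \<in> R k" "f \<notin> q" using q(1) unfolding relevant_primes_def by blast
 have "\<not> vanishes z k f" using prime_at(2)[OF z f(2)] f(3) q(2) by blast
 hence nz: "val z k (f ^ d) \<noteq> 0" "val z j (?g ^ d) \<noteq> 0" using j by (simp_all add: vanishes_def)
 let ?F = "(f ^ d) ^ j" and ?G = "(?g ^ d) ^ k"
 have FR: "?F \<in> R ((j * k) * d)" and GR: "?G \<in> R ((j * k) * d)"
  using R_power[OF power_d[OF f(2)], of j] R_power[OF power_d[OF gR], of k] by (simp_all add: ac_simps)
 have vF: "val z (j * k) ?F = val z k (f ^ d) ^ j" using val_power[OF z power_d[OF f(2)], of j] .
 have vG: "val z (j * k) ?G = val z j (?g ^ d) ^ k" using val_power[OF z power_d[OF gR], of k] by (simp add: mult.commute)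
 let ?p = "val z (j * k) ?G" and ?b = "- val z (j * k) ?F"
 let ?u = "Const ?p * ?F + Const ?b * ?G"
 have uR: "?u \<in> R ((j * k) * d)" by (intro R_add R_Const_mult FR GR)
 have "val z (j * k) ?u = 0"
  unfolding val_add[OF z R_Const_mult[OF FR] R_Const_mult[OF GR]] val_Const_mult[OF z FR] val_Const_mult[OF z GR] by simp
 hence uq: "?u \<in> q" using prime_at_veronese[OF z uR] q(2) by blast
 have "(- Const ?b) * ?G \<in> q"
 proof -
  obtain m where "d * k = Suc m" using d_pos f(1) by (metis gr0_implies_Suc mult_pos_pos not_one_le_zero not_gr_zero)
  hence "?G = ?g * ?g ^ m" by (simp flip: power_mult)
  moreover have "?g * ?g ^ m \<in> q" by (rule prime_mult[OF q(1) gq R_graded_sum[OF R_power[OF gR]]])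
  ultimately have "?G \<in> q" by simp
  hence "?G * Const (- ?b) \<in> q" by (rule prime_mult[OF q(1) _ R_graded_sum[OF R_Const]])
  thus ?thesis by (simp add: mult.commute Const_uminus)
 qed
 from prime_add[OF q(1) uq this] have "Const ?p * ?F \<in> q" by simp
 moreover have "?p \<noteq> 0" unfolding vG using nz by simp
 ultimately have "?F \<in> q" using prime_Const[OF q(1) _ R_graded_sum[OF FR]] by simp
 hence "f \<in> q" using prime_power[OF q(1)] R_graded_sum[OF f(2)] R_graded_sum[OF power_d[OF f(2)]] by blast
 thus False using f(3) by simp
qed

text \<open>Were all \<open>h j\<close> in \<open>p\<close>, then so would be every element of
  positive degree in the Veronese subalgebra, and therefore, through its power with exponent
  \<open>d\<close>, every element of positive degree of \<open>R\<close>.\<close>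

lemma relevant_prime_not_h:
 assumes p: "p \<in> relevant_primes R"
 obtains j where "j \<in> {1..N}" "h j \<notin> p"
proof (rule ccontr)
 assume "\<not> thesis"
 hence hp: "h j \<in> p" if "j \<in> {1..N}" for j using that \<open>\<not> thesis\<close> \<open>\<And>j. j \<in> {1..N} \<Longrightarrow> h j \<notin> p \<Longrightarrow> thesis\<close> by blast
 have *: "hfun k F \<Longrightarrow> \<exists>g\<in>R (k * d). (\<forall>x. peval g x = F (pt x)) \<and> (k > 0 \<longrightarrow> g \<in> p)" for k F
 proof (induction rule: hfun.induct)
  case (const b)
  show ?case using hfun_R[OF hfun.const] by simp
 next
  case param
  show ?case using hfun_R[OF hfun.param] by simp
 next
  case (coord i)
  thus ?case using h_R[of i] hp[of i] R_0[of "1 * d"] prime_0[OF p]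
   by (cases "i \<le> N") (auto simp: coord_point_def intro: bexI[of _ "h i"] bexI[of _ 0])
 next
  case (zero k)
  show ?case using prime_0[OF p] by (intro bexI[of _ 0] R_0) simp
 next
  case (add k F G)
  then obtain f g where fg: "f \<in> R (k * d)" "\<forall>x. peval f x = F (pt x)" "k > 0 \<longrightarrow> f \<in> p"
   "g \<in> R (k * d)" "\<forall>x. peval g x = G (pt x)" "k > 0 \<longrightarrow> g \<in> p" by blast
  thus ?case using prime_add[OF p, of f g] by (intro bexI[of _ "f + g"] R_add) (auto simp: peval_add)
 next
  case (mult k F l G)
  then obtain f g where fg: "f \<in> R (k * d)" "\<forall>x. peval f x = F (pt x)" "k > 0 \<longrightarrow> f \<in> p"
   "g \<in> R (l * d)" "\<forall>x. peval g x = G (pt x)" "l > 0 \<longrightarrow> g \<in> p" by blast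
  have "f * g \<in> R ((k + l) * d)" using R_mult[OF fg(1,4)] by (simp add: add_mult_distrib)
  moreover have "k + l > 0 \<longrightarrow> f * g \<in> p"
   using prime_mult[OF p, of f g] prime_mult[OF p, of g f] fg R_graded_sum by (auto simp: mult.commute)
  ultimately show ?case using fg by (intro bexI[of _ "f * g"]) (simp_all add: peval_mult)
 qed
 obtain k f where f: "k \<ge> 1" "f \<in> R k" "f \<notin> p" using p unfolding relevant_primes_def by blast
 obtain F where F: "hfun k F" "\<And>x. peval (f ^ d) x = F (pt x)" using generated[OF power_d[OF f(2)]] by blast
 obtain g where "g \<in> p" "\<forall>x. peval g x = F (pt x)" using *[OF F(1)] f(1) by auto
 hence "f ^ d \<in> p" using F(2) peval_eqD[of "f ^ d" g] by simp
 thus False using prime_power[OF p R_graded_sum[OF f(2)]] f(3) by blast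
qed

text \<open>On the chart where \<open>h j\<close> is nonzero the prime becomes a proper ideal
  \<open>J\<close> of polynomials, and the Nullstellensatz supplies a common zero \<open>w\<close>.
  All relations of \<open>cone\<close> belong to \<open>J\<close>, so \<open>w\<close> is a point of
  it.\<close>

lemma relevant_prime_point:
 assumes p: "p \<in> relevant_primes R"
 obtains z where "z \<in> cone" "p \<subseteq> prime_at z"
proof -
 obtain j where j: "j \<in> {1..N}" "h j \<notin> p" by (rule relevant_prime_not_h[OF p])
 have hR: "h j \<in> R d" and hT: "h j \<in> graded_sum R" using h_R[OF j(1)] R_graded_sum by blast+
 have ptj: "pt x j = peval (h j) x" for x using j by (simp add: coord_point_def)
 have j0: "j > 0" using j by simp
 let ?y = "\<lambda>x. rescale (1 / peval (h j) x) (pt x)"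
 \<comment> \<open>\<open>g\<close> is the homogenization of \<open>F\<close> in degree
   \<open>k d\<close>, with \<open>h j\<close> as the homogenizing coordinate.\<close>
 let ?rep = "\<lambda>F k g. g \<in> p \<and> g \<in> R (k * d) \<and> (\<forall>x. peval (h j) x \<noteq> 0 \<longrightarrow> peval g x = peval (h j) x ^ k * peval F (?y x))"
 define J :: "nat cpoly set" where "J = {F. \<exists>k g. ?rep F k g}"
 have hpow: "h j ^ k \<in> R (k * d)" for k using R_power[OF hR] .
 have "poly_ideal J" unfolding poly_ideal_def
 proof (intro conjI ballI allI)
  show "0 \<in> J" unfolding J_def using prime_0[OF p] R_0[of "0 * d"] by (intro CollectI exI[of _ 0]) simp
 next
  fix F G assume "F \<in> J" "G \<in> J"
  then obtain k f l g where f: "?rep F k f" and g: "?rep G l g" unfolding J_def by blast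
  have "f * h j ^ l \<in> R ((k + l) * d)" "g * h j ^ k \<in> R ((k + l) * d)"
   using R_mult[of f "k * d" "h j ^ l" "l * d"] R_mult[of g "l * d" "h j ^ k" "k * d"] f g hpow by (simp_all add: add_mult_distrib add.commute)
  hence "?rep (F + G) (k + l) (f * h j ^ l + g * h j ^ k)"
   using f g prime_mult[OF p, of f "h j ^ l"] prime_mult[OF p, of g "h j ^ k"] R_graded_sum[OF hpow]
   by (auto intro!: prime_add[OF p] R_add simp: peval_add peval_mult peval_power power_add algebra_simps)
  thus "F + G \<in> J" unfolding J_def by blast
 next
  fix F H assume "F \<in> J"
  then obtain k f where f: "?rep F k f" unfolding J_def by blast
  obtain l H' where H': "hfun l H'" "\<And>z. z j \<noteq> 0 \<Longrightarrow> H' z = z j ^ l * peval H (rescale (1 / z j) z)"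
   using homogenization[OF j0, of H] by blast
  obtain g where g: "g \<in> R (l * d)" "\<And>x. peval g x = H' (pt x)" using hfun_R[OF H'(1)] by blast
  have "g * f \<in> R ((l + k) * d)" using R_mult[OF g(1), of f "k * d"] f by (simp add: add_mult_distrib)
  moreover have "g * f \<in> p" using prime_mult[OF p, of f g] f R_graded_sum[OF g(1)] by (simp add: mult.commute)
  ultimately have "?rep (H * F) (l + k) (g * f)" using f g(2) H'(2) by (auto simp: peval_mult ptj power_add)
  thus "H * F \<in> J" unfolding J_def by blast
 qed
 moreover have "1 \<notin> J"
 proof
  assume "1 \<in> J"
  then obtain k g where g: "g \<in> p" "\<And>x. peval (h j) x \<noteq> 0 \<Longrightarrow> peval g x = peval (h j) x ^ k" unfolding J_def by auto
  \<comment> \<open>The identity with a power of \<open>h j\<close> is known only off the zeros of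
    \<open>h j\<close>; one more factor extends it to all points.\<close>
  have "g * h j = h j ^ Suc k"
  proof (rule peval_eqD)
   fix x show "peval (g * h j) x = peval (h j ^ Suc k) x"
    using g(2)[of x] by (cases "peval (h j) x = 0") (simp_all add: peval_mult peval_power)
  qed
  hence "h j ^ Suc k \<in> p" using prime_mult[OF p g(1) hT] by simp
  thus False using prime_power[OF p hT] j(2) by blast
 qed
 ultimately obtain w where "\<forall>F\<in>J. peval F w = 0" by (rule nullstellensatz)
 hence w: "peval F w = 0" if "F \<in> J" for F using that by blast
 have zero_J: "F \<in> J" if "\<And>x. peval (h j) x \<noteq> 0 \<Longrightarrow> peval F (?y x) = 0" for F
  unfolding J_def using that prime_0[OF p] R_0[of "0 * d"] by (intro CollectI exI[of _ 0]) simp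
 have "w 0 = a" using w[OF zero_J, of "Indet 0 - Const a"] by (simp add: peval_diff coord_point_def)
 moreover have wj: "w j = 1" using w[OF zero_J, of "Indet j - 1"] j0 ptj by (simp add: peval_diff rescale_pos)
 moreover have "w i = 0" if "i > N" for i using w[OF zero_J, of "Indet i"] that by (simp add: rescale_def coord_point_def)
 moreover have "F w = 0" if F: "hfun k F" "\<forall>x. F (pt x) = 0" for k F
 proof -
  obtain P where P: "F = peval P" using hfun_range_peval[OF F(1)] by blast
  have "peval P (?y x) = 0" for x using hfun_rescale[OF F(1)] F(2) unfolding P by simp
  thus ?thesis using w[OF zero_J, of P] P by simp
 qed
 ultimately have wc: "w \<in> cone" unfolding cone_def using j0 by (auto intro!: exI[of _ j])
 have "p \<subseteq> prime_at w"
 proof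
  fix g assume g: "g \<in> p"
  have "vanishes w k (comp k g)" for k
  proof -
   let ?g = "comp k g"
   have gR: "?g \<in> R k" and gp: "?g \<in> p" using comp_in_R[OF prime_subset[OF p g]] prime_comp[OF p g] by auto
   have gd: "?g ^ d \<in> p"
   proof -
    have "?g ^ d = ?g * ?g ^ (d - 1)" using d_pos by (simp add: power_eq_if)
    thus ?thesis using prime_mult[OF p gp R_graded_sum[OF R_power[OF gR]]] by simp
   qed
   obtain F where F: "hfun k F" "\<And>x. peval (?g ^ d) x = F (pt x)" using generated[OF power_d[OF gR]] by blast
   obtain P where P: "F = peval P" using hfun_range_peval[OF F(1)] by blast
   have "?rep P k (?g ^ d)" using gd power_d[OF gR] hfun_rescale[OF F(1)] F(2) unfolding P by (simp add: power_divide)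
   hence "F w = 0" using w[of P] P unfolding J_def by blast
   thus ?thesis unfolding vanishes_def using val_eq[OF wc F] by simp
  qed
  thus "g \<in> prime_at w" unfolding prime_at_def using prime_subset[OF p g] by blast
 qed
 thus ?thesis using wc that by blast
qed

lemma proj_points_eq: "proj_points R = prime_at ` cone"
proof (intro equalityI subsetI)
 fix p assume p: "p \<in> proj_points R"
 hence "p \<in> relevant_primes R" unfolding proj_points_def by blast
 then obtain z where z: "z \<in> cone" "p \<subseteq> prime_at z" by (rule relevant_prime_point)
 hence "prime_at z = p" using p prime_at(1)[OF z(1)] unfolding proj_points_def by blast
 thus "p \<in> prime_at ` cone" using z by blast
next
 fix p assume "p \<in> prime_at ` cone"
 then obtain z where z: "z \<in> cone" "p = prime_at z" by blast
 thus "p \<in> proj_points R" unfolding proj_points_def using prime_at(1)[OF z(1)] prime_at_maximal[OF z(1)] by blast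
qed

lemma prime_at_eq_iff:
 assumes z: "z \<in> cone" and w: "w \<in> cone"
 shows "prime_at z = prime_at w \<longleftrightarrow> orbit z = orbit w"
proof
 assume eq: "prime_at z = prime_at w"
 have cross: "z i * w j = z j * w i" if ij: "i \<in> {1..N}" "j \<in> {1..N}" for i j
 proof -
  \<comment> \<open>At a point \<open>y\<close> of the cone this element takes the value
    \<open>z i * y j - z j * y i\<close>, which measures whether \<open>y\<close> and
    \<open>z\<close> are proportional in these two positions.\<close>
  let ?u = "Const (z i) * h j + Const (- z j) * h i"
  have hR: "h j \<in> R (1 * d)" "h i \<in> R (1 * d)" using h_R ij by simp_all
  have uR: "?u \<in> R (1 * d)" by (intro R_add R_Const_mult hR)
  have v: "val y 1 ?u = z i * y j - z j * y i" if y: "y \<in> cone" for y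
   unfolding val_add[OF y R_Const_mult[OF hR(1)] R_Const_mult[OF hR(2)]] val_Const_mult[OF y hR(1)] val_Const_mult[OF y hR(2)]
   using val_h[OF y] ij by simp
  have "?u \<in> prime_at w" using prime_at_veronese[OF z uR] v[OF z] eq by simp
  thus ?thesis using prime_at_veronese[OF w uR] v[OF w] by simp
 qed
 obtain i where i: "i \<in> {1..N}" "z i \<noteq> 0" using z by (rule cone_coord)
 obtain j where j: "j \<in> {1..N}" "w j \<noteq> 0" using w by (rule cone_coord)
 have wi: "w i \<noteq> 0" using cross[OF i(1) j(1)] i j by auto
 have "w = rescale (w i / z i) z"
 proof
  fix k
  consider "k = 0" | "k \<in> {1..N}" | "k > N" by fastforce
  thus "w k = rescale (w i / z i) z k"
  proof cases
   case 2
   thus ?thesis using cross[OF i(1) 2] i by (simp add: rescale_pos field_simps)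
  qed (use z w in \<open>auto simp: cone_def rescale_def\<close>)
 qed
 thus "orbit z = orbit w" using wi i by (auto simp: orbit_eq_iff intro!: exI[of _ "w i / z i"])
next
 assume "orbit z = orbit w"
 then obtain b where b: "b \<noteq> 0" "w = rescale b z" unfolding orbit_eq_iff by blast
 have "vanishes w k g \<longleftrightarrow> vanishes z k g" if g: "g \<in> R k" for k g
 proof -
  obtain F where F: "hfun k F" "\<And>x. peval (g ^ d) x = F (pt x)" using generated[OF power_d[OF g]] by blast
  have "val w k (g ^ d) = F w" by (rule val_eq[OF w F])
  also have "F w = b ^ k * F z" unfolding b(2) by (rule hfun_rescale[OF F(1)])
  finally show ?thesis unfolding vanishes_def val_eq[OF z F] using b(1) by simp
 qed
 thus "prime_at z = prime_at w" unfolding prime_at_def using comp_in_R by blast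
qed

definition quotient_value :: "'v cpoly \<Rightarrow> 'v cpoly \<Rightarrow> 'v cpoly set \<Rightarrow> complex" where
 "quotient_value f s p = (THE v. f - Const v * s \<in> p)"

text \<open>A fraction \<open>f / s\<close> of arbitrary degree gets its value by expanding it with
  \<open>s ^ (d - 1)\<close>, which moves numerator and denominator into degree
  \<open>k d\<close>.\<close>

lemma quotient_prime_at:
 assumes z: "z \<in> cone" and fs: "f \<in> R k" "s \<in> R k" "s \<notin> prime_at z"
 shows "f - Const v * s \<in> prime_at z \<longleftrightarrow> v = val z k (f * s ^ (d - 1)) / val z k (s ^ d)"
  and "quotient_value f s (prime_at z) = val z k (f * s ^ (d - 1)) / val z k (s ^ d)"
  and "f * s ^ (d - 1) \<in> R (k * d)"
proof -
 note s1 = power_pred[OF fs(2)]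
 show fR: "f * s ^ (d - 1) \<in> R (k * d)" using R_mult[OF fs(1) s1(1)] s1(2) by simp
 have sR: "s ^ d \<in> R (k * d)" by (rule power_d[OF fs(2)])
 have nz: "val z k (s ^ d) \<noteq> 0" using prime_at(2)[OF z fs(2)] fs(3) by (simp add: vanishes_def)
 have ns: "\<not> vanishes z ((d - 1) * k) (s ^ (d - 1))" using prime_at z s1 prime_power R_graded_sum fs by blast
 have 1: "f - Const v * s \<in> prime_at z \<longleftrightarrow> v = val z k (f * s ^ (d - 1)) / val z k (s ^ d)" for v
 proof -
  let ?u = "f + Const (- v) * s"
  have uR: "?u \<in> R k" by (intro R_add R_Const_mult fs)
  have "?u \<in> prime_at z \<longleftrightarrow> vanishes z (k + (d - 1) * k) (?u * s ^ (d - 1))"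
   unfolding vanishes_mult[OF z uR s1(1)] using prime_at(2)[OF z uR] ns by simp
  also have "?u * s ^ (d - 1) = f * s ^ (d - 1) + Const (- v) * (s * s ^ (d - 1))" by (simp add: algebra_simps)
  also have "\<dots> = f * s ^ (d - 1) + Const (- v) * s ^ d" unfolding s1(3) ..
  also have "vanishes z (k + (d - 1) * k) \<dots> \<longleftrightarrow> val z k (f * s ^ (d - 1)) - v * val z k (s ^ d) = 0"
   unfolding s1(2) vanishes_veronese[OF z R_add[OF fR R_Const_mult[OF sR]]]
    val_add[OF z fR R_Const_mult[OF sR]] val_Const_mult[OF z sR] by simp
  also have "\<dots> \<longleftrightarrow> v = val z k (f * s ^ (d - 1)) / val z k (s ^ d)" using nz by (auto simp: field_simps)
  finally show ?thesis by (simp add: Const_uminus)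
 qed
 show "f - Const v * s \<in> prime_at z \<longleftrightarrow> v = val z k (f * s ^ (d - 1)) / val z k (s ^ d)" by (rule 1)
 show "quotient_value f s (prime_at z) = val z k (f * s ^ (d - 1)) / val z k (s ^ d)" unfolding quotient_value_def 1 by simp
qed

section \<open>Proj as a presented space\<close>

definition Proj_basis :: "('v cpoly set set \<times> ('v cpoly set \<Rightarrow> complex)) set" where
 "Proj_basis = {({p \<in> proj_points R. s \<notin> p}, quotient_value f s) | k f s. f \<in> R k \<and> s \<in> R k}"

lemma quotient_value_iff:
 assumes "p \<in> proj_points R" "f \<in> R k" "s \<in> R k" "s \<notin> p"
 shows "f - Const v * s \<in> p \<longleftrightarrow> v = quotient_value f s p"
using assms proj_points_eq quotient_prime_at by auto

lemma Proj_presented: "presented (Proj R) Proj_basis"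
proof (rule presentedI)
 show "refining Proj_basis" unfolding refining_def
 proof (intro allI impI)
  fix E g E' g' p assume "(E, g) \<in> Proj_basis" "(E', g') \<in> Proj_basis" "p \<in> E \<inter> E'"
  then obtain k f s l f' s' where 1: "f \<in> R k" "s \<in> R k" "E = {p \<in> proj_points R. s \<notin> p}" "g = quotient_value f s"
   "f' \<in> R l" "s' \<in> R l" "E' = {p \<in> proj_points R. s' \<notin> p}" and p: "p \<in> E" "p \<in> E'" unfolding Proj_basis_def by auto
  let ?E = "{p \<in> proj_points R. s * s' \<notin> p}"
  have R: "f * s' \<in> R (k + l)" "s * s' \<in> R (k + l)" using R_mult 1 by blast+
  have prime: "s * s' \<in> q \<longleftrightarrow> s \<in> q \<or> s' \<in> q" if "q \<in> proj_points R" for q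
  proof -
   have q: "q \<in> relevant_primes R" using that unfolding proj_points_def by blast
   show ?thesis using prime_prime[OF q R_graded_sum[OF 1(2)] R_graded_sum[OF 1(6)]] prime_mult[OF q _ R_graded_sum[OF 1(6)], of s]
     prime_mult[OF q _ R_graded_sum[OF 1(2)], of s'] by (auto simp: mult.commute)
  qed
  have "?E = E \<inter> E'" using prime 1 by auto
  moreover have "quotient_value (f * s') (s * s') q = g q" if "q \<in> ?E" for q
  proof -
   have q: "q \<in> proj_points R" "s * s' \<notin> q" "s \<notin> q" using that prime by auto
   hence qr: "q \<in> relevant_primes R" unfolding proj_points_def by blast
   have "f - Const (g q) * s \<in> q" using quotient_value_iff[OF q(1) 1(1,2) q(3)] 1(4) by simp
   hence "(f - Const (g q) * s) * s' \<in> q" by (rule prime_mult[OF qr _ R_graded_sum[OF 1(6)]])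
   hence "f * s' - Const (g q) * (s * s') \<in> q" by (simp add: algebra_simps)
   thus ?thesis using quotient_value_iff[OF q(1) R q(2)] by simp
  qed
  moreover have "(?E, quotient_value (f * s') (s * s')) \<in> Proj_basis" unfolding Proj_basis_def using R by blast
  ultimately show "\<exists>D'' g''. (D'', g'') \<in> Proj_basis \<and> p \<in> D'' \<and> D'' \<subseteq> E \<inter> E' \<and> (\<forall>y\<in>D''. g'' y = g y)"
   using p by (intro exI[of _ ?E] exI[of _ "quotient_value (f * s') (s * s')"]) simp
 qed
 have "fst ` Proj_basis = {{p \<in> proj_points R. f \<notin> p} | f. f \<in> (\<Union>k. R k)}"
  unfolding Proj_basis_def by (force simp: image_def)
 thus top: "zariski (Proj R) = topology_generated_by (fst ` Proj_basis)" by (simp add: Proj_def Let_def)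
 show "u \<in> regular (Proj R) U \<longleftrightarrow> (\<forall>x\<in>U. \<exists>V D g. openin (zariski (Proj R)) V \<and>
   x \<in> V \<and> V \<subseteq> U \<and> (D, g) \<in> Proj_basis \<and> V \<subseteq> D \<and> (\<forall>y\<in>V. u y = g y))" (is "_ \<longleftrightarrow> (\<forall>x\<in>U. ?P x)") for U u
 proof -
  have sub: "V \<subseteq> proj_points R" if "openin (zariski (Proj R)) V" for V
   using openin_subset[OF that] unfolding top topology_generated_by_topspace Proj_basis_def by auto
  have "(\<exists>k. \<exists>f\<in>R k. \<exists>s\<in>R k. \<forall>q\<in>V. s \<notin> q \<and> f - Const (u q) * s \<in> q) \<longleftrightarrow>
    (\<exists>D g. (D, g) \<in> Proj_basis \<and> V \<subseteq> D \<and> (\<forall>y\<in>V. u y = g y))" if V: "openin (zariski (Proj R)) V" for V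
  proof
   assume "\<exists>k. \<exists>f\<in>R k. \<exists>s\<in>R k. \<forall>q\<in>V. s \<notin> q \<and> f - Const (u q) * s \<in> q"
   then obtain k f s where fs: "f \<in> R k" "s \<in> R k" "\<forall>q\<in>V. s \<notin> q \<and> f - Const (u q) * s \<in> q" by blast
   have "\<forall>q\<in>V. u q = quotient_value f s q" using fs quotient_value_iff sub V by force
   moreover have "V \<subseteq> {p \<in> proj_points R. s \<notin> p}" using fs(3) sub[OF V] by blast
   moreover have "({p \<in> proj_points R. s \<notin> p}, quotient_value f s) \<in> Proj_basis" unfolding Proj_basis_def using fs by blast
   ultimately show "\<exists>D g. (D, g) \<in> Proj_basis \<and> V \<subseteq> D \<and> (\<forall>y\<in>V. u y = g y)" by blast
  next
   assume "\<exists>D g. (D, g) \<in> Proj_basis \<and> V \<subseteq> D \<and> (\<forall>y\<in>V. u y = g y)"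
   then obtain k f s where fs: "f \<in> R k" "s \<in> R k" "V \<subseteq> {p \<in> proj_points R. s \<notin> p}" "\<forall>y\<in>V. u y = quotient_value f s y"
    unfolding Proj_basis_def by blast
   have "\<forall>q\<in>V. s \<notin> q \<and> f - Const (u q) * s \<in> q" using fs quotient_value_iff by blast
   thus "\<exists>k. \<exists>f\<in>R k. \<exists>s\<in>R k. \<forall>q\<in>V. s \<notin> q \<and> f - Const (u q) * s \<in> q" using fs(1,2) by blast
  qed
  moreover have "u \<in> regular (Proj R) U \<longleftrightarrow> (\<forall>p\<in>U. \<exists>V. openin (zariski (Proj R)) V \<and> p \<in> V \<and> V \<subseteq> U \<and>
       (\<exists>k. \<exists>f\<in>R k. \<exists>s\<in>R k. \<forall>q\<in>V. s \<notin> q \<and> f - Const (u q) * s \<in> q))"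
   by (simp add: Proj_def Let_def)
  ultimately show ?thesis by (simp cong: conj_cong)
 qed
qed

theorem Proj_iso:
 assumes W: "presented W (proj_basis cone)"
 shows "var_iso W (Proj R)"
proof -
 have ptsW: "points W = orbit ` cone"
 proof -
  have "x \<in> points W \<longleftrightarrow> x \<in> points (proj_space cone)" for x
   unfolding presented_points_iff[OF W] presented_points_iff[OF presented_proj_space[OF is_cone_cone]] ..
  thus ?thesis using points_proj_space[OF is_cone_cone] by blast
 qed
 have ptsP: "points (Proj R) = prime_at ` cone"
 proof -
  have "p \<in> points (Proj R) \<longleftrightarrow> p \<in> proj_points R" for p unfolding presented_points_iff[OF Proj_presented]
  using prime_not_1 R_1 unfolding proj_points_def Proj_basis_def by auto
  thus ?thesis using proj_points_eq by blast
 qed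
 define H where "H = (\<lambda>v. prime_at (orbit_rep v))"
 have H: "H (orbit z) = prime_at z" if z: "z \<in> cone" for z
 proof -
  obtain b where b: "b \<noteq> 0" "orbit_rep (orbit z) = rescale b z" by (rule orbit_rep_orbit)
  hence "rescale b z \<in> cone" using is_cone_cone z unfolding is_cone_def by blast
  thus ?thesis unfolding H_def b(2) using prime_at_eq_iff[OF _ z] orbit_rescale[OF b(1)] by simp
 qed
 have "bij_betw H (points W) (points (Proj R))" unfolding ptsW ptsP bij_betw_def inj_on_def
  using H prime_at_eq_iff by (auto simp: image_iff)
 thus ?thesis
 proof (rule presented_iso[OF W Proj_presented])
  fix E u v assume "(E, u) \<in> Proj_basis" "v \<in> points W" "H v \<in> E"
  then obtain k f s z where 1: "f \<in> R k" "s \<in> R k" "E = {p \<in> proj_points R. s \<notin> p}" "u = quotient_value f s"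
   and z: "z \<in> cone" "v = orbit z" "s \<notin> prime_at z" unfolding Proj_basis_def ptsW using H by auto
  obtain F where F: "hfun k F" "\<And>x. peval (f * s ^ (d - 1)) x = F (pt x)"
   using generated[OF quotient_prime_at(3)[OF z(1) 1(1,2) z(3)]] by blast
  obtain G where G: "hfun k G" "\<And>x. peval (s ^ d) x = G (pt x)" using generated[OF power_d[OF 1(2)]] by blast
  have sG: "s \<in> prime_at y \<longleftrightarrow> G y = 0" if "y \<in> cone" for y
   using prime_at(2)[OF that 1(2)] val_eq[OF that G] by (simp add: vanishes_def)
  have "H q \<in> E \<and> ratio F G q = u (H q)" if q: "q \<in> basic_open cone G" for q
  proof -
   obtain y where y: "y \<in> cone" "q = orbit y" "G y \<noteq> 0" using q by (rule basic_openE)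
   hence "s \<notin> prime_at y" using sG by simp
   thus ?thesis using y(1) proj_points_eq quotient_prime_at(2)[OF y(1) 1(1,2)]
    unfolding 1(3,4) y(2) H[OF y(1)] ratio_orbit[OF F(1) G(1)] val_eq[OF y(1) F] val_eq[OF y(1) G] by simp
  qed
  moreover have "v \<in> basic_open cone G" using z sG by (simp add: orbit_in_basic_open[OF is_cone_cone G(1)])
  ultimately show "\<exists>D' u'. (D', u') \<in> proj_basis cone \<and> v \<in> D' \<and> (\<forall>y\<in>D'. H y \<in> E \<and> u' y = u (H y))"
   using proj_basisI[OF F(1) G(1), of cone] by blast
 next
  fix E u v assume "(E, u) \<in> proj_basis cone" and oE: "v \<in> E"
  then obtain k F G where FG: "hfun k F" "hfun k G" "E = basic_open cone G" "u = ratio F G" by (auto elim!: proj_basisE)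
  obtain f where f: "f \<in> R (k * d)" "\<And>x. peval f x = F (pt x)" using hfun_R[OF FG(1)] by blast
  obtain g where g: "g \<in> R (k * d)" "\<And>x. peval g x = G (pt x)" using hfun_R[OF FG(2)] by blast
  have gG: "g \<in> prime_at y \<longleftrightarrow> G y = 0" if "y \<in> cone" for y
   using prime_at_veronese[OF that g(1)] val_eq[OF that FG(2) g(2)] by simp
  have qv: "quotient_value f g (prime_at y) = F y / G y" if y: "y \<in> cone" "G y \<noteq> 0" for y
  proof -
   have "Const (- (F y / G y)) * g \<in> R (k * d)" using g(1) by (rule R_Const_mult)
   hence "val y k (f + Const (- (F y / G y)) * g) = 0"
    using y val_add[OF y(1) f(1)] val_Const_mult[OF y(1) g(1)] val_eq[OF y(1) FG(1) f(2)] val_eq[OF y(1) FG(2) g(2)] by simp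
   hence "f + Const (- (F y / G y)) * g \<in> prime_at y" using prime_at_veronese[OF y(1) R_add[OF f(1) R_Const_mult[OF g(1)]]] by simp
   hence "f - Const (F y / G y) * g \<in> prime_at y" by (simp add: Const_uminus)
   thus ?thesis using quotient_value_iff[of "prime_at y", OF _ f(1) g(1)] gG[OF y(1)] y proj_points_eq by auto
  qed
  let ?E = "{p \<in> proj_points R. g \<notin> p}"
  have "(?E, quotient_value f g) \<in> Proj_basis" unfolding Proj_basis_def using f(1) g(1) by blast
  moreover have "H v \<in> ?E"
  proof -
   obtain y where y: "y \<in> cone" "v = orbit y" "G y \<noteq> 0" using oE unfolding FG(3) by (rule basic_openE)
   thus ?thesis using H gG proj_points_eq by auto
  qed
  moreover have "q \<in> E \<and> u q = quotient_value f g (H q)" if q: "q \<in> points W" "H q \<in> ?E" for q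
  using q ptsW H gG FG orbit_in_basic_open is_cone_cone ratio_orbit qv by auto
  ultimately show "\<exists>D' u'. (D', u') \<in> Proj_basis \<and> H v \<in> D' \<and> (\<forall>y\<in>points W. H y \<in> D' \<longrightarrow> y \<in> E \<and> u y = u' (H y))" by blast
 qed
qed

end

section \<open>Finitely generated cones and faces of polytopes\<close>

definition fin_cone :: "'a::real_vector set \<Rightarrow> 'a set" where
 "fin_cone T = {\<Sum>t\<in>T. c t *\<^sub>R t | c. \<forall>t\<in>T. 0 \<le> c t}"

lemma fin_coneI: "(\<And>t. t \<in> T \<Longrightarrow> 0 \<le> c t) \<Longrightarrow> (\<Sum>t\<in>T. c t *\<^sub>R t) \<in> fin_cone T"
 unfolding fin_cone_def by blast

lemma fin_cone_generator:
 assumes "finite T" "t \<in> T"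
 shows "t \<in> fin_cone T"
proof -
 have "(\<Sum>s\<in>T. (if s = t then 1 else 0) *\<^sub>R s) = (\<Sum>s\<in>T. if s = t then t else 0)" by (intro sum.cong) auto
 thus ?thesis using fin_coneI[of T "\<lambda>s. if s = t then 1 else 0"] assms by simp
qed

text \<open>
 Farkas' lemma, by induction on the number of generators: if a functional separates \<open>m\<close> from the first
 generators but is negative on the last generator \<open>b\<close>, one projects along \<open>b\<close> to its kernel.
\<close>

lemma farkas_family:
 fixes x :: "'i \<Rightarrow> 'a::real_vector"
 assumes "finite I" "\<And>c. (\<forall>i\<in>I. 0 \<le> c i) \<Longrightarrow> m \<noteq> (\<Sum>i\<in>I. c i *\<^sub>R x i)"
 shows "\<exists>u. linear u \<and> (\<forall>i\<in>I. 0 \<le> u (x i)) \<and> u m < (0::real)"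
 using assms
proof (induction I arbitrary: x m rule: finite_induct)
 case empty
 hence "m \<noteq> 0" by simp
 then obtain u :: "'a \<Rightarrow> real" where u: "linear u" "u m = -1"
  using real_vector.linear_independent_extend[of "{m}" "\<lambda>_. -1"] by auto
 thus ?case by (intro exI[of _ u]) simp
next
 case (insert b I)
 have cone: "m \<noteq> d *\<^sub>R x b + (\<Sum>i\<in>I. c i *\<^sub>R x i)" if "0 \<le> d" "\<forall>i\<in>I. 0 \<le> c i" for c d
 proof -
  have "(\<Sum>i\<in>I. (c(b := d)) i *\<^sub>R x i) = (\<Sum>i\<in>I. c i *\<^sub>R x i)" using insert.hyps by (intro sum.cong refl) auto
  thus ?thesis using insert.prems[of "c(b := d)"] insert.hyps that by simp
 qed
 have "m \<noteq> (\<Sum>i\<in>I. c i *\<^sub>R x i)" if "\<forall>i\<in>I. 0 \<le> c i" for c using cone[of 0 c] that by simp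
 then obtain u where u: "linear u" "\<forall>i\<in>I. 0 \<le> u (x i)" "u m < (0::real)" using insert.IH[of m x] by blast
 interpret u: linear u by fact
 show ?case
 proof (cases "0 \<le> u (x b)")
  case True
  thus ?thesis using u by blast
 next
  case False
  define p where "p y = y - (u y / u (x b)) *\<^sub>R x b" for y
  have lin: "linear p" unfolding p_def by (rule linearI) (simp_all add: u.add u.scale add_divide_distrib algebra_simps)
  have "p m \<noteq> (\<Sum>i\<in>I. c i *\<^sub>R p (x i))" if c: "\<forall>i\<in>I. 0 \<le> c i" for c
  proof
   \<comment> \<open>This sum is nonpositive, because \<open>u\<close> is nonnegative on the other
     generators and negative on \<open>x b\<close>; so the coefficient of \<open>x b\<close> below
     is nonnegative and \<open>m\<close> would lie in the cone.\<close>
   let ?s = "\<Sum>i\<in>I. c i * (u (x i) / u (x b))"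
   assume "p m = (\<Sum>i\<in>I. c i *\<^sub>R p (x i))"
   hence "p m = (\<Sum>i\<in>I. c i *\<^sub>R x i) - ?s *\<^sub>R x b" by (simp add: p_def algebra_simps sum_subtractf scaleR_sum_left)
   hence "m = (u m / u (x b) - ?s) *\<^sub>R x b + (\<Sum>i\<in>I. c i *\<^sub>R x i)" by (simp add: p_def algebra_simps)
   moreover have "?s \<le> 0" using c u(2) False by (intro sum_nonpos mult_nonneg_nonpos divide_nonneg_nonpos) auto
   moreover have "0 \<le> u m / u (x b)" using u(3) False by (simp add: divide_nonpos_nonpos)
   ultimately show False using cone[of "u m / u (x b) - ?s" c] c by simp
  qed
  then obtain v where v: "linear v" "\<forall>i\<in>I. 0 \<le> v (p (x i))" "v (p m) < (0::real)"
   using insert.IH[of "p m" "\<lambda>i. p (x i)"] by blast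
  have "p (x b) = 0" using False by (simp add: p_def)
  thus ?thesis using v linear_compose[OF lin v(1)] linear_0[OF v(1)] by (intro exI[of _ "v \<circ> p"]) (simp add: comp_def)
 qed
qed

lemma farkas:
 fixes T :: "'a::real_vector set"
 assumes "finite T" "m \<notin> fin_cone T"
 obtains u where "linear u" "\<And>t. t \<in> T \<Longrightarrow> 0 \<le> u t" "u m < (0::real)"
 using farkas_family[OF assms(1), of m "\<lambda>t. t"] assms(2) fin_coneI[of T] by blast

text \<open>Coefficients are indexed by \<open>I\<close> and not by the set of points, because
  different indices may give the same point.\<close>

lemma convex_hull_image_sum:
 assumes "finite I"
 shows "convex hull (x ` I) = {\<Sum>i\<in>I. c i *\<^sub>R x i | c. (\<forall>i\<in>I. 0 \<le> c i) \<and> sum c I = (1::real)}" (is "_ = ?S")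
proof (intro equalityI hull_minimal image_subsetI)
 fix j assume "j \<in> I"
 thus "x j \<in> ?S" using assms
  by (intro CollectI exI[of _ "\<lambda>i. if i = j then 1 else 0"]) (simp add: if_distrib[of "\<lambda>a. a *\<^sub>R _"] cong: if_cong)
next
 show "convex ?S"
 proof (rule convexI)
  fix p q and u v :: real assume "p \<in> ?S" "q \<in> ?S" and uv: "0 \<le> u" "0 \<le> v" "u + v = 1"
  then obtain c d where c: "p = (\<Sum>i\<in>I. c i *\<^sub>R x i)" "\<forall>i\<in>I. 0 \<le> c i" "sum c I = 1"
   and d: "q = (\<Sum>i\<in>I. d i *\<^sub>R x i)" "\<forall>i\<in>I. 0 \<le> d i" "sum d I = 1" by blast
  show "u *\<^sub>R p + v *\<^sub>R q \<in> ?S" unfolding c(1) d(1) using c(2,3) d(2,3) uv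
   by (intro CollectI exI[of _ "\<lambda>i. u * c i + v * d i"])
    (simp add: scaleR_sum_right sum.distrib scaleR_left_distrib flip: sum_distrib_left)
 qed
next
 show "?S \<subseteq> convex hull (x ` I)" by (auto intro!: convex_sum[OF assms convex_convex_hull] intro: hull_inc)
qed

text \<open>If \<open>c j < 1\<close>, the given point lies between \<open>x j\<close> and the
  weighted mean \<open>y\<close> of the other points. Unless these two coincide, it is inside an
  open segment of the hull, and a face meeting an open segment contains its ends.\<close>

lemma face_of_support:
 assumes Q: "Q face_of convex hull (x ` I)" and I: "finite I" and q: "(\<Sum>i\<in>I. c i *\<^sub>R x i) \<in> Q"
  and c: "\<forall>i\<in>I. 0 \<le> c i" "sum c I = (1::real)" and j: "j \<in> I" "c j > 0"
 shows "x j \<in> Q"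
proof -
 let ?q = "\<Sum>i\<in>I. c i *\<^sub>R x i" and ?P = "convex hull (x ` I)"
 have split: "?q = c j *\<^sub>R x j + (\<Sum>i\<in>I - {j}. c i *\<^sub>R x i)" "1 = c j + sum c (I - {j})"
  using sum.remove[OF I j(1), of "\<lambda>i. c i *\<^sub>R x i"] sum.remove[OF I j(1), of c] c(2) by simp_all
 show ?thesis
 proof (cases "c j = 1")
  case True
  hence "sum c (I - {j}) = 0" using split by simp
  hence "\<forall>i\<in>I - {j}. c i = 0" using I c(1) by (subst (asm) sum_nonneg_eq_0_iff) auto
  thus ?thesis using q True split by simp
 next
  case False
  have "0 \<le> sum c (I - {j})" using c(1) by (intro sum_nonneg) auto
  hence lt: "c j < 1" using False split by linarith
  define y where "y = (\<Sum>i\<in>I - {j}. (c i / (1 - c j)) *\<^sub>R x i)"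
  have "y \<in> ?P" unfolding y_def
  proof (rule convex_sum)
   show "(\<Sum>i\<in>I - {j}. c i / (1 - c j)) = 1" using split lt by (simp flip: sum_divide_distrib)
  qed (use I c(1) lt in \<open>auto intro: hull_inc divide_nonneg_nonneg\<close>)
  have yq: "?q = c j *\<^sub>R x j + (1 - c j) *\<^sub>R y"
   unfolding split(1) y_def scaleR_sum_right using lt by (intro arg_cong2[where f = "(+)"] refl sum.cong) auto
  show ?thesis
  proof (cases "x j = y")
   case True
   hence "?q = x j" using yq by (simp flip: scaleR_left_distrib)
   thus ?thesis using q by simp
  next
   case False
   have "?q \<in> open_segment y (x j)"
    unfolding in_segment using False yq j(2) lt by (intro conjI exI[of _ "c j"]) (auto simp: add.commute)
   thus ?thesis using Q q \<open>y \<in> ?P\<close> hull_inc[of "x j" "x ` I"] j(1) unfolding face_of_def by blast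
  qed
 qed
qed

text \<open>This is the smallest face through \<open>w\<close>, described by prolonging segments
  beyond \<open>w\<close>, so that no relative interior is needed.\<close>

lemma minimal_face:
 assumes P: "convex P" and w: "w \<in> P"
 shows "{p \<in> P. \<exists>e>0. w + e *\<^sub>R (w - p) \<in> P} face_of P" (is "?Q face_of P")
proof -
 have shrink: "w + d *\<^sub>R (w - p) \<in> P" if "w + e *\<^sub>R (w - p) \<in> P" "0 < d" "d \<le> e" for p and d e :: real
 proof -
  have "(1 - d / e) *\<^sub>R w + (d / e) *\<^sub>R (w + e *\<^sub>R (w - p)) \<in> P" using that w P by (intro convexD) auto
  moreover have "(1 - d / e) *\<^sub>R w + (d / e) *\<^sub>R (w + e *\<^sub>R (w - p)) = w + d *\<^sub>R (w - p)"
   using that by (simp add: algebra_simps)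
  ultimately show ?thesis by simp
 qed
 have seg: "a \<in> ?Q" if ab: "a \<in> P" "b \<in> P" and x: "x \<in> ?Q" "x = (1 - t) *\<^sub>R a + t *\<^sub>R b" and t: "0 < t" "t < 1" for a b x and t :: real
 proof -
  obtain e where e: "e > 0" "w + e *\<^sub>R (w - x) \<in> P" using x(1) by blast
  have pos: "1 + e * t > 0" using e t by (simp add: add_pos_pos)
  \<comment> \<open>This length comes from the convex combination below: its weights make
    \<open>b\<close> cancel and leave a point on the ray from \<open>a\<close> through
    \<open>w\<close>.\<close>
  let ?d = "e * (1 - t) / (1 + e * t)"
  have "(1 / (1 + e * t)) *\<^sub>R (w + e *\<^sub>R (w - x)) + (e * t / (1 + e * t)) *\<^sub>R b \<in> P"
   using e t ab pos by (intro convexD[OF P]) (auto simp: field_simps)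
  moreover have "(1 / (1 + e * t)) *\<^sub>R (w + e *\<^sub>R (w - x)) + (e * t / (1 + e * t)) *\<^sub>R b = w + ?d *\<^sub>R (w - a)"
  proof -
   have "(1 + e * t) *\<^sub>R ((1 / (1 + e * t)) *\<^sub>R (w + e *\<^sub>R (w - x)) + (e * t / (1 + e * t)) *\<^sub>R b) = (1 + e * t) *\<^sub>R (w + ?d *\<^sub>R (w - a))"
   proof -
    have 1: "(1 + e * t) * (1 / (1 + e * t)) = 1" "(1 + e * t) * (e * t / (1 + e * t)) = e * t" "(1 + e * t) * ?d = e * (1 - t)"
     using pos by simp_all
    show ?thesis unfolding scaleR_add_right[of "1 + e * t"] scaleR_scaleR 1 x(2) by (simp add: algebra_simps)
   qed
   thus ?thesis using pos by simp
  qed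
  ultimately have "w + ?d *\<^sub>R (w - a) \<in> P" by simp
  moreover have "?d > 0" using e t pos by simp
  ultimately show ?thesis using ab(1) by blast
 qed
 show ?thesis unfolding face_of_def
 proof (intro conjI ballI impI)
  show "?Q \<subseteq> P" by blast
  show "convex ?Q"
  proof (rule convexI)
   fix p q and u v :: real assume "p \<in> ?Q" "q \<in> ?Q" and uv: "0 \<le> u" "0 \<le> v" "u + v = 1"
   then obtain d e where pq: "p \<in> P" "q \<in> P" "d > 0" "w + d *\<^sub>R (w - p) \<in> P" "e > 0" "w + e *\<^sub>R (w - q) \<in> P" by blast
   let ?m = "min d e"
   have "w + ?m *\<^sub>R (w - p) \<in> P" "w + ?m *\<^sub>R (w - q) \<in> P" using shrink pq by auto
   hence "u *\<^sub>R (w + ?m *\<^sub>R (w - p)) + v *\<^sub>R (w + ?m *\<^sub>R (w - q)) \<in> P" using uv by (intro convexD[OF P])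
   moreover have "u *\<^sub>R (w + ?m *\<^sub>R (w - p)) + v *\<^sub>R (w + ?m *\<^sub>R (w - q)) = (u + v) *\<^sub>R (w + ?m *\<^sub>R w) - ?m *\<^sub>R (u *\<^sub>R p + v *\<^sub>R q)"
    by (simp add: algebra_simps)
   ultimately have "w + ?m *\<^sub>R (w - (u *\<^sub>R p + v *\<^sub>R q)) \<in> P" unfolding uv(3) by (simp add: algebra_simps)
   moreover have "u *\<^sub>R p + v *\<^sub>R q \<in> P" using uv pq by (intro convexD[OF P])
   ultimately show "u *\<^sub>R p + v *\<^sub>R q \<in> ?Q" using pq by (intro CollectI conjI exI[of _ ?m]) auto
  qed
  fix a b x assume ab: "a \<in> P" "b \<in> P" and x: "x \<in> ?Q" "x \<in> open_segment a b"
  then obtain t where t: "0 < t" "t < 1" "x = (1 - t) *\<^sub>R a + t *\<^sub>R b" unfolding in_segment by blast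
  hence "x = (1 - (1 - t)) *\<^sub>R b + (1 - t) *\<^sub>R a" by (simp add: add.commute)
  thus "a \<in> ?Q" "b \<in> ?Q" using seg[OF ab x(1) t(3)] seg[OF ab(2,1) x(1), of "1 - t"] t by auto
 qed
qed

section \<open>Toric varieties of polytopes\<close>

text \<open>The charts \<open>h s\<close> cover \<open>W\<close>, condition \<open>A\<close> makes
  them morphisms, and \<open>B\<close> makes their images open and lets functions descend. Thus
  \<open>W\<close> carries the glued structure, and \<open>k\<close> only renames its
  points.\<close>

lemma presented_glued_iso:
 assumes W: "presented W \<G>" and C: "\<And>s. s \<in> S \<Longrightarrow> presented (C s) (\<F> s)"
  and h: "\<And>s x. s \<in> S \<Longrightarrow> x \<in> points (C s) \<Longrightarrow> h s x \<in> points W"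
  and cover: "\<And>w. w \<in> points W \<Longrightarrow> \<exists>s\<in>S. \<exists>x\<in>points (C s). w = h s x"
  and A: "\<And>s D p x. s \<in> S \<Longrightarrow> (D, p) \<in> \<G> \<Longrightarrow> x \<in> points (C s) \<Longrightarrow> h s x \<in> D \<Longrightarrow>
   \<exists>D' p'. (D', p') \<in> \<F> s \<and> x \<in> D' \<and> (\<forall>y\<in>D'. h s y \<in> D \<and> p' y = p (h s y))"
  and B: "\<And>s D p x. s \<in> S \<Longrightarrow> (D, p) \<in> \<F> s \<Longrightarrow> x \<in> D \<Longrightarrow>
   \<exists>D' p'. (D', p') \<in> \<G> \<and> h s x \<in> D' \<and> (\<forall>w\<in>D'. \<exists>y\<in>D. w = h s y \<and> p y = p' w)"
  and k: "inj_on k (points W)"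
  and opn: "\<And>V. openin (zariski T) V \<longleftrightarrow> V \<subseteq> k ` points W \<and>
   (\<forall>s\<in>S. openin (zariski (C s)) {x \<in> points (C s). k (h s x) \<in> V})"
  and reg: "\<And>V f. openin (zariski T) V \<Longrightarrow> f \<in> regular T V \<longleftrightarrow>
   (\<forall>s\<in>S. (f \<circ> k) \<circ> h s \<in> regular (C s) {x \<in> points (C s). k (h s x) \<in> V})"
 shows "var_iso W T"
proof -
 have mor: "var_morphism (C s) W (h s)" if "s \<in> S" for s
  by (rule presented_morphism[OF C[OF that] W, where h = "h s"]) (rule h[OF that] A[OF that], assumption+)+
 have open_iff: "openin (zariski W) U \<longleftrightarrow> (\<forall>s\<in>S. openin (zariski (C s)) (preim (C s) (h s) U))"
  if U: "U \<subseteq> points W" for U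
 proof
  assume "openin (zariski W) U"
  thus "\<forall>s\<in>S. openin (zariski (C s)) (preim (C s) (h s) U)"
   using mor unfolding var_morphism_def continuous_map_def preim_def by blast
 next
  assume R: "\<forall>s\<in>S. openin (zariski (C s)) (preim (C s) (h s) U)"
  show "openin (zariski W) U"
  proof (rule presented_openI[OF W])
   fix w assume w: "w \<in> U"
   then obtain s x where x: "s \<in> S" "x \<in> points (C s)" "w = h s x" using cover U by blast
   hence "x \<in> preim (C s) (h s) U" using w by (simp add: preim_def)
   then obtain D p where D: "(D, p) \<in> \<F> s" "x \<in> D" "D \<subseteq> preim (C s) (h s) U"
    using presented_openE[OF C[OF x(1)] bspec[OF R x(1)]] by blast
   from B[OF x(1) D(1,2)] obtain D' p' where D': "(D', p') \<in> \<G>" "w \<in> D'" "\<forall>v\<in>D'. \<exists>y\<in>D. v = h s y \<and> p y = p' v"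
    unfolding x(3) by (elim exE conjE)
   have "v \<in> U" if v: "v \<in> D'" for v
   proof -
    obtain y where "y \<in> D" "v = h s y" using D'(3) v by blast
    thus ?thesis using D(3) unfolding preim_def by auto
   qed
   thus "\<exists>D p. (D, p) \<in> \<G> \<and> w \<in> D \<and> D \<subseteq> U" using D' by blast
  qed
 qed
 have reg_iff: "f \<in> regular W U \<longleftrightarrow> (\<forall>s\<in>S. f \<circ> h s \<in> regular (C s) (preim (C s) (h s) U))"
  if U: "openin (zariski W) U" for U f
 proof
  assume "f \<in> regular W U"
  thus "\<forall>s\<in>S. f \<circ> h s \<in> regular (C s) (preim (C s) (h s) U)" using mor U unfolding var_morphism_def by blast
 next
  assume R: "\<forall>s\<in>S. f \<circ> h s \<in> regular (C s) (preim (C s) (h s) U)"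
  have pre: "openin (zariski (C s)) (preim (C s) (h s) U)" if "s \<in> S" for s using open_iff[OF openin_subset[OF U]] U that by blast
  show "f \<in> regular W U"
  proof (rule presented_regularI[OF W U])
   fix w assume w: "w \<in> U"
   then obtain s x where x: "s \<in> S" "x \<in> points (C s)" "w = h s x" using cover openin_subset[OF U] by blast
   hence "x \<in> preim (C s) (h s) U" using w by (simp add: preim_def)
   then obtain D p where D: "(D, p) \<in> \<F> s" "x \<in> D" "D \<subseteq> preim (C s) (h s) U" "\<And>y. y \<in> D \<Longrightarrow> (f \<circ> h s) y = p y"
    using presented_regularE[OF C[OF x(1)] pre[OF x(1)] bspec[OF R x(1)]] by blast
   from B[OF x(1) D(1,2)] obtain D' p' where D': "(D', p') \<in> \<G>" "w \<in> D'" "\<forall>v\<in>D'. \<exists>y\<in>D. v = h s y \<and> p y = p' v"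
    unfolding x(3) by (elim exE conjE)
   have "v \<in> U \<and> f v = p' v" if v: "v \<in> D'" for v
   proof -
    obtain y where "y \<in> D" "v = h s y" "p y = p' v" using D'(3) v by blast
    thus ?thesis using D(3,4) unfolding preim_def by auto
   qed
   thus "near \<G> w U f" using D' by blast
  qed
 qed
 have pts: "openin (zariski T) V \<Longrightarrow> V \<subseteq> k ` points W" for V using opn by blast
 have pre: "{x \<in> points (C s). k (h s x) \<in> V} = preim (C s) (h s) (preim W k V)" if "s \<in> S" for s V
  using h[OF that] unfolding preim_def by blast
 have opn': "openin (zariski T) V \<longleftrightarrow> V \<subseteq> k ` points W \<and> openin (zariski W) (preim W k V)" for V
 proof -
  have "preim W k V \<subseteq> points W" by (auto simp: preim_def)
  thus ?thesis unfolding opn by (simp add: open_iff pre)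
 qed
 have top: "points T = k ` points W"
 proof
  show "points T \<subseteq> k ` points W" by (rule pts) (rule openin_topspace)
  have "preim W k (k ` points W) = points W" by (auto simp: preim_def)
  hence "openin (zariski T) (k ` points W)" unfolding opn' by simp
  thus "k ` points W \<subseteq> points T" by (rule openin_subset)
 qed
 have im: "preim W k (k ` U) = U" if "U \<subseteq> points W" for U using that k unfolding preim_def inj_on_def by blast
 have "homeomorphic_map (zariski W) (zariski T) k"
 proof (rule bijective_open_imp_homeomorphic_map)
  show "continuous_map (zariski W) (zariski T) k" unfolding continuous_map_def preim_def[symmetric] using opn' top by auto
  show "open_map (zariski W) (zariski T) k" unfolding open_map_def
  proof (intro allI impI)
   fix U assume U: "openin (zariski W) U"
   show "openin (zariski T) (k ` U)" unfolding opn' im[OF openin_subset[OF U]] using U openin_subset[OF U] by blast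
  qed
 qed (use k top in auto)
 moreover have "f \<in> regular T V \<longleftrightarrow> f \<circ> k \<in> regular W (preim W k V)" if V: "openin (zariski T) V" for V f
 proof -
  have "openin (zariski W) (preim W k V)" using V opn' by blast
  thus ?thesis unfolding reg[OF V] by (simp add: reg_iff pre)
 qed
 ultimately show ?thesis unfolding var_iso_def by blast
qed

declare One_nat_def [simp del]

definition nonneg_comb :: "(nat \<Rightarrow> 'a::real_vector) \<Rightarrow> nat \<Rightarrow> real \<Rightarrow> 'a \<Rightarrow> bool" where
 "nonneg_comb A N k m \<longleftrightarrow> (\<exists>l. (\<forall>j\<in>{1..N}. 0 \<le> l j) \<and> m = (\<Sum>j\<in>{1..N}. l j *\<^sub>R A j) \<and> sum l {1..N} = k)"

lemma nonneg_comb_single: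
 assumes "j \<in> {1..N}" "0 \<le> a"
 shows "nonneg_comb A N a (a *\<^sub>R A j)"
 unfolding nonneg_comb_def
proof (intro exI conjI)
 let ?l = "\<lambda>i. if i = j then a else 0"
 show "\<forall>i\<in>{1..N}. 0 \<le> ?l i" using assms(2) by simp
 have "(\<Sum>i\<in>{1..N}. ?l i *\<^sub>R A i) = (\<Sum>i\<in>{1..N}. if i = j then a *\<^sub>R A j else 0)" by (intro sum.cong) auto
 thus "a *\<^sub>R A j = (\<Sum>i\<in>{1..N}. ?l i *\<^sub>R A i)" using assms(1) by simp
 show "sum ?l {1..N} = a" using assms(1) by simp
qed

lemma nonneg_comb_add:
 assumes "nonneg_comb A N k m" "nonneg_comb A N k' m'"
 shows "nonneg_comb A N (k + k') (m + m')"
proof -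
 obtain l l' where "\<forall>j\<in>{1..N}. 0 \<le> l j" "m = (\<Sum>j\<in>{1..N}. l j *\<^sub>R A j)" "sum l {1..N} = k"
  "\<forall>j\<in>{1..N}. 0 \<le> l' j" "m' = (\<Sum>j\<in>{1..N}. l' j *\<^sub>R A j)" "sum l' {1..N} = k'"
  using assms unfolding nonneg_comb_def by blast
 thus ?thesis unfolding nonneg_comb_def by (intro exI[of _ "\<lambda>j. l j + l' j"]) (simp add: sum.distrib scaleR_left_distrib)
qed

lemma nonneg_comb_0: "nonneg_comb A N 0 0"
 unfolding nonneg_comb_def by (intro exI[of _ "\<lambda>_. 0"]) simp

lemma nonneg_comb_scale:
 assumes "nonneg_comb A N k m" "0 \<le> a"
 shows "nonneg_comb A N (a * k) (a *\<^sub>R m)"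
proof -
 obtain l where "\<forall>j\<in>{1..N}. 0 \<le> l j" "m = (\<Sum>j\<in>{1..N}. l j *\<^sub>R A j)" "sum l {1..N} = k"
  using assms unfolding nonneg_comb_def by blast
 thus ?thesis using assms(2) unfolding nonneg_comb_def
  by (intro exI[of _ "\<lambda>j. a * l j"]) (auto simp: sum_distrib_left[symmetric] scaleR_sum_right)
qed

lemma nonneg_comb_sum:
 assumes "\<And>t. t \<in> T \<Longrightarrow> nonneg_comb A N (k t) (m t)"
 shows "nonneg_comb A N (sum k T) (sum m T)"
 using assms by (induction T rule: infinite_finite_induct) (simp_all add: nonneg_comb_0 nonneg_comb_add)

lemma nonneg_comb_hull: "p \<in> convex hull (A ` {1..N}) \<longleftrightarrow> nonneg_comb A N 1 p"
 unfolding convex_hull_image_sum[OF finite_atLeastAtMost] nonneg_comb_def by blast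

abbreviation lsum :: "(nat \<Rightarrow> 'a::comm_monoid_add) \<Rightarrow> nat list \<Rightarrow> 'a" where
 "lsum A xs \<equiv> sum_list (map A xs)"

abbreviation lprod :: "cvec \<Rightarrow> nat list \<Rightarrow> complex" where
 "lprod z xs \<equiv> prod_list (map z xs)"

lemma lprod_eq_0_iff: "lprod z xs = 0 \<longleftrightarrow> (\<exists>x\<in>set xs. z x = 0)"
 by (induction xs) auto

lemma lsum_concat_replicate:
 fixes A :: "nat \<Rightarrow> 'a::real_vector"
 assumes "finite T"
 obtains ys where "set ys \<subseteq> b ` T" "length ys = (\<Sum>t\<in>T. n t)" "lsum A ys = (\<Sum>t\<in>T. real (n t) *\<^sub>R A (b t))"
proof -
 have rep: "sum_list (replicate k x) = real k *\<^sub>R x" for k and x :: 'a by (induction k) (simp_all add: scaleR_left_distrib)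
 have "\<exists>ys. set ys \<subseteq> b ` T \<and> length ys = (\<Sum>t\<in>T. n t) \<and> lsum A ys = (\<Sum>t\<in>T. real (n t) *\<^sub>R A (b t))"
  using assms
 proof (induction T)
  case empty
  show ?case by (intro exI[of _ "[]"]) simp
 next
  case (insert t T)
  then obtain ys where "set ys \<subseteq> b ` T" "length ys = (\<Sum>t\<in>T. n t)" "lsum A ys = (\<Sum>t\<in>T. real (n t) *\<^sub>R A (b t))"
   by blast
  thus ?case using insert.hyps by (intro exI[of _ "replicate (n t) (b t) @ ys"]) (auto simp: rep)
 qed
 thus ?thesis using that by blast
qed

text \<open>By \<open>gen\<close>, lattice points of the multiple \<open>k P\<close> are sums of
  \<open>k\<close> of the \<open>A j\<close>. The case \<open>k = 1\<close> says that the
  \<open>A j\<close> are all the lattice points of \<open>P\<close>, not only its vertices.\<close>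

locale toric =
 fixes M :: "'a::real_vector set" and A :: "nat \<Rightarrow> 'a" and N :: nat
 assumes M_0: "0 \<in> M" and M_add: "x \<in> M \<Longrightarrow> y \<in> M \<Longrightarrow> x + y \<in> M" and M_diff: "x \<in> M \<Longrightarrow> y \<in> M \<Longrightarrow> x - y \<in> M"
  and A_M: "j \<in> {1..N} \<Longrightarrow> A j \<in> M"
  and gen: "m \<in> M \<Longrightarrow> nonneg_comb A N (real k) m \<Longrightarrow> \<exists>xs. length xs = k \<and> set xs \<subseteq> {1..N} \<and> m = lsum A xs"
begin

definition P where "P = convex hull (A ` {1..N})"

abbreviation L where "L \<equiv> direction P"

abbreviation Lat where "Lat \<equiv> M \<inter> L"

text \<open>For nonempty \<open>B\<close> this is the normal cone of the smallest face containing
  all \<open>A b\<close>. Indexing cones by sets of lattice points turns the intersection of cones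
  into the union of index sets.\<close>

definition ncone :: "nat set \<Rightarrow> ('a \<Rightarrow> real) set" where
 "ncone B = {u \<in> dual_space L. \<forall>i\<in>{1..N}. \<forall>b\<in>B. 0 \<le> u (A i - A b)}"

definition semig :: "nat set \<Rightarrow> 'a set" where
 "semig B = dual_semigroup Lat (ncone B)"

abbreviation chars where "chars B \<equiv> semigroup_points (semig B)"

lemma A_P: "i \<in> {1..N} \<Longrightarrow> A i \<in> P"
 unfolding P_def by (intro hull_inc) auto

lemma diff_L: "p \<in> P \<Longrightarrow> q \<in> P \<Longrightarrow> p - q \<in> L"
 unfolding direction_def by (intro real_vector.span_base) blast

lemma subspace_L: "subspace L"
 unfolding direction_def by (rule subspace_span)

lemma lsum_M: "set xs \<subseteq> {1..N} \<Longrightarrow> lsum A xs \<in> M"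
 by (induction xs) (auto intro!: M_0 M_add A_M)

lemma dual_spaceE:
 assumes "u \<in> dual_space L'"
 obtains v where "linear v" "\<And>x. x \<in> L' \<Longrightarrow> u x = v x" using assms unfolding dual_space_def by force

lemma semig_0: "0 \<in> semig B"
proof -
 have "u 0 = 0" if "u \<in> dual_space L" for u using that by (rule dual_spaceE) (use subspace_0[OF subspace_L] linear_0 in force)
 hence "\<forall>u\<in>ncone B. 0 \<le> u 0" unfolding ncone_def by force
 thus ?thesis unfolding semig_def dual_semigroup_def using M_0 subspace_0[OF subspace_L] by blast
qed

lemma semig_add: "x \<in> semig B \<Longrightarrow> y \<in> semig B \<Longrightarrow> x + y \<in> semig B"
proof -
 assume x: "x \<in> semig B" and y: "y \<in> semig B"
 hence L: "x \<in> L" "y \<in> L" and M: "x \<in> M" "y \<in> M" and u: "\<forall>u\<in>ncone B. 0 \<le> u x" "\<forall>u\<in>ncone B. 0 \<le> u y"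
  unfolding semig_def dual_semigroup_def by auto
 have "u (x + y) = u x + u y" if "u \<in> dual_space L" for u
  using that by (rule dual_spaceE) (use L subspace_add[OF subspace_L L] linear_add in metis)
 hence "v (x + y) = v x + v y" if "v \<in> ncone B" for v using that unfolding ncone_def by blast
 hence "\<forall>v\<in>ncone B. 0 \<le> v (x + y)" using u by fastforce
 thus ?thesis using subspace_add[OF subspace_L L] M_add[OF M] unfolding semig_def dual_semigroup_def by blast
qed

lemma diff_semig:
 assumes "i \<in> {1..N}" "b \<in> B" "B \<subseteq> {1..N}"
 shows "A i - A b \<in> semig B"
using assms M_diff A_M diff_L A_P unfolding semig_def dual_semigroup_def ncone_def by blast

lemma lsum_diff_semig:
 assumes "length xs = length ys" "set xs \<subseteq> {1..N}" "set ys \<subseteq> B" "B \<subseteq> {1..N}"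
 shows "lsum A xs - lsum A ys \<in> semig B"
 using assms
proof (induction xs ys rule: list_induct2)
 case Nil
 show ?case using semig_0 by simp
next
 case (Cons x xs y ys)
 have "lsum A (x # xs) - lsum A (y # ys) = (A x - A y) + (lsum A xs - lsum A ys)" by simp
 thus ?case using Cons semig_add[OF diff_semig[of x y]] by (simp only:) simp
qed

text \<open>
 The saturated semigroup of a chart is generated by the differences \<open>A i - A b\<close>: by Farkas' lemma an
 element is a nonnegative real combination of them, and adding enough \<open>A b\<close> gives a lattice point of
 a multiple of the polytope.
\<close>

lemma semigE:
 assumes m: "m \<in> semig B" and B: "B \<subseteq> {1..N}"
 obtains xs ys where "length xs = length ys" "set xs \<subseteq> {1..N}" "set ys \<subseteq> B" "m = lsum A xs - lsum A ys"
proof -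
 define T where "T = (\<lambda>(i, b). A i - A b) ` ({1..N} \<times> B)"
 have finB: "finite B" using B finite_subset by blast
 hence finT: "finite T" unfolding T_def by auto
 have "m \<in> fin_cone T"
 proof (rule ccontr)
  assume "m \<notin> fin_cone T"
  then obtain u where u: "linear u" "\<And>t. t \<in> T \<Longrightarrow> 0 \<le> u t" "u m < (0::real)" by (rule farkas[OF finT]) blast
  have "restrict u L \<in> ncone B" unfolding ncone_def
  proof (intro CollectI conjI ballI)
   show "restrict u L \<in> dual_space L" using u(1) unfolding dual_space_def by blast
   fix i b assume ib: "i \<in> {1..N}" "b \<in> B"
   hence "A i - A b \<in> L" using B by (intro diff_L A_P) auto
   moreover have "A i - A b \<in> T" unfolding T_def using ib by force
   ultimately show "0 \<le> restrict u L (A i - A b)" using u(2) by simp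
  qed
  hence "0 \<le> restrict u L m" using m unfolding semig_def dual_semigroup_def by blast
  moreover have "m \<in> L" using m unfolding semig_def dual_semigroup_def by blast
  ultimately show False using u(3) by simp
 qed
 then obtain c where c: "m = (\<Sum>t\<in>T. c t *\<^sub>R t)" "\<forall>t\<in>T. 0 \<le> c t" unfolding fin_cone_def by blast
 have "\<forall>t\<in>T. \<exists>ib. fst ib \<in> {1..N} \<and> snd ib \<in> B \<and> t = A (fst ib) - A (snd ib)" unfolding T_def by force
 then obtain ib where "\<forall>t\<in>T. fst (ib t) \<in> {1..N} \<and> snd (ib t) \<in> B \<and> t = A (fst (ib t)) - A (snd (ib t))" by metis
 hence ib: "\<And>t. t \<in> T \<Longrightarrow> i t \<in> {1..N}" "\<And>t. t \<in> T \<Longrightarrow> b t \<in> B" "\<And>t. t \<in> T \<Longrightarrow> t = A (i t) - A (b t)"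
  if "i = fst \<circ> ib" "b = snd \<circ> ib" for i b using that by auto
 define i b where "i = fst \<circ> ib" and "b = snd \<circ> ib"
 note ib = ib[OF this]
 \<comment> \<open>With \<open>n t\<close> at least \<open>c t\<close>, adding \<open>n t\<close>
   copies of \<open>A (b t)\<close> replaces a multiple of a difference by a combination with
   coefficients \<open>c t\<close> and \<open>n t - c t\<close>, both nonnegative and of integral
   total \<open>n t\<close>.\<close>
 define n where "n t = nat \<lceil>c t\<rceil>" for t
 have n: "c t \<le> real (n t)" for t unfolding n_def by linarith
 obtain ys where ys: "set ys \<subseteq> b ` T" "length ys = (\<Sum>t\<in>T. n t)" "lsum A ys = (\<Sum>t\<in>T. real (n t) *\<^sub>R A (b t))"
  using lsum_concat_replicate[OF finT] by blast
 have ysB: "set ys \<subseteq> B" using ys(1) ib(2) by blast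
 have "m + lsum A ys = (\<Sum>t\<in>T. c t *\<^sub>R A (i t) + (real (n t) - c t) *\<^sub>R A (b t))"
 proof -
  have "m = (\<Sum>t\<in>T. c t *\<^sub>R (A (i t) - A (b t)))" unfolding c(1) using ib(3) by (intro sum.cong) auto
  thus ?thesis unfolding ys(3) by (simp add: sum.distrib[symmetric] scaleR_diff_right scaleR_diff_left algebra_simps)
 qed
 moreover have "nonneg_comb A N (\<Sum>t\<in>T. c t + (real (n t) - c t)) (\<Sum>t\<in>T. c t *\<^sub>R A (i t) + (real (n t) - c t) *\<^sub>R A (b t))"
 proof (intro nonneg_comb_sum nonneg_comb_add nonneg_comb_single)
  fix t assume "t \<in> T"
  thus "i t \<in> {1..N}" "0 \<le> c t" "b t \<in> {1..N}" "0 \<le> real (n t) - c t"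
   using ib(1)[of t] ib(2)[of t] subsetD[OF B, of "b t"] c(2) n[of t] by simp_all
 qed
 ultimately have "nonneg_comb A N (real (length ys)) (m + lsum A ys)" unfolding ys(2) by simp
 moreover have "m + lsum A ys \<in> M" using m lsum_M[of ys] ysB B unfolding semig_def dual_semigroup_def by (intro M_add) auto
 ultimately obtain xs where "length xs = length ys" "set xs \<subseteq> {1..N}" "m + lsum A ys = lsum A xs" using gen by blast
 thus ?thesis using ysB by (intro that[of xs ys]) (auto simp: eq_diff_eq)
qed

section \<open>The binomial cone and its charts\<close>

definition Y0 :: "cvec set" where
 "Y0 = {z. z 0 = 0 \<and> (\<forall>j>N. z j = 0) \<and> (\<exists>j\<in>{1..N}. z j \<noteq> 0) \<and>
   (\<forall>xs ys. set xs \<subseteq> {1..N} \<longrightarrow> set ys \<subseteq> {1..N} \<longrightarrow> length xs = length ys \<longrightarrow> lsum A xs = lsum A ys \<longrightarrow>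
    lprod z xs = lprod z ys)}"

definition charts :: "nat set \<Rightarrow> cvec set" where
 "charts B = {z \<in> Y0. \<forall>b\<in>B. z b \<noteq> 0}"

lemma Y0_eq:
 assumes "z \<in> Y0" "set xs \<subseteq> {1..N}" "set ys \<subseteq> {1..N}" "length xs = length ys" "lsum A xs = lsum A ys"
 shows "lprod z xs = lprod z ys"
 using assms unfolding Y0_def by blast

lemma lprod_rescale: "set xs \<subseteq> {1..N} \<Longrightarrow> lprod (rescale a z) xs = a ^ length xs * lprod z xs"
 by (induction xs) (auto simp: rescale_def)

lemma Y0_rescale:
 assumes "z \<in> Y0" "a \<noteq> 0"
 shows "rescale a z \<in> Y0"
 unfolding Y0_def
proof (intro CollectI conjI allI impI)
 obtain j where "j \<in> {1..N}" "z j \<noteq> 0" using assms(1) unfolding Y0_def by blast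
 thus "\<exists>j\<in>{1..N}. rescale a z j \<noteq> 0" using assms(2) by (intro bexI[of _ j]) (auto simp: rescale_def)
 show "rescale a z j = 0" if "N < j" for j using assms(1) that unfolding Y0_def rescale_def by simp
 show "rescale a z 0 = 0" using assms(1) unfolding Y0_def by simp
 fix xs ys assume "set xs \<subseteq> {1..N}" "set ys \<subseteq> {1..N}" "length xs = length ys" "lsum A xs = lsum A ys"
 thus "lprod (rescale a z) xs = lprod (rescale a z) ys"
  using Y0_eq[OF assms(1), of xs ys] lprod_rescale[of xs a z] lprod_rescale[of ys a z] by presburger
qed

lemma is_cone_Y0: "is_cone Y0"
 unfolding is_cone_def using Y0_rescale by blast

text \<open>The homogeneous coordinates of a character of the chart semigroup, normalized to 1 in
  position \<open>b\<close>. Another choice of \<open>b\<close> rescales them.\<close>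

definition point :: "('a \<Rightarrow> complex) \<Rightarrow> nat \<Rightarrow> nat \<Rightarrow> complex" where
 "point g b = (\<lambda>j. if j \<in> {1..N} then g (A j - A b) else 0)"

lemma sp_add: "g \<in> semigroup_points S \<Longrightarrow> m \<in> S \<Longrightarrow> m' \<in> S \<Longrightarrow> g (m + m') = g m * g m'"
 and sp_0: "g \<in> semigroup_points S \<Longrightarrow> g 0 = 1" unfolding semigroup_points_def by auto

lemma lprod_point:
 assumes g: "g \<in> chars B" and b: "b \<in> B" "B \<subseteq> {1..N}" and xs: "set xs \<subseteq> {1..N}"
 shows "lprod (point g b) xs = g (lsum A xs - real (length xs) *\<^sub>R A b)" (is ?eq)
  and "lsum A xs - real (length xs) *\<^sub>R A b \<in> semig B" (is ?mem)
proof -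
 have "?eq \<and> ?mem" using xs
 proof (induction xs)
  case Nil
  show ?case using sp_0[OF g] semig_0 by simp
 next
  case (Cons x xs)
  have 1: "A x - A b \<in> semig B" using Cons.prems b by (intro diff_semig) auto
  have 2: "lsum A (x # xs) - real (length (x # xs)) *\<^sub>R A b = (A x - A b) + (lsum A xs - real (length xs) *\<^sub>R A b)"
   by (simp add: scaleR_left_distrib)
  have IH: "lprod (point g b) xs = g (lsum A xs - real (length xs) *\<^sub>R A b)" "lsum A xs - real (length xs) *\<^sub>R A b \<in> semig B"
   using Cons by auto
  have "point g b x = g (A x - A b)" using Cons.prems by (simp add: point_def)
  thus ?case unfolding 2 using IH sp_add[OF g 1 IH(2)] semig_add[OF 1 IH(2)] by simp
 qed
 thus ?eq ?mem by auto
qed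

lemma point_charts:
 assumes g: "g \<in> chars B" and b: "b \<in> B" "B \<subseteq> {1..N}"
 shows "point g b \<in> charts B"
proof -
 have nz: "point g b b' \<noteq> 0" if "b' \<in> B" for b'
 proof -
  have "A b' - A b \<in> semig B" "A b - A b' \<in> semig B" using that b by (auto intro!: diff_semig)
  hence "g (A b' - A b) * g (A b - A b') = g 0" using sp_add[OF g] by force
  hence "g (A b' - A b) \<noteq> 0" using sp_0[OF g] by auto
  thus ?thesis using that b by (auto simp: point_def)
 qed
 have "point g b \<in> Y0" unfolding Y0_def
 proof (intro CollectI conjI allI impI)
  show "\<exists>j\<in>{1..N}. point g b j \<noteq> 0" using nz[OF b(1)] b by blast
  fix xs ys :: "nat list" assume "set xs \<subseteq> {1..N}" "set ys \<subseteq> {1..N}" "length xs = length ys" "lsum A xs = lsum A ys"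
  thus "lprod (point g b) xs = lprod (point g b) ys" using lprod_point(1)[OF g b] by simp
 qed (auto simp: point_def)
 thus ?thesis using nz unfolding charts_def by blast
qed

lemma point_quot:
 assumes g: "g \<in> chars B" and b: "b \<in> B" "B \<subseteq> {1..N}"
  and l: "length xs = length ys" and xs: "set xs \<subseteq> {1..N}" and ys: "set ys \<subseteq> B"
 shows "g (lsum A xs - lsum A ys) * lprod (point g b) ys = lprod (point g b) xs"
proof -
 have ys': "set ys \<subseteq> {1..N}" using ys b(2) by blast
 have "lsum A xs - lsum A ys + (lsum A ys - real (length ys) *\<^sub>R A b) = lsum A xs - real (length xs) *\<^sub>R A b" using l by simp
 thus ?thesis
  using sp_add[OF g lsum_diff_semig[OF l xs ys b(2)] lprod_point(2)[OF g b ys']] lprod_point(1)[OF g b ys'] lprod_point(1)[OF g b xs] by presburger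
qed

lemma point_change:
 assumes g: "g \<in> chars B" and b: "b \<in> B" "b' \<in> B" "B \<subseteq> {1..N}"
 shows "point g b' = rescale (g (A b - A b')) (point g b)" "g (A b - A b') \<noteq> 0"
proof -
 show "point g b' = rescale (g (A b - A b')) (point g b)"
 proof
  fix j show "point g b' j = rescale (g (A b - A b')) (point g b) j"
  proof (cases "j \<in> {1..N}")
   case True
   have "A b - A b' \<in> semig B" "A j - A b \<in> semig B" using True b by (auto intro!: diff_semig)
   hence "g ((A b - A b') + (A j - A b)) = g (A b - A b') * g (A j - A b)" by (rule sp_add[OF g])
   thus ?thesis using True by (simp add: point_def rescale_def)
  qed (simp add: point_def rescale_def)
 qed
 have "point g b' b \<noteq> 0" using point_charts[OF g b(2,3)] b(1) unfolding charts_def by blast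
 thus "g (A b - A b') \<noteq> 0" using b by (auto simp: point_def)
qed

text \<open>The inverse of \<open>point\<close>, up to rescaling. The quotient does not depend on
  the two words, since the binomial equations hold for \<open>z\<close> and the coordinates in
  \<open>B\<close> do not vanish.\<close>

definition chi :: "nat set \<Rightarrow> cvec \<Rightarrow> 'a \<Rightarrow> complex" where
 "chi B z = restrict (\<lambda>m. SOME v. \<exists>xs ys. length xs = length ys \<and> set xs \<subseteq> {1..N} \<and> set ys \<subseteq> B \<and>
   m = lsum A xs - lsum A ys \<and> v = lprod z xs / lprod z ys) (semig B)"

lemma chi_eq:
 assumes z: "z \<in> charts B" and B: "B \<subseteq> {1..N}" and l: "length xs = length ys" and xs: "set xs \<subseteq> {1..N}" and ys: "set ys \<subseteq> B"
 shows "chi B z (lsum A xs - lsum A ys) = lprod z xs / lprod z ys"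
proof -
 let ?Q = "\<lambda>v. \<exists>xs' ys'. length xs' = length ys' \<and> set xs' \<subseteq> {1..N} \<and> set ys' \<subseteq> B \<and>
   lsum A xs - lsum A ys = lsum A xs' - lsum A ys' \<and> v = lprod z xs' / lprod z ys'"
 have "v = lprod z xs / lprod z ys" if Q: "?Q v" for v
 proof -
  obtain xs' ys' where 1: "length xs' = length ys'" "set xs' \<subseteq> {1..N}" "set ys' \<subseteq> B"
   "lsum A xs - lsum A ys = lsum A xs' - lsum A ys'" "v = lprod z xs' / lprod z ys'" using Q by (elim exE conjE)
  have "lsum A (xs @ ys') = lsum A (xs' @ ys)" using 1(4) by (simp add: diff_eq_eq algebra_simps)
  hence "lprod z (xs @ ys') = lprod z (xs' @ ys)" using z 1 l xs ys B unfolding charts_def by (intro Y0_eq) auto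
  moreover have "lprod z ys \<noteq> 0" "lprod z ys' \<noteq> 0" using z ys 1(3) unfolding charts_def lprod_eq_0_iff by auto
  ultimately show ?thesis unfolding 1(5) by (simp add: frac_eq_eq mult.commute)
 qed
 moreover have "?Q (lprod z xs / lprod z ys)" using l xs ys by blast
 ultimately have "(SOME v. ?Q v) = lprod z xs / lprod z ys" by (rule some_equality[rotated])
 thus ?thesis unfolding chi_def using lsum_diff_semig[OF l xs ys B] by simp
qed

lemma chi_semigroup_points:
 assumes z: "z \<in> charts B" and B: "B \<subseteq> {1..N}"
 shows "chi B z \<in> chars B"
 unfolding semigroup_points_def
proof (intro CollectI conjI ballI)
 show "chi B z \<in> extensional (semig B)" by (simp add: chi_def)
 show "chi B z 0 = 1" using chi_eq[OF z B, of "[]" "[]"] by simp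
 fix m m' assume m: "m \<in> semig B" and m': "m' \<in> semig B"
 obtain xs ys where 1: "length xs = length ys" "set xs \<subseteq> {1..N}" "set ys \<subseteq> B" "m = lsum A xs - lsum A ys"
  by (rule semigE[OF m B])
 obtain xs' ys' where 2: "length xs' = length ys'" "set xs' \<subseteq> {1..N}" "set ys' \<subseteq> B" "m' = lsum A xs' - lsum A ys'"
  by (rule semigE[OF m' B])
 have "m + m' = lsum A (xs @ xs') - lsum A (ys @ ys')" unfolding 1(4) 2(4) by simp
 hence "chi B z (m + m') = lprod z (xs @ xs') / lprod z (ys @ ys')" using 1 2 by (simp only:) (intro chi_eq[OF z B], auto)
 thus "chi B z (m + m') = chi B z m * chi B z m'" unfolding 1(4) 2(4) chi_eq[OF z B 1(1-3)] chi_eq[OF z B 2(1-3)] by simp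
qed

lemma point_chi:
 assumes z: "z \<in> charts B" and B: "B \<subseteq> {1..N}" and b: "b \<in> B"
 shows "point (chi B z) b = rescale (1 / z b) z"
proof
 fix j show "point (chi B z) b j = rescale (1 / z b) z j"
 proof (cases "j \<in> {1..N}")
  case True
  thus ?thesis using chi_eq[OF z B, of "[j]" "[b]"] b by (simp add: point_def rescale_def)
 next
  case False
  hence "z j = 0" using z unfolding charts_def Y0_def by (cases "j = 0") auto
  thus ?thesis using False by (auto simp: point_def rescale_def)
 qed
qed

lemma chi_point:
 assumes g: "g \<in> chars B" and b: "b \<in> B" "B \<subseteq> {1..N}" and a: "a \<noteq> 0"
 shows "chi B (rescale a (point g b)) = g"
proof
 let ?z = "rescale a (point g b)"
 have c: "point g b \<in> charts B" by (rule point_charts[OF g b])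
 hence z: "?z \<in> charts B" using Y0_rescale a b(2) unfolding charts_def by (force simp: rescale_def)
 fix m show "chi B ?z m = g m"
 proof (cases "m \<in> semig B")
  case True
  obtain xs ys where 1: "length xs = length ys" "set xs \<subseteq> {1..N}" "set ys \<subseteq> B" "m = lsum A xs - lsum A ys"
   by (rule semigE[OF True b(2)])
  have ys: "set ys \<subseteq> {1..N}" using 1(3) b(2) by blast
  have "lprod (point g b) ys \<noteq> 0" using c 1(3) unfolding lprod_eq_0_iff charts_def by auto
  thus ?thesis unfolding 1(4) chi_eq[OF z b(2) 1(1-3)] lprod_rescale[OF ys] lprod_rescale[OF 1(2)] point_quot[OF g b 1(1-3), symmetric]
   using a 1(1) by simp
 next
  case False
  moreover have "g m = undefined" using g False unfolding semigroup_points_def extensional_def by blast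
  ultimately show ?thesis by (simp add: chi_def)
 qed
qed

end

section \<open>Spectra of semigroup algebras\<close>

lemma affine_toric_eq:
 "affine_toric S = function_algebra_space (semigroup_points S) {\<lambda>p. meval p g | g. keys g \<subseteq> S}"
 unfolding affine_toric_def meval_def ..

abbreviation toric_basis :: "'a::comm_monoid_add set \<Rightarrow> (('a \<Rightarrow> complex) set \<times> (('a \<Rightarrow> complex) \<Rightarrow> complex)) set" where
 "toric_basis S \<equiv> {({p \<in> semigroup_points S. s p \<noteq> 0}, \<lambda>p. f p / s p) | f s.
   f \<in> {\<lambda>p. meval p g | g. keys g \<subseteq> S} \<and> s \<in> {\<lambda>p. meval p g | g. keys g \<subseteq> S}}"

lemma semigroup_algebra_mult:
 fixes f g :: "'a::comm_monoid_add \<Rightarrow>\<^sub>0 complex"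
 assumes "\<And>x y. x \<in> S \<Longrightarrow> y \<in> S \<Longrightarrow> x + y \<in> S" "keys f \<subseteq> S" "keys g \<subseteq> S"
 shows "keys (f * g) \<subseteq> S" "p \<in> semigroup_points S \<Longrightarrow> meval p (f * g) = meval p f * meval p g"
proof -
 show "keys (f * g) \<subseteq> S" using keys_mult assms by blast
 show "meval p (f * g) = meval p f * meval p g" if "p \<in> semigroup_points S"
  using that assms(2,3) unfolding semigroup_points_def by (intro meval_mult) blast
qed

lemma affine_toric_presented:
 assumes "\<And>x y. x \<in> S \<Longrightarrow> y \<in> S \<Longrightarrow> x + y \<in> S"
 shows "presented (affine_toric S) (toric_basis S)"
 unfolding affine_toric_eq
proof (rule presented_function_algebra_space)
 fix f f' :: "('a \<Rightarrow> complex) \<Rightarrow> complex"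
 assume "f \<in> {\<lambda>p. meval p g | g. keys g \<subseteq> S}" "f' \<in> {\<lambda>p. meval p g | g. keys g \<subseteq> S}"
 then obtain g g' where g: "f = (\<lambda>p. meval p g)" "keys g \<subseteq> S" "f' = (\<lambda>p. meval p g')" "keys g' \<subseteq> S"
  by blast
 note m = semigroup_algebra_mult[OF assms g(2,4)]
 show "\<exists>h\<in>{\<lambda>p. meval p g | g. keys g \<subseteq> S}. \<forall>x\<in>semigroup_points S. h x = f x * f' x"
  unfolding g(1,3) by (intro bexI[of _ "\<lambda>p. meval p (g * g')"] CollectI exI[of _ "g * g'"] conjI ballI refl m)
qed

lemma toric_basisI:
 "keys f \<subseteq> S \<Longrightarrow> keys s \<subseteq> S \<Longrightarrow>
  ({g \<in> semigroup_points S. meval g s \<noteq> 0}, \<lambda>g. meval g f / meval g s) \<in> toric_basis S"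
 by (intro CollectI exI[of _ "\<lambda>g. meval g f"] exI[of _ "\<lambda>g. meval g s"] conjI refl exI[of _ f] exI[of _ s])

lemma toric_basisE:
 assumes "(D, p) \<in> toric_basis S"
 obtains f s where "keys f \<subseteq> S" "keys s \<subseteq> S"
  "D = {g \<in> semigroup_points S. meval g s \<noteq> 0}" "p = (\<lambda>g. meval g f / meval g s)" using assms by blast

lemma points_affine_toric:
 assumes "\<And>x y. x \<in> S \<Longrightarrow> y \<in> S \<Longrightarrow> x + y \<in> S" "0 \<in> S"
 shows "points (affine_toric S) = semigroup_points S"
proof -
 have pr: "presented (affine_toric S) (toric_basis S)" by (rule affine_toric_presented) (rule assms(1))
 have "g \<in> points (affine_toric S) \<longleftrightarrow> g \<in> semigroup_points S" for g unfolding presented_points_iff[OF pr]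
 proof
  assume g: "g \<in> semigroup_points S"
  let ?e = "single 0 1 :: 'a \<Rightarrow>\<^sub>0 complex"
  have "keys ?e \<subseteq> S" using assms(2) by simp
  moreover have "g 0 = 1" using g unfolding semigroup_points_def by blast
  hence "meval g ?e \<noteq> 0" by (simp only: meval_single) simp
  ultimately show "\<exists>D p. (D, p) \<in> toric_basis S \<and> g \<in> D"
   using toric_basisI[of ?e S ?e] g by (intro exI conjI) (assumption, simp)
 qed (auto elim!: toric_basisE)
 thus ?thesis by blast
qed

context toric
begin

section \<open>Faces, normal cones and the fan\<close>

definition vertices_in :: "'a set \<Rightarrow> nat set" where
 "vertices_in Q = {j \<in> {1..N}. A j \<in> Q}"

lemma face_vertices:
 assumes Q: "Q face_of P" and q: "q \<in> Q"
 obtains l where "\<forall>j\<in>{1..N}. 0 \<le> l j" "q = (\<Sum>j\<in>{1..N}. l j *\<^sub>R A j)" "sum l {1..N} = (1::real)"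
  "\<And>j. j \<in> {1..N} \<Longrightarrow> l j > 0 \<Longrightarrow> j \<in> vertices_in Q"
proof -
 have "q \<in> P" using Q q unfolding face_of_def by blast
 then obtain l where l: "\<forall>j\<in>{1..N}. 0 \<le> l j" "q = (\<Sum>j\<in>{1..N}. l j *\<^sub>R A j)" "sum l {1..N} = 1"
  unfolding P_def nonneg_comb_hull nonneg_comb_def by blast
 thus ?thesis
  using that face_of_support[OF Q[unfolded P_def] finite_atLeastAtMost q[unfolded l(2)] l(1,3)] unfolding vertices_in_def by blast
qed

text \<open>A point of a face is a convex combination of those \<open>A j\<close> that lie in the
  face, so a functional need only be compared at these.\<close>

lemma normal_cone_eq:
 assumes Q: "Q face_of P" "Q \<noteq> {}"
 shows "vertices_in Q \<noteq> {}" "normal_cone P Q = ncone (vertices_in Q)"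
proof -
 obtain q0 where q0: "q0 \<in> Q" using Q by blast
 obtain l where l: "\<forall>j\<in>{1..N}. 0 \<le> l j" "q0 = (\<Sum>j\<in>{1..N}. l j *\<^sub>R A j)" "sum l {1..N} = (1::real)"
  "\<And>j. j \<in> {1..N} \<Longrightarrow> l j > 0 \<Longrightarrow> j \<in> vertices_in Q" by (rule face_vertices[OF Q(1) q0]) blast
 have "\<exists>j\<in>{1..N}. l j > 0"
 proof (rule ccontr)
  assume "\<not> ?thesis"
  hence "sum l {1..N} \<le> 0" by (intro sum_nonpos) force
  thus False using l(3) by simp
 qed
 thus ne: "vertices_in Q \<noteq> {}" using l(4) by blast
 show "normal_cone P Q = ncone (vertices_in Q)"
 proof (intro equalityI subsetI)
  fix u assume "u \<in> normal_cone P Q"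
  thus "u \<in> ncone (vertices_in Q)" unfolding normal_cone_def ncone_def vertices_in_def using A_P by blast
 next
  fix u assume u: "u \<in> ncone (vertices_in Q)"
  hence ud: "u \<in> dual_space L" and u0: "\<And>i b. i \<in> {1..N} \<Longrightarrow> b \<in> vertices_in Q \<Longrightarrow> 0 \<le> u (A i - A b)"
   unfolding ncone_def by blast+
  obtain v where v: "linear v" "\<And>x. x \<in> L \<Longrightarrow> u x = v x" using ud by (rule dual_spaceE) blast
  obtain b0 where b0: "b0 \<in> vertices_in Q" using ne by blast
  have uA: "v (A b) \<le> v (A i)" if "i \<in> {1..N}" "b \<in> vertices_in Q" for i b
  proof -
   have "A i - A b \<in> L" using that unfolding vertices_in_def by (intro diff_L A_P) auto
   thus ?thesis using u0[OF that] v(2) linear_diff[OF v(1)] by simp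
  qed
  have "0 \<le> u (p - q)" if p: "p \<in> P" and q: "q \<in> Q" for p q
  proof -
   obtain c where c: "\<forall>j\<in>{1..N}. 0 \<le> c j" "p = (\<Sum>j\<in>{1..N}. c j *\<^sub>R A j)" "sum c {1..N} = 1"
    using p unfolding P_def nonneg_comb_hull nonneg_comb_def by blast
   obtain d where d: "\<forall>j\<in>{1..N}. 0 \<le> d j" "q = (\<Sum>j\<in>{1..N}. d j *\<^sub>R A j)" "sum d {1..N} = (1::real)"
    "\<And>j. j \<in> {1..N} \<Longrightarrow> d j > 0 \<Longrightarrow> j \<in> vertices_in Q" by (rule face_vertices[OF Q(1) q]) blast
   have "v (A b0) = (\<Sum>j\<in>{1..N}. c j * v (A b0))" using c(3) by (simp flip: sum_distrib_right)
   also have "\<dots> \<le> (\<Sum>j\<in>{1..N}. c j * v (A j))" using c(1) uA[OF _ b0] by (intro sum_mono mult_left_mono) auto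
   also have "\<dots> = v p" unfolding c(2) linear_sum[OF v(1)] linear_scale[OF v(1)] by simp
   finally have 1: "v (A b0) \<le> v p" .
   have "v q = (\<Sum>j\<in>{1..N}. d j * v (A j))" unfolding d(2) linear_sum[OF v(1)] linear_scale[OF v(1)] by simp
   also have "\<dots> \<le> (\<Sum>j\<in>{1..N}. d j * v (A b0))"
   proof (rule sum_mono)
    fix j assume j: "j \<in> {1..N}"
    have b0': "b0 \<in> {1..N}" using b0 unfolding vertices_in_def by blast
    show "d j * v (A j) \<le> d j * v (A b0)"
    proof (cases "d j > 0")
     case True
     thus ?thesis using uA[OF b0' d(4)[OF j True]] by simp
    next
     case False
     thus ?thesis using d(1) j by force
    qed
   qed
   also have "\<dots> = v (A b0)" using d(3) by (simp flip: sum_distrib_right)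
   finally have "v q \<le> v p" using 1 by simp
   moreover have "q \<in> P" using Q(1) q unfolding face_of_def by blast
   ultimately show ?thesis using v(2)[OF diff_L[OF p]] linear_diff[OF v(1)] by simp
  qed
  thus "u \<in> normal_cone P Q" unfolding normal_cone_def using ud by blast
 qed
qed

abbreviation F where "F \<equiv> normal_fan P"

text \<open>For a cone of the fan this is the largest index set that defines it. It depends on the
  cone alone, so that the face from which the cone arose can be forgotten.\<close>

definition verts :: "('a \<Rightarrow> real) set \<Rightarrow> nat set" where
 "verts s = {b \<in> {1..N}. \<forall>u\<in>s. \<forall>i\<in>{1..N}. 0 \<le> u (A i - A b)}"

lemma verts_subset: "verts s \<subseteq> {1..N}"
 unfolding verts_def by blast

lemma ncone_antimono: "B \<subseteq> B' \<Longrightarrow> ncone B' \<subseteq> ncone B"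
 unfolding ncone_def by blast

lemma ncone_Un: "ncone (B \<union> B') = ncone B \<inter> ncone B'"
 unfolding ncone_def by blast

lemma fan_verts:
 assumes "s \<in> F"
 shows "verts s \<noteq> {}" "ncone (verts s) = s"
proof -
 obtain Q where Q: "Q face_of P" "Q \<noteq> {}" "s = normal_cone P Q" using assms unfolding normal_fan_def by blast
 note s = Q(3)[unfolded normal_cone_eq(2)[OF Q(1,2)]]
 have sub: "vertices_in Q \<subseteq> verts s"
 proof
  fix b assume b: "b \<in> vertices_in Q"
  hence "b \<in> {1..N}" unfolding vertices_in_def by blast
  thus "b \<in> verts s" using b unfolding verts_def s ncone_def by blast
 qed
 thus "verts s \<noteq> {}" using normal_cone_eq(1)[OF Q(1,2)] by blast
 have "ncone (verts s) \<subseteq> s" using ncone_antimono[OF sub] s by simp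
 moreover have "s \<subseteq> dual_space L" unfolding s ncone_def by blast
 hence "s \<subseteq> ncone (verts s)" unfolding ncone_def verts_def by blast
 ultimately show "ncone (verts s) = s" by (rule equalityI)
qed

lemma dual_semigroup_fan: "s \<in> F \<Longrightarrow> dual_semigroup Lat s = semig (verts s)"
 unfolding semig_def by (simp add: fan_verts)

lemma dual_semigroup_fan_Int:
 "s \<in> F \<Longrightarrow> t \<in> F \<Longrightarrow> dual_semigroup Lat (s \<inter> t) = semig (verts s \<union> verts t)"
 unfolding semig_def by (simp add: fan_verts ncone_Un)

text \<open>The support of a point of \<open>Y0\<close> is the set of lattice points on a face: the minimal face through its barycentre.\<close>

lemma support_face:
 assumes z: "z \<in> Y0"
 obtains q where "q \<in> F" "z \<in> charts (verts q)"
proof -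
 define J where "J = {j \<in> {1..N}. z j \<noteq> 0}"
 have J: "J \<subseteq> {1..N}" "J \<noteq> {}" "finite J" using z unfolding J_def Y0_def by auto
 hence cJ: "card J > 0" by (simp add: card_gt_0_iff)
 define r where "r = real (card J)"
 have r: "r > 0" using cJ by (simp add: r_def)
 define w where "w = (\<Sum>j\<in>{1..N}. (if j \<in> J then 1 / r else 0) *\<^sub>R A j)"
 have wJ: "r *\<^sub>R w = (\<Sum>j\<in>J. A j)"
 proof -
  have "r *\<^sub>R w = (\<Sum>j\<in>{1..N}. if j \<in> J then A j else 0)"
   unfolding w_def scaleR_sum_right using r by (intro sum.cong) auto
  also have "\<dots> = (\<Sum>j\<in>{1..N} \<inter> J. A j)" by (simp add: sum.inter_restrict)
  finally show ?thesis using J(1) by (simp add: Int_absorb1)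
 qed
 have s1: "(\<Sum>j\<in>{1..N}. if j \<in> J then 1 / r else 0) = 1"
 proof -
  have "(\<Sum>j\<in>{1..N}. if j \<in> J then 1 / r else 0) = (\<Sum>j\<in>{1..N} \<inter> J. 1 / r)"
   by (rule sum.inter_restrict[symmetric]) simp
  thus ?thesis using J(1) r by (simp add: Int_absorb1 r_def)
 qed
 have w1: "nonneg_comb A N 1 w" unfolding nonneg_comb_def w_def using r s1 by (intro exI[of _ "\<lambda>j. if j \<in> J then 1 / r else 0"]) auto
 hence wP: "w \<in> P" unfolding P_def nonneg_comb_hull .
 define Q where "Q = {p \<in> P. \<exists>e>0. w + e *\<^sub>R (w - p) \<in> P}"
 have Q: "Q face_of P" unfolding Q_def by (rule minimal_face[OF _ wP]) (simp add: P_def)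
 have wQ: "w \<in> Q" unfolding Q_def using wP by (auto intro!: exI[of _ 1])
 have sub1: "J \<subseteq> vertices_in Q"
 proof
  fix j assume j: "j \<in> J"
  hence "A j \<in> Q" using face_of_support[OF Q[unfolded P_def] finite_atLeastAtMost wQ[unfolded w_def] _ s1, of j] r J(1) by auto
  thus "j \<in> vertices_in Q" using j J(1) unfolding vertices_in_def by blast
 qed
 have sub2: "vertices_in Q \<subseteq> J"
 proof
  fix i assume "i \<in> vertices_in Q"
  hence i: "i \<in> {1..N}" "A i \<in> Q" unfolding vertices_in_def by auto
  then obtain e where e: "e > 0" "w + e *\<^sub>R (w - A i) \<in> P" unfolding Q_def by blast
  define p where "p = w + e *\<^sub>R (w - A i)"
  have p: "nonneg_comb A N 1 p" using e(2) unfolding p_def P_def nonneg_comb_hull .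
  \<comment> \<open>\<open>K\<close> is chosen so large that \<open>K\<close> times the sum over
    \<open>J\<close>, minus \<open>A i\<close>, is a nonnegative combination of \<open>p\<close> and
    \<open>w\<close>: the prolongation \<open>p\<close> beyond the barycentre supplies
    \<open>- A i\<close>. Then a monomial supported on \<open>J\<close> equals one that contains
    \<open>z i\<close>.\<close>
  obtain K :: nat where "(1 + e) / (r * e) \<le> real K" using real_arch_simple by blast
  hence K: "(1 + e) / e \<le> real K * r" using e(1) r by (simp add: field_simps)
  define m where "m = real K *\<^sub>R (\<Sum>j\<in>J. A j) - A i"
  have "m = (1 / e) *\<^sub>R p + (real K * r - (1 + e) / e) *\<^sub>R w"
   unfolding m_def wJ[symmetric] p_def using e(1) by (simp add: algebra_simps add_divide_distrib)
  moreover have "nonneg_comb A N (1 / e * 1 + (real K * r - (1 + e) / e) * 1) ((1 / e) *\<^sub>R p + (real K * r - (1 + e) / e) *\<^sub>R w)"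
   using e(1) K by (intro nonneg_comb_add nonneg_comb_scale p w1) auto
  ultimately have "nonneg_comb A N (real K * r - 1) m" using e(1) by (simp add: add_divide_distrib)
  moreover have "K \<noteq> 0" using K e(1) by (intro notI) (simp add: field_simps)
  hence pos: "K * card J \<ge> 1" using cJ by (cases K) simp_all
  ultimately have c: "nonneg_comb A N (real (K * card J - 1)) m" by (simp add: of_nat_diff r_def)
  obtain ys where ys: "set ys \<subseteq> (\<lambda>j. j) ` J" "length ys = (\<Sum>j\<in>J. K)" "lsum A ys = (\<Sum>j\<in>J. real K *\<^sub>R A j)"
   using lsum_concat_replicate[OF J(3), of "\<lambda>j. j" "\<lambda>_. K" A] by blast
  have "lsum A ys = m + A i" unfolding ys(3) m_def by (simp add: scaleR_sum_right)
  have ysJ: "set ys \<subseteq> J" using ys(1) by simp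
  have "m \<in> M" using \<open>lsum A ys = m + A i\<close> M_diff[OF lsum_M[of ys] A_M[OF i(1)]] ysJ J(1) by auto
  then obtain xs where xs: "length xs = K * card J - 1" "set xs \<subseteq> {1..N}" "m = lsum A xs" using gen c by blast
  have "lprod z (i # xs) = lprod z ys"
  proof (rule Y0_eq[OF z])
   show "length (i # xs) = length ys" using xs(1) ys(2) pos by (simp add: mult.commute)
   show "lsum A (i # xs) = lsum A ys" using xs(3) \<open>lsum A ys = m + A i\<close> by simp
  qed (use i xs ysJ J in auto)
  moreover have "lprod z ys \<noteq> 0" using ysJ unfolding lprod_eq_0_iff J_def by blast
  ultimately have "z i \<noteq> 0" by auto
  thus "i \<in> J" using i(1) unfolding J_def by blast
 qed
 have JQ: "vertices_in Q = J" using sub1 sub2 by blast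
 have "Q \<noteq> {}" using wQ by blast
 let ?q = "normal_cone P Q"
 have q: "?q = ncone J" using normal_cone_eq(2)[OF Q \<open>Q \<noteq> {}\<close>] JQ by simp
 \<comment> \<open>\<open>verts\<close> may a priori be larger than the support. But
   \<open>A j - A b\<close> lies in the semigroup of \<open>J\<close>, and the resulting binomial
   equation shows that \<open>z b\<close> is a factor of a nonzero monomial.\<close>
 have "z b \<noteq> 0" if b: "b \<in> verts ?q" for b
 proof -
  obtain j where j: "j \<in> J" using J by blast
  have bI: "b \<in> {1..N}" using b verts_subset by blast
  have jI: "j \<in> {1..N}" using j J by blast
  have "A j - A b \<in> M \<inter> L" using M_diff[OF A_M A_M] diff_L[OF A_P A_P] jI bI by blast
  moreover have "\<forall>u\<in>ncone J. 0 \<le> u (A j - A b)" using b jI unfolding verts_def q by blast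
  ultimately have "A j - A b \<in> semig J" unfolding semig_def dual_semigroup_def by blast
  then obtain xs ys where 1: "length xs = length ys" "set xs \<subseteq> {1..N}" "set ys \<subseteq> J" "A j - A b = lsum A xs - lsum A ys"
   by (rule semigE[OF _ J(1)])
  have "lprod z (j # ys) = lprod z (b # xs)"
  proof (rule Y0_eq[OF z])
   show "lsum A (j # ys) = lsum A (b # xs)" using 1(4) by (simp add: algebra_simps)
  qed (use 1 J jI bI in auto)
  moreover have "lprod z (j # ys) \<noteq> 0" using 1(3) j unfolding lprod_eq_0_iff J_def by auto
  ultimately show ?thesis by auto
 qed
 hence "z \<in> charts (verts ?q)" using z unfolding charts_def by blast
 thus ?thesis using that[of ?q] Q \<open>Q \<noteq> {}\<close> unfolding normal_fan_def by blast
qed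

end

context toric
begin

section \<open>Gluing the charts\<close>

definition chart_map :: "('a \<Rightarrow> real) set \<Rightarrow> ('a \<Rightarrow> complex) \<Rightarrow> cvec set" where
 "chart_map s g = orbit (point g (SOME b. b \<in> verts s))"

lemma chart_map_eq:
 assumes "s \<in> F" "g \<in> chars (verts s)" "b \<in> verts s"
 shows "chart_map s g = orbit (point g b)"
proof -
 have b': "(SOME b. b \<in> verts s) \<in> verts s" using assms(3) by (rule someI)
 show ?thesis unfolding chart_map_def point_change(1)[OF assms(2,3) b' verts_subset]
  by (rule orbit_rescale) (rule point_change(2)[OF assms(2,3) b' verts_subset])
qed

lemma chart_map_chi:
 assumes "s \<in> F" "z \<in> charts (verts s)"
 shows "chart_map s (chi (verts s) z) = orbit z"
proof -
 obtain b where b: "b \<in> verts s" using fan_verts(1)[OF assms(1)] by blast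
 have "z b \<noteq> 0" using assms(2) b unfolding charts_def by blast
 thus ?thesis unfolding chart_map_eq[OF assms(1) chi_semigroup_points[OF assms(2) verts_subset] b] point_chi[OF assms(2) verts_subset b]
  by (intro orbit_rescale) simp
qed

lemma chi_restrict:
 assumes z: "z \<in> charts B'" and B: "B \<subseteq> B'" "B' \<subseteq> {1..N}"
 shows "restrict (chi B' z) (semig B) = chi B z"
proof
 fix m
 have B1: "B \<subseteq> {1..N}" and z1: "z \<in> charts B" using z B unfolding charts_def by auto
 show "restrict (chi B' z) (semig B) m = chi B z m"
 proof (cases "m \<in> semig B")
  case True
  obtain xs ys where 1: "length xs = length ys" "set xs \<subseteq> {1..N}" "set ys \<subseteq> B" "m = lsum A xs - lsum A ys"
   by (rule semigE[OF True B1])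
  have "set ys \<subseteq> B'" using 1(3) B(1) by blast
  thus ?thesis using True chi_eq[OF z B(2) 1(1,2)] chi_eq[OF z1 B1 1(1-3)] unfolding 1(4) by simp
 qed (simp add: chi_def)
qed

lemma semig_mono: "B \<subseteq> B' \<Longrightarrow> semig B \<subseteq> semig B'"
 unfolding semig_def dual_semigroup_def using ncone_antimono by blast

lemma points_chart:
 assumes "s \<in> F"
 shows "points (chart Lat s) = chars (verts s)"
 unfolding dual_semigroup_fan[OF assms] by (rule points_affine_toric) (simp_all add: semig_add semig_0)

text \<open>If two chart points have the same orbit, a common representative is nonzero in all
  positions of both index sets; its character on their union is the point over the intersection of
  the cones that glues the two.\<close>

lemma gluing_iff:
 assumes s: "s \<in> F" and t: "t \<in> F" and g: "g \<in> points (chart Lat s)" and d: "d \<in> points (chart Lat t)"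
 shows "((s, g), (t, d)) \<in> gluing Lat F \<longleftrightarrow> chart_map s g = chart_map t d"
proof -
 let ?B = "verts s" and ?B' = "verts t" and ?U = "verts s \<union> verts t"
 note g' = g[unfolded points_chart[OF s]] and d' = d[unfolded points_chart[OF t]]
 have U: "?U \<subseteq> {1..N}" using verts_subset by blast
 obtain b b' where b: "b \<in> ?B" and b': "b' \<in> ?B'" using fan_verts(1)[OF s] fan_verts(1)[OF t] by blast
 have pts: "points (chart Lat (s \<inter> t)) = chars ?U"
  unfolding dual_semigroup_fan_Int[OF s t] by (rule points_affine_toric) (simp_all add: semig_add semig_0)
 have "((s, g), (t, d)) \<in> gluing Lat F \<longleftrightarrow>
   (\<exists>e\<in>chars ?U. restrict e (semig ?B) = g \<and> restrict e (semig ?B') = d)"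
  unfolding gluing_def using s t by (simp add: pts dual_semigroup_fan)
 also have "\<dots> \<longleftrightarrow> chart_map s g = chart_map t d"
 proof
  assume "\<exists>e\<in>chars ?U. restrict e (semig ?B) = g \<and> restrict e (semig ?B') = d"
  then obtain e where e: "e \<in> chars ?U" "g = restrict e (semig ?B)" "d = restrict e (semig ?B')" by blast
  have "point g b = point e b" unfolding e(2) point_def using diff_semig[OF _ b verts_subset] by auto
  moreover have "point d b' = point e b'" unfolding e(3) point_def using diff_semig[OF _ b' verts_subset] by auto
  moreover have "orbit (point e b) = orbit (point e b')" using point_change[OF e(1) _ _ U, of b' b] b b' by (simp add: orbit_rescale)
  ultimately show "chart_map s g = chart_map t d" unfolding chart_map_eq[OF s g' b] chart_map_eq[OF t d' b'] by simp
 next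
  assume "chart_map s g = chart_map t d"
  then obtain a where a: "a \<noteq> 0" "point g b = rescale a (point d b')"
   unfolding chart_map_eq[OF s g' b] chart_map_eq[OF t d' b'] by (metis orbit_eq_iff)
  define z where "z = point g b"
  have z1: "z \<in> charts ?B" unfolding z_def by (rule point_charts[OF g' b verts_subset])
  have "z i \<noteq> 0" if "i \<in> ?B'" for i using point_charts[OF d' b' verts_subset] that a(1) verts_subset[of t]
   unfolding z_def a(2) charts_def by (auto simp: rescale_def)
  hence z: "z \<in> charts ?U" using z1 unfolding charts_def by blast
  have "restrict (chi ?U z) (semig ?B) = g"
   using chi_restrict[OF z _ U, of ?B] chi_point[OF g' b verts_subset, of 1] unfolding z_def by simp
  moreover have "restrict (chi ?U z) (semig ?B') = d"
   using chi_restrict[OF z _ U, of ?B'] chi_point[OF d' b' verts_subset a(1)] a(2) unfolding z_def by simp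
  ultimately show "\<exists>e\<in>chars ?U. restrict e (semig ?B) = g \<and> restrict e (semig ?B') = d"
   using chi_semigroup_points[OF z U] by blast
 qed
 finally show ?thesis .
qed

text \<open>Clearing denominators: the value of \<open>chi B z\<close> at a lattice point is a
  quotient of monomials whose denominator involves only coordinates from \<open>B\<close>, nonzero
  on the chart.\<close>

lemma semigroup_algebra_homogenize:
 assumes B: "B \<subseteq> {1..N}" and g: "keys g \<subseteq> semig B"
 obtains G ys where "hfun (length ys) G" "set ys \<subseteq> B" "\<forall>z\<in>charts B. G z = meval (chi B z) g * lprod z ys"
proof -
 have "finite K \<Longrightarrow> K \<subseteq> semig B \<Longrightarrow> \<exists>G ys. hfun (length ys) G \<and> set ys \<subseteq> B \<and>
   (\<forall>z\<in>charts B. G z = (\<Sum>m\<in>K. lookup g m * chi B z m) * lprod z ys)" for K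
 proof (induction K rule: finite_induct)
  case empty
  show ?case using hfun.zero[of 0] by (intro exI[of _ "\<lambda>_. 0"] exI[of _ "[]"]) simp
 next
  case (insert m K)
  then obtain G ys where G: "hfun (length ys) G" "set ys \<subseteq> B"
   "\<forall>z\<in>charts B. G z = (\<Sum>m\<in>K. lookup g m * chi B z m) * lprod z ys" by blast
  have "m \<in> semig B" using insert.prems by blast
  then obtain us vs where 1: "length us = length vs" "set us \<subseteq> {1..N}" "set vs \<subseteq> B" "m = lsum A us - lsum A vs"
   by (rule semigE[OF _ B])
  have p: "hfun (length us) (\<lambda>z. lprod z us)" using 1(2) by (intro hfun_prod_list) force
  have q: "hfun (length vs) (\<lambda>z. lprod z vs)" using 1(3) B by (intro hfun_prod_list) force
  have r: "hfun (length ys) (\<lambda>z. lprod z ys)" using G(2) B by (intro hfun_prod_list) force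
  let ?G = "\<lambda>z. G z * lprod z vs + lookup g m * (lprod z ys * lprod z us)"
  have "hfun (length (ys @ vs)) ?G" using hfun.add[OF hfun.mult[OF G(1) q] hfun_cmult[OF hfun.mult[OF r p], unfolded 1(1)]] by simp
  moreover have "\<forall>z\<in>charts B. ?G z = (\<Sum>m\<in>insert m K. lookup g m * chi B z m) * lprod z (ys @ vs)"
  proof
   fix z assume z: "z \<in> charts B"
   hence "lprod z vs \<noteq> 0" using 1(3) unfolding charts_def lprod_eq_0_iff by blast
   hence "chi B z m * lprod z vs = lprod z us" unfolding 1(4) chi_eq[OF z B 1(1-3)] by simp
   hence e: "lookup g m * (lprod z ys * lprod z us) = lookup g m * chi B z m * lprod z (ys @ vs)" by simp
   show "?G z = (\<Sum>m\<in>insert m K. lookup g m * chi B z m) * lprod z (ys @ vs)"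
    unfolding sum.insert[OF insert.hyps] e bspec[OF G(3) z] by (simp add: ring_distribs)
  qed
  moreover have "set (ys @ vs) \<subseteq> B" using G(2) 1(3) by simp
  ultimately show ?case by blast
 qed
 hence "\<exists>G ys. hfun (length ys) G \<and> set ys \<subseteq> B \<and> (\<forall>z\<in>charts B. G z = meval (chi B z) g * lprod z ys)"
  unfolding meval_def using g by simp
 thus ?thesis using that by blast
qed

lemma hfun_point_semigroup_algebra:
 assumes B: "b \<in> B" "B \<subseteq> {1..N}" and G: "hfun k G"
 obtains g where "keys g \<subseteq> semig B" "\<And>p. p \<in> chars B \<Longrightarrow> G (point p b) = meval p g"
proof -
 let ?Q = "\<lambda>G. \<exists>g. keys g \<subseteq> semig B \<and> (\<forall>p\<in>chars B. G (point p b) = meval p g)"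
 have "?Q G" using G
 proof (induction rule: hfun.induct)
  case (const a)
  show ?case using semig_0 sp_0 by (intro exI[of _ "single 0 a"]) (auto simp: meval_single)
 next
  case param
  show ?case by (intro exI[of _ 0]) (simp add: point_def)
 next
  case (coord i)
  show ?case
  proof (cases "i \<in> {1..N}")
   case True
   thus ?thesis using diff_semig[OF True B] by (intro exI[of _ "single (A i - A b) 1"]) (auto simp: point_def)
  next
   case False
   thus ?thesis by (intro exI[of _ 0]) (auto simp: point_def)
  qed
 next
  case (zero k)
  show ?case by (intro exI[of _ 0]) simp
 next
  case (add k F G)
  then obtain f g where fg: "keys f \<subseteq> semig B" "keys g \<subseteq> semig B"
   "\<forall>p\<in>chars B. F (point p b) = meval p f" "\<forall>p\<in>chars B. G (point p b) = meval p g" by blast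
  have "keys (f + g) \<subseteq> semig B" using fg(1,2) keys_add[of f g] by blast
  thus ?case using fg(3,4) by (intro exI[of _ "f + g"]) (simp add: meval_add)
 next
  case (mult k F l G)
  then obtain f g where fg: "keys f \<subseteq> semig B" "keys g \<subseteq> semig B"
   "\<forall>p\<in>chars B. F (point p b) = meval p f" "\<forall>p\<in>chars B. G (point p b) = meval p g" by blast
  show ?case using fg(3,4) semigroup_algebra_mult[OF semig_add fg(1,2)] by (intro exI[of _ "f * g"]) simp
 qed
 thus ?thesis using that by blast
qed

theorem proj_toric_iso:
 assumes W: "presented W (proj_basis Y0)"
 shows "var_iso W (normal_toric_variety M P)"
proof -
 let ?C = "chart Lat" and ?T = "normal_toric_variety M P" and ?g = "\<lambda>q h. gluing Lat F `` {(q, h)}"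
 define S where "S = (\<lambda>q. semig (verts q))"
 \<comment> \<open>The glued point belonging to an orbit, as the set of all its representatives in
   the charts.\<close>
 define k where "k w = {(q, h) \<in> (SIGMA q:F. points (?C q)). chart_map q h = w}" for w
 let ?p = "\<lambda>q V. {h \<in> points (?C q). k (chart_map q h) \<in> V}"
 have ptsW: "points W = orbit ` Y0"
 proof -
  have "points W = points (proj_space Y0)"
   using presented_points_iff[OF W] presented_points_iff[OF presented_proj_space[OF is_cone_Y0]] by blast
  thus ?thesis unfolding points_proj_space[OF is_cone_Y0] .
 qed
 have ptsC: "points (?C q) = semigroup_points (S q)" if "q \<in> F" for q unfolding S_def by (rule points_chart[OF that])
 have presC: "presented (?C q) (toric_basis (S q))" if "q \<in> F" for q
  unfolding S_def dual_semigroup_fan[OF that] by (rule affine_toric_presented) (rule semig_add)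
 have hW: "chart_map q h \<in> points W" if q: "q \<in> F" and h: "h \<in> points (?C q)" for q h
 proof -
  obtain b where b: "b \<in> verts q" using fan_verts(1)[OF q] by blast
  have h': "h \<in> chars (verts q)" using h ptsC[OF q] S_def by simp
  have "point h b \<in> Y0" using point_charts[OF h' b verts_subset] unfolding charts_def by blast
  thus ?thesis unfolding ptsW chart_map_eq[OF q h' b] by blast
 qed
 have cover: "\<exists>q\<in>F. \<exists>h\<in>points (?C q). w = chart_map q h" if w: "w \<in> points W" for w
 proof -
  obtain z where z: "z \<in> Y0" "w = orbit z" using w unfolding ptsW by blast
  obtain q where q: "q \<in> F" "z \<in> charts (verts q)" by (rule support_face[OF z(1)])
  show ?thesis using chi_semigroup_points[OF q(2) verts_subset] chart_map_chi[OF q] q(1) z(2) unfolding ptsC[OF q(1)] S_def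
   by (intro bexI[of _ q] bexI[of _ "chi (verts q) z"]) (simp_all add: ptsC S_def)
 qed
 have glue: "?g q h = k (chart_map q h)" if q: "q \<in> F" and h: "h \<in> points (?C q)" for q h
 proof -
  have sub: "x \<in> (SIGMA q:F. points (?C q))" if "((q, h), x) \<in> gluing Lat F" for x
  proof -
   obtain t v e where 1: "x = (t, v)" "t \<in> F" "e \<in> points (?C (q \<inter> t))" "v = restrict e (dual_semigroup Lat t)"
    using \<open>((q, h), x) \<in> gluing Lat F\<close> unfolding gluing_def by blast
   let ?U = "verts q \<union> verts t"
   have "e \<in> chars ?U"
    using 1(3) unfolding dual_semigroup_fan_Int[OF q 1(2)] by (subst (asm) points_affine_toric) (simp_all add: semig_add semig_0)
   moreover have "semig (verts t) \<subseteq> semig ?U" by (rule semig_mono) blast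
   ultimately have "v \<in> chars (verts t)"
    unfolding 1(4) dual_semigroup_fan[OF 1(2)] semigroup_points_def using semig_0 semig_add by (auto simp: subset_iff)
   thus ?thesis using 1(1,2) ptsC[OF 1(2)] S_def by simp
  qed
  show ?thesis
  proof (intro equalityI subsetI)
   fix x assume x: "x \<in> ?g q h"
   obtain t v where [simp]: "x = (t, v)" by (cases x)
   have "t \<in> F" "v \<in> points (?C t)" using sub x by auto
   thus "x \<in> k (chart_map q h)" using x gluing_iff[OF q _ h] unfolding k_def by simp
  next
   fix x assume x: "x \<in> k (chart_map q h)"
   obtain t v where [simp]: "x = (t, v)" by (cases x)
   have "t \<in> F" "v \<in> points (?C t)" "chart_map t v = chart_map q h" using x unfolding k_def by auto
   thus "x \<in> ?g q h" using gluing_iff[OF q _ h] by simp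
  qed
 qed
 have glued: "glued_points Lat F = k ` points W"
 proof (intro equalityI subsetI)
  fix x assume "x \<in> glued_points Lat F"
  then obtain q h where "q \<in> F" "h \<in> points (?C q)" "x = ?g q h" unfolding glued_points_def quotient_def by blast
  thus "x \<in> k ` points W" using glue hW by simp
 next
  fix x assume "x \<in> k ` points W"
  then obtain w where w: "w \<in> points W" "x = k w" by blast
  obtain q h where q: "q \<in> F" "h \<in> points (?C q)" "w = chart_map q h" using cover[OF w(1)] by blast
  hence "x = ?g q h" using glue w(2) by simp
  thus "x \<in> glued_points Lat F" using q(1,2) unfolding glued_points_def quotient_def by blast
 qed
 have pre: "chart_preimage Lat F q V = ?p q V" if "q \<in> F" for q V unfolding chart_preimage_def using glue[OF that] by auto
 have opn: "openin (zariski ?T) V \<longleftrightarrow> V \<subseteq> k ` points W \<and>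
   (\<forall>q\<in>F. openin (zariski (?C q)) (?p q V))" for V
 proof -
  have "openin (zariski ?T) V \<longleftrightarrow> V \<subseteq> glued_points Lat F \<and>
    (\<forall>q\<in>F. openin (zariski (?C q)) (chart_preimage Lat F q V))"
   unfolding normal_toric_variety_def toric_variety_def fspace.simps by (subst topology_inverse'[OF istopology_toric_variety]) (rule refl)
  thus ?thesis unfolding glued by (simp add: pre)
 qed
 have reg: "r \<in> regular ?T V \<longleftrightarrow>
   (\<forall>q\<in>F. (r \<circ> k) \<circ> chart_map q \<in> regular (?C q) (?p q V))" if "openin (zariski ?T) V" for V r
 proof -
  have "(\<lambda>h. r (?g q h)) \<in> regular (?C q) U \<longleftrightarrow> (r \<circ> k) \<circ> chart_map q \<in> regular (?C q) U"
   if q: "q \<in> F" and U: "openin (zariski (?C q)) U" for q U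
  proof -
   have "U \<subseteq> points (?C q)" using U by (rule openin_subset)
   hence eq: "r (?g q h) = ((r \<circ> k) \<circ> chart_map q) h" if "h \<in> U" for h using glue[OF q] that by auto
   note R = presC[OF q, unfolded presented_def, THEN conjunct2, THEN conjunct2, rule_format, OF U]
   show ?thesis unfolding R using eq by (intro ball_cong refl) (smt (verit, best) subsetD)
  qed
  thus ?thesis using that unfolding opn unfolding normal_toric_variety_def toric_variety_def fspace.simps mem_Collect_eq by (simp add: pre)
 qed
 show ?thesis
 proof (rule presented_glued_iso[OF W presC hW cover _ _ _ opn reg])
  show "inj_on k (points W)"
  proof (rule inj_onI)
   fix w w' assume w: "w \<in> points W" "w' \<in> points W" "k w = k w'"
   obtain q h where q: "q \<in> F" "h \<in> points (?C q)" "w = chart_map q h" using cover[OF w(1)] by blast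
   hence "(q, h) \<in> k w'" using w(3) unfolding k_def by auto
   thus "w = w'" using q(3) unfolding k_def by simp
  qed
 next
  fix q D u h assume q: "q \<in> F" and D: "(D, u) \<in> proj_basis Y0" and h: "h \<in> points (?C q)" "chart_map q h \<in> D"
  let ?B = "verts q"
  obtain b where b: "b \<in> ?B" using fan_verts(1)[OF q] by blast
  obtain d F G where FG: "hfun d F" "hfun d G" "D = basic_open Y0 G" "u = ratio F G" by (rule proj_basisE[OF D])
  obtain f where f: "keys f \<subseteq> semig ?B" "\<And>h. h \<in> chars ?B \<Longrightarrow> F (point h b) = meval h f"
   using hfun_point_semigroup_algebra[OF b verts_subset FG(1)] by blast
  obtain g where g: "keys g \<subseteq> semig ?B" "\<And>h. h \<in> chars ?B \<Longrightarrow> G (point h b) = meval h g"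
   using hfun_point_semigroup_algebra[OF b verts_subset FG(2)] by blast
  have mem: "chart_map q y \<in> D \<longleftrightarrow> meval y g \<noteq> 0" and val: "u (chart_map q y) = meval y f / meval y g"
   if y: "y \<in> chars ?B" for y
  proof -
   have p: "point y b \<in> Y0" using point_charts[OF y b verts_subset] unfolding charts_def by blast
   show "chart_map q y \<in> D \<longleftrightarrow> meval y g \<noteq> 0"
    unfolding chart_map_eq[OF q y b] FG(3) orbit_in_basic_open[OF is_cone_Y0 FG(2) p] g(2)[OF y] ..
   show "u (chart_map q y) = meval y f / meval y g" unfolding chart_map_eq[OF q y b] FG(4) ratio_orbit[OF FG(1,2)] g(2)[OF y] f(2)[OF y] ..
  qed
  show "\<exists>D' u'. (D', u') \<in> toric_basis (S q) \<and> h \<in> D' \<and> (\<forall>y\<in>D'. chart_map q y \<in> D \<and> u' y = u (chart_map q y))"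
  proof (intro exI conjI ballI)
   show "({h \<in> semigroup_points (S q). meval h g \<noteq> 0}, \<lambda>h. meval h f / meval h g) \<in> toric_basis (S q)"
    unfolding S_def by (rule toric_basisI[OF f(1) g(1)])
  qed (use h mem val ptsC[OF q] S_def in auto)
 next
  fix q D u h assume q: "q \<in> F" and D: "(D, u) \<in> toric_basis (S q)" and h: "h \<in> D"
  let ?B = "verts q"
  obtain b where b: "b \<in> ?B" using fan_verts(1)[OF q] by blast
  obtain f s where fs: "keys f \<subseteq> semig ?B" "keys s \<subseteq> semig ?B"
   "D = {h \<in> chars ?B. meval h s \<noteq> 0}" "u = (\<lambda>h. meval h f / meval h s)" by (rule toric_basisE[OF D[unfolded S_def]])
  obtain f' us where f': "hfun (length us) f'" "set us \<subseteq> ?B" "\<forall>z\<in>charts ?B. f' z = meval (chi ?B z) f * lprod z us"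
   by (rule semigroup_algebra_homogenize[OF verts_subset fs(1)])
  obtain s' vs where s': "hfun (length vs) s'" "set vs \<subseteq> ?B" "\<forall>z\<in>charts ?B. s' z = meval (chi ?B z) s * lprod z vs"
   by (rule semigroup_algebra_homogenize[OF verts_subset fs(2)])
  have finB: "finite ?B" using verts_subset finite_subset by blast
  \<comment> \<open>The product of all coordinates in \<open>verts q\<close> becomes a factor of the
    denominator: it confines the basic open set to the image of the chart. The numerator gets the
    same factor, so the quotient is unchanged.\<close>
  define bs where "bs = sorted_list_of_set ?B"
  have bs: "set bs = ?B" using finB by (simp add: bs_def)
  have hl: "hfun (length xs) (\<lambda>z. lprod z xs)" if "set xs \<subseteq> ?B" for xs
   using that verts_subset[of q] by (intro hfun_prod_list) force
  have 1: "hfun (length us + length (vs @ bs)) (\<lambda>z. f' z * lprod z (vs @ bs))" using s'(2) bs by (intro hfun.mult f'(1) hl) simp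
  have "hfun (length vs + length (us @ bs)) (\<lambda>z. s' z * lprod z (us @ bs))" using f'(2) bs by (intro hfun.mult s'(1) hl) simp
  hence 2: "hfun (length us + length (vs @ bs)) (\<lambda>z. s' z * lprod z (us @ bs))" by (simp add: algebra_simps)
  have nz: "lprod z xs \<noteq> 0" if "z \<in> charts ?B" "set xs \<subseteq> ?B" for z xs
   using that unfolding charts_def lprod_eq_0_iff by blast
  have nz': "z \<in> charts ?B" if "z \<in> Y0" "s' z * lprod z (us @ bs) \<noteq> 0" for z
   using that bs unfolding charts_def by (auto simp: lprod_eq_0_iff)
  show "\<exists>D' u'. (D', u') \<in> proj_basis Y0 \<and> chart_map q h \<in> D' \<and> (\<forall>w\<in>D'. \<exists>y\<in>D. w = chart_map q y \<and> u y = u' w)"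
  proof (intro exI conjI ballI)
   show "(basic_open Y0 (\<lambda>z. s' z * lprod z (us @ bs)), ratio (\<lambda>z. f' z * lprod z (vs @ bs)) (\<lambda>z. s' z * lprod z (us @ bs))) \<in> proj_basis Y0"
    by (rule proj_basisI[OF 1 2])
   have h': "h \<in> chars ?B" "meval h s \<noteq> 0" using h unfolding fs(3) by auto
   have z: "point h b \<in> charts ?B" by (rule point_charts[OF h'(1) b verts_subset])
   hence z0: "point h b \<in> Y0" unfolding charts_def by blast
   have "chi ?B (point h b) = h" using chi_point[OF h'(1) b verts_subset, of 1] by simp
   hence "s' (point h b) \<noteq> 0" unfolding bspec[OF s'(3) z] using h'(2) nz[OF z s'(2)] by simp
   moreover have "lprod (point h b) (us @ bs) \<noteq> 0" using f'(2) bs by (intro nz[OF z]) simp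
   ultimately show "chart_map q h \<in> basic_open Y0 (\<lambda>z. s' z * lprod z (us @ bs))"
    unfolding chart_map_eq[OF q h'(1) b] orbit_in_basic_open[OF is_cone_Y0 2 z0] by simp
   fix w assume "w \<in> basic_open Y0 (\<lambda>z. s' z * lprod z (us @ bs))"
   then obtain z where z: "z \<in> Y0" "w = orbit z" "s' z * lprod z (us @ bs) \<noteq> 0" by (rule basic_openE)
   have zB: "z \<in> charts ?B" by (rule nz'[OF z(1,3)])
   have "meval (chi ?B z) s \<noteq> 0" using z(3) bspec[OF s'(3) zB] by auto
   hence "chi ?B z \<in> D" unfolding fs(3) using chi_semigroup_points[OF zB verts_subset] by blast
   moreover have "w = chart_map q (chi ?B z)" using chart_map_chi[OF q zB] z(2) by simp
   moreover have "u (chi ?B z) = ratio (\<lambda>z. f' z * lprod z (vs @ bs)) (\<lambda>z. s' z * lprod z (us @ bs)) w"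
    unfolding z(2) ratio_orbit[OF 1 2] fs(4) bspec[OF f'(3) zB] bspec[OF s'(3) zB]
    using nz[OF zB f'(2)] nz[OF zB s'(2)] nz[OF zB, of bs] bs by (simp add: field_simps)
   ultimately show "\<exists>y\<in>D. w = chart_map q y \<and> u y = ratio (\<lambda>z. f' z * lprod z (vs @ bs)) (\<lambda>z. s' z * lprod z (us @ bs)) w"
    by blast
  qed
 qed
qed

end

section \<open>The fibres of the Rees degeneration\<close>

context rees
begin

lemma Phi_at_0: "j \<in> {1..N} \<Longrightarrow> fam 0 x j = mono_eval x (s j)"
 by (simp add: fam_def heval_at_0[OF f_weight] f_initial)

lemma lprod_Phi_0: "set xs \<subseteq> {1..N} \<Longrightarrow> lprod (fam 0 x) xs = mono_eval x (lsum s xs)"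
 by (induction xs) (auto simp: Phi_at_0 mono_eval_add)

lemma S_I: "set xs \<subseteq> {1..N} \<Longrightarrow> lsum s xs \<in> S (length xs)"
 unfolding S_def words_def by blast

text \<open>A function of degree \<open>k\<close> evaluates on \<open>fam 0 x\<close> and on the points of the toric fibre through the same polynomial.\<close>

lemma fibre_0:
 "fibre 0 = {z. z 0 = 0 \<and> (\<forall>j>N. z j = 0) \<and> (\<exists>j\<in>{1..N}. z j \<noteq> 0) \<and>
   (\<forall>xs ys. set xs \<subseteq> {1..N} \<longrightarrow> set ys \<subseteq> {1..N} \<longrightarrow> length xs = length ys \<longrightarrow> lsum s xs = lsum s ys \<longrightarrow>
    lprod z xs = lprod z ys)}" (is "_ = ?Y")
proof (intro equalityI subsetI)
 fix z assume z: "z \<in> fibre 0"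
 have "lprod z xs = lprod z ys" if xy: "set xs \<subseteq> {1..N}" "set ys \<subseteq> {1..N}" "length xs = length ys" "lsum s xs = lsum s ys" for xs ys
 proof -
  have 1: "hfun (length xs) (\<lambda>z. lprod z xs)" "hfun (length ys) (\<lambda>z. lprod z ys)" by (rule hfun_prod_list, use xy in force)+
  have "hfun (length xs) (\<lambda>z. lprod z xs - lprod z ys)" by (rule hfun_diff[OF 1(1) 1(2)[folded xy(3)]])
  moreover have "\<forall>x. lprod (fam 0 x) xs - lprod (fam 0 x) ys = 0" using xy by (simp add: lprod_Phi_0)
  ultimately have "lprod z xs - lprod z ys = 0" using z unfolding fibre_def by blast
  thus ?thesis by simp
 qed
 moreover have "\<exists>j\<in>{1..N}. z j \<noteq> 0" using z unfolding fibre_def by (intro nonzero_coord) auto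
 ultimately show "z \<in> ?Y" using z unfolding fibre_def by blast
next
 fix z assume z: "z \<in> ?Y"
 hence rel: "lprod z xs = lprod z ys"
  if "set xs \<subseteq> {1..N}" "set ys \<subseteq> {1..N}" "length xs = length ys" "lsum s xs = lsum s ys" for xs ys using that by blast
 have z0: "z 0 = 0" "\<forall>j>N. z j = 0" using z by auto
 \<comment> \<open>On the binomial set the fixed factorization may be replaced by any other one of
   the same exponent.\<close>
 have cm: "cmono (length xs) (lsum s xs) z = lprod z xs" if "set xs \<subseteq> {1..N}" for xs
  using word[OF S_I[OF that]] that unfolding cmono_def words_def by (intro rel) auto
 have nf: "\<exists>g. keys g \<subseteq> S k \<and> (\<forall>x. F (fam 0 x) = peval g x) \<and> F z = meval (\<lambda>e. cmono k e z) g"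
  if "hfun k F" for k F using that
 proof (induction rule: hfun.induct)
  case (const a)
  have "0 \<in> S 0" using S_I[of "[]"] by simp
  moreover have "cmono 0 0 z = 1" using cm[of "[]"] by simp
  ultimately show ?case by (intro exI[of _ "single 0 a"]) (auto simp: peval_eq_meval)
 next
  case param
  show ?case by (intro exI[of _ 0]) (simp add: z0)
 next
  case (coord i)
  show ?case
  proof (cases "i \<le> N")
   case True
   hence i: "i \<in> {1..N}" using coord by simp
   have "s i \<in> S 1" "cmono 1 (s i) z = z i" using S_I[of "[i]"] cm[of "[i]"] i by (simp_all add: One_nat_def)
   thus ?thesis using i by (intro exI[of _ "single (s i) 1"]) (auto simp: peval_eq_meval Phi_at_0)
  next
   case False
   thus ?thesis using z0 by (intro exI[of _ 0]) (auto simp: fam_def)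
  qed
 next
  case (zero k)
  show ?case by (intro exI[of _ 0]) simp
 next
  case (add k F G)
  obtain f where f: "keys f \<subseteq> S k" "\<forall>x. F (fam 0 x) = peval f x" "F z = meval (\<lambda>e. cmono k e z) f"
   using add.IH(1) by (elim exE conjE)
  obtain g where g: "keys g \<subseteq> S k" "\<forall>x. G (fam 0 x) = peval g x" "G z = meval (\<lambda>e. cmono k e z) g"
   using add.IH(2) by (elim exE conjE)
  have "keys (f + g) \<subseteq> S k" using f(1) g(1) keys_add[of f g] by blast
  thus ?case using f(2,3) g(2,3) by (intro exI[of _ "f + g"]) (simp add: peval_add meval_add)
 next
  case (mult k F l G)
  obtain f where f: "keys f \<subseteq> S k" "\<forall>x. F (fam 0 x) = peval f x" "F z = meval (\<lambda>e. cmono k e z) f"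
   using mult.IH(1) by (elim exE conjE)
  obtain g where g: "keys g \<subseteq> S l" "\<forall>x. G (fam 0 x) = peval g x" "G z = meval (\<lambda>e. cmono l e z) g"
   using mult.IH(2) by (elim exE conjE)
  have Sadd: "e + e' \<in> S (k + l) \<and> cmono (k + l) (e + e') z = cmono k e z * cmono l e' z" if e: "e \<in> S k" "e' \<in> S l" for e e'
  proof -
   obtain xs ys where 1: "length xs = k" "set xs \<subseteq> {1..N}" "e = lsum s xs" "length ys = l" "set ys \<subseteq> {1..N}" "e' = lsum s ys"
    using e unfolding S_def words_def by blast
   show ?thesis using S_I[of "xs @ ys"] cm[of "xs @ ys"] cm[OF 1(2)] cm[OF 1(5)] 1 by simp
  qed
  have "keys (f * g) \<subseteq> S (k + l)" using keys_mult Sadd f g by blast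
  moreover have "meval (\<lambda>e. cmono (k + l) e z) (f * g) = meval (\<lambda>e. cmono k e z) f * meval (\<lambda>e. cmono l e z) g"
   using Sadd f(1) g(1) by (intro meval_mult) blast
  ultimately show ?case using f(2,3) g(2,3) by (intro exI[of _ "f * g"]) (simp add: peval_mult)
 qed
 have "F z = 0" if F: "hfun k F" "\<forall>x. F (fam 0 x) = 0" for k F
 proof -
  obtain g where g: "\<forall>x. F (fam 0 x) = peval g x" "F z = meval (\<lambda>e. cmono k e z) g" using nf[OF F(1)] by (elim exE conjE)
  have "g = 0" using g(1) F(2) by (intro peval_eq_0D) simp
  thus ?thesis using g(2) by simp
 qed
 moreover have "\<exists>i>0. z i \<noteq> 0"
 proof -
  obtain j where "j \<in> {1..N}" "z j \<noteq> 0" using z by blast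
  thus ?thesis by (intro exI[of _ j]) simp
 qed
 ultimately show "z \<in> fibre 0" unfolding fibre_def using z0 by blast
qed

section \<open>Fibres over nonzero parameters\<close>

context
 fixes a :: complex assumes a: "a \<noteq> 0"
begin

abbreviation scaled :: "nat \<Rightarrow> 'v cpoly" where
 "scaled j \<equiv> Const (a ^ weight c (s j)) * f j"

text \<open>The torus element with weights \<open>c\<close> carries the fibre at \<open>a\<close> to
  the embedding by the generators themselves, up to the constants
  \<open>a ^ weight c (s j)\<close>.\<close>

lemma Phi_scaled: "fam a (\<lambda>v. a ^ c v * x v) = coord_point a N scaled x"
proof
 fix j show "fam a (\<lambda>v. a ^ c v * x v) j = coord_point a N scaled x j"
  using heval_peval[OF f_weight, of j a x] by (cases "j = 0") (auto simp: fam_def coord_point_def peval_mult)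
qed

lemma Phi_unscaled: "fam a x = coord_point a N scaled (\<lambda>v. x v / a ^ c v)"
 unfolding Phi_scaled[symmetric] using a by simp

lemma fibre_generic:
 "fibre a = {z. z 0 = a \<and> (\<forall>j>N. z j = 0) \<and> (\<exists>i>0. z i \<noteq> 0) \<and>
   (\<forall>k F. hfun k F \<longrightarrow> (\<forall>x. F (coord_point a N scaled x) = 0) \<longrightarrow> F z = 0)}"
proof -
 have "(\<forall>x. F (fam a x) = 0) \<longleftrightarrow> (\<forall>x. F (coord_point a N scaled x) = 0)" for F :: "cvec \<Rightarrow> complex"
  by (metis Phi_scaled Phi_unscaled)
 thus ?thesis unfolding fibre_def by simp
qed

text \<open>Subduction at the parameter \<open>a\<close>, divided by \<open>a ^ w\<close>. Hence the
  algebra is generated in degree one by the elements with the prescribed leading monomials.\<close>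

lemma scaled_generates:
 assumes "g \<in> R k"
 shows "\<exists>F. hfun k F \<and> (\<forall>x. peval g x = F (coord_point a N scaled x))"
proof -
 obtain w where w: "weight_le c w g" using weight_le_ex by blast
 obtain b where b: "\<And>t x. heval c w g t x = (\<Sum>e\<in>S k. b e * t ^ (w - weight c e) * cmono k e (fam t x))"
  using subduction[OF assms w] by blast
 let ?F = "\<lambda>z. \<Sum>e\<in>S k. (b e * a ^ (w - weight c e) / a ^ w) * cmono k e z"
 have "hfun k ?F" by (intro hfun_sum hfun_cmult cmono_hfun)
 moreover have "peval g x = ?F (coord_point a N scaled x)" for x
 proof -
  have "a ^ w * peval g x = (\<Sum>e\<in>S k. b e * a ^ (w - weight c e) * cmono k e (coord_point a N scaled x))"
   unfolding heval_peval[OF w, symmetric] b Phi_scaled ..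
  hence "peval g x = (\<Sum>e\<in>S k. b e * a ^ (w - weight c e) * cmono k e (coord_point a N scaled x)) / a ^ w"
   using a by (simp add: field_simps)
  thus ?thesis unfolding sum_divide_distrib by simp
 qed
 ultimately show ?thesis by blast
qed

end

end

theorem veronese_toric_degeneration:
 assumes "graded_algebra R D" and d: "d > 0" and "rees c (\<lambda>k. R (k * d)) N f s" and "toric M (\<lambda>j. real_expo (s j)) N"
  and inj: "\<And>xs ys. set xs \<subseteq> {1..N} \<Longrightarrow> set ys \<subseteq> {1..N} \<Longrightarrow>
   lsum (\<lambda>j. real_expo (s j)) xs = lsum (\<lambda>j. real_expo (s j)) ys \<longleftrightarrow> lsum s xs = lsum s ys"
 shows "toric_degeneration (Proj R) (normal_toric_variety M (convex hull ((\<lambda>j. real_expo (s j)) ` {1..N})))"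
proof -
 interpret R: graded_algebra R D by fact
 interpret rees c "\<lambda>k. R (k * d)" N f s by fact
 interpret T: toric M "\<lambda>j. real_expo (s j)" N by fact
 show ?thesis
 proof (rule rees_toric_degeneration)
  fix a W assume a: "a \<noteq> 0" and W: "presented W (proj_basis (fibre a))"
  interpret V: veronese R D d N a "\<lambda>j. Const (a ^ weight c (s j)) * f j"
  proof
   show "d > 0" by (rule d)
   show "Const (a ^ weight c (s j)) * f j \<in> R d" if "j \<in> {1..N}" for j using f_R[OF that] by (intro R.R_Const_mult) simp
   show "\<exists>F. hfun k F \<and> (\<forall>x. peval g x = F (coord_point a N (\<lambda>j. Const (a ^ weight c (s j)) * f j) x))"
    if "g \<in> R (k * d)" for g k by (rule scaled_generates[OF a that])
  qed
  have "fibre a = V.cone" unfolding fibre_generic[OF a] V.cone_def ..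
  thus "var_iso W (Proj R)" using V.Proj_iso W by simp
 next
  fix W assume W: "presented W (proj_basis (fibre 0))"
  have "fibre 0 = T.Y0" unfolding fibre_0 T.Y0_def using inj by blast
  thus "var_iso W (normal_toric_variety M (convex hull ((\<lambda>j. real_expo (s j)) ` {1..N})))"
   using T.proj_toric_iso W by (simp add: T.P_def)
 qed
qed

section \<open>Degenerations of graded algebras with finitely generated initial algebra\<close>

lemma lookup_scaleR: "lookup (a *\<^sub>R (m :: 'v \<Rightarrow>\<^sub>0 'a::real_vector)) v = a *\<^sub>R lookup m v"
proof -
 have "finite {v. a *\<^sub>R lookup m v \<noteq> 0}" by (rule finite_subset[of _ "keys m"]) (auto simp: in_keys_iff)
 thus ?thesis unfolding scaleR_poly_mapping_def by (simp add: lookup_Abs_poly_mapping)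
qed

lemma lookup_real_expo: "lookup (real_expo e) v = real (lookup e v)"
 by (simp add: real_expo_def Poly_Mapping.map.rep_eq when_def)

lemma keys_real_expo [simp]: "keys (real_expo e) = keys e"
 by (auto simp: in_keys_iff lookup_real_expo)

lemma real_expo_0 [simp]: "real_expo 0 = 0"
 by (rule poly_mapping_eqI) (simp add: lookup_real_expo)

lemma real_expo_add: "real_expo (e + e') = real_expo e + real_expo e'"
 by (rule poly_mapping_eqI) (simp add: lookup_real_expo lookup_add)

lemma real_expo_inject: "real_expo e = real_expo e' \<longleftrightarrow> e = e'"
proof
 assume "real_expo e = real_expo e'"
 hence "real (lookup e v) = real (lookup e' v)" for v by (metis lookup_real_expo)
 thus "e = e'" by (intro poly_mapping_eqI) simp
qed simp

lemma real_expo_sum: "real_expo (\<Sum>i\<in>I. e i) = (\<Sum>i\<in>I. real_expo (e i))"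
 by (induction I rule: infinite_finite_induct) (simp_all add: real_expo_add)

lemma real_expo_lsum: "real_expo (sum_list (map s xs)) = sum_list (map (\<lambda>j. real_expo (s j)) xs)"
 by (induction xs) (simp_all add: real_expo_add)

section \<open>Degrees of real and integral exponents\<close>

definition total_degree :: "('v \<Rightarrow>\<^sub>0 real) \<Rightarrow> real" where
 "total_degree m = (\<Sum>v\<in>keys m. lookup m v)"

lemma total_degree_eq_sum:
 assumes "finite K" "keys m \<subseteq> K"
 shows "total_degree m = (\<Sum>v\<in>K. lookup m v)"
 unfolding total_degree_def using assms by (intro sum.mono_neutral_left) (auto simp: in_keys_iff)

lemma linear_total_degree: "linear total_degree"
proof (rule linearI)
 fix x y :: "'a \<Rightarrow>\<^sub>0 real" and a :: real
 let ?K = "keys x \<union> keys y"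
 show "total_degree (x + y) = total_degree x + total_degree y"
  using keys_add[of x y] by (simp add: total_degree_eq_sum[of ?K] lookup_add sum.distrib)
 have "keys (a *\<^sub>R x) \<subseteq> keys x" by (auto simp: in_keys_iff lookup_scaleR)
 thus "total_degree (a *\<^sub>R x) = a *\<^sub>R total_degree x"
  by (simp add: total_degree_eq_sum[of "keys x"] lookup_scaleR sum_distrib_left)
qed

lemma total_degree_real_expo: "total_degree (real_expo e) = real (tdeg e)"
 by (simp add: total_degree_def weight_def lookup_real_expo)

lemma weight_one_eq_0_iff: "tdeg e = 0 \<longleftrightarrow> e = 0"
 by (auto simp: weight_def in_keys_iff intro!: poly_mapping_eqI)

definition copies :: "nat \<Rightarrow> 'v expo \<Rightarrow> 'v expo" where
 "copies n v = sum_list (replicate n v)"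

lemma copies_add: "copies (m + n) v = copies m v + copies n v"
 by (simp add: copies_def replicate_add)

lemma weight_copies: "weight c (copies n v) = n * weight c v"
 by (induction n) (simp_all add: copies_def weight_add)

lemma real_expo_copies: "real_expo (copies n v) = real n *\<^sub>R real_expo v"
 by (induction n) (simp_all add: copies_def real_expo_add scaleR_left_distrib)

lemma keys_copies: "keys (copies n v) \<subseteq> keys v"
proof (induction n)
 case (Suc n)
 thus ?case using keys_add[of v "copies n v"] by (auto simp: copies_def)
qed (simp add: copies_def)

lemma keys_sum_subset:
 fixes e :: "'i \<Rightarrow> 'v \<Rightarrow>\<^sub>0 'b::comm_monoid_add"
 assumes "\<And>i. i \<in> I \<Longrightarrow> keys (e i) \<subseteq> V"
 shows "keys (\<Sum>i\<in>I. e i) \<subseteq> V"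
 using assms
proof (induction I rule: infinite_finite_induct)
 case (insert i I)
 thus ?case using keys_add[of "e i" "\<Sum>i\<in>I. e i"] by auto
qed auto

lemma subset_image_map:
 "set es \<subseteq> s ` I \<Longrightarrow> \<exists>js. set js \<subseteq> I \<and> es = map s js"
proof (induction es)
 case (Cons e es)
 then obtain js j where "set js \<subseteq> I" "es = map s js" "j \<in> I" "e = s j" by auto
 thus ?case by (intro exI[of _ "j # js"]) simp
qed simp

lemma fin_cone_add: "x \<in> fin_cone T \<Longrightarrow> y \<in> fin_cone T \<Longrightarrow> x + y \<in> fin_cone T"
proof -
 assume "x \<in> fin_cone T" "y \<in> fin_cone T"
 then obtain c c' where "x = (\<Sum>t\<in>T. c t *\<^sub>R t)" "\<forall>t\<in>T. 0 \<le> c t" "y = (\<Sum>t\<in>T. c' t *\<^sub>R t)" "\<forall>t\<in>T. 0 \<le> c' t"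
  unfolding fin_cone_def by blast
 thus ?thesis using fin_coneI[of T "\<lambda>t. c t + c' t"] by (simp add: sum.distrib scaleR_left_distrib)
qed

lemma fin_cone_scale: "x \<in> fin_cone T \<Longrightarrow> 0 \<le> a \<Longrightarrow> a *\<^sub>R x \<in> fin_cone T"
by (auto simp: fin_cone_def fin_coneI scaleR_sum_right)

lemma fin_cone_sum: "(\<And>i. i \<in> I \<Longrightarrow> x i \<in> fin_cone T) \<Longrightarrow> sum x I \<in> fin_cone T"
proof (induction I rule: infinite_finite_induct)
 case (insert i I)
 thus ?case by (simp add: fin_cone_add)
qed (use fin_coneI[of T "\<lambda>_. 0"] in auto)

lemma int_lattice_closed:
 "0 \<in> int_lattice V" "x \<in> int_lattice V \<Longrightarrow> y \<in> int_lattice V \<Longrightarrow> x + y \<in> int_lattice V"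
 "x \<in> int_lattice V \<Longrightarrow> y \<in> int_lattice V \<Longrightarrow> x - y \<in> int_lattice V"
 using keys_add[of x y] keys_diff[of x y] by (auto simp: int_lattice_def lookup_add lookup_minus)

lemma real_expo_lattice: "keys e \<subseteq> V \<Longrightarrow> real_expo e \<in> int_lattice V"
 by (simp add: int_lattice_def lookup_real_expo)

text \<open>
 A finitely generated graded monoid of exponents has a Veronese submonoid generated in degree one:
 with \<open>L\<close> the product of the degrees of the generators, any element of degree at least \<open>L\<close> times the
 number of generators has a multiple of a generator of degree \<open>L\<close> as a summand.
\<close>

locale expo_monoid =
 fixes H :: "'v expo set"
 assumes finite_H: "finite H" and H_0: "0 \<notin> H"
begin

abbreviation deg :: "'v expo \<Rightarrow> nat" where "deg \<equiv> tdeg"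

definition comb :: "('v expo \<Rightarrow> nat) \<Rightarrow> 'v expo" where
 "comb a = (\<Sum>v\<in>H. copies (a v) v)"

definition L where "L = (\<Prod>v\<in>H. deg v)"

lemma deg_pos: "v \<in> H \<Longrightarrow> deg v > 0"
 using H_0 weight_one_eq_0_iff[of v] by (metis gr0I)

lemma L_pos: "L > 0"
 unfolding L_def using deg_pos by (intro prod_pos) auto

lemma deg_dvd_L: "v \<in> H \<Longrightarrow> deg v dvd L"
 unfolding L_def using finite_H by (rule dvd_prodI)

lemma deg_comb: "deg (comb a) = (\<Sum>v\<in>H. a v * deg v)"
 by (simp add: comb_def weight_sum weight_copies)

lemma comb_add: "comb (\<lambda>v. a v + b v) = comb a + comb b"
 by (simp add: comb_def copies_add sum.distrib)

lemma comb_single: "v \<in> H \<Longrightarrow> comb (\<lambda>u. if u = v then n else 0) = copies n v"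
proof -
 assume v: "v \<in> H"
 have "comb (\<lambda>u. if u = v then n else 0) = (\<Sum>u\<in>H. if u = v then copies n v else 0)"
  unfolding comb_def by (intro sum.cong) (auto simp: copies_def)
 thus ?thesis using v finite_H by simp
qed

lemma split_off:
 assumes "deg (comb a) \<ge> card H * L" "deg (comb a) > 0"
 obtains b b' where "comb a = comb b + comb b'" "deg (comb b) = L"
proof -
 have "H \<noteq> {}" using assms(2) by (auto simp: comb_def)
 have "\<exists>v\<in>H. L div deg v \<le> a v"
 proof (rule ccontr)
  assume small: "\<not> (\<exists>v\<in>H. L div deg v \<le> a v)"
  have "a v * deg v < L" if "v \<in> H" for v using small that deg_pos deg_dvd_L by force
  hence "(\<Sum>v\<in>H. a v * deg v) < (\<Sum>v\<in>H. L)" using finite_H \<open>H \<noteq> {}\<close> by (intro sum_strict_mono)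
  thus False using assms(1) by (simp add: deg_comb)
 qed
 then obtain v where v: "v \<in> H" "L div deg v \<le> a v" by blast
 let ?b = "\<lambda>u. if u = v then L div deg v else 0" and ?b' = "\<lambda>u. if u = v then a v - L div deg v else a u"
 have "a = (\<lambda>u. ?b u + ?b' u)" using v(2) by (intro ext) auto
 hence "comb a = comb ?b + comb ?b'" using comb_add[of ?b ?b'] by simp
 moreover have "deg (comb ?b) = L" using deg_dvd_L[OF v(1)] by (simp add: comb_single[OF v(1)] weight_copies)
 ultimately show ?thesis by (rule that)
qed

lemma split_off_many:
 assumes "deg (comb a) = (m + t) * L" "t \<ge> card H" "t > 0"
 shows "\<exists>b b'. comb a = comb b + comb b' \<and> deg (comb b) = m * L"
 using assms(1)
proof (induction m arbitrary: a)
 case 0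
 have "comb (\<lambda>_. 0) = 0" by (simp add: comb_def copies_def)
 thus ?case by (intro exI[of _ "\<lambda>_. 0"] exI[of _ a]) simp
next
 case (Suc m)
 have "card H * L \<le> (Suc m + t) * L" using assms(2) by (intro mult_right_mono) auto
 moreover have "0 < (Suc m + t) * L" using L_pos by simp
 ultimately obtain b b' where b: "comb a = comb b + comb b'" "deg (comb b) = L" using split_off[of a] Suc.prems by metis
 have "deg (comb b') = (m + t) * L" using Suc.prems b by (simp add: weight_add)
 then obtain u u' where u: "comb b' = comb u + comb u'" "deg (comb u) = m * L" using Suc.IH by blast
 thus ?case using b comb_add[of b u] by (intro exI[of _ "\<lambda>v. b v + u v"] exI[of _ u']) (simp add: add.assoc weight_add)
qed

text \<open>Pieces of degree \<open>d D\<close> are split off one at a time. The factor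
  \<open>card H + 1\<close> guarantees that what remains after each of these steps is large enough
  for a multiple of a generator in degree \<open>L\<close> to be found throughout the step; the last
  piece is taken whole.\<close>

definition d where "d = (card H + 1) * L"

lemma d_pos: "d > 0"
 using L_pos by (simp add: d_def)

lemma veronese_generated:
 assumes "D > 0" "deg (comb a) = k * d * D"
 shows "\<exists>es. length es = k \<and> (\<forall>e\<in>set es. e \<in> range comb \<and> deg e = d * D) \<and> comb a = sum_list es"
 using assms(2)
proof (induction k arbitrary: a)
 case 0
 hence "comb a = 0" using weight_one_eq_0_iff by auto
 thus ?case by (intro exI[of _ "[]"]) simp
next
 case (Suc k)
 show ?case
 proof (cases "k = 0")
  case True
  thus ?thesis using Suc.prems by (intro exI[of _ "[comb a]"]) auto
 next
  case False
  have "deg (comb a) = ((card H + 1) * D + k * (card H + 1) * D) * L" using Suc.prems by (simp add: d_def algebra_simps)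
  moreover have "1 * (card H + 1) * 1 \<le> k * (card H + 1) * D" using False assms(1) by (intro mult_le_mono) auto
  hence "card H + 1 \<le> k * (card H + 1) * D" by (simp only: mult_1 mult_1_right)
  hence "card H \<le> k * (card H + 1) * D" "0 < k * (card H + 1) * D" by (rule add_leD1, rule less_le_trans[rotated]) simp
  ultimately obtain b b' where b: "comb a = comb b + comb b'" "deg (comb b) = (card H + 1) * D * L"
   using split_off_many[of a "(card H + 1) * D" "k * (card H + 1) * D"] by blast
  have db: "deg (comb b) = d * D" using b(2) by (simp add: d_def mult.commute mult.left_commute)
  hence "deg (comb b') = k * d * D" using Suc.prems b(1) by (simp add: weight_add add_mult_distrib)
  then obtain es where "length es = k" "\<forall>e\<in>set es. e \<in> range comb \<and> deg e = d * D" "comb b' = sum_list es"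
   using Suc.IH by blast
  thus ?thesis using b(1) db by (intro exI[of _ "comb b # es"]) simp
 qed
qed

lemma finite_deg: "finite {e \<in> range comb. deg e = n}"
proof (rule finite_subset)
 show "{e \<in> range comb. deg e = n} \<subseteq> comb ` (PiE H (\<lambda>_. {..n}))"
 proof
  fix e assume "e \<in> {e \<in> range comb. deg e = n}"
  then obtain a where a: "e = comb a" "deg (comb a) = n" by blast
  have "a v \<le> n" if "v \<in> H" for v
  proof -
   have "a v \<le> a v * deg v" using deg_pos[OF that] by simp
   also have "\<dots> \<le> n" unfolding a(2)[symmetric] deg_comb by (rule member_le_sum[OF that _ finite_H]) simp
   finally show ?thesis .
  qed
  hence "restrict a H \<in> PiE H (\<lambda>_. {..n})" by auto
  moreover have "e = comb (restrict a H)" unfolding a(1) comb_def by (intro sum.cong) auto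
  ultimately show "e \<in> comb ` (PiE H (\<lambda>_. {..n}))" by blast
 qed
 show "finite (comb ` (PiE H (\<lambda>_. {..n})))" using finite_H by (intro finite_imageI finite_PiE) auto
qed

lemma real_expo_comb: "real_expo (comb a) = (\<Sum>v\<in>H. real (a v) *\<^sub>R real_expo v)"
 by (simp add: comb_def real_expo_sum real_expo_copies)

lemma keys_comb: "(\<And>v. v \<in> H \<Longrightarrow> keys v \<subseteq> V) \<Longrightarrow> keys (comb a) \<subseteq> V"
 unfolding comb_def using keys_copies by (intro keys_sum_subset) fast

end

lemma keys_initial_form: "keys (initial_form c g) \<subseteq> keys g"
 unfolding initial_form_def by (rule keys_sum_subset) (auto simp: in_keys_iff split: if_splits)

text \<open>\<open>comb\<close> runs through the monoid generated by \<open>H\<close>. Hypothesis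
  \<open>lat\<close> is the saturation of this monoid, and \<open>init\<close> and
  \<open>lift\<close> identify it, degree by degree, with the initial exponents of \<open>R\<close>.
  The factor \<open>a\<close> will be the degree of the Veronese subalgebra.\<close>

theorem graded_toric_degeneration:
 fixes R :: "nat \<Rightarrow> 'v cpoly set" and H :: "'v expo set"
 assumes R: "graded_algebra R D" and H: "finite H" "0 \<notin> H" "\<And>v. v \<in> H \<Longrightarrow> keys v \<subseteq> V"
  and lat: "\<And>e. keys e \<subseteq> V \<Longrightarrow> real_expo e \<in> fin_cone (real_expo ` H) \<Longrightarrow> e \<in> range (expo_monoid.comb H)"
  and init: "\<And>k g e. g \<in> R k \<Longrightarrow> e \<in> keys (initial_form c g) \<Longrightarrow>
   keys e \<subseteq> V \<and> real_expo e \<in> fin_cone (real_expo ` H)"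
  and lift: "\<And>k e. e \<in> range (expo_monoid.comb H) \<Longrightarrow> tdeg e = k * D \<Longrightarrow> \<exists>g\<in>R k. has_LM c g e"
  and nonneg: "\<And>m. m \<in> int_lattice V \<Longrightarrow> m \<in> fin_cone (real_expo ` H) \<Longrightarrow> \<exists>e. m = real_expo e"
 shows "\<exists>a>0. toric_degeneration (Proj R)
  (normal_toric_variety (int_lattice V) ((*\<^sub>R) a ` {m \<in> fin_cone (real_expo ` H). total_degree m = real D}))"
proof -
 interpret R: graded_algebra R D by fact
 interpret H: expo_monoid H by standard fact+
 let ?C = "fin_cone (real_expo ` H)"
 have D: "D > 0" by (rule R.D_pos)
 define d where "d = H.d"
 have d: "d > 0" unfolding d_def by (rule H.d_pos)
 \<comment> \<open>The monoid elements of degree \<open>d D\<close> become the degree one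
   generators. They are numbered from 1 because position 0 of a point holds the parameter.\<close>
 define E where "E = {e \<in> range H.comb. H.deg e = d * D}"
 have finE: "finite E" unfolding E_def by (rule H.finite_deg)
 define N where "N = card E"
 obtain s where s: "bij_betw s {1..N} E" unfolding N_def using ex_bij_betw_nat_finite_1[OF finE] by blast
 have sE: "s j \<in> E" if "j \<in> {1..N}" for j using s that unfolding bij_betw_def by blast
 have imE: "s ` {1..N} = E" using s unfolding bij_betw_def by blast
 let ?A = "\<lambda>j. real_expo (s j)"
 have comb_C: "real_expo (H.comb a) \<in> ?C" for a
  unfolding H.real_expo_comb using H(1) by (intro fin_cone_sum fin_cone_scale fin_cone_generator) auto
 have comb_V: "keys (H.comb a) \<subseteq> V" for a using H(3) by (rule H.keys_comb)
 have sC: "?A j \<in> ?C" and sV: "keys (s j) \<subseteq> V" and s_deg: "H.deg (s j) = d * D" if j: "j \<in> {1..N}" for j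
 proof -
  obtain a where "s j = H.comb a" "H.deg (s j) = d * D" using sE[OF j] unfolding E_def by blast
  thus "?A j \<in> ?C" "keys (s j) \<subseteq> V" "H.deg (s j) = d * D" using comb_C[of a] comb_V[of a] by simp_all
 qed
 have words: "\<exists>xs. length xs = k \<and> set xs \<subseteq> {1..N} \<and> e = sum_list (map s xs)"
  if e: "keys e \<subseteq> V" "real_expo e \<in> ?C" "H.deg e = k * d * D" for e k
 proof -
  obtain a where "e = H.comb a" using lat[OF e(1,2)] by blast
  then obtain es where es: "length es = k" "\<forall>e\<in>set es. e \<in> range H.comb \<and> H.deg e = d * D" "e = sum_list es"
   using H.veronese_generated[OF D, of a k] e(3) unfolding d_def by blast
  have "set es \<subseteq> s ` {1..N}" unfolding imE E_def using es(2) by blast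
  then obtain xs where "set xs \<subseteq> {1..N}" "es = map s xs" using subset_image_map by blast
  thus ?thesis using es by (intro exI[of _ xs]) auto
 qed
 have comb_C': "m \<in> ?C \<and> total_degree m = k * real (d * D)" if m: "nonneg_comb ?A N k m" for m k
 proof -
  obtain l where l: "\<forall>j\<in>{1..N}. 0 \<le> l j" "m = (\<Sum>j\<in>{1..N}. l j *\<^sub>R ?A j)" "sum l {1..N} = k"
   using m unfolding nonneg_comb_def by blast
  have "m \<in> ?C" unfolding l(2) using l(1) sC by (intro fin_cone_sum fin_cone_scale) auto
  moreover have "total_degree m = (\<Sum>j\<in>{1..N}. l j * real (d * D))"
   unfolding l(2) linear_sum[OF linear_total_degree] linear_scale[OF linear_total_degree] total_degree_real_expo
   using s_deg by (intro sum.cong) auto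
  ultimately show ?thesis using l(3) by (simp flip: sum_distrib_right)
 qed
 have toric: "toric (int_lattice V) ?A N"
 proof
  show "?A j \<in> int_lattice V" if "j \<in> {1..N}" for j using sV[OF that] by (rule real_expo_lattice)
  fix m k assume m: "m \<in> int_lattice V" "nonneg_comb ?A N (real k) m"
  then obtain e where e: "m = real_expo e" using nonneg comb_C' by blast
  have "keys e \<subseteq> V" using m(1) unfolding e int_lattice_def by simp
  moreover have "real (H.deg e) = real (k * d * D)" using comb_C'[OF m(2)] unfolding e total_degree_real_expo by (simp add: mult.assoc)
  ultimately obtain xs where "length xs = k" "set xs \<subseteq> {1..N}" "e = sum_list (map s xs)"
   using words[of e k] comb_C'[OF m(2)] unfolding e of_nat_eq_iff by blast
  thus "\<exists>xs. length xs = k \<and> set xs \<subseteq> {1..N} \<and> m = lsum ?A xs" unfolding e using real_expo_lsum by blast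
 qed (auto intro: int_lattice_closed)
 have "\<exists>g. g \<in> R d \<and> weight_le c (weight c (s j)) g \<and> wpart c (weight c (s j)) g = Monom (s j)" if j: "j \<in> {1..N}" for j
 proof -
  obtain g where g: "g \<in> R d" "has_LM c g (s j)" using lift[of "s j" d] sE[OF j] unfolding E_def by blast
  then obtain a where a: "a \<noteq> 0" "weight_le c (weight c (s j)) g" "wpart c (weight c (s j)) g = single (s j) a"
   unfolding has_LM_iff by blast
  have "wpart c (weight c (s j)) (Const (1 / a) * g) = Monom (s j)"
   unfolding wpart_Const_mult a(3) using a(1) by (simp add: Const_def Monom_def mult_single)
  thus ?thesis using R.R_Const_mult[OF g(1)] weight_le_Const_mult[OF a(2)] by blast
 qed
 then obtain f where f: "\<And>j. j \<in> {1..N} \<Longrightarrow> f j \<in> R d"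
  "\<And>j. j \<in> {1..N} \<Longrightarrow> weight_le c (weight c (s j)) (f j)"
  "\<And>j. j \<in> {1..N} \<Longrightarrow> wpart c (weight c (s j)) (f j) = Monom (s j)" by metis
 have rees: "rees c (\<lambda>k. R (k * d)) N f s"
 proof
  fix g k e assume g: "g \<in> R (k * d)" and e: "e \<in> keys (initial_form c g)"
  have "H.deg e = k * d * D" using R.R_degree[OF g] e keys_initial_form by blast
  thus "\<exists>xs. length xs = k \<and> set xs \<subseteq> {1..N} \<and> e = sum_list (map s xs)" using init[OF g e] by (intro words) auto
 next
  fix g h k l assume "g \<in> R (k * d)" "h \<in> R (l * d)"
  thus "g * h \<in> R ((k + l) * d)" using R.R_mult by (simp add: add_mult_distrib)
 qed (use R.R_0 R.R_add R.R_Const_mult R.R_1 f in auto)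
 have hull: "convex hull (?A ` {1..N}) = (*\<^sub>R) (real d) ` {m \<in> ?C. total_degree m = real D}"
 proof (intro equalityI subsetI)
  fix m assume "m \<in> convex hull (?A ` {1..N})"
  hence m: "m \<in> ?C" "total_degree m = real (d * D)" using comb_C'[of 1 m] unfolding nonneg_comb_hull by auto
  have "total_degree ((1 / real d) *\<^sub>R m) = real D" using m(2) d unfolding linear_scale[OF linear_total_degree] by simp
  moreover have "(1 / real d) *\<^sub>R m \<in> ?C" using m(1) by (intro fin_cone_scale) simp_all
  moreover have "m = real d *\<^sub>R ((1 / real d) *\<^sub>R m)" using d by simp
  ultimately show "m \<in> (*\<^sub>R) (real d) ` {m \<in> ?C. total_degree m = real D}" by blast
 next
  fix m assume "m \<in> (*\<^sub>R) (real d) ` {m \<in> ?C. total_degree m = real D}"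
  then obtain p where p: "p \<in> ?C" "total_degree p = real D" "m = real d *\<^sub>R p" by blast
  obtain q where q: "p = (\<Sum>t\<in>real_expo ` H. q t *\<^sub>R t)" "\<forall>t\<in>real_expo ` H. 0 \<le> q t" using p(1) unfolding fin_cone_def by blast
  have "nonneg_comb ?A N (q t * total_degree t / real (d * D)) (q t *\<^sub>R t)" if t: "t \<in> real_expo ` H" for t
  proof -
   obtain v where v: "v \<in> H" "t = real_expo v" using t by blast
   have dv: "H.deg v dvd d * D" unfolding d_def H.d_def using H.deg_dvd_L[OF v(1)] by simp
   \<comment> \<open>A multiple of each generator of the cone has degree exactly \<open>d D\<close>,
     so it is among the numbered exponents; this puts the ray of \<open>v\<close> into the cone over
     the hull.\<close>
   define n where "n = d * D div H.deg v"
   have n: "n * H.deg v = d * D" using dv by (simp add: n_def)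
   have "H.deg (copies n v) = d * D" using n by (simp add: weight_copies)
   moreover have "copies n v \<in> range H.comb" using H.comb_single[OF v(1), of n, symmetric] by (rule range_eqI[of _ H.comb])
   ultimately have "copies n v \<in> E" unfolding E_def by blast
   then obtain j where j: "j \<in> {1..N}" "s j = copies n v" using imE by (metis imageE)
   have pos: "real n > 0" using n d D by (cases n) auto
   have "real (d * D) = real n * real (H.deg v)" using n by (metis of_nat_mult)
   hence "q t * total_degree t / real (d * D) = q t / real n" unfolding v(2) total_degree_real_expo using H.deg_pos[OF v(1)] by simp
   moreover have "q t *\<^sub>R t = (q t / real n) *\<^sub>R ?A j" unfolding j(2) real_expo_copies using v(2) pos by simp
   moreover have "0 \<le> q t / real n" using q(2) t pos by (intro divide_nonneg_pos) blast+
   ultimately show ?thesis using nonneg_comb_single[OF j(1)] by metis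
  qed
  hence "nonneg_comb ?A N (\<Sum>t\<in>real_expo ` H. q t * total_degree t / real (d * D)) p" unfolding q(1) by (rule nonneg_comb_sum)
  moreover have "(\<Sum>t\<in>real_expo ` H. q t * total_degree t / real (d * D)) = 1 / real d"
  proof -
   have "(\<Sum>t\<in>real_expo ` H. q t * total_degree t) = real D"
    unfolding p(2)[symmetric] q(1) linear_sum[OF linear_total_degree] linear_scale[OF linear_total_degree] by simp
   thus ?thesis using D by (simp flip: sum_divide_distrib)
  qed
  ultimately have "nonneg_comb ?A N (1 / real d) p" by simp
  hence "nonneg_comb ?A N (real d * (1 / real d)) m" unfolding p(3) by (rule nonneg_comb_scale) simp
  thus "m \<in> convex hull (?A ` {1..N})" unfolding nonneg_comb_hull using d by simp
 qed
 have "toric_degeneration (Proj R) (normal_toric_variety (int_lattice V) (convex hull (?A ` {1..N})))"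
 proof (rule veronese_toric_degeneration[OF R d rees toric])
  show "lsum ?A xs = lsum ?A ys \<longleftrightarrow> lsum s xs = lsum s ys" for xs ys
   unfolding real_expo_lsum[symmetric] by (rule real_expo_inject)
 qed
 thus ?thesis unfolding hull using d by (intro exI[of _ "real d"]) simp
qed

lemma normal_toric_variety_scale:
 assumes a: "a > 0"
 shows "normal_toric_variety M ((*\<^sub>R) a ` P) = normal_toric_variety M P"
proof -
 have sub: "direction ((*\<^sub>R) b ` Q) \<subseteq> direction Q" for b and Q :: "'a set" unfolding direction_def
 proof (rule span_minimal)
  show "{p - q |p q. p \<in> (*\<^sub>R) b ` Q \<and> q \<in> (*\<^sub>R) b ` Q} \<subseteq> span {p - q |p q. p \<in> Q \<and> q \<in> Q}"
  proof
   fix x assume "x \<in> {p - q |p q. p \<in> (*\<^sub>R) b ` Q \<and> q \<in> (*\<^sub>R) b ` Q}"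
   then obtain p q where "p \<in> Q" "q \<in> Q" "x = b *\<^sub>R (p - q)" unfolding scaleR_diff_right by blast
   thus "x \<in> span {p - q |p q. p \<in> Q \<and> q \<in> Q}" by (simp only:) (intro span_scale span_base, blast)
  qed
 qed simp
 have inv: "(*\<^sub>R) (1 / a) ` (*\<^sub>R) a ` Q = Q" for Q :: "'a set" using a by (simp add: image_image)
 have dir: "direction ((*\<^sub>R) a ` P) = direction P" using sub[of a P] sub[of "1 / a" "(*\<^sub>R) a ` P"] unfolding inv by blast
 have cone: "normal_cone ((*\<^sub>R) a ` P) ((*\<^sub>R) a ` Q) = normal_cone P Q" if "Q \<subseteq> P" for Q
 proof -
  have "0 \<le> u (a *\<^sub>R p - a *\<^sub>R q) \<longleftrightarrow> 0 \<le> u (p - q)" if u: "u \<in> dual_space (direction P)" and pq: "p \<in> P" "q \<in> P" for u p q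
  proof -
   obtain v where v: "linear v" "u = restrict v (direction P)" using u unfolding dual_space_def by blast
   have 1: "p - q \<in> direction P" unfolding direction_def using pq by (intro span_base) blast
   hence 2: "a *\<^sub>R (p - q) \<in> direction P" unfolding direction_def by (rule span_scale)
   have "u (a *\<^sub>R p - a *\<^sub>R q) = a * u (p - q)"
    unfolding scaleR_diff_right[symmetric] v(2) using 1 2 linear_scale[OF v(1)] by simp
   thus ?thesis using a by (simp add: zero_le_mult_iff)
  qed
  thus ?thesis unfolding normal_cone_def dir using that by blast
 qed
 have lin: "linear ((*\<^sub>R) a :: 'a \<Rightarrow> 'a)" "inj ((*\<^sub>R) a :: 'a \<Rightarrow> 'a)" using a by (auto simp: linear_scaleR inj_on_def)
 have face: "(*\<^sub>R) a ` Q face_of (*\<^sub>R) a ` P \<longleftrightarrow> Q face_of P" for Q :: "'a set" by (rule face_of_linear_image[OF lin])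
 have "normal_fan ((*\<^sub>R) a ` P) = normal_fan P"
 proof (intro equalityI subsetI)
  fix s assume "s \<in> normal_fan ((*\<^sub>R) a ` P)"
  then obtain Q where Q: "Q face_of (*\<^sub>R) a ` P" "Q \<noteq> {}" "s = normal_cone ((*\<^sub>R) a ` P) Q" unfolding normal_fan_def by blast
  define Q' where "Q' = (*\<^sub>R) (1 / a) ` Q"
  have Q': "Q = (*\<^sub>R) a ` Q'" unfolding Q'_def using a by (simp add: image_image)
  hence f: "Q' face_of P" using Q(1) face by simp
  hence "Q' \<subseteq> P" by (rule face_of_imp_subset)
  thus "s \<in> normal_fan P" using f Q(2,3) cone unfolding normal_fan_def Q' by blast
 next
  fix s assume "s \<in> normal_fan P"
  then obtain Q where Q: "Q face_of P" "Q \<noteq> {}" "s = normal_cone P Q" unfolding normal_fan_def by blast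
  hence "s = normal_cone ((*\<^sub>R) a ` P) ((*\<^sub>R) a ` Q)" using cone face_of_imp_subset by blast
  thus "s \<in> normal_fan ((*\<^sub>R) a ` P)" using Q face unfolding normal_fan_def by blast
 qed
 thus ?thesis unfolding normal_toric_variety_def dir by simp
qed

declare One_nat_def [simp]

section \<open>Relative invariants and Plucker coordinates\<close>

text \<open>Doubling all variables multiplies each term by the power of 2 given by its degree. By
  linear independence of monomials the relation can be compared term by term.\<close>

lemma homogeneous_degree:
 assumes "\<And>x. peval f (\<lambda>v. 2 * x v) = b * peval f x" and e: "e \<in> keys f"
 shows "b = 2 ^ tdeg e"
proof -
 let ?K = "keys f" and ?a = "\<lambda>e. lookup f e * (2 ^ tdeg e - b)"
 have "(\<Sum>e\<in>?K. ?a e * mono_eval x e) = 0" for x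
 proof -
  have "mono_eval (\<lambda>v. 2 * x v) e = 2 ^ tdeg e * mono_eval x e" for e
   using mono_eval_times[of "\<lambda>_. 2" x e] mono_eval_power[of 2 "\<lambda>_. 1" e] by simp
  hence "(\<Sum>e\<in>?K. lookup f e * (2 ^ tdeg e * mono_eval x e)) = b * (\<Sum>e\<in>?K. lookup f e * mono_eval x e)"
   using assms(1)[of x] unfolding peval_eq_meval meval_def by simp
  thus ?thesis by (simp add: sum_distrib_left sum_subtractf algebra_simps)
 qed
 hence "\<forall>e\<in>?K. ?a e = 0" by (intro mono_eval_independent) auto
 thus ?thesis using e by (auto simp: in_keys_iff)
qed

lemma peval_det:
 "peval (det (mat r r (\<lambda>(a, t). F a t))) x = det (mat r r (\<lambda>(a, t). peval (F a t) x))"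
proof -
 interpret comm_ring_hom "\<lambda>f. peval f x" by unfold_locales (auto simp: peval_add peval_mult simp flip: Const_1)
 have "map_mat (\<lambda>f. peval f x) (mat r r (\<lambda>(a, t). F a t)) = mat r r (\<lambda>(a, t). peval (F a t) x)" by (rule eq_matI) auto
 thus ?thesis using hom_det[of "mat r r (\<lambda>(a, t). F a t)"] by simp
qed

lemma subalgebra_substitute:
 assumes "\<And>v. y v \<in> subalgebra B"
 obtains F where "F \<in> subalgebra B" "\<forall>x. peval F x = peval f (\<lambda>v. peval (y v) x)"
proof -
 have "\<exists>F\<in>subalgebra B. \<forall>x. peval F x = peval f (\<lambda>v. peval (y v) x)"
 proof (induction f rule: cpoly_induct)
  case (1 a)
  show ?case using subalgebra.const[of a B] by (intro bexI[of _ "Const a"]) auto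
 next
  case (2 v)
  show ?case using assms[of v] by (intro bexI[of _ "y v"]) auto
 next
  case (3 f g)
  then obtain F G where "F \<in> subalgebra B" "\<forall>x. peval F x = peval f (\<lambda>v. peval (y v) x)"
   "G \<in> subalgebra B" "\<forall>x. peval G x = peval g (\<lambda>v. peval (y v) x)" by blast
  thus ?case by (intro bexI[of _ "F + G"] subalgebra.add) (simp_all add: peval_add)
 next
  case (4 f g)
  then obtain F G where "F \<in> subalgebra B" "\<forall>x. peval F x = peval f (\<lambda>v. peval (y v) x)"
   "G \<in> subalgebra B" "\<forall>x. peval G x = peval g (\<lambda>v. peval (y v) x)" by blast
  thus ?case by (intro bexI[of _ "F * G"] subalgebra.mult) (simp_all add: peval_mult)
 qed
 thus ?thesis using that by blast
qed

lemma subalgebra_power: "f \<in> subalgebra B \<Longrightarrow> f ^ k \<in> subalgebra B"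
 by (induction k) (auto intro: subalgebra.mult subalgebra.const[of 1, simplified])

lemma sum_double:
 assumes "s < r"
 shows "(\<Sum>t<r. (2 \<cdot>\<^sub>m 1\<^sub>m r :: complex mat) $$ (s, t) * y t) = 2 * y s"
proof -
 have "(\<Sum>t<r. (2 \<cdot>\<^sub>m 1\<^sub>m r :: complex mat) $$ (s, t) * y t) = (\<Sum>t<r. if t = s then 2 * y s else 0)"
  using assms by (intro sum.cong refl) simp
 thus ?thesis using assms by simp
qed

locale plucker_algebra =
 fixes r N :: nat and X :: "nat \<Rightarrow> nat \<Rightarrow> 'v"
 assumes r_pos: "r > 0"
  and X_inj: "s < r \<Longrightarrow> s' < r \<Longrightarrow> q < N \<Longrightarrow> q' < N \<Longrightarrow> X s q = X s' q' \<Longrightarrow> s = s' \<and> q = q'"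
begin

abbreviation A where "A \<equiv> subalgebra (plucker r X ` minors r N)"

definition cols :: "(nat \<Rightarrow> nat) \<Rightarrow> 'v cpoly" where
 "cols k = det (mat r r (\<lambda>(a, t). Indet (X a (k t))))"

lemma peval_cols: "peval (cols k) x = det (mat r r (\<lambda>(a, t). x (X a (k t))))"
 unfolding cols_def peval_det by simp

lemma minor_list:
 assumes "I \<in> minors r N"
 shows "length (sorted_list_of_set I) = r" "set (sorted_list_of_set I) = I" "distinct (sorted_list_of_set I)"
  "t < r \<Longrightarrow> sorted_list_of_set I ! t < N" "finite I"
proof -
 show fin: "finite I" using assms finite_subset unfolding minors_def by blast
 show l: "length (sorted_list_of_set I) = r" "set (sorted_list_of_set I) = I" "distinct (sorted_list_of_set I)"
  using assms fin unfolding minors_def by auto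
 show "t < r \<Longrightarrow> sorted_list_of_set I ! t < N"
  using nth_mem[of t "sorted_list_of_set I"] assms unfolding l(1,2) minors_def by auto
qed

text \<open>Repeated columns give determinant 0; otherwise a permutation sorts the columns, at the
  cost of a sign.\<close>

lemma cols_subalgebra:
 assumes k: "\<And>t. t < r \<Longrightarrow> k t < N"
 shows "cols k \<in> A"
proof (cases "inj_on k {..<r}")
 case False
 then obtain i j where ij: "i < r" "j < r" "i \<noteq> j" "k i = k j" unfolding inj_on_def by auto
 let ?B = "mat r r (\<lambda>(a, t). Indet (X a (k t)))"
 have "col ?B i = col ?B j" by (rule eq_vecI) (use ij in auto)
 hence "cols k = 0" unfolding cols_def by (intro det_identical_columns[OF _ ij(3,1,2)]) auto
 thus ?thesis using subalgebra.const[of 0 "plucker r X ` minors r N"] by simp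
next
 case True
 let ?J = "k ` {..<r}"
 have J: "?J \<in> minors r N" using k card_image[OF True] unfolding minors_def by auto
 define ls where "ls = sorted_list_of_set ?J"
 note ls = minor_list[OF J, folded ls_def]
 define q where "q t = (if t < r then inv_into {..<r} ((!) ls) (k t) else t)" for t
 have im: "(!) ls ` {..<r} = ?J" using ls(1,2) nth_image[of r ls] by (simp add: lessThan_atLeast0)
 have q: "q t < r \<and> ls ! q t = k t" if "t < r" for t
 proof -
  have "k t \<in> (!) ls ` {..<r}" unfolding im using that by blast
  thus ?thesis using that inv_into_into[of "k t" "(!) ls" "{..<r}"] f_inv_into_f[of "k t" "(!) ls" "{..<r}"] by (simp add: q_def)
 qed
 have "inj_on q {0..<r}"
 proof (rule inj_onI)
  fix x y assume "x \<in> {0..<r}" "y \<in> {0..<r}" "q x = q y"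
  hence "k x = k y" using q[of x] q[of y] by auto
  thus "x = y" using True \<open>x \<in> {0..<r}\<close> \<open>y \<in> {0..<r}\<close> unfolding inj_on_def by auto
 qed
 moreover have "q ` {0..<r} \<subseteq> {0..<r}" using q by auto
 ultimately have "bij_betw q {0..<r} {0..<r}" by (simp add: endo_inj_surj bij_betw_def)
 hence perm: "q permutes {0..<r}" by (rule bij_imp_permutes) (simp add: q_def)
 let ?P = "mat r r (\<lambda>(s, t). Indet (X s (ls ! t)))"
 have P: "?P \<in> carrier_mat r r" by simp
 have "cols k = det (transpose_mat (mat r r (\<lambda>(a, t). Indet (X a (k t)))))"
  unfolding cols_def by (rule det_transpose[symmetric]) auto
 also have "transpose_mat (mat r r (\<lambda>(a, t). Indet (X a (k t)))) = mat r r (\<lambda>(i, j). transpose_mat ?P $$ (q i, j))"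
  using q by (intro eq_matI) auto
 also have "det \<dots> = of_int (sign q) * det (transpose_mat ?P)" using perm by (intro det_permute_rows) auto
 also have "det (transpose_mat ?P) = plucker r X ?J" unfolding det_transpose[OF P] unfolding plucker_def ls_def ..
 finally have eq: "cols k = of_int (sign q) * plucker r X ?J" .
 have p: "plucker r X ?J \<in> A" using J by (intro subalgebra.gen) blast
 have "of_int (sign q) = (1 :: 'v cpoly) \<or> of_int (sign q) = (-1 :: 'v cpoly)" by (simp add: sign_def)
 thus ?thesis
 proof
  assume "of_int (sign q) = (1 :: 'v cpoly)"
  thus ?thesis unfolding eq using p by simp
 next
  assume "of_int (sign q) = (-1 :: 'v cpoly)"
  hence "cols k = Const (-1) * plucker r X ?J" unfolding eq by (simp add: Const_uminus)
  thus ?thesis using subalgebra.mult[OF subalgebra.const p, of "-1"] by simp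
 qed
qed

text \<open>The action is expressed by a relation between two points, because the entries of the
  matrix of variables are reached only through \<open>X\<close>.\<close>

definition relative_invariant :: "nat \<Rightarrow> 'v cpoly \<Rightarrow> bool" where
 "relative_invariant K f \<longleftrightarrow> vars f \<subseteq> {X s q | s q. s < r \<and> q < N} \<and>
   (\<forall>h x x'. h \<in> carrier_mat r r \<longrightarrow> det h \<noteq> 0 \<longrightarrow>
    (\<forall>s<r. \<forall>q<N. x' (X s q) = (\<Sum>t<r. h $$ (s, t) * x (X t q))) \<longrightarrow>
    peval f x' = det h ^ K * peval f x)"

lemma relative_invariantD:
 assumes "relative_invariant K f" "h \<in> carrier_mat r r" "det h \<noteq> 0"
  "\<And>s q. s < r \<Longrightarrow> q < N \<Longrightarrow> x' (X s q) = (\<Sum>t<r. h $$ (s, t) * x (X t q))"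
 shows "peval f x' = det h ^ K * peval f x"
 using assms unfolding relative_invariant_def by blast

text \<open>
 Applying a relative invariant to \<open>adj B x\<close>, with \<open>B\<close> the minor of \<open>x\<close> in the columns \<open>I\<close>, expresses it
 through Plucker coordinates: the entries of \<open>adj B x\<close> are maximal minors of \<open>x\<close> by Cramer's rule.
\<close>

lemma relative_invariant_clear:
 assumes f: "relative_invariant K f" and I: "I \<in> minors r N"
 shows "f * plucker r X I ^ (r * K + 1) \<in> A"
proof -
 define ls where "ls = sorted_list_of_set I"
 note ls = minor_list[OF I, folded ls_def]
 \<comment> \<open>By Cramer's rule the entry \<open>(s, q)\<close> of \<open>adj B x\<close> is the
   minor in which column \<open>q\<close> of \<open>x\<close> takes the place of column
   \<open>s\<close> of \<open>B\<close>; \<open>y\<close> collects these minors as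
   polynomials.\<close>
 define y where "y v = (if \<exists>s q. s < r \<and> q < N \<and> v = X s q
  then (let (s, q) = (SOME (s, q). s < r \<and> q < N \<and> v = X s q) in cols (\<lambda>t. if t = s then q else ls ! t)) else 0)" for v
 have y: "y (X s q) = cols (\<lambda>t. if t = s then q else ls ! t)" if "s < r" "q < N" for s q
 proof -
  have "(SOME (s', q'). s' < r \<and> q' < N \<and> X s q = X s' q') = (s, q)" using that X_inj[of s _ q] by (intro some_equality) fast+
  thus ?thesis using that unfolding y_def by auto
 qed
 have "y v \<in> A" for v
 proof (cases "\<exists>s q. s < r \<and> q < N \<and> v = X s q")
  case True
  then obtain s q where "s < r" "q < N" "v = X s q" by blast
  thus ?thesis using ls(4) by (simp add: y cols_subalgebra)
 next
  case False
  thus ?thesis using subalgebra.const[of 0 "plucker r X ` minors r N"] by (subst y_def, subst if_not_P) simp_all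
 qed
 then obtain F where F: "F \<in> A" "\<forall>x. peval F x = peval f (\<lambda>v. peval (y v) x)" by (rule subalgebra_substitute)
 let ?p = "plucker r X I"
 \<comment> \<open>From \<open>det (adj B) * det B = det B ^ r\<close> comes
   \<open>det B ^ K * F = det B ^ (r * K) * f\<close> where \<open>det B\<close> is nonzero. The
   additional factor on both sides makes the identity hold everywhere.\<close>
 have "f * ?p ^ (r * K + 1) = ?p ^ (K + 1) * F"
 proof (rule peval_eqD)
  fix x :: "'v \<Rightarrow> complex"
  define B where "B = mat r r (\<lambda>(a, t). x (X a (ls ! t)))"
  have B: "B \<in> carrier_mat r r" by (simp add: B_def)
  have pB: "peval ?p x = det B" unfolding plucker_def peval_det B_def ls_def by simp
  show "peval (f * ?p ^ (r * K + 1)) x = peval (?p ^ (K + 1) * F) x"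
  proof (cases "det B = 0")
   case True
   thus ?thesis by (simp add: peval_mult peval_power pB)
  next
   case False
   let ?h = "adj_mat B"
   note adj = adj_mat[OF B]
   have "det ?h * det B = det (?h * B)" by (rule det_mult[OF adj(1) B, symmetric])
   also have "\<dots> = det B ^ r" unfolding adj(3) by simp
   finally have dh: "det ?h * det B = det B ^ r" .
   hence nz: "det ?h \<noteq> 0" using False by auto
   have "peval (y (X s q)) x = (\<Sum>t<r. ?h $$ (s, t) * x (X t q))" if sq: "s < r" "q < N" for s q
   proof -
    define C where "C = mat r r (\<lambda>(a, t). x (X a (if t = s then q else ls ! t)))"
    have C: "C \<in> carrier_mat r r" by (simp add: C_def)
    have "peval (y (X s q)) x = det C" unfolding y[OF sq] peval_cols C_def ..
    also have "\<dots> = (\<Sum>i<r. C $$ (i, s) * cofactor C i s)" by (rule laplace_expansion_column[OF C sq(1)])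
    also have "\<dots> = (\<Sum>t<r. ?h $$ (s, t) * x (X t q))"
    proof (rule sum.cong[OF refl])
     fix t assume "t \<in> {..<r}"
     hence t: "t < r" by simp
     have "mat_delete C t s = mat_delete B t s" unfolding mat_delete_def C_def B_def using t sq by (intro eq_matI) auto
     hence "cofactor C t s = cofactor B t s" by (simp add: cofactor_def)
     thus "C $$ (t, s) * cofactor C t s = ?h $$ (s, t) * x (X t q)" using t sq by (simp add: C_def adj_mat_def B_def)
    qed
    finally show ?thesis .
   qed
   hence "peval F x = det ?h ^ K * peval f x" unfolding spec[OF F(2)] by (intro relative_invariantD[OF f adj(1) nz])
   hence "det B ^ K * peval F x = det B ^ (r * K) * peval f x" unfolding power_mult dh[symmetric] power_mult_distrib by simp
   thus ?thesis by (simp add: peval_mult peval_power pB)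
  qed
 qed
 moreover have "?p \<in> A" using I by (intro subalgebra.gen) blast
 ultimately show ?thesis using F(1) by (metis subalgebra.mult subalgebra_power)
qed

text \<open>Tested on the scalar matrix 2, whose determinant is \<open>2 ^ r\<close>.\<close>

lemma relative_invariant_degree:
 assumes f: "relative_invariant K f" and e: "e \<in> keys f"
 shows "tdeg e = r * K"
proof -
 let ?h = "2 \<cdot>\<^sub>m 1\<^sub>m r :: complex mat"
 have d: "det ?h = 2 ^ r" by simp
 have "peval f (\<lambda>v. 2 * x v) = (2 ^ r) ^ K * peval f x" for x unfolding d[symmetric]
 proof (rule relative_invariantD[OF f])
  fix s q assume "s < r" "q < N"
  thus "2 * x (X s q) = (\<Sum>t<r. ?h $$ (s, t) * x (X t q))" by (intro sum_double[symmetric])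
 qed auto
 hence "(2 ^ r) ^ K = (2 :: complex) ^ tdeg e" by (rule homogeneous_degree[OF _ e])
 hence "norm ((2 :: complex) ^ (r * K)) = norm ((2 :: complex) ^ tdeg e)" unfolding power_mult by (rule arg_cong)
 hence "(2 :: real) ^ (r * K) = 2 ^ tdeg e" unfolding norm_power by simp
 thus ?thesis by simp
qed

text \<open>
 If \<open>N < r\<close>, the rows of \<open>x\<close> are linearly dependent, so some \<open>h\<close> of determinant \<open>2\<close> fixes \<open>x\<close>.
\<close>

lemma relative_invariant_few_columns:
 assumes f: "relative_invariant K f" and N: "N < r" and K: "K > 0"
 shows "f = 0"
proof (rule peval_eq_0D)
 fix x :: "'v \<Rightarrow> complex"
 \<comment> \<open>The columns of \<open>x\<close>, written as rows and padded by zero rows to a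
   square matrix. Row \<open>N\<close> is zero, so there is a kernel vector \<open>w\<close>, which
   is a linear relation among the rows of \<open>x\<close>.\<close>
 define B where "B = mat r r (\<lambda>(q, t). if q < N then x (X t q) else 0)"
 have B: "B \<in> carrier_mat r r" by (simp add: B_def)
 have "det B = 0" unfolding det_def'[OF B]
 proof (rule sum.neutral, rule ballI)
  fix p assume "p \<in> {p. p permutes {0..<r}}"
  hence "p N < r" using permutes_in_image[of p "{0..<r}" N] N by simp
  hence "B $$ (N, p N) = 0" using N by (simp add: B_def)
  hence "(\<Prod>i = 0..<r. B $$ (i, p i)) = 0" using N by (intro prod_zero) auto
  thus "of_int (sign p) * (\<Prod>i = 0..<r. B $$ (i, p i)) = 0" by simp
 qed
 then obtain w where w: "w \<in> carrier_vec r" "w \<noteq> 0\<^sub>v r" "B *\<^sub>v w = 0\<^sub>v r" unfolding det_0_iff_vec_prod_zero_field[OF B] by blast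
 have "\<exists>i<r. vec_index w i \<noteq> 0" using ccontr w eq_vecI by auto
 then obtain i where i: "i < r" "vec_index w i \<noteq> 0" by blast
 have dep: "(\<Sum>t<r. vec_index w t * x (X t q)) = 0" if "q < N" for q
 proof -
  have "vec_index (B *\<^sub>v w) q = (\<Sum>t\<in>{0..<r}. B $$ (q, t) * vec_index w t)" using that N w(1) B by (simp add: scalar_prod_def)
  also have "\<dots> = (\<Sum>t<r. vec_index w t * x (X t q))"
   unfolding lessThan_atLeast0[symmetric] using that N by (intro sum.cong) (auto simp: B_def)
  finally show ?thesis using w(3) that N by simp
 qed
 \<comment> \<open>The identity matrix with \<open>w / w i\<close> added to its row
   \<open>i\<close>. It adds a vanishing combination of rows to row \<open>i\<close> of
   \<open>x\<close>, so \<open>x\<close> is fixed, while the entry at \<open>(i, i)\<close>, and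
   with it the determinant, becomes 2.\<close>
 define h where "h = mat r r (\<lambda>(s, t). (if s = t then 1 else 0) + (if s = i then vec_index w t / vec_index w i else 0))"
 have h: "h \<in> carrier_mat r r" by (simp add: h_def)
 have "mat_delete h i i = 1\<^sub>m (r - 1)" unfolding mat_delete_def h_def using i(1) by (intro eq_matI) auto
 hence "cofactor h i i = 1" by (simp add: cofactor_def flip: mult_2)
 moreover have "det h = (\<Sum>s<r. h $$ (s, i) * cofactor h s i)" by (rule laplace_expansion_column[OF h i(1)])
 moreover have "(\<Sum>s<r. h $$ (s, i) * cofactor h s i) = (\<Sum>s<r. if s = i then 2 * cofactor h i i else 0)"
  using i by (intro sum.cong) (auto simp: h_def)
 ultimately have d: "det h = 2" using i(1) by simp
 have "peval f x = det h ^ K * peval f x"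
 proof (rule relative_invariantD[OF f h])
  fix s q assume sq: "s < r" "q < N"
  have "(\<Sum>t<r. h $$ (s, t) * x (X t q)) = (\<Sum>t<r. (if t = s then x (X s q) else 0) + (if s = i then 1 / vec_index w i else 0) * (vec_index w t * x (X t q)))"
   using sq by (intro sum.cong) (auto simp: h_def algebra_simps)
  also have "\<dots> = x (X s q)" unfolding sum.distrib sum_distrib_left[symmetric] dep[OF sq(2)] using sq(1) by simp
  finally show "x (X s q) = (\<Sum>t<r. h $$ (s, t) * x (X t q))" ..
 qed (simp add: d)
 moreover have "(2::complex) ^ K \<noteq> 1"
 proof
  assume "(2::complex) ^ K = 1"
  hence "norm ((2::complex) ^ K) = 1" by simp
  hence "(2::real) ^ K = 1" by (simp add: norm_power)
  moreover have "1 < (2::real) ^ K" using K by (intro one_less_power) simp_all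
  ultimately show False by simp
 qed
 ultimately show "peval f x = 0" unfolding d by simp
qed

end

section \<open>Cones over matching field polytopes\<close>

lemma convex_cone_fin_cone: "convex_cone (fin_cone T)"
 unfolding convex_cone_iff using fin_coneI[of T "\<lambda>_. 0"] by (auto intro: fin_cone_add fin_cone_scale)

lemma convex_cone_hull_convex_hull:
 assumes "finite T"
 shows "convex_cone hull (convex hull T) = fin_cone T"
proof
 have "convex hull T \<subseteq> fin_cone T"
 proof (rule hull_minimal)
  show "T \<subseteq> fin_cone T" using fin_cone_generator[OF assms] by blast
  show "convex (fin_cone T)" using convex_cone_fin_cone[of T] by (simp add: convex_cone_def)
 qed
 thus "convex_cone hull (convex hull T) \<subseteq> fin_cone T" by (rule hull_minimal) (rule convex_cone_fin_cone)
 show "fin_cone T \<subseteq> convex_cone hull (convex hull T)"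
 proof
  fix m assume "m \<in> fin_cone T"
  then obtain a where a: "m = (\<Sum>t\<in>T. a t *\<^sub>R t)" "\<forall>t\<in>T. 0 \<le> a t" unfolding fin_cone_def by blast
  let ?H = "convex_cone hull (convex hull T)"
  have H: "convex_cone ?H" by (rule convex_cone_convex_cone_hull)
  have "finite S \<Longrightarrow> S \<subseteq> T \<Longrightarrow> (\<Sum>t\<in>S. a t *\<^sub>R t) \<in> ?H" for S
  proof (induction S rule: finite_induct)
   case empty
   show ?case using convex_cone_contains_0[OF H] by simp
  next
   case (insert t S)
   hence "t \<in> T" by blast
   hence "t \<in> ?H" by (intro hull_inc)
   hence "a t *\<^sub>R t \<in> ?H" using a(2) \<open>t \<in> T\<close> by (intro convex_cone_scaleR[OF H]) auto
   thus ?case using insert convex_cone_add[OF H] by simp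
  qed
  thus "m \<in> ?H" using assms unfolding a(1) by blast
 qed
qed

lemma keys_subalgebra_Monom:
 assumes "g \<in> subalgebra (Monom ` S)" "e \<in> keys g" "linear u" "\<And>v. v \<in> S \<Longrightarrow> 0 \<le> (u (real_expo v) :: real)"
 shows "0 \<le> u (real_expo e)"
 using assms(1,2)
proof (induction arbitrary: e rule: subalgebra.induct)
 case (gen f)
 thus ?case using assms(4) by (auto simp: Monom_def)
next
 case (const a)
 hence "e = 0" by (auto simp: Const_def split: if_splits)
 thus ?case using linear_0[OF assms(3)] by simp
next
 case (add f g)
 thus ?case using keys_add[of f g] by blast
next
 case (mult f g)
 then obtain a b where "e = a + b" "a \<in> keys f" "b \<in> keys g" using keys_mult[of f g] by blast
 thus ?case using mult linear_add[OF assms(3)] by (simp add: real_expo_add)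
qed

lemma has_LM_power: "has_LM c f e \<Longrightarrow> has_LM c (f ^ k) (copies k e)"
proof (induction k)
 case 0
 thus ?case using has_LM_Const[of 1 c] by (simp add: copies_def)
next
 case (Suc k)
 thus ?case using has_LM_mult[of c f e "f ^ k" "copies k e"] by (simp add: copies_def)
qed

lemma initial_algebraI: "g \<in> B \<Longrightarrow> initial_form c g \<in> initial_algebra c B"
 unfolding initial_algebra_def cspan_def by (intro CollectI exI[of _ "{initial_form c g}"] exI[of _ "\<lambda>_. 1"]) auto

locale plucker_degeneration = plucker_algebra r N X for r N :: nat and X :: "nat \<Rightarrow> nat \<Rightarrow> 'v" +
 fixes c :: "'v \<Rightarrow> nat" and \<Lambda> :: "nat set \<Rightarrow> nat \<Rightarrow> nat"
 assumes mf: "gives_gr_mf c r N X \<Lambda>" and degen: "gr_toric_degeneration c r N X \<Lambda>"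
begin

definition lead :: "nat set \<Rightarrow> 'v expo" where
 "lead I = gr_mono r X I (\<Lambda> I)"

lemma weight_gr_mono: "tdeg (gr_mono r X I s) = r"
 by (simp add: gr_mono_def weight_sum)

text \<open>The columns of a minor are distinct and \<open>X\<close> is injective on the matrix, so
  the exponent records the row used in each column. Hence the terms of a minor are distinct
  monomials with coefficients 1 and -1, and nothing cancels.\<close>

lemma gr_mono_inject:
 assumes I: "I \<in> minors r N" and s: "s permutes {..<r}" "p permutes {..<r}" and eq: "gr_mono r X I s = gr_mono r X I p"
 shows "s = p"
proof
 fix t
 let ?ls = "sorted_list_of_set I"
 note ls = minor_list[OF I]
 show "s t = p t"
 proof (cases "t < r")
  case True
  have look: "lookup (gr_mono r X I q) v = (\<Sum>t<r. if X (q t) (?ls ! t) = v then 1 else 0)" for q v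
   unfolding gr_mono_def lookup_sum by (simp add: lookup_single when_def cong: if_cong)
  have "0 < (\<Sum>t'<r. if X (s t') (?ls ! t') = X (s t) (?ls ! t) then 1 else (0::nat))" using True by (intro sum_pos2[of _ t]) auto
  hence "(\<Sum>t'<r. if X (p t') (?ls ! t') = X (s t) (?ls ! t) then 1 else (0::nat)) \<noteq> 0" unfolding look[symmetric] eq by simp
  hence "\<exists>t'\<in>{..<r}. (if X (p t') (?ls ! t') = X (s t) (?ls ! t) then 1 else (0::nat)) \<noteq> 0"
   using sum.not_neutral_contains_not_neutral by blast
  then obtain t' where t': "t' < r" "X (p t') (?ls ! t') = X (s t) (?ls ! t)" by (auto split: if_splits)
  have "p t' < r" "s t < r" using permutes_in_image[OF s(1), of t] permutes_in_image[OF s(2), of t'] True t'(1) by auto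
  hence "p t' = s t \<and> ?ls ! t' = ?ls ! t" using X_inj[of "p t'" "s t" "?ls ! t'" "?ls ! t"] ls(4) True t' by auto
  moreover from this have "t' = t" using nth_eq_iff_index_eq[OF ls(3)] True t'(1) ls(1) by simp
  ultimately show ?thesis by simp
 next
  case False
  thus ?thesis using s by (simp add: permutes_not_in)
 qed
qed

lemma plucker_LM:
 assumes I: "I \<in> minors r N"
 shows "has_LM c (plucker r X I) (lead I)"
proof -
 let ?ls = "sorted_list_of_set I" and ?P = "{p. p permutes {..<r}}"
 have \<Lambda>: "\<Lambda> I permutes {..<r}" using mf I unfolding gives_gr_mf_def by blast
 have prod: "(\<Prod>j<m. Indet (X (p j) (?ls ! j))) = Monom (\<Sum>t<m. single (X (p t) (?ls ! t)) 1)" for p m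
  by (induction m) (simp_all add: Indet_def Monom_def mult_single)
 have pl: "plucker r X I = (\<Sum>p\<in>?P. of_int (sign p) * Monom (gr_mono r X I p))"
 proof -
  have "plucker r X I = (\<Sum>p\<in>?P. of_int (sign p) * (\<Prod>j<r. mat r r (\<lambda>(s, t). Indet (X s (?ls ! t))) $$ (p j, j)))"
   unfolding plucker_def lessThan_atLeast0 by (subst det_col[where n = r]) (simp_all add: lessThan_atLeast0)
  also have "\<dots> = (\<Sum>p\<in>?P. of_int (sign p) * (\<Prod>j<r. Indet (X (p j) (?ls ! j))))"
  proof (intro sum.cong refl arg_cong2[where f = "(*)"] prod.cong)
   fix p j assume "p \<in> ?P" "j \<in> {..<r}"
   hence "p j < r" "j < r" using permutes_in_image[of p "{..<r}" j] by auto
   thus "mat r r (\<lambda>(s, t). Indet (X s (?ls ! t))) $$ (p j, j) = Indet (X (p j) (?ls ! j))" by simp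
  qed
  finally show ?thesis unfolding prod gr_mono_def .
 qed
 have look: "lookup (plucker r X I) e = (\<Sum>p\<in>?P. if gr_mono r X I p = e then of_int (sign p) else 0)" for e
 proof -
  have "lookup (of_int k * Monom e') e = (if e' = e then of_int k else 0)" for k and e' :: "'v expo"
  proof -
   have "of_int k = (Const (of_int k) :: 'v cpoly)" by (induction k rule: int_induct[of _ 0]) (simp_all add: Const_add Const_diff)
   thus ?thesis by (simp add: lookup_Const_mult Monom_def lookup_single when_def)
  qed
  thus ?thesis unfolding pl lookup_sum by simp
 qed
 have "lookup (plucker r X I) (lead I) = (\<Sum>p\<in>?P. if p = \<Lambda> I then of_int (sign (\<Lambda> I)) else 0)"
  unfolding look lead_def using gr_mono_inject[OF I _ \<Lambda>] by (intro sum.cong) auto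
 hence a: "lookup (plucker r X I) (lead I) = of_int (sign (\<Lambda> I))" using \<Lambda> by (simp add: finite_permutations)
 have keys: "e = lead I \<or> weight c e < weight c (lead I)" if e: "e \<in> keys (plucker r X I)" for e
 proof -
  have "(\<Sum>p\<in>?P. if gr_mono r X I p = e then of_int (sign p) else 0) \<noteq> (0::complex)" using e look by (simp add: in_keys_iff)
  hence "\<exists>p\<in>?P. (if gr_mono r X I p = e then of_int (sign p) else 0) \<noteq> (0::complex)"
   using sum.not_neutral_contains_not_neutral by blast
  then obtain p where "p permutes {..<r}" "gr_mono r X I p = e" by (auto split: if_splits)
  thus ?thesis using mf I unfolding gives_gr_mf_def lead_def by blast
 qed
 have "wpart c (weight c (lead I)) (plucker r X I) = single (lead I) (of_int (sign (\<Lambda> I)))"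
 proof (rule poly_mapping_eqI)
  fix e
  show "lookup (wpart c (weight c (lead I)) (plucker r X I)) e
    = lookup (single (lead I) (of_int (sign (\<Lambda> I)))) e" using a keys[of e] by (cases "e \<in> keys (plucker r X I)")
    (auto simp: lookup_wpart lookup_single when_def not_in_keys_iff_lookup_eq_zero)
 qed
 moreover have "weight_le c (weight c (lead I)) (plucker r X I)" unfolding weight_le_def using keys by force
 moreover have "of_int (sign (\<Lambda> I)) \<noteq> (0::complex)" by (simp add: sign_def)
 ultimately show ?thesis unfolding has_LM_iff by blast
qed

text \<open>
 The initial exponents of a relative invariant lie in the cone over the matching field polytope: after
 multiplication with a power of any one Plucker coordinate they lie in the monoid generated by the
 leading exponents, and a separating functional can be normalized to vanish on one of the latter.
\<close>

theorem initial_exponent_in_cone: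
 assumes f: "relative_invariant K f" and e: "e \<in> keys (initial_form c f)"
 shows "real_expo e \<in> convex_cone hull (mf_polytope r N X \<Lambda>)"
proof -
 let ?T = "(\<lambda>I. real_expo (lead I)) ` minors r N"
 have fin: "finite (minors r N)" unfolding minors_def by simp
 have hull: "convex_cone hull (mf_polytope r N X \<Lambda>) = fin_cone ?T"
  unfolding mf_polytope_def lead_def[symmetric] using fin by (intro convex_cone_hull_convex_hull) simp
 have ek: "e \<in> keys f" using e keys_initial_form by blast
 have deg: "tdeg e = r * K" by (rule relative_invariant_degree[OF f ek])
 show ?thesis unfolding hull
 proof (cases "N < r")
  case True
  \<comment> \<open>Without maximal minors the polytope is empty and its cone is the origin; a
    positive \<open>K\<close> would force \<open>f = 0\<close>, so \<open>e\<close> has degree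
    0.\<close>
  hence "K = 0" using relative_invariant_few_columns[OF f] ek by (cases "K = 0") auto
  hence "e = 0" using deg weight_one_eq_0_iff[of e] by simp
  thus "real_expo e \<in> fin_cone ?T" using convex_cone_contains_0[OF convex_cone_fin_cone] by simp
 next
  case False
  hence "{..<r} \<in> minors r N" unfolding minors_def by auto
  hence ne: "minors r N \<noteq> {}" by blast
  show "real_expo e \<in> fin_cone ?T"
  proof (rule ccontr)
   assume "real_expo e \<notin> fin_cone ?T"
   then obtain u where u: "linear u" "\<And>t. t \<in> ?T \<Longrightarrow> 0 \<le> u t" "u (real_expo e) < (0::real)"
    by (rule farkas[OF finite_imageI[OF fin]]) blast
   define p where "p = Min ((\<lambda>I. u (real_expo (lead I))) ` minors r N)"
   have "p \<in> (\<lambda>I. u (real_expo (lead I))) ` minors r N" unfolding p_def using fin ne by (intro Min_in) auto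
   then obtain I where I: "I \<in> minors r N" "p = u (real_expo (lead I))" by blast
   have p: "p \<le> u (real_expo (lead J))" if "J \<in> minors r N" for J unfolding p_def using fin that by (intro Min_le) auto
   have p0: "0 \<le> p" unfolding I(2) using u(2) I(1) by blast
   \<comment> \<open>All leading exponents have degree \<open>r\<close>, so this lowers
     \<open>u\<close> by \<open>p\<close> on each of them. The result is zero at the leading
     exponent of \<open>I\<close>, so multiplication by powers of that Plucker coordinate is
     invisible to \<open>u'\<close>; and at \<open>e\<close> it does not exceed
     \<open>u\<close>.\<close>
   define u' where "u' m = u m - (p / r) * total_degree m" for m
   have lin: "linear u'" unfolding u'_def
    by (rule linearI) (simp_all add: linear_add[OF u(1)] linear_add[OF linear_total_degree] linear_scale[OF u(1)]
      linear_scale[OF linear_total_degree] algebra_simps)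
   have u'_lead: "u' (real_expo (lead J)) = u (real_expo (lead J)) - p" for J
    unfolding u'_def total_degree_real_expo lead_def weight_gr_mono using r_pos by simp
   define m where "m = r * K + 1"
   have key: "e + copies m (lead I) \<in> keys (initial_form c (f * plucker r X I ^ m))"
    by (rule keys_initial_form_mult[OF e has_LM_power[OF plucker_LM[OF I(1)]]])
   have "f * plucker r X I ^ m \<in> A" unfolding m_def by (rule relative_invariant_clear[OF f I(1)])
   hence "initial_form c (f * plucker r X I ^ m) \<in> initial_algebra c A" by (rule initial_algebraI)
   hence init: "initial_form c (f * plucker r X I ^ m) \<in> subalgebra (Monom ` lead ` minors r N)"
    unfolding degen[unfolded gr_toric_degeneration_def] image_image lead_def .
   have "0 \<le> u' (real_expo v)" if "v \<in> lead ` minors r N" for v using that u'_lead p by auto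
   hence "0 \<le> u' (real_expo (e + copies m (lead I)))" by (rule keys_subalgebra_Monom[OF init key lin])
   also have "\<dots> = u' (real_expo e)"
    unfolding real_expo_add real_expo_copies linear_add[OF lin] linear_scale[OF lin] u'_lead I(2) by simp
   also have "\<dots> \<le> u (real_expo e)" unfolding u'_def total_degree_real_expo using p0 by simp
   finally show False using u(3) by simp
  qed
 qed
qed

end

section \<open>Semi-invariants\<close>

lemma vars_add: "vars (f + g) \<subseteq> vars f \<union> vars g"
 unfolding vars_def using keys_add[of f g] by blast

lemma vars_mult: "vars (f * g) \<subseteq> vars f \<union> vars g"
using keys_mult keys_add unfolding vars_def by force

lemma inverse_matrix:
 assumes h: "h \<in> carrier_mat r r" and d: "det h \<noteq> (0 :: complex)"
 obtains g where "g \<in> carrier_mat r r" "inverts_mat g h" "inverts_mat h g" "det g * det h = 1"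
proof -
 let ?g = "(1 / det h) \<cdot>\<^sub>m adj_mat h"
 note adj = adj_mat[OF h]
 have g: "?g \<in> carrier_mat r r" using adj(1) by simp
 have "?g * h = 1\<^sub>m r" unfolding mult_smult_assoc_mat[OF adj(1) h] adj(3) using d by (intro eq_matI) auto
 moreover have "h * ?g = 1\<^sub>m r" unfolding mult_smult_distrib[OF h adj(1)] adj(2) using d by (intro eq_matI) auto
 moreover have "det ?g * det h = 1" using det_mult[OF g h] calculation(1) by simp
 ultimately show ?thesis using g h by (intro that[of ?g]) (auto simp: inverts_mat_def)
qed

lemma inverts_det:
 assumes "g \<in> carrier_mat r r" "h \<in> carrier_mat r r" "inverts_mat g h"
 shows "det g \<noteq> (0 :: complex)"
proof -
 have "det g * det h = det (1\<^sub>m r)" using det_mult[OF assms(1,2)] assms unfolding inverts_mat_def by (metis carrier_matD(1))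
 thus ?thesis by auto
qed

lemma invertible_det:
 assumes "g \<in> carrier_mat r r" "invertible_mat g"
 shows "det g \<noteq> (0 :: complex)"
proof -
 obtain B where B: "inverts_mat g B" "inverts_mat B g" using assms(2) unfolding invertible_mat_def by blast
 have "dim_col B = dim_col (g * B)" by simp
 hence c: "dim_col B = r" using B(1) assms(1) unfolding inverts_mat_def by auto
 have "dim_col g = dim_col (B * g)" by simp
 hence "dim_row B = r" using B(2) assms(1) unfolding inverts_mat_def by auto
 thus ?thesis using inverts_det[OF assms(1) _ B(1)] c by blast
qed

lemma SI_D:
 assumes "f \<in> SI r1 r2 n a" "g1 \<in> carrier_mat r1 r1" "h1 \<in> carrier_mat r1 r1" "inverts_mat g1 h1" "inverts_mat h1 g1"
  "g2 \<in> carrier_mat r2 r2" "invertible_mat g2" "\<And>i. i < n \<Longrightarrow> A i \<in> carrier_mat r2 r1"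
 shows "peval f (coords (\<lambda>i. g2 * A i * h1)) =
  det g1 powi fst a * det g2 powi snd a * peval f (coords A)" using assms unfolding SI_def by blast

lemma SI_vars: "f \<in> SI r1 r2 n a \<Longrightarrow> vars f \<subseteq> var_set r1 r2 n"
 unfolding SI_def by blast

lemma SI_mult:
 assumes f: "f \<in> SI r1 r2 n a" and g: "g \<in> SI r1 r2 n b"
 shows "f * g \<in> SI r1 r2 n (fst a + fst b, snd a + snd b)"
 unfolding SI_def mem_Collect_eq
proof (intro conjI allI impI)
 show "vars (f * g) \<subseteq> var_set r1 r2 n" using vars_mult[of f g] SI_vars[OF f] SI_vars[OF g] by blast
 fix g1 h1 g2 :: "complex mat" and A :: "nat \<Rightarrow> complex mat"
 assume 1: "g1 \<in> carrier_mat r1 r1" "h1 \<in> carrier_mat r1 r1" "inverts_mat g1 h1" "inverts_mat h1 g1"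
  "g2 \<in> carrier_mat r2 r2" "invertible_mat g2" "\<forall>i<n. A i \<in> carrier_mat r2 r1"
 hence "det g1 \<noteq> 0" "det g2 \<noteq> 0" using inverts_det invertible_det by blast+
 thus "peval (f * g) (coords (\<lambda>i. g2 * A i * h1)) =
   det g1 powi fst (fst a + fst b, snd a + snd b) *
   det g2 powi snd (fst a + fst b, snd a + snd b) * peval (f * g) (coords A)"
  using SI_D[OF f 1(1-6), of A] SI_D[OF g 1(1-6), of A] 1(7) by (simp add: peval_mult power_int_add)
qed

lemma SI_add: "f \<in> SI r1 r2 n a \<Longrightarrow> g \<in> SI r1 r2 n a \<Longrightarrow> f + g \<in> SI r1 r2 n a"
 using vars_add[of f g] unfolding SI_def by (auto simp: peval_add distrib_left)

lemma SI_Const_mult: "f \<in> SI r1 r2 n p \<Longrightarrow> Const a * f \<in> SI r1 r2 n p"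
 using keys_Const_mult[of a f] unfolding SI_def vars_def by (auto simp: peval_mult)

lemma SI_0: "0 \<in> SI r1 r2 n a"
 unfolding SI_def vars_def by simp

lemma SI_1: "1 \<in> SI r1 r2 n (0, 0)"
using Const_1 split if_splits peval_Const unfolding vars_def Const_def SI_def by auto

section \<open>The two group actions on semi-invariants\<close>

definition mats :: "nat \<Rightarrow> nat \<Rightarrow> (var \<Rightarrow> complex) \<Rightarrow> nat \<Rightarrow> complex mat" where
 "mats r1 r2 x i = mat r2 r1 (\<lambda>(j, k). x (i, j, k))"

lemma mats_carrier: "mats r1 r2 x i \<in> carrier_mat r2 r1"
 by (simp add: mats_def)

lemma peval_coords:
 assumes f: "vars f \<subseteq> var_set r1 r2 n" and "\<And>i j k. i < n \<Longrightarrow> j < r2 \<Longrightarrow> k < r1 \<Longrightarrow> B i $$ (j, k) = x (i, j, k)"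
 shows "peval f (coords B) = peval f x"
proof (rule peval_cong)
 fix v assume "v \<in> vars f"
 then obtain i j k where "v = (i, j, k)" "i < n" "j < r2" "k < r1" using f unfolding var_set_def by blast
 thus "coords B v = x v" using assms(2) by (simp add: coords_def)
qed

text \<open>Multiplying the stacked and transposed matrix by \<open>h\<close> from the left is the
  action with the transpose of \<open>h\<close> in the role of the inverse of \<open>g1\<close>;
  therefore the determinant enters with the opposite exponent.\<close>

lemma SI_act_right:
 assumes f: "f \<in> SI r1 r2 n a" and h: "h \<in> carrier_mat r1 r1" "det h \<noteq> 0"
  and x': "\<And>i j s. i < n \<Longrightarrow> j < r2 \<Longrightarrow> s < r1 \<Longrightarrow> x' (i, j, s) = (\<Sum>t<r1. h $$ (s, t) * x (i, j, t))"
 shows "peval f x' = det h powi (- fst a) * peval f x"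
proof -
 have hT: "transpose_mat h \<in> carrier_mat r1 r1" "det (transpose_mat h) = det h" using h(1) det_transpose[OF h(1)] by auto
 obtain g where g: "g \<in> carrier_mat r1 r1" "inverts_mat g (transpose_mat h)" "inverts_mat (transpose_mat h) g"
  "det g * det h = 1" using inverse_matrix[OF hT(1)] hT(2) h(2) by metis
 have one: "1\<^sub>m r2 \<in> carrier_mat r2 r2" "invertible_mat (1\<^sub>m r2 :: complex mat)"
  by (auto simp: invertible_mat_def inverts_mat_def intro!: exI[of _ "1\<^sub>m r2"])
 have "peval f x' = peval f (coords (\<lambda>i. 1\<^sub>m r2 * mats r1 r2 x i * transpose_mat h))"
 proof (rule peval_coords[OF SI_vars[OF f], symmetric])
  fix i j k assume ijk: "i < n" "j < r2" "k < r1"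
  have "(1\<^sub>m r2 * mats r1 r2 x i * transpose_mat h) $$ (j, k) = (mats r1 r2 x i * transpose_mat h) $$ (j, k)"
   using left_mult_one_mat[OF mats_carrier] by simp
  also have "\<dots> = (\<Sum>t\<in>{0..<r1}. x (i, j, t) * h $$ (k, t))" using ijk h(1) by (simp add: mats_def scalar_prod_def)
  also have "\<dots> = x' (i, j, k)" unfolding x'[OF ijk] lessThan_atLeast0 by (simp add: mult.commute)
  finally show "(1\<^sub>m r2 * mats r1 r2 x i * transpose_mat h) $$ (j, k) = x' (i, j, k)" .
 qed
 also have "\<dots> = det g powi fst a * peval f (coords (mats r1 r2 x))"
  using SI_D[OF f g(1) hT(1) g(2,3) one, of "mats r1 r2 x"] mats_carrier by simp
 also have "peval f (coords (mats r1 r2 x)) = peval f x" by (rule peval_coords[OF SI_vars[OF f]]) (simp add: mats_def)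
 also have "det g = inverse (det h)" using g(4) h(2) by (simp add: field_simps)
 finally show ?thesis by (simp add: power_int_minus power_int_inverse)
qed

lemma SI_act_left:
 assumes f: "f \<in> SI r1 r2 n a" and h: "h \<in> carrier_mat r2 r2" "det h \<noteq> 0"
  and x': "\<And>i s k. i < n \<Longrightarrow> s < r2 \<Longrightarrow> k < r1 \<Longrightarrow> x' (i, s, k) = (\<Sum>t<r2. h $$ (s, t) * x (i, t, k))"
 shows "peval f x' = det h powi snd a * peval f x"
proof -
 obtain g where g: "g \<in> carrier_mat r2 r2" "inverts_mat g h" "inverts_mat h g" using inverse_matrix[OF h] by metis
 have inv: "invertible_mat h" using g h(1) by (auto simp: invertible_mat_def)
 have one: "1\<^sub>m r1 \<in> carrier_mat r1 r1" "inverts_mat (1\<^sub>m r1 :: complex mat) (1\<^sub>m r1)" by (auto simp: inverts_mat_def)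
 have "peval f x' = peval f (coords (\<lambda>i. h * mats r1 r2 x i * 1\<^sub>m r1))"
 proof (rule peval_coords[OF SI_vars[OF f], symmetric])
  fix i j k assume ijk: "i < n" "j < r2" "k < r1"
  have "(h * mats r1 r2 x i * 1\<^sub>m r1) $$ (j, k) = (h * mats r1 r2 x i) $$ (j, k)"
   using right_mult_one_mat[of "h * mats r1 r2 x i" r2 r1] mult_carrier_mat[OF h(1) mats_carrier] by simp
  also have "\<dots> = (\<Sum>t\<in>{0..<r2}. h $$ (j, t) * x (i, t, k))" using ijk h(1) by (simp add: mats_def scalar_prod_def)
  finally show "(h * mats r1 r2 x i * 1\<^sub>m r1) $$ (j, k) = x' (i, j, k)" unfolding x'[OF ijk] lessThan_atLeast0 .
 qed
 also have "\<dots> = det h powi snd a * peval f (coords (mats r1 r2 x))"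
  using SI_D[OF f one(1,1,2,2) h(1) inv, of "mats r1 r2 x"] mats_carrier by simp
 also have "peval f (coords (mats r1 r2 x)) = peval f x" by (rule peval_coords[OF SI_vars[OF f]]) (simp add: mats_def)
 finally show ?thesis .
qed

lemma two_powi_eq:
 assumes "(2 :: complex) powi m = 2 ^ d"
 shows "m = int d"
proof -
 have "norm ((2 :: complex) powi m) = norm ((2::complex) ^ d)" using assms by simp
 hence "(2 :: real) powi m = 2 powi int d" by (simp add: norm_power_int norm_power)
 thus ?thesis using power_int_strict_increasing[of m "int d" "2::real"] power_int_strict_increasing[of "int d" m "2::real"]
  by (cases m "int d" rule: linorder_cases) auto
qed

text \<open>Both equations come from the scalar matrix 2, taken once in each of the two general
  linear groups.\<close>

lemma SI_degree:
 assumes f: "f \<in> SI r1 r2 n a" and e: "e \<in> keys f"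
 shows "int (tdeg e) = - (int r1 * fst a)" "int (tdeg e) = int r2 * snd a"
proof -
 have d: "det (2 \<cdot>\<^sub>m 1\<^sub>m r :: complex mat) = 2 powi int r" for r by simp
 have nz: "det (2 \<cdot>\<^sub>m 1\<^sub>m r :: complex mat) \<noteq> 0" for r by simp
 have c: "2 \<cdot>\<^sub>m 1\<^sub>m r \<in> carrier_mat r r" for r by simp
 have "peval f (\<lambda>v. 2 * x v) = det (2 \<cdot>\<^sub>m 1\<^sub>m r1 :: complex mat) powi (- fst a) * peval f x" for x
  by (rule SI_act_right[OF f c nz]) (rule sum_double[symmetric])
 hence "det (2 \<cdot>\<^sub>m 1\<^sub>m r1 :: complex mat) powi (- fst a) = 2 ^ tdeg e" by (rule homogeneous_degree[OF _ e])
 hence "(2 :: complex) powi (int r1 * (- fst a)) = 2 ^ tdeg e" unfolding d power_int_mult .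
 thus "int (tdeg e) = - (int r1 * fst a)" using two_powi_eq by fastforce
 have "peval f (\<lambda>v. 2 * x v) = det (2 \<cdot>\<^sub>m 1\<^sub>m r2 :: complex mat) powi snd a * peval f x" for x
  by (rule SI_act_left[OF f c nz]) (rule sum_double[symmetric])
 hence "det (2 \<cdot>\<^sub>m 1\<^sub>m r2 :: complex mat) powi snd a = 2 ^ tdeg e" by (rule homogeneous_degree[OF _ e])
 hence "(2 :: complex) powi (int r2 * snd a) = 2 ^ tdeg e" unfolding d power_int_mult .
 thus "int (tdeg e) = int r2 * snd a" using two_powi_eq by fastforce
qed

context
 fixes r1 r2 n :: nat
 assumes pos: "r1 > 0" "r2 > 0"
begin

abbreviation SIk :: "nat \<Rightarrow> var cpoly set" where
 "SIk k \<equiv> SI r1 r2 n (theta_multiple r1 r2 k)"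

lemma graded_SI: "graded_algebra SIk (r1 * r2)"
proof
 fix f g k l assume "f \<in> SIk k" "g \<in> SIk l"
 hence "f * g \<in> SI r1 r2 n (fst (theta_multiple r1 r2 k) + fst (theta_multiple r1 r2 l), snd (theta_multiple r1 r2 k) + snd (theta_multiple r1 r2 l))"
  by (rule SI_mult)
 thus "f * g \<in> SIk (k + l)" by (simp add: theta_multiple_def algebra_simps)
next
 show "1 \<in> SIk 0" using SI_1 by (simp add: theta_multiple_def)
 show "tdeg e = k * (r1 * r2)" if "f \<in> SIk k" "e \<in> keys f" for f k e
 proof -
  have "int (tdeg e) = int (k * (r1 * r2))" using SI_degree(2)[OF that] by (simp add: theta_multiple_def)
  thus ?thesis unfolding of_nat_eq_iff .
 qed
 show "0 < r1 * r2" using pos by simp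
qed (auto intro: SI_0 SI_add SI_Const_mult)

lemma plucker_algebra_stacked: "plucker_algebra r1 (n * r2) (stacked r2)"
proof
 fix s s' q q' assume "stacked r2 s q = stacked r2 s' q'"
 thus "s = s' \<and> q = q'" unfolding stacked_def by (metis div_mult_mod_eq prod.inject)
qed (rule pos)

lemma plucker_algebra_side_by_side: "plucker_algebra r2 (n * r1) (side_by_side r1)"
proof
 fix s s' q q' assume "side_by_side r1 s q = side_by_side r1 s' q'"
 thus "s = s' \<and> q = q'" unfolding side_by_side_def by (metis div_mult_mod_eq prod.inject)
qed (rule pos)

lemma div_mod_index: "i < n \<Longrightarrow> j < r \<Longrightarrow> (i * r + j) div r = i \<and> (i * r + j) mod r = j \<and> i * r + j < n * (r::nat)"
 using less_mult_imp_div_less[of j 1 r] mult_le_mono1[of "Suc i" n r] by auto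

lemma SI_relative_invariant_stacked:
 assumes f: "f \<in> SIk k"
 shows "plucker_algebra.relative_invariant r1 (n * r2) (stacked r2) (k * r2) f"
proof -
 interpret plucker_algebra r1 "n * r2" "stacked r2" by (rule plucker_algebra_stacked)
 have idx: "stacked r2 s (i * r2 + j) = (i, j, s)" "i * r2 + j < n * r2" if "i < n" "j < r2" for i j s
  using div_mod_index[of i j r2] that by (simp_all add: stacked_def)
 show ?thesis unfolding relative_invariant_def
 proof (intro conjI allI impI)
  show "vars f \<subseteq> {stacked r2 s q | s q. s < r1 \<and> q < n * r2}"
  proof
   fix v assume "v \<in> vars f"
   then obtain i j k where v: "v = (i, j, k)" "i < n" "j < r2" "k < r1" using SI_vars[OF f] unfolding var_set_def by blast
   thus "v \<in> {stacked r2 s q | s q. s < r1 \<and> q < n * r2}" using idx(1)[of i j k] idx(2)[of i j] by (intro CollectI exI[of _ k] exI[of _ "i * r2 + j"]) auto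
  qed
  fix h x x' assume h: "h \<in> carrier_mat r1 r1" "det h \<noteq> (0::complex)"
   and x': "\<forall>s<r1. \<forall>q<n * r2. x' (stacked r2 s q) = (\<Sum>t<r1. h $$ (s, t) * x (stacked r2 t q))"
  have "peval f x' = det h powi (- fst (theta_multiple r1 r2 k)) * peval f x"
  proof (rule SI_act_right[OF f h])
   fix i j s assume ijs: "i < n" "j < r2" "s < r1"
   thus "x' (i, j, s) = (\<Sum>t<r1. h $$ (s, t) * x (i, j, t))"
    using x'[rule_format, OF ijs(3) idx(2)[OF ijs(1,2)]] by (simp only: idx(1)[OF ijs(1,2)])
  qed
  also have "- fst (theta_multiple r1 r2 k) = int (k * r2)" by (simp add: theta_multiple_def)
  finally show "peval f x' = det h ^ (k * r2) * peval f x" unfolding power_int_of_nat .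
 qed
qed

lemma SI_relative_invariant_side_by_side:
 assumes f: "f \<in> SIk k"
 shows "plucker_algebra.relative_invariant r2 (n * r1) (side_by_side r1) (k * r1) f"
proof -
 interpret plucker_algebra r2 "n * r1" "side_by_side r1" by (rule plucker_algebra_side_by_side)
 have idx: "side_by_side r1 s (i * r1 + j) = (i, s, j)" "i * r1 + j < n * r1" if "i < n" "j < r1" for i j s
  using div_mod_index[of i j r1] that by (simp_all add: side_by_side_def)
 show ?thesis unfolding relative_invariant_def
 proof (intro conjI allI impI)
  show "vars f \<subseteq> {side_by_side r1 s q | s q. s < r2 \<and> q < n * r1}"
  proof
   fix v assume "v \<in> vars f"
   then obtain i j k where v: "v = (i, j, k)" "i < n" "j < r2" "k < r1" using SI_vars[OF f] unfolding var_set_def by blast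
   thus "v \<in> {side_by_side r1 s q | s q. s < r2 \<and> q < n * r1}" using idx(1)[of i k j] idx(2)[of i k] by (intro CollectI exI[of _ j] exI[of _ "i * r1 + k"]) auto
  qed
  fix h x x' assume h: "h \<in> carrier_mat r2 r2" "det h \<noteq> (0::complex)"
   and x': "\<forall>s<r2. \<forall>q<n * r1. x' (side_by_side r1 s q) = (\<Sum>t<r2. h $$ (s, t) * x (side_by_side r1 t q))"
  have "peval f x' = det h powi snd (theta_multiple r1 r2 k) * peval f x"
  proof (rule SI_act_left[OF f h])
   fix i s k assume isk: "i < n" "s < r2" "k < r1"
   thus "x' (i, s, k) = (\<Sum>t<r2. h $$ (s, t) * x (i, t, k))"
    using x'[rule_format, OF isk(2) idx(2)[OF isk(1,3)]] by (simp only: idx(1)[OF isk(1,3)])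
  qed
  also have "snd (theta_multiple r1 r2 k) = int (k * r1)" by (simp add: theta_multiple_def)
  finally show "peval f x' = det h ^ (k * r1) * peval f x" unfolding power_int_of_nat .
 qed
qed

text \<open>Products of the given semi-invariants come with some weight, not a prescribed one. The
  degree of a single term already determines both entries of the weight, so the product lands in the
  right graded piece.\<close>

lemma SI_weight:
 assumes f: "f \<in> SI r1 r2 n a" and e: "e \<in> keys f" "tdeg e = k * (r1 * r2)"
 shows "a = theta_multiple r1 r2 k"
proof -
 have "int k * (int r1 * int r2) = - (int r1 * fst a)" "int k * (int r1 * int r2) = int r2 * snd a"
  using SI_degree[OF f e(1)] unfolding e(2) by simp_all
 hence "int r1 * fst a = int r1 * (- (int k * int r2))" "int r2 * snd a = int r2 * (int k * int r1)" by (simp_all add: algebra_simps)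
 hence "fst a = - (int k * int r2)" "snd a = int k * int r1" using pos by (simp_all only: mult_cancel_left) auto
 thus ?thesis by (simp add: theta_multiple_def prod_eq_iff)
qed

end

section \<open>Rational cones\<close>

text \<open>Dirichlet's theorem. The numerators are natural numbers because an integer at distance
  less than 1 from a nonnegative number is nonnegative.\<close>

lemma simultaneous_approximation:
 fixes t :: "'i \<Rightarrow> real"
 assumes S: "finite S" "\<And>i. i \<in> S \<Longrightarrow> 0 \<le> t i" and Q: "Q > 0"
 obtains q p where "(1 :: real) \<le> q" "\<And>i. i \<in> S \<Longrightarrow> \<bar>real (p i) - q * t i\<bar> < 1 / real Q"
proof -
 obtain b where b: "bij_betw b {0..<card S} S" using ex_bij_betw_nat_finite[OF S(1)] by blast
 obtain q p where qp: "0 < q" "\<And>i. i < card S \<Longrightarrow> \<bar>of_int q * t (b i) - of_int (p i)\<bar> < 1 / real Q"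
  using Dirichlet_approx_simult[OF Q, of "card S" "\<lambda>i. t (b i)"] by blast
 define p' where "p' i = nat (p (the_inv_into {0..<card S} b i))" for i
 have "\<bar>real (p' i) - of_int q * t i\<bar> < 1 / real Q" if "i \<in> S" for i
 proof -
  let ?j = "the_inv_into {0..<card S} b i"
  have inj: "inj_on b {0..<card S}" and im: "b ` {0..<card S} = S" using b unfolding bij_betw_def by auto
  have j: "?j < card S" "b ?j = i" using the_inv_into_into[OF inj, of i "{0..<card S}"] f_the_inv_into_f[OF inj, of i] that im by auto
  have ap: "\<bar>of_int q * t i - of_int (p ?j)\<bar> < 1 / real Q" using qp(2)[OF j(1)] j(2) by simp
  have "0 \<le> of_int q * t i" using S(2)[OF that] qp(1) by simp
  moreover have "1 / real Q \<le> 1" using Q by simp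
  ultimately have "- 1 < real_of_int (p ?j)" using ap by linarith
  hence "real (p' i) = real_of_int (p ?j)" unfolding p'_def by simp
  thus ?thesis using ap by linarith
 qed
 moreover have "1 \<le> real_of_int q" using qp(1) by linarith
 ultimately show ?thesis using that by blast
qed

lemma fin_cone_real_expo:
 "x \<in> fin_cone (real_expo ` T) \<Longrightarrow> \<exists>a. (\<forall>t\<in>T. 0 \<le> a t) \<and> x = (\<Sum>t\<in>T. a t *\<^sub>R real_expo t)"
by (auto simp: fin_cone_def inj_on_def real_expo_inject sum.reindex _)

lemma copies_sum_fin_cone:
 assumes "finite T"
 shows "real_expo (\<Sum>t\<in>T. copies (p t) t) \<in> fin_cone (real_expo ` T)"
 unfolding real_expo_sum real_expo_copies using assms by (intro fin_cone_sum fin_cone_scale fin_cone_generator) auto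

text \<open>
 The intersection of two rational cones is generated by its lattice points: a real relation between the
 generators is approximated, after scaling, so well by integers that the latter satisfy it too.
\<close>

lemma rational_cone_Int:
 fixes T1 T2 :: "'v expo set"
 assumes T: "finite T1" "finite T2" and W: "finite W"
  and V: "\<And>t. t \<in> T1 \<Longrightarrow> keys t \<subseteq> V"
  and lat: "\<And>e. keys e \<subseteq> V \<Longrightarrow> real_expo e \<in> fin_cone (real_expo ` T1) \<Longrightarrow>
   real_expo e \<in> fin_cone (real_expo ` T2) \<Longrightarrow> real_expo e \<in> fin_cone W"
  and x: "x \<in> fin_cone (real_expo ` T1)" "x \<in> fin_cone (real_expo ` T2)"
 shows "x \<in> fin_cone W"
proof (rule ccontr)
 assume "x \<notin> fin_cone W"
 then obtain u where u: "linear u" "\<And>t. t \<in> W \<Longrightarrow> 0 \<le> u t" "u x < (0::real)" by (rule farkas[OF W]) blast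
 obtain a where a: "\<forall>t\<in>T1. 0 \<le> a t" "x = (\<Sum>t\<in>T1. a t *\<^sub>R real_expo t)" using fin_cone_real_expo[OF x(1)] by blast
 obtain b where b: "\<forall>t\<in>T2. 0 \<le> b t" "x = (\<Sum>t\<in>T2. b t *\<^sub>R real_expo t)" using fin_cone_real_expo[OF x(2)] by blast
 define g where "g = case_sum a b"
 define U where "U = (\<Sum>t\<in>T1. \<bar>u (real_expo t)\<bar>)"
 define D where "D = (\<Sum>t\<in>T1. real (tdeg t)) + (\<Sum>t\<in>T2. real (tdeg t))"
 \<comment> \<open>Two demands on the precision: \<open>Q > D\<close> makes the integral vectors
   \<open>e1\<close> and \<open>e2\<close> differ by less than 1 in every coordinate, so that they
   coincide; \<open>Q > U / (- u x)\<close> keeps the error in \<open>u\<close> below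
   \<open>- u x\<close>, so that \<open>u\<close> is still negative at \<open>e1\<close>.\<close>
 obtain Q :: nat where Q: "max (U / (- u x)) D < real Q" using reals_Archimedean2 by blast
 have D0: "D \<ge> 0" unfolding D_def by (intro add_nonneg_nonneg sum_nonneg) auto
 hence Q0: "Q > 0" using Q by (intro gr0I) auto
 obtain q p where qp: "1 \<le> q" "\<And>i. i \<in> T1 <+> T2 \<Longrightarrow> \<bar>real (p i) - q * g i\<bar> < 1 / real Q"
 proof (rule simultaneous_approximation[of "T1 <+> T2" g Q])
  show "finite (T1 <+> T2)" using T by simp
  show "0 \<le> g i" if "i \<in> T1 <+> T2" for i using that a(1) b(1) unfolding g_def by auto
  show "Q > 0" by (rule Q0)
 qed blast
 define p1 p2 where "p1 t = p (Inl t)" and "p2 t = p (Inr t)" for t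
 have p1: "\<bar>real (p1 t) - q * a t\<bar> \<le> 1 / real Q" if "t \<in> T1" for t
  using qp(2)[OF InlI[OF that]] unfolding g_def p1_def by simp
 have p2: "\<bar>real (p2 t) - q * b t\<bar> \<le> 1 / real Q" if "t \<in> T2" for t
  using qp(2)[OF InrI[OF that]] unfolding g_def p2_def by simp
 define e1 e2 where "e1 = (\<Sum>t\<in>T1. copies (p1 t) t)" and "e2 = (\<Sum>t\<in>T2. copies (p2 t) t)"
 have bound: "\<bar>f (\<Sum>t\<in>S. real (r t) *\<^sub>R real_expo t) - q * f (\<Sum>t\<in>S. s t *\<^sub>R real_expo t)\<bar> \<le> (\<Sum>t\<in>S. \<bar>f (real_expo t)\<bar>) / real Q"
  if f: "linear f" and rs: "\<And>t. t \<in> S \<Longrightarrow> \<bar>real (r t) - q * s t\<bar> \<le> 1 / real Q"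
  for f :: "('v \<Rightarrow>\<^sub>0 real) \<Rightarrow> real" and S :: "'v expo set" and r :: "'v expo \<Rightarrow> nat" and s
 proof -
  have "f (\<Sum>t\<in>S. real (r t) *\<^sub>R real_expo t) - q * f (\<Sum>t\<in>S. s t *\<^sub>R real_expo t) = (\<Sum>t\<in>S. (real (r t) - q * s t) * f (real_expo t))"
   unfolding linear_sum[OF f] linear_scale[OF f] sum_distrib_left sum_subtractf[symmetric] by (simp add: algebra_simps)
  also have "\<bar>\<dots>\<bar> \<le> (\<Sum>t\<in>S. \<bar>(real (r t) - q * s t) * f (real_expo t)\<bar>)" by (rule sum_abs)
  also have "\<dots> \<le> (\<Sum>t\<in>S. (1 / real Q) * \<bar>f (real_expo t)\<bar>)"
   unfolding abs_mult using rs by (intro sum_mono mult_right_mono) auto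
  finally show ?thesis by (simp add: sum_divide_distrib)
 qed
 have "e1 = e2"
 proof (rule poly_mapping_eqI)
  fix v
  define l where "l m = lookup m v" for m :: "'v \<Rightarrow>\<^sub>0 real"
  have l: "linear l" unfolding l_def by (rule linearI) (simp_all add: lookup_add lookup_scaleR)
  have deg: "\<bar>l (real_expo t)\<bar> \<le> real (tdeg t)" for t
  proof -
   have "lookup t v \<le> tdeg t"
   proof (cases "v \<in> keys t")
    case True
    thus ?thesis unfolding weight_def by (simp add: member_le_sum)
   qed (simp add: in_keys_iff)
   thus ?thesis by (simp add: l_def lookup_real_expo)
  qed
  have "\<bar>l (real_expo e1) - q * l x\<bar> \<le> (\<Sum>t\<in>T1. \<bar>l (real_expo t)\<bar>) / real Q"
   unfolding e1_def real_expo_sum real_expo_copies a(2) using p1 by (intro bound[OF l])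
  moreover have "\<bar>l (real_expo e2) - q * l x\<bar> \<le> (\<Sum>t\<in>T2. \<bar>l (real_expo t)\<bar>) / real Q"
   unfolding e2_def real_expo_sum real_expo_copies b(2) using p2 by (intro bound[OF l])
  ultimately have "\<bar>l (real_expo e1) - l (real_expo e2)\<bar> \<le> ((\<Sum>t\<in>T1. \<bar>l (real_expo t)\<bar>) + (\<Sum>t\<in>T2. \<bar>l (real_expo t)\<bar>)) / real Q"
   unfolding add_divide_distrib by linarith
  also have "\<dots> \<le> D / real Q" unfolding D_def using deg by (intro divide_right_mono add_mono sum_mono) auto
  also have "\<dots> < 1" using Q Q0 by simp
  finally show "lookup e1 v = lookup e2 v" unfolding l_def lookup_real_expo by linarith
 qed
 have "keys e1 \<subseteq> V" unfolding e1_def using keys_copies V by (intro keys_sum_subset) fast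
 moreover have "real_expo e1 \<in> fin_cone (real_expo ` T1)" unfolding e1_def by (rule copies_sum_fin_cone[OF T(1)])
 moreover have "real_expo e1 \<in> fin_cone (real_expo ` T2)" unfolding \<open>e1 = e2\<close> e2_def by (rule copies_sum_fin_cone[OF T(2)])
 ultimately have "real_expo e1 \<in> fin_cone W" by (rule lat)
 then obtain w where "real_expo e1 = (\<Sum>t\<in>W. w t *\<^sub>R t)" "\<forall>t\<in>W. 0 \<le> w t" unfolding fin_cone_def by blast
 hence "0 \<le> u (real_expo e1)" using u(2) by (simp add: linear_sum[OF u(1)] linear_scale[OF u(1)] sum_nonneg)
 moreover have "\<bar>u (real_expo e1) - q * u x\<bar> \<le> U / real Q"
  unfolding e1_def real_expo_sum real_expo_copies a(2) U_def using p1 by (intro bound[OF u(1)])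
 moreover have "U / real Q < - u x" using Q Q0 u(3) by (simp add: field_simps)
 moreover have "q * u x \<le> 1 * u x" using qp(1) u(3) by (intro mult_right_mono_neg) auto
 ultimately show False by linarith
qed

text \<open>All generators have degree \<open>r\<close>, so the degree of a combination is
  \<open>r\<close> times the sum of its coefficients; fixing the degree fixes that sum to
  \<open>l\<close>.\<close>

lemma cone_slice:
 assumes T: "finite T" "\<And>t. t \<in> T \<Longrightarrow> total_degree t = real r" and pos: "r > 0" "l > 0"
 shows "{m \<in> fin_cone T. total_degree m = real (r * l)} = (*\<^sub>R) (real l) ` (convex hull T)"
proof (intro equalityI subsetI)
 fix m assume "m \<in> {m \<in> fin_cone T. total_degree m = real (r * l)}"
 hence m: "m \<in> fin_cone T" "total_degree m = real (r * l)" by auto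
 then obtain a where a: "m = (\<Sum>t\<in>T. a t *\<^sub>R t)" "\<forall>t\<in>T. 0 \<le> a t" unfolding fin_cone_def by blast
 have "total_degree m = (\<Sum>t\<in>T. a t * real r)"
  unfolding a(1) linear_sum[OF linear_total_degree] linear_scale[OF linear_total_degree] using T(2) by (intro sum.cong) auto
 hence "sum a T * real r = real l * real r" using m(2) unfolding sum_distrib_right by (simp add: mult.commute[of "real l"])
 hence s: "sum a T = real l" using pos by simp
 have "(\<Sum>t\<in>T. (a t / real l) *\<^sub>R t) \<in> convex hull T"
  using T(1) a(2) pos s by (intro convex_sum) (auto simp: hull_inc simp flip: sum_divide_distrib)
 moreover have "m = real l *\<^sub>R (\<Sum>t\<in>T. (a t / real l) *\<^sub>R t)" unfolding a(1) scaleR_sum_right using pos by simp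
 ultimately show "m \<in> (*\<^sub>R) (real l) ` (convex hull T)" by blast
next
 fix m assume "m \<in> (*\<^sub>R) (real l) ` (convex hull T)"
 then obtain p where p: "p \<in> convex hull T" "m = real l *\<^sub>R p" by blast
 have "p \<in> convex_cone hull (convex hull T)" using p(1) by (rule hull_inc)
 hence "m \<in> fin_cone T" unfolding p(2) convex_cone_hull_convex_hull[OF T(1)] by (intro fin_cone_scale) simp_all
 moreover obtain b where b: "sum b T = 1" "(\<Sum>t\<in>T. b t *\<^sub>R t) = p" using p(1) unfolding convex_hull_finite[OF T(1)] by blast
 have "total_degree p = (\<Sum>t\<in>T. b t * real r)"
  unfolding b(2)[symmetric] linear_sum[OF linear_total_degree] linear_scale[OF linear_total_degree] using T(2) by (intro sum.cong) auto
 hence "total_degree p = real r" using b(1) by (simp flip: sum_distrib_right)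
 ultimately show "m \<in> {m \<in> fin_cone T. total_degree m = real (r * l)}"
  unfolding p(2) using linear_scale[OF linear_total_degree, of "real l" p] by simp
qed

lemma fin_cone_nonneg:
 assumes "m \<in> fin_cone (real_expo ` T)"
 shows "0 \<le> lookup m v"
proof -
 obtain a where a: "\<forall>t\<in>T. 0 \<le> a t" "m = (\<Sum>t\<in>T. a t *\<^sub>R real_expo t)" using fin_cone_real_expo[OF assms] by blast
 thus ?thesis by (simp add: lookup_sum lookup_scaleR lookup_real_expo sum_nonneg)
qed

lemma lattice_point_expo:
 assumes "m \<in> int_lattice V" "\<And>v. 0 \<le> lookup m v"
 obtains e where "m = real_expo e"
proof -
 have "m = real_expo (Poly_Mapping.map (\<lambda>x. nat \<lfloor>x\<rfloor>) m)"
 proof (rule poly_mapping_eqI)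
  fix v
  obtain k where k: "lookup m v = of_int k" using assms(1) unfolding int_lattice_def by (blast elim: Ints_cases)
  thus "lookup m v = lookup (real_expo (Poly_Mapping.map (\<lambda>x. nat \<lfloor>x\<rfloor>) m)) v"
   using assms(2)[of v] by (simp add: lookup_real_expo Poly_Mapping.map.rep_eq when_def)
 qed
 thus ?thesis by (rule that)
qed

text \<open>Leading exponents add under multiplication, and a product of semi-invariants is a
  semi-invariant of some weight, which is left open at this point.\<close>

lemma SI_comb_LM:
 assumes "finite H" "\<And>v. v \<in> H \<Longrightarrow> \<exists>q. \<exists>f\<in>SI r1 r2 n q. has_LM c f v"
 shows "\<exists>q. \<exists>f\<in>SI r1 r2 n q. has_LM c f (\<Sum>v\<in>H. copies (a v) v)"
 using assms
proof (induction H rule: finite_induct)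
 case empty
 show ?case using SI_1[of r1 r2 n] has_LM_Const[of 1 c] by auto
next
 case (insert v H)
 obtain q f where f: "f \<in> SI r1 r2 n q" "has_LM c f v" using insert.prems by blast
 obtain b g where g: "g \<in> SI r1 r2 n b" "has_LM c g (\<Sum>v\<in>H. copies (a v) v)" using insert.IH insert.prems by blast
 have "\<exists>p. f ^ k \<in> SI r1 r2 n p" for k
 proof (induction k)
  case 0
  show ?case using SI_1[of r1 r2 n] by auto
 next
  case (Suc k)
  then obtain p where "f ^ k \<in> SI r1 r2 n p" by blast
  hence "f ^ Suc k \<in> SI r1 r2 n (fst q + fst p, snd q + snd p)" unfolding power_Suc by (rule SI_mult[OF f(1)])
  thus ?case by (rule exI)
 qed
 then obtain p where p: "f ^ a v \<in> SI r1 r2 n p" by blast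
 have "has_LM c (f ^ a v * g) (\<Sum>v\<in>insert v H. copies (a v) v)"
  unfolding sum.insert[OF insert.hyps] by (rule has_LM_mult[OF has_LM_power[OF f(2)] g(2)])
 thus ?case using SI_mult[OF p g(1)] by blast
qed

lemma has_LM_keys: "has_LM c f e \<Longrightarrow> e \<in> keys f"
 using keys_initial_form[of c f] by (auto simp: has_LM_def)

section \<open>The degeneration of the Kronecker moduli space\<close>

theorem theorem4p3:
  fixes r1 r2 n :: nat
    and c :: "var \<Rightarrow> nat"
    and \<Lambda>1 \<Lambda>2 :: "nat set \<Rightarrow> nat \<Rightarrow> nat"
    and \<Lambda> :: "linked_pair \<Rightarrow> col_perms"
    and G :: "(var \<Rightarrow>\<^sub>0 real) set"
  defines "M \<equiv> int_lattice (var_set r1 r2 n)"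
    and "P1 \<equiv> mf_polytope r1 (n * r2) (stacked r2) \<Lambda>1"
    and "P2 \<equiv> mf_polytope r2 (n * r1) (side_by_side r1) \<Lambda>2"
  assumes pos: "r1 > 0" "r2 > 0" "n > 0"
    and mf1: "gives_gr_mf c r1 (n * r2) (stacked r2) \<Lambda>1"
    and mf2: "gives_gr_mf c r2 (n * r1) (side_by_side r1) \<Lambda>2"
    and mf: "gives_kronecker_mf c r1 r2 n \<Lambda>"
    and degen1: "gr_toric_degeneration c r1 (n * r2) (stacked r2) \<Lambda>1"
    and degen2: "gr_toric_degeneration c r2 (n * r1) (side_by_side r1) \<Lambda>2"
    and generators: "finite G"
      "(convex_cone hull P1) \<inter> (convex_cone hull P2) \<inter> M = semigroup_generated G"
    and semi_invariants:
      "\<forall>v\<in>G. \<exists>\<alpha>. \<exists>f\<in>SI r1 r2 n \<alpha>. \<exists>e. has_LM c f e \<and> real_expo e = v"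
  shows "toric_degeneration (kronecker_moduli r1 r2 n)
    (normal_toric_variety M (((*\<^sub>R) (real r2) ` P1) \<inter> ((*\<^sub>R) (real r1) ` P2)))"
proof -
 interpret P1: plucker_degeneration r1 "n * r2" "stacked r2" c \<Lambda>1
  by (intro plucker_degeneration.intro plucker_degeneration_axioms.intro plucker_algebra_stacked pos mf1 degen1)
 interpret P2: plucker_degeneration r2 "n * r1" "side_by_side r1" c \<Lambda>2
  by (intro plucker_degeneration.intro plucker_degeneration_axioms.intro plucker_algebra_side_by_side pos mf2 degen2)
 let ?V = "var_set r1 r2 n" and ?R = "\<lambda>k. SI r1 r2 n (theta_multiple r1 r2 k)"
 define T1 where "T1 = P1.lead ` minors r1 (n * r2)"
 define T2 where "T2 = P2.lead ` minors r2 (n * r1)"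
 have fin: "finite T1" "finite T2" unfolding T1_def T2_def minors_def by simp_all
 have P1: "P1 = convex hull (real_expo ` T1)" and P2: "P2 = convex hull (real_expo ` T2)"
  unfolding P1_def P2_def mf_polytope_def T1_def T2_def P1.lead_def P2.lead_def image_image by simp_all
 let ?C1 = "fin_cone (real_expo ` T1)" and ?C2 = "fin_cone (real_expo ` T2)"
 have C1: "convex_cone hull P1 = ?C1" and C2: "convex_cone hull P2 = ?C2"
  unfolding P1 P2 using fin by (simp_all add: convex_cone_hull_convex_hull)
 \<comment> \<open>The generators as exponent vectors; every element of \<open>G\<close> comes from
   one, being a leading exponent. Zero is dropped so that all generators have positive
   degree.\<close>
 define H where "H = {e. real_expo e \<in> G} - {0}"
 have "inj (real_expo :: var expo \<Rightarrow> _)" by (simp add: inj_on_def real_expo_inject)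
 hence "finite {e :: var expo. real_expo e \<in> G}" using finite_vimageI[OF generators(1)] unfolding vimage_def by blast
 hence finH: "finite H" unfolding H_def by simp
 have H0: "0 \<notin> H" unfolding H_def by simp
 interpret H: expo_monoid H by standard fact+
 have H_LM: "\<exists>\<alpha>. \<exists>f\<in>SI r1 r2 n \<alpha>. has_LM c f v" if "v \<in> H" for v
 proof -
  have "real_expo v \<in> G" using that unfolding H_def by blast
  then obtain \<alpha> f e where "f \<in> SI r1 r2 n \<alpha>" "has_LM c f e" "real_expo e = real_expo v" using bspec[OF semi_invariants] by blast
  thus ?thesis unfolding real_expo_inject by blast
 qed
 have H_V: "keys v \<subseteq> ?V" if v: "v \<in> H" for v using H_LM v SI_vars has_LM_keys unfolding vars_def by blast
 have G_expo: "\<exists>e. v = real_expo e" if "v \<in> G" for v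
  using bspec[OF semi_invariants that] by (elim exE bexE conjE) (rule exI, erule sym)
 \<comment> \<open>A generator is itself an element of the generated semigroup, with coefficient 1,
   and so lies in both cones.\<close>
 have G_C: "v \<in> ?C1 \<inter> ?C2" if v: "v \<in> G" for v
 proof -
  have "(\<Sum>w\<in>G. real (if w = v then 1 else 0) *\<^sub>R w) = (\<Sum>w\<in>G. if w = v then v else 0)" by (intro sum.cong) auto
  hence "v = (\<Sum>w\<in>G. real (if w = v then 1 else 0) *\<^sub>R w)" using v generators(1) by simp
  hence "v \<in> semigroup_generated G" unfolding semigroup_generated_def
   by (intro CollectI exI[of _ "\<lambda>w. if w = v then 1 else 0"] conjI TrueI)
  thus ?thesis using generators(2) unfolding C1 C2 by blast
 qed
 let ?C = "fin_cone (real_expo ` H)"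
 have C_sub: "?C \<subseteq> ?C1 \<inter> ?C2"
 proof
  fix m assume "m \<in> ?C"
  then obtain a where a: "\<forall>t\<in>H. 0 \<le> a t" "m = (\<Sum>t\<in>H. a t *\<^sub>R real_expo t)" using fin_cone_real_expo by blast
  have "real_expo t \<in> ?C1" "real_expo t \<in> ?C2" if "t \<in> H" for t using G_C[of "real_expo t"] that unfolding H_def by auto
  thus "m \<in> ?C1 \<inter> ?C2" unfolding a(2) using a(1) by (intro IntI fin_cone_sum fin_cone_scale) auto
 qed
 have lat: "e \<in> range H.comb" if e: "keys e \<subseteq> ?V" "real_expo e \<in> ?C1 \<inter> ?C2" for e
 proof -
  have "real_expo e \<in> semigroup_generated G" using e real_expo_lattice[OF e(1)] generators(2) unfolding C1 C2 M_def by blast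
  then obtain k where k: "real_expo e = (\<Sum>v\<in>G. real (k v) *\<^sub>R v)" unfolding semigroup_generated_def by blast
  have "(\<Sum>v\<in>G. real (k v) *\<^sub>R v) = (\<Sum>v\<in>real_expo ` H. real (k v) *\<^sub>R v)"
  proof (rule sum.mono_neutral_right[OF generators(1)])
   show "real_expo ` H \<subseteq> G" unfolding H_def by blast
   show "\<forall>v\<in>G - real_expo ` H. real (k v) *\<^sub>R v = 0" using e G_expo unfolding H_def by force
  qed
  also have "\<dots> = (\<Sum>v\<in>H. real (k (real_expo v)) *\<^sub>R real_expo v)"
   by (subst sum.reindex) (auto simp: inj_on_def real_expo_inject)
  also have "\<dots> = real_expo (H.comb (\<lambda>v. k (real_expo v)))" by (rule H.real_expo_comb[symmetric])
  finally have "e = H.comb (\<lambda>v. k (real_expo v))" unfolding k[symmetric] real_expo_inject .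
  thus ?thesis by (rule range_eqI[of _ H.comb])
 qed
 have comb_C: "real_expo (H.comb a) \<in> ?C" for a
  unfolding H.real_expo_comb using finH by (intro fin_cone_sum fin_cone_scale fin_cone_generator) auto
 \<comment> \<open>\<open>lat\<close> covers only the lattice points of the intersection; its real
   points are reached by the rationality of both cones.\<close>
 have C_sup: "?C1 \<inter> ?C2 \<subseteq> ?C"
 proof
  fix x assume x: "x \<in> ?C1 \<inter> ?C2"
  show "x \<in> ?C"
  proof (rule rational_cone_Int[OF fin, where V = ?V])
   show "finite (real_expo ` H)" using finH by simp
   show "x \<in> ?C1" "x \<in> ?C2" using x by auto
   show "real_expo e \<in> ?C" if "keys e \<subseteq> ?V" "real_expo e \<in> ?C1" "real_expo e \<in> ?C2" for e
    using lat[of e] that comb_C by blast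
   show "keys t \<subseteq> ?V" if t: "t \<in> T1" for t
   proof -
    obtain I where I: "I \<in> minors r1 (n * r2)" "t = P1.lead I" using t unfolding T1_def by blast
    have \<Lambda>: "\<Lambda>1 I permutes {..<r1}" using mf1 I(1) unfolding gives_gr_mf_def by blast
    show ?thesis unfolding I(2) P1.lead_def gr_mono_def
    proof (rule keys_sum_subset)
     fix i assume "i \<in> {..<r1}"
     hence "\<Lambda>1 I i < r1" "sorted_list_of_set I ! i < n * r2"
      using permutes_in_image[OF \<Lambda>, of i] P1.minor_list(4)[OF I(1)] by auto
     thus "keys (single (stacked r2 (\<Lambda>1 I i) (sorted_list_of_set I ! i)) (1::nat)) \<subseteq> ?V"
      using pos by (simp add: stacked_def var_set_def less_mult_imp_div_less)
    qed
   qed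
  qed
 qed
 have C: "?C = ?C1 \<inter> ?C2" using C_sub C_sup by (rule equalityI)
 \<comment> \<open>\<open>P1\<close> lies in degree \<open>r1\<close> and \<open>P2\<close> in
   degree \<open>r2\<close>, so in degree \<open>r1 * r2\<close> their cones are cut in
   \<open>r2 P1\<close> and \<open>r1 P2\<close>.\<close>
 have slice: "{m \<in> ?C. total_degree m = real (r1 * r2)} = (*\<^sub>R) (real r2) ` P1 \<inter> (*\<^sub>R) (real r1) ` P2"
 proof -
  have "{m \<in> ?C1. total_degree m = real (r1 * r2)} = (*\<^sub>R) (real r2) ` P1" unfolding P1
  proof (rule cone_slice)
   show "total_degree t = real r1" if "t \<in> real_expo ` T1" for t
    using that unfolding T1_def by (elim imageE) (simp only: total_degree_real_expo P1.lead_def P1.weight_gr_mono)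
  qed (use fin pos in simp_all)
  moreover have "{m \<in> ?C2. total_degree m = real (r2 * r1)} = (*\<^sub>R) (real r1) ` P2" unfolding P2
  proof (rule cone_slice)
   show "total_degree t = real r2" if "t \<in> real_expo ` T2" for t
    using that unfolding T2_def by (elim imageE) (simp only: total_degree_real_expo P2.lead_def P2.weight_gr_mono)
  qed (use fin pos in simp_all)
  ultimately show ?thesis unfolding C mult.commute[of r2 r1] by blast
 qed
 have "\<exists>a>0. toric_degeneration (Proj ?R) (normal_toric_variety (int_lattice ?V) ((*\<^sub>R) a ` {m \<in> ?C. total_degree m = real (r1 * r2)}))"
 proof (rule graded_toric_degeneration[where c = c])
  show "graded_algebra ?R (r1 * r2)" by (rule graded_SI[OF pos(1,2)])
  show "e \<in> range H.comb" if "keys e \<subseteq> ?V" "real_expo e \<in> ?C" for e using lat[of e] that C by blast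
  show "keys e \<subseteq> ?V \<and> real_expo e \<in> ?C" if g: "g \<in> ?R k" and e: "e \<in> keys (initial_form c g)" for g k e
  proof
   show "keys e \<subseteq> ?V" using SI_vars[OF g] e keys_initial_form[of c g] unfolding vars_def by blast
   have "real_expo e \<in> ?C1"
    using P1.initial_exponent_in_cone[OF SI_relative_invariant_stacked[OF pos(1,2) g] e] unfolding P1_def[symmetric] C1 .
   moreover have "real_expo e \<in> ?C2"
    using P2.initial_exponent_in_cone[OF SI_relative_invariant_side_by_side[OF pos(1,2) g] e] unfolding P2_def[symmetric] C2 .
   ultimately show "real_expo e \<in> ?C" unfolding C by blast
  qed
  show "\<exists>g\<in>?R k. has_LM c g e" if e: "e \<in> range H.comb" "tdeg e = k * (r1 * r2)" for k e
  proof -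
   obtain a where a: "e = H.comb a" using e(1) by blast
   obtain \<alpha> f where f: "f \<in> SI r1 r2 n \<alpha>" "has_LM c f e"
    using SI_comb_LM[OF finH H_LM, where a = a] unfolding a H.comb_def by blast
   have "\<alpha> = theta_multiple r1 r2 k" by (rule SI_weight[OF pos(1,2) f(1) has_LM_keys[OF f(2)] e(2)])
   thus ?thesis using f by blast
  qed
  show "\<exists>e. m = real_expo e" if "m \<in> int_lattice ?V" "m \<in> ?C" for m
   using lattice_point_expo[OF that(1) fin_cone_nonneg[OF that(2)]] by blast
 qed (use finH H0 H_V in auto)
 \<comment> \<open>The factor \<open>a\<close> from the Veronese subalgebra is removed here, as
   scaling the polytope does not change the toric variety.\<close>
 thus ?thesis unfolding slice normal_toric_variety_scale kronecker_moduli_def M_def using normal_toric_variety_scale by metis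
qed

end
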